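(* Let $d\ge1$. Let $2\leq q\leq\infty$, $2\leq r\leq\infty$ be such that $\frac2q+\frac dr=\frac d2$ and $(q,r,d)\neq(2,\infty,2)$, and similarly let $2\leq\tilde q\leq\infty$, $2\leq\tilde r\leq\infty$ with $\frac2{\tilde q}+\frac d{\tilde r}=\frac d2$ and $(\tilde q,\tilde r,d)\neq(2,\infty,2)$. Then there is a constant $C>0$ such that, for all $u_0\in L^2(\mathbb R^d)$ and all $F=F(t,x)$ on $\mathbb R\times\mathbb R^d$ for which the right-hand side is finite, the following hold: (homogeneous Strichartz estimates) $$\|e^{it\Delta}u_0\|_{W(L^\infty,L^q)_tW(L^2,L^r)_x}\leq C\|u_0\|_{L^2_x};$$ (dual homogeneous Strichartz estimates) $$\Big\|\int e^{-is\Delta}F(s)\,ds\Big\|_{L^2}\leq C\|F\|_{W(L^1,L^{\tilde q'})_tW(L^2,L^{\tilde r'})_x};$$ (retarded Strichartz estimates) $$\Big\|\int_{s<t}e^{i(t-s)\Delta}F(s)\,ds\Big\|_{W(L^\infty,L^q)_tW(L^2,L^r)_x}\leq C\|F\|_{W(L^1,L^{\tilde q'})_tW(L^2,L^{\tilde r'})_x}.$$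
   Context: $p'$ denotes the conjugate exponent of $p$, and $1/\infty=0$. $e^{it\Delta}$ is the Schr\"odinger propagator: $u(t,\cdot)=e^{it\Delta}u_0$ solves $i\partial_tu+\Delta u=0$, $u(0,\cdot)=u_0$ on $\mathbb R^d$; it is the Fourier multiplier with symbol $e^{-4\pi^2 it|\xi|^2}$, with $\hat f(\xi)=\int f(x)e^{-2\pi i x\xi}dx$. $F(s)$ stands for $F(s,\cdot)$. Wiener amalgam spaces on $\mathbb R^n$: fix a window $g\in C_0^\infty(\mathbb R^n)$ with $\|g\|_{L^2}=1$ and let $T_yg(x)=g(x-y)$. For $1\le p,q\le\infty$, $W(L^p,L^q)$ is the space of functions $f$ locally in $L^p$ with $\|f\|_{W(L^p,L^q)}=\big\|\,y\mapsto\|f\,T_yg\|_{L^p}\big\|_{L^q}<\infty$. Different windows give equivalent norms. For functions of $(t,x)\in\mathbb R\times\mathbb R^d$ the mixed norm is $$\|F\|_{W(L^{q_1},L^{q_2})_tW(L^{r_1},L^{r_2})_x}=\big\|\,\|F(t,\cdot)\|_{W(L^{r_1},L^{r_2})(\mathbb R^d)}\big\|_{W(L^{q_1},L^{q_2})(\mathbb R)}.$$ Integrals in $s$ of $L^2$-valued expressions are understood in the weak (duality) sense. *)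

theory Defs
  imports "HOL-Analysis.Analysis" "HOL-Probability.Essential_Supremum"
begin

text \<open>
  Exponents in \<open>[1, \<infinity>]\<close> are extended nonnegative reals, where \<open>1 / \<infinity> = 0\<close> and \<open>1 / 0 = \<infinity>\<close>, so that
  the following is the solution \<open>p'\<close> of \<open>1 / p + 1 / p' = 1\<close> for all \<open>1 \<le> p \<le> \<infinity>\<close>.
\<close>

definition conj_exponent :: "ennreal \<Rightarrow> ennreal"
  where "conj_exponent p = 1 / (1 - 1 / p)"

definition ennreal_powr :: "ennreal \<Rightarrow> real \<Rightarrow> ennreal"
  where "ennreal_powr x a = (if x = \<infinity> then \<infinity> else ennreal (enn2real x powr a))"

text \<open>
  Functions are Lebesgue measurable functions, not classes modulo null sets; norms take values in
  \<open>[0, \<infinity>]\<close>. The \<open>L\<^sup>p\<close> norm is defined for functions with values in \<open>[0, \<infinity>]\<close> because a mixed norm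
  applies it to a function that is itself a norm.
\<close>

definition Lp_norm :: "ennreal \<Rightarrow> ('a::euclidean_space \<Rightarrow> ennreal) \<Rightarrow> ennreal"
  where "Lp_norm p h =
    (if p = \<infinity> then esssup lebesgue h
     else ennreal_powr (\<integral>\<^sup>+x. ennreal_powr (h x) (enn2real p) \<partial>lebesgue) (1 / enn2real p))"

definition L2_norm :: "('a::euclidean_space \<Rightarrow> complex) \<Rightarrow> ennreal"
  where "L2_norm f = Lp_norm 2 (\<lambda>x. ennreal (cmod (f x)))"

definition L2 :: "('a::euclidean_space \<Rightarrow> complex) set"
  where "L2 = {f \<in> borel_measurable lebesgue. L2_norm f < \<infinity>}"

definition L2_inner :: "('a::euclidean_space \<Rightarrow> complex) \<Rightarrow> ('a \<Rightarrow> complex) \<Rightarrow> complex"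
  where "L2_inner f h = (LINT x|lebesgue. f x * cnj (h x))"

primrec Ck :: "nat \<Rightarrow> ('a::euclidean_space \<Rightarrow> complex) \<Rightarrow> bool" where
  "Ck 0 f \<longleftrightarrow> continuous_on UNIV f"
| "Ck (Suc k) f \<longleftrightarrow>
     (\<forall>x. f differentiable (at x)) \<and> (\<forall>v. Ck k (\<lambda>x. frechet_derivative f (at x) v))"

definition window :: "('a::euclidean_space \<Rightarrow> complex) \<Rightarrow> bool"
  where "window g \<longleftrightarrow> (\<forall>k. Ck k g) \<and> compact (closure {x. g x \<noteq> 0}) \<and> L2_norm g = 1"

definition amalgam_norm ::
    "('a::euclidean_space \<Rightarrow> complex) \<Rightarrow> ennreal \<Rightarrow> ennreal \<Rightarrow> ('a \<Rightarrow> ennreal) \<Rightarrow> ennreal"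
  where "amalgam_norm g p q h = Lp_norm q (\<lambda>y. Lp_norm p (\<lambda>x. h x * ennreal (cmod (g (x - y)))))"

text \<open>
  The norm of \<open>W(L\<^bsup>q1\<^esup>, L\<^bsup>q2\<^esup>)\<^sub>t W(L\<^bsup>r1\<^esup>, L\<^bsup>r2\<^esup>)\<^sub>x\<close>, with window \<open>g\<close> in time and \<open>\<gamma>\<close> in space.
\<close>

definition mixed_amalgam_norm ::
    "(real \<Rightarrow> complex) \<Rightarrow> ('a::euclidean_space \<Rightarrow> complex) \<Rightarrow>
     ennreal \<Rightarrow> ennreal \<Rightarrow> ennreal \<Rightarrow> ennreal \<Rightarrow> (real \<Rightarrow> 'a \<Rightarrow> complex) \<Rightarrow> ennreal"
  where "mixed_amalgam_norm g \<gamma> q1 q2 r1 r2 F =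
    amalgam_norm g q1 q2 (\<lambda>t. amalgam_norm \<gamma> r1 r2 (\<lambda>x. ennreal (cmod (F t x))))"

definition fourier_integral :: "('a::euclidean_space \<Rightarrow> complex) \<Rightarrow> 'a \<Rightarrow> complex"
  where "fourier_integral f \<xi> = (LINT x|lebesgue. f x * cis (- 2 * pi * (x \<bullet> \<xi>)))"

text \<open>
  Plancherel: the Fourier transform of \<open>f \<in> L\<^sup>2\<close> is the limit in \<open>L\<^sup>2\<close> of the Fourier integrals of the
  truncations of \<open>f\<close> to balls. It is unique up to null sets, as are the propagator and the weak
  integral below; the choice operator selects a representative.
\<close>

definition fourier_L2 :: "('a::euclidean_space \<Rightarrow> complex) \<Rightarrow> 'a \<Rightarrow> complex"
  where "fourier_L2 f = (SOME h. h \<in> L2 \<and>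
    (\<lambda>n. L2_norm (\<lambda>\<xi>. h \<xi> - fourier_integral (\<lambda>x. indicator (cball 0 (real n)) x * f x) \<xi>))
      \<longlonglongrightarrow> 0)"

text \<open>The propagator \<open>e\<^bsup>it\<Delta>\<^esup>\<close> on \<open>L\<^sup>2\<close>.\<close>

definition schrodinger :: "real \<Rightarrow> ('a::euclidean_space \<Rightarrow> complex) \<Rightarrow> 'a \<Rightarrow> complex"
  where "schrodinger t f = (SOME v. v \<in> L2 \<and>
    (AE \<xi> in lebesgue. fourier_L2 v \<xi> = cis (- 4 * pi\<^sup>2 * t * (norm \<xi>)\<^sup>2) * fourier_L2 f \<xi>))"

definition has_weak_integral ::
    "(real \<Rightarrow> 'a::euclidean_space \<Rightarrow> complex) \<Rightarrow> ('a \<Rightarrow> complex) \<Rightarrow> real set \<Rightarrow> bool"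
  where "has_weak_integral G w S \<longleftrightarrow> w \<in> L2 \<and>
    (\<forall>\<phi>\<in>L2. set_integrable lebesgue S (\<lambda>s. L2_inner (G s) \<phi>) \<and>
             (LINT s:S|lebesgue. L2_inner (G s) \<phi>) = L2_inner w \<phi>)"

definition weak_integral :: "real set \<Rightarrow> (real \<Rightarrow> 'a::euclidean_space \<Rightarrow> complex) \<Rightarrow> 'a \<Rightarrow> complex"
  where "weak_integral S G = (SOME w. has_weak_integral G w S)"

end

theory Submission
  imports Defs "HOL-Probability.Probability" "HOL-Library.Discrete_Functions"
begin

text \<open>
  The amalgam norms are discretized: a cubic mesh in space and an interval mesh in time, finer than the
  balls on which the windows are bounded away from \<open>0\<close>, reduce the estimates to mixed
  \<open>l\<^sup>q(l\<^sup>r)\<close> norms of \<open>L\<^sup>2\<close> norms over cells. Two pieces in distinct cells are orthogonal at equal times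
  and, by the dispersive estimate and Cauchy--Schwarz on cells of finite measure, have propagated inner
  product of size \<open>\<bar>n - m\<bar>\<^bsup>-d/2\<^esup>\<close> when they sit in time cells \<open>n \<noteq> m\<close>; no small-time singularity
  remains. Interpolating between orthogonality and dispersion bounds the resulting bilinear form by discrete
  Hardy--Littlewood--Sobolev summation, or, at the endpoint, by a dyadic decomposition in \<open>\<bar>n - m\<bar>\<close>
  with atomic decompositions of the sequences (Keel--Tao). The time-ordered part of the form gives the retarded
  estimate directly; duality of sequence norms and the Riesz representation theorem give the other
  two and the weak integrals.
\<close>

text \<open>Exponents enter through reciprocals: \<open>rho\<close> stands for 1/r, the value 0 for
  infinity, and Hoelder becomes addition. Interpolation is done by hand. A family of vectors is cut
  into blocks whose l2 and l1 sizes are both known, each pair of blocks takes the better of two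
  bounds, and the loss away from their crossover is a geometric series summed by Schur's test. For
  one fixed functional, interpolating between mixed norms is log-convexity of its dual norm. The two
  given pairs may differ, but both lie on the segment from (0, 1/2) to one common pair
  (\<open>alpha1\<close>, \<open>rho1\<close>), where the form is estimated with equal exponents.
  Time ordering survives because only sums over \<open>m < n\<close> are estimated, with an
  arbitrary set \<open>D\<close> of equal-time terms added. The supremum over a time cell is
  replaced by one sample time per cell, with bounds uniform in the samples. The retarded solution is
  tested against the advanced solution of a pulsed source, so the forcing itself is only ever
  paired. The Hilbert space is real; complex pairings return through multiplication by i.\<close>

lemma ennreal_powr_2: "0 <= a ==> ennreal_powr (ennreal a) 2 = ennreal (a^2)"
 by (simp add: ennreal_powr_def)

lemma ennreal_powr_half: "0 <= a ==> ennreal_powr (ennreal a) (1/2) = ennreal (sqrt a)"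
 by (simp add: ennreal_powr_def powr_half_sqrt)

section \<open>Square-integrable functions modulo null sets as a real Hilbert space\<close>

lemma L2_norm_nn: "L2_norm f = ennreal_powr (\<integral>\<^sup>+x. ennreal ((cmod (f x))^2) \<partial>lebesgue) (1/2)"
 by (simp add: L2_norm_def Lp_norm_def ennreal_powr_2)

lemma L2_iff: "f : L2 \<longleftrightarrow> f : borel_measurable lebesgue & integrable lebesgue (%x. (cmod (f x))^2)"
proof (cases "f : borel_measurable lebesgue")
 case True
 then have [measurable]: "f : borel_measurable lebesgue" .
 have "(%x. (cmod (f x))^2) : borel_measurable lebesgue" by measurable
 then show ?thesis
  by (auto simp: L2_def L2_norm_nn integrable_iff_bounded ennreal_powr_def less_top)
qed (simp add: L2_def)

lemma L2_norm_eq: "f : L2 ==> L2_norm f = ennreal (sqrt (LINT x|lebesgue. (cmod (f x))^2))"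
 unfolding L2_norm_nn L2_iff by (subst nn_integral_eq_integral) (auto simp: ennreal_powr_half)

lemma L2D: "f : L2 ==> f : borel_measurable lebesgue" "f : L2 ==> integrable lebesgue (%x. (cmod (f x))^2)"
 by (auto simp: L2_iff)

lemma L2_bound:
 assumes [measurable]: "f : borel_measurable lebesgue" and h: "h : L2"
  and b: "AE x in lebesgue. cmod (f x) <= C * cmod (h x)"
 shows "f : L2"
proof -
 have "AE x in lebesgue. (cmod (f x))^2 <= C^2 * (cmod (h x))^2"
  using b by eventually_elim (metis norm_ge_zero power_mono power_mult_distrib)
 then have "integrable lebesgue (%x. (cmod (f x))^2)"
  by (intro Bochner_Integration.integrable_bound[OF integrable_mult_right[OF L2D(2)[OF h], of "C^2"]]) auto
 then show ?thesis by (simp add: L2_iff)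
qed

lemma L2_add:
 assumes "f : L2" "h : L2" shows "(%x. f x + h x) : L2"
proof -
 have [measurable]: "f : borel_measurable lebesgue" "h : borel_measurable lebesgue"
  using assms by (auto dest: L2D)
 have "integrable lebesgue (%x. 2 * (cmod (f x))^2 + 2 * (cmod (h x))^2)"
  by (intro Bochner_Integration.integrable_add integrable_mult_right L2D(2) assms)
 then have "integrable lebesgue (%x. (cmod (f x + h x))^2)"
 proof (rule Bochner_Integration.integrable_bound)
  have "(cmod (f x + h x))^2 <= 2 * (cmod (f x))^2 + 2 * (cmod (h x))^2" for x
  proof -
   have "(cmod (f x + h x))^2 <= (cmod (f x) + cmod (h x))^2"
    by (intro power_mono norm_triangle_ineq) auto
   also have "... <= 2 * (cmod (f x))^2 + 2 * (cmod (h x))^2"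
    using zero_le_power2[of "cmod (f x) - cmod (h x)"] by (simp add: power2_eq_square algebra_simps)
   finally show ?thesis .
  qed
  then show "AE x in lebesgue. norm ((cmod (f x + h x))^2) <= norm (2 * (cmod (f x))^2 + 2 * (cmod (h x))^2)"
   by (intro AE_I2) (simp add: abs_of_nonneg)
 qed measurable
 then show ?thesis by (simp add: L2_iff)
qed

lemma L2_mult_bounded:
 assumes "f : L2" "m : borel_measurable lebesgue" "!!x. cmod (m x) <= C"
 shows "(%x. m x * f x) : L2"
proof (rule L2_bound[OF _ assms(1)])
 show "(%x. m x * f x) : borel_measurable lebesgue"
  using assms(2) L2D(1)[OF assms(1)] by measurable
 show "AE x in lebesgue. cmod (m x * f x) <= C * cmod (f x)"
  using assms(3) by (auto simp: norm_mult intro!: mult_right_mono)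
qed

lemma L2_cmult: "f : L2 ==> (%x. c * f x) : L2"
 by (rule L2_mult_bounded[where C = "cmod c"]) auto

lemma L2_zero: "(%x. 0) : L2"
 by (simp add: L2_iff)

lemma L2_uminus: "f : L2 ==> (%x. - f x) : L2"
 using L2_cmult[of f "-1"] by simp

lemma L2_diff: "f : L2 ==> h : L2 ==> (%x. f x - h x) : L2"
 using L2_add[OF _ L2_uminus, of f h] by simp

lemma L2_integrable_mult:
 assumes "f : L2" "h : L2" shows "integrable lebesgue (%x. f x * cnj (h x))"
proof -
 have [measurable]: "f : borel_measurable lebesgue" "h : borel_measurable lebesgue"
  using assms by (auto dest: L2D)
 have [measurable]: "(%x. cnj (h x)) : borel_measurable lebesgue"
  by (rule borel_measurable_continuous_onI[THEN measurable_compose[rotated]]) (auto intro!: continuous_intros)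
 have "integrable lebesgue (%x. (cmod (f x))^2 + (cmod (h x))^2)"
  by (intro Bochner_Integration.integrable_add L2D(2) assms)
 then show ?thesis
 proof (rule Bochner_Integration.integrable_bound)
  have "cmod (f x) * cmod (h x) <= (cmod (f x))^2 + (cmod (h x))^2" for x
   using zero_le_power2[of "cmod (f x) - cmod (h x)"] mult_nonneg_nonneg[of "cmod (f x)" "cmod (h x)"]
   by (simp add: power2_eq_square algebra_simps del: mult_nonneg_nonneg zero_le_mult_iff)
  then show "AE x in lebesgue. norm (f x * cnj (h x)) <= norm ((cmod (f x))^2 + (cmod (h x))^2)"
   by (intro AE_I2) (simp add: norm_mult abs_of_nonneg)
 qed measurable
qed

text \<open>A partial equivalence relation: it is reflexive exactly on \<open>L2\<close>, so the
  quotient discards all other functions and identifies those equal almost everywhere.\<close>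

definition l2rel :: "('a::euclidean_space => complex) => ('a => complex) => bool"
 where "l2rel f h \<longleftrightarrow> f : L2 & h : L2 & (AE x in lebesgue. f x = h x)"

lemma part_equivp_l2rel: "part_equivp (l2rel :: ('a::euclidean_space => complex) => _)" (is "part_equivp ?R")
proof (rule part_equivpI)
 show "EX f::'a => complex. l2rel f f" using L2_zero by (auto simp: l2rel_def)
 show "symp ?R" by (auto simp: l2rel_def symp_def elim: eventually_mono)
 show "transp ?R"
 proof (rule transpI)
  fix f h k :: "'a => complex" assume "l2rel f h" "l2rel h k"
  then show "l2rel f k" unfolding l2rel_def by (auto elim: eventually_elim2)
 qed
qed

quotient_type (overloaded) 'a l2 = "'a::euclidean_space => complex" / partial: l2rel
 by (rule part_equivp_l2rel)

instantiation l2 :: (euclidean_space) real_inner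
begin

lift_definition zero_l2 :: "'a l2" is "%x. 0"
 by (simp add: l2rel_def L2_zero)

lift_definition plus_l2 :: "'a l2 => 'a l2 => 'a l2" is "%f h x. f x + h x"
 by (auto simp: l2rel_def L2_add elim: eventually_elim2)

lift_definition minus_l2 :: "'a l2 => 'a l2 => 'a l2" is "%f h x. f x - h x"
 by (auto simp: l2rel_def L2_diff elim: eventually_elim2)

lift_definition uminus_l2 :: "'a l2 => 'a l2" is "%f x. - f x"
 by (auto simp: l2rel_def L2_uminus elim: eventually_mono)

lift_definition scaleR_l2 :: "real => 'a l2 => 'a l2" is "%r f x. complex_of_real r * f x"
 by (auto simp: l2rel_def L2_cmult elim: eventually_mono)

text \<open>The real part, because the type class and the Riesz theorem below are real. Nothing is
  lost: the imaginary part of the complex pairing is the real pairing with i times the second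
  argument.\<close>

lift_definition inner_l2 :: "'a l2 => 'a l2 => real" is "%f h. Re (L2_inner f h)"
proof -
 fix f f' h h' :: "'a => complex" assume *: "l2rel f f'" "l2rel h h'"
 then have "AE x in lebesgue. f x * cnj (h x) = f' x * cnj (h' x)"
  unfolding l2rel_def by (auto elim: eventually_elim2)
 moreover have "integrable lebesgue (%x. f x * cnj (h x))" "integrable lebesgue (%x. f' x * cnj (h' x))"
  using * by (auto simp: l2rel_def intro: L2_integrable_mult)
 ultimately show "Re (L2_inner f h) = Re (L2_inner f' h')"
  unfolding L2_inner_def by (subst integral_cong_AE) auto
qed

definition norm_l2 :: "'a l2 => real" where "norm_l2 v = sqrt (inner v v)"
definition dist_l2 :: "'a l2 => 'a l2 => real" where "dist_l2 v w = norm (v - w)"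
definition sgn_l2 :: "'a l2 => 'a l2" where "sgn_l2 v = scaleR (inverse (norm v)) v"
definition uniformity_l2 :: "('a l2 \<times> 'a l2) filter"
 where "uniformity_l2 = (INF e\<in>{0<..}. principal {(x, y). dist x y < e})"
definition open_l2 :: "'a l2 set => bool"
 where "open_l2 U = (ALL x:U. \<forall>\<^sub>F (x', y) in uniformity. x' = x --> y : U)"

lemma inner_self_eq:
 assumes "f : L2" shows "Re (L2_inner f f) = (LINT x|lebesgue. (cmod (f x))^2)"
proof -
 have "L2_inner f f = (LINT x|lebesgue. complex_of_real ((cmod (f x))^2))"
  unfolding L2_inner_def by (intro Bochner_Integration.integral_cong refl) (simp only: complex_norm_square)
 then show ?thesis by (simp only: integral_complex_of_real Re_complex_of_real)
qed

instance
proof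
 fix a b c :: "'a l2" and r s :: real
 show "a + b + c = a + (b + c)" by transfer (auto simp: l2rel_def add.assoc intro: L2_add)
 show "a + b = b + a" by transfer (auto simp: l2rel_def add.commute intro: L2_add)
 show "0 + a = a" by transfer (auto simp: l2rel_def)
 show "- a + a = 0" by transfer (auto simp: l2rel_def L2_zero)
 show "a - b = a + - b" by transfer (auto simp: l2rel_def L2_add L2_diff L2_uminus)
 show "r *\<^sub>R (a + b) = r *\<^sub>R a + r *\<^sub>R b"
  by transfer (auto simp: l2rel_def distrib_left intro!: L2_add L2_cmult)
 show "(r + s) *\<^sub>R a = r *\<^sub>R a + s *\<^sub>R a"
 proof transfer
  fix r s :: real and f :: "'a => complex" assume "l2rel f f"
  then have "f : L2" by (simp add: l2rel_def)
  then show "l2rel (%x. complex_of_real (r + s) * f x) (%x. complex_of_real r * f x + complex_of_real s * f x)"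
   unfolding l2rel_def by (intro conjI L2_cmult L2_add) (auto simp: algebra_simps)
 qed
 show "r *\<^sub>R s *\<^sub>R a = (r * s) *\<^sub>R a"
 proof transfer
  fix r s :: real and f :: "'a => complex" assume "l2rel f f"
  then have "f : L2" by (simp add: l2rel_def)
  then show "l2rel (%x. complex_of_real r * (complex_of_real s * f x)) (%x. complex_of_real (r * s) * f x)"
   unfolding l2rel_def by (intro conjI L2_cmult L2_add) (auto simp: algebra_simps)
 qed
 show "1 *\<^sub>R a = a" by transfer (auto simp: l2rel_def)
 show "dist a b = norm (a - b)" by (simp add: dist_l2_def)
 show "sgn a = scaleR (inverse (norm a)) a" by (simp add: sgn_l2_def)
 show "uniformity = (INF e\<in>{0<..}. principal {(x :: 'a l2, y). dist x y < e})"
  by (simp add: uniformity_l2_def)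
 show "open U = (ALL x:U. \<forall>\<^sub>F (x', y) in uniformity. x' = x --> y : U)" for U :: "'a l2 set"
  by (simp add: open_l2_def)
 show "norm a = sqrt (inner a a)" by (simp add: norm_l2_def)
 show "inner a b = inner b a"
 proof transfer
  fix f h :: "'a => complex"
  have "L2_inner f h = cnj (L2_inner h f)"
   unfolding L2_inner_def Bochner_Integration.integral_cnj[symmetric] by (simp add: mult.commute)
  then show "Re (L2_inner f h) = Re (L2_inner h f)" by simp
 qed
 show "inner (a + b) c = inner a c + inner b c"
  by transfer (auto simp: L2_inner_def l2rel_def distrib_right Bochner_Integration.integral_add L2_integrable_mult)
 show "inner (r *\<^sub>R a) b = r * inner a b"
  by transfer (auto simp: L2_inner_def mult.assoc)
 show "0 <= inner a a"
  by transfer (auto simp: l2rel_def inner_self_eq)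
 show "inner a a = 0 \<longleftrightarrow> a = 0"
 proof transfer
  fix f :: "'a => complex" assume "l2rel f f"
  then have f: "f : L2" by (simp add: l2rel_def)
  have "(LINT x|lebesgue. (cmod (f x))^2) = 0 \<longleftrightarrow> (AE x in lebesgue. (cmod (f x))^2 = 0)"
   using f by (intro integral_nonneg_eq_0_iff_AE) (auto dest: L2D)
  then show "Re (L2_inner f f) = 0 \<longleftrightarrow> l2rel f (%x. 0)"
   using f by (simp add: inner_self_eq l2rel_def L2_zero)
 qed
qed

end

lemma rep_l2_in [simp]: "rep_l2 v : L2"
 using Quotient_rel_rep[OF Quotient_l2, of v v] by (simp add: l2rel_def)

lemma abs_rep_l2 [simp]: "abs_l2 (rep_l2 v) = v"
 by (rule Quotient_abs_rep[OF Quotient_l2])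

lemma rep_l2_measurable [measurable]: "rep_l2 v : borel_measurable lebesgue"
 by (rule L2D) simp

lemma abs_l2_eq_iff: "f : L2 ==> h : L2 ==> abs_l2 f = abs_l2 h \<longleftrightarrow> (AE x in lebesgue. f x = h x)"
 using Quotient_rel[OF Quotient_l2, of f h] by (auto simp: l2rel_def)

lemma rep_abs_l2: "f : L2 ==> AE x in lebesgue. rep_l2 (abs_l2 f) x = f x"
 by (subst abs_l2_eq_iff[symmetric]) auto

lemma abs_l2_add: "f : L2 ==> h : L2 ==> abs_l2 f + abs_l2 h = abs_l2 (%x. f x + h x)"
 by (rule plus_l2.abs_eq) (auto simp: l2rel_def)

lemma abs_l2_diff: "f : L2 ==> h : L2 ==> abs_l2 f - abs_l2 h = abs_l2 (%x. f x - h x)"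
 by (rule minus_l2.abs_eq) (auto simp: l2rel_def)

lemma abs_l2_scaleR: "f : L2 ==> r *\<^sub>R abs_l2 f = abs_l2 (%x. complex_of_real r * f x)"
 by (rule scaleR_l2.abs_eq) (auto simp: l2rel_def)

lemma inner_abs_l2: "f : L2 ==> h : L2 ==> inner (abs_l2 f) (abs_l2 h) = Re (L2_inner f h)"
 by (rule inner_l2.abs_eq) (auto simp: l2rel_def)

lemma norm_abs_l2: "f : L2 ==> norm (abs_l2 f) = sqrt (LINT x|lebesgue. (cmod (f x))^2)"
 by (simp add: norm_l2_def inner_abs_l2 inner_self_eq)

lemma L2_norm_abs: "f : L2 ==> L2_norm f = ennreal (norm (abs_l2 f))"
 by (simp add: L2_norm_eq norm_abs_l2)

lemma L2_of_nn_integral: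
 assumes [measurable]: "f : borel_measurable lebesgue"
  and "(\<integral>\<^sup>+x. ennreal ((cmod (f x))^2) \<partial>lebesgue) <= ennreal (C^2)" "0 <= C"
 shows "f : L2" "norm (abs_l2 f) <= C"
proof -
 have "integrable lebesgue (%x. (cmod (f x))^2)"
  using le_less_trans[OF assms(2) ennreal_less_top] by (intro integrableI_bounded) auto
 then show f: "f : L2" by (simp add: L2_iff)
 have "ennreal (LINT x|lebesgue. (cmod (f x))^2) <= ennreal (C^2)"
  using assms(2) f by (subst nn_integral_eq_integral[symmetric]) (auto dest: L2D)
 then have "(LINT x|lebesgue. (cmod (f x))^2) <= C^2"
  by (simp add: ennreal_le_iff)
 then show "norm (abs_l2 f) <= C"
  using f assms(3) by (simp add: norm_abs_l2 real_le_lsqrt)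
qed

text \<open>Fatou's lemma for the squared moduli. Membership in \<open>L2\<close> is part of the
  conclusion, so it applies to limits not yet known to be square integrable.\<close>

lemma L2_Fatou:
 assumes f: "!!k. f k : L2" and [measurable]: "g : borel_measurable lebesgue"
  and lim: "AE x in lebesgue. (%k. f k x) \<longlonglongrightarrow> g x"
  and bound: "!!k. norm (abs_l2 (f k)) <= C"
 shows "g : L2" "norm (abs_l2 g) <= C"
proof -
 have [measurable]: "f k : borel_measurable lebesgue" for k using f L2D by blast
 have C: "0 <= C" using bound[of 0] norm_ge_zero[of "abs_l2 (f 0)"] by linarith
 have "(\<integral>\<^sup>+x. ennreal ((cmod (g x))^2) \<partial>lebesgue)
   = (\<integral>\<^sup>+x. liminf (%k. ennreal ((cmod (f k x))^2)) \<partial>lebesgue)"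
 proof (rule nn_integral_cong_AE)
  show "AE x in lebesgue. ennreal ((cmod (g x))^2) = liminf (%k. ennreal ((cmod (f k x))^2))"
   using lim
  proof eventually_elim
   case (elim x)
   then have "(%k. ennreal ((cmod (f k x))^2)) \<longlonglongrightarrow> ennreal ((cmod (g x))^2)"
    by (intro tendsto_intros) auto
   then show ?case by (intro lim_imp_Liminf[symmetric]) auto
  qed
 qed
 also have "... <= liminf (%k. \<integral>\<^sup>+x. ennreal ((cmod (f k x))^2) \<partial>lebesgue)"
  by (rule nn_integral_liminf) measurable
 also have "... <= ennreal (C^2)"
 proof (rule Liminf_le)
  show "\<forall>\<^sub>F k in sequentially. (\<integral>\<^sup>+x. ennreal ((cmod (f k x))^2) \<partial>lebesgue) <= ennreal (C^2)"
  proof (rule always_eventually, rule allI)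
   fix k
   have "(LINT x|lebesgue. (cmod (f k x))^2) <= C^2"
    using bound[of k] f C by (simp add: norm_abs_l2 sqrt_le_D)
   then show "(\<integral>\<^sup>+x. ennreal ((cmod (f k x))^2) \<partial>lebesgue) <= ennreal (C^2)"
    using f by (subst nn_integral_eq_integral) (auto dest: L2D intro!: ennreal_leI)
  qed
 qed auto
 finally have "(\<integral>\<^sup>+x. ennreal ((cmod (g x))^2) \<partial>lebesgue) <= ennreal (C^2)" .
 from L2_of_nn_integral[OF _ this C] show "g : L2" "norm (abs_l2 g) <= C" by auto
qed

text \<open>Terms and limit are both at most \<open>C\<close> times \<open>w\<close>, so
  \<open>(2 * C)^2\<close> times the square of \<open>w\<close> dominates the squared
  differences.\<close>

lemma l2_dominated_convergence:
 assumes "f : borel_measurable lebesgue" "!!k. s k : borel_measurable lebesgue" and w: "w : L2"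
  and lim: "AE x in lebesgue. (%k. s k x) \<longlonglongrightarrow> f x"
  and bound: "!!k. AE x in lebesgue. cmod (s k x) <= C * cmod (w x)"
 shows "f : L2" "!!k. s k : L2" "(%k. abs_l2 (s k)) \<longlonglongrightarrow> abs_l2 f"
proof -
 note [measurable] = assms(1,2)
 show s: "s k : L2" for k by (rule L2_bound[OF assms(2) w bound])
 have bd: "AE x in lebesgue. ALL k. cmod (s k x) <= C * cmod (w x)"
  using bound by (simp add: AE_all_countable)
 have bf: "AE x in lebesgue. cmod (f x) <= C * cmod (w x)"
  using lim bd
 proof eventually_elim
  case (elim x)
  have "(%k. cmod (s k x)) \<longlonglongrightarrow> cmod (f x)" using elim(1) by (rule tendsto_norm)
  then show ?case by (rule LIMSEQ_le_const2) (use elim(2) in blast)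
 qed
 show f: "f : L2" by (rule L2_bound[OF assms(1) w bf])
 have "(%k. LINT x|lebesgue. (cmod (s k x - f x))^2) \<longlonglongrightarrow> (LINT x::'a|lebesgue. 0)"
 proof (rule integral_dominated_convergence)
  show "integrable lebesgue (%x. (2 * C)^2 * (cmod (w x))^2)"
   by (intro integrable_mult_right L2D w)
  show "AE x in lebesgue. (%k. (cmod (s k x - f x))^2) \<longlonglongrightarrow> 0"
   using lim
  proof eventually_elim
   case (elim x)
   then have "(%k. (cmod (s k x - f x))^2) \<longlonglongrightarrow> (cmod (f x - f x))\<^sup>2"
    by (rule tendsto_power[OF tendsto_norm[OF tendsto_diff[OF _ tendsto_const]]])
   then show ?case by simp
  qed
  show "AE x in lebesgue. norm ((cmod (s k x - f x))^2) <= (2 * C)^2 * (cmod (w x))^2" for k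
   using bound[of k] bf
  proof eventually_elim
   case (elim x)
   have "cmod (s k x - f x) <= 2 * C * cmod (w x)"
    using norm_triangle_ineq4[of "s k x" "f x"] elim by linarith
   then have "(cmod (s k x - f x))^2 <= (2 * C * cmod (w x))^2" by (intro power_mono) auto
   then show ?case by (simp add: power_mult_distrib)
  qed
  show "(%x. (cmod (s k x - f x))^2) : borel_measurable lebesgue" for k by measurable
 qed simp
 from tendsto_real_sqrt[OF this] have "(%k. norm (abs_l2 (s k) - abs_l2 f)) \<longlonglongrightarrow> 0"
  using s f by (simp add: abs_l2_diff norm_abs_l2 L2_diff)
 then show "(%k. abs_l2 (s k)) \<longlonglongrightarrow> abs_l2 f"
  by (subst LIM_zero_iff[symmetric], rule tendsto_norm_zero_cancel)
qed

lemma L2_bounded_indicator: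
 assumes "A : sets lebesgue" "A <= cball 0 R"
 shows "(%x. c * indicator A x) : L2"
proof -
 have "emeasure lebesgue A <= emeasure lebesgue (cball 0 R :: 'a set)"
  using assms by (intro emeasure_mono) auto
 also have "... < \<infinity>" using emeasure_lborel_cball_finite[of 0 R] by simp
 finally have "integrable lebesgue (indicator A :: 'a => real)"
  using assms by (intro integrable_real_indicator) auto
 moreover have "(cmod (indicator A x))^2 = indicator A x" for x by (auto simp: indicator_def)
 ultimately have "(indicator A :: 'a => complex) : L2" using assms by (simp add: L2_iff)
 then show ?thesis by (rule L2_cmult)
qed

lemma l2_truncation_tendsto:
 assumes "f : L2" shows "(%n. abs_l2 (%x. indicator (cball 0 (real n)) x * f x)) \<longlonglongrightarrow> abs_l2 f"
proof (rule l2_dominated_convergence(3)[where C = 1, OF _ _ assms])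
 note [measurable] = L2D(1)[OF assms]
 show "f : borel_measurable lebesgue" by fact
 show "(%x. indicator (cball 0 (real k)) x * f x) : borel_measurable lebesgue" for k
  by (intro borel_measurable_times borel_measurable_indicator) auto
 show "AE x in lebesgue. (%k. indicator (cball 0 (real k)) x * f x) \<longlonglongrightarrow> f x"
 proof (rule AE_I2)
  fix x :: 'a
  obtain N where "norm x <= real N" using real_arch_simple by blast
  then have "\<forall>\<^sub>F k in sequentially. indicator (cball 0 (real k)) x * f x = f x"
   by (intro eventually_sequentiallyI[of N]) (auto simp: indicator_def)
  then show "(%k. indicator (cball 0 (real k)) x * f x) \<longlonglongrightarrow> f x" by (rule tendsto_eventually)
 qed
qed (auto simp: indicator_def)

text \<open>Simple functions of bounded support are dense, so a property stable under sums and
  limits spreads from multiples of bounded indicators to the whole space.\<close>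

lemma l2_induct [consumes 0, case_names closed add indicator]:
 fixes P :: "'a::euclidean_space l2 => bool"
 assumes closed: "closed {v. P v}"
  and add: "!!v w. P v ==> P w ==> P (v + w)"
  and ind: "!!c A R. A : sets lebesgue ==> A <= cball 0 R ==> P (abs_l2 (%x. c * indicator A x))"
 shows "P v"
proof -
 define f where "f = rep_l2 v"
 have f: "f : L2" and v: "v = abs_l2 f" by (auto simp: f_def)
 note [measurable] = L2D(1)[OF f]
 obtain s where s: "!!i. simple_function lebesgue (s i)" "!!x. (%i. s i x) \<longlonglongrightarrow> f x"
   "!!i x. dist (s i x) 0 <= 2 * dist (f x) 0"
  using borel_measurable_implies_sequence_metric[of f lebesgue 0] by auto
 have sm[measurable]: "s i : borel_measurable lebesgue" for i
  using s(1) by (rule borel_measurable_simple_function)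
 \<comment> \<open>Cutting the simple approximants to balls gives their level sets finite measure,
   including the level set of the value 0.\<close>
 define t where "t k x = indicator (cball 0 (real k)) x * s k x" for k x
 have "(%k. abs_l2 (t k)) \<longlonglongrightarrow> abs_l2 f"
 proof (rule l2_dominated_convergence(3)[where C = 2, OF _ _ f])
  show "AE x in lebesgue. (%k. t k x) \<longlonglongrightarrow> f x"
  proof (rule AE_I2)
   fix x :: 'a
   obtain N where "norm x <= real N" using real_arch_simple by blast
   then have "\<forall>\<^sub>F k in sequentially. s k x = t k x"
    by (intro eventually_sequentiallyI[of N]) (auto simp: indicator_def t_def)
   from Lim_transform_eventually[OF s(2)[of x] this] show "(%k. t k x) \<longlonglongrightarrow> f x" .
  qed
  show "AE x in lebesgue. cmod (t k x) <= 2 * cmod (f x)" for k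
   using s(3) by (auto simp: t_def norm_mult indicator_def)
  show "t k : borel_measurable lebesgue" for k
   unfolding t_def[abs_def] by (intro borel_measurable_times borel_measurable_indicator sm) auto
 qed auto
 moreover have "P (abs_l2 (t k))" for k
 proof -
  define B where "B c = (s k -` {c}) \<inter> cball 0 (real k)" for c
  have Bm: "B c : sets lebesgue" for c
   using measurable_sets[OF sm[of k], of "{c}"] by (auto simp: B_def)
  have fin: "finite (range (s k))" using s(1)[of k] by (simp add: simple_function_def)
  have "t k = (%x. SUM c:range (s k). c * indicator (B c) x)"
  proof
   fix x
   have "(SUM c:range (s k). c * indicator (B c) x) = (SUM c:{s k x}. c * indicator (B c) x)"
    using fin by (intro sum.mono_neutral_right) (auto simp: B_def indicator_def)
   then show "t k x = (SUM c:range (s k). c * indicator (B c) x)"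
    by (simp add: t_def B_def indicator_def)
  qed
  moreover have "(%x. SUM c:D. c * indicator (B c) x) : L2 & P (abs_l2 (%x. SUM c:D. c * indicator (B c) x))"
   if "finite D" for D
   using that
  proof induction
   case empty
   show ?case using ind[of "{}" 0 0] by (simp add: L2_zero)
  next
   case (insert c D)
   have *: "(%x. c * indicator (B c) x) : L2" "P (abs_l2 (%x. c * indicator (B c) x))"
    by (rule L2_bounded_indicator[where R = k] ind[where R = k], use Bm in \<open>auto simp: B_def\<close>)+
   have "(%x. SUM c:insert c D. c * indicator (B c) x) = (%x. c * indicator (B c) x + (SUM c:D. c * indicator (B c) x))"
    by (rule ext, rule sum.insert) (use insert.hyps in auto)
   then show ?case
    using insert.IH add[OF *(2), of "abs_l2 (%x. SUM c:D. c * indicator (B c) x)"]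
    by (simp only: abs_l2_add * L2_add simp_thms)
  qed
  ultimately show ?thesis using fin by simp
 qed
 ultimately show ?thesis
  using closed_sequentially[OF closed, of "%k. abs_l2 (t k)" "abs_l2 f"] unfolding v by simp
qed

text \<open>Riesz-Fischer: a subsequence with steps below 2^-k converges almost everywhere, and
  \<open>L2_Fatou\<close> turns the pointwise limit into a limit in norm.\<close>

instance l2 :: (euclidean_space) complete_space
proof
 fix X :: "nat => 'a l2" assume X: "Cauchy X"
 have "EX N. \<forall>m\<ge>N. \<forall>n\<ge>N. norm (X m - X n) < (1/2)^k" for k :: nat
  using X by (intro CauchyD) auto
 then obtain N where N: "!!k m n. m >= N k ==> n >= N k ==> norm (X m - X n) < (1/2)^k"
  by metis
 \<comment> \<open>A partial sum of the thresholds is monotone and at least as large as each of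
   them, so it selects the subsequence directly.\<close>
 define r where "r k = (\<Sum>i\<le>k. N i)" for k
 have rN: "N k <= r k" "r k <= r (Suc k)" for k
  by (auto simp: r_def intro!: member_le_sum)
 define f where "f k = rep_l2 (X (r k))" for k
 have f: "f k : L2" "X (r k) = abs_l2 (f k)" for k by (auto simp: f_def)
 have [measurable]: "f k : borel_measurable lebesgue" for k by (simp add: f_def)
 have step: "norm (X (r (Suc k)) - X (r k)) < (1/2)^k" for k
  using rN[of k] by (intro N) auto
 define S where "S n x = (\<Sum>k<n. cmod (f (Suc k) x - f k x))" for n x
 have Sm[measurable]: "S n : borel_measurable lebesgue" for n
  unfolding S_def by measurable
 have S: "(%x. complex_of_real (S n x)) : L2 & norm (abs_l2 (%x. complex_of_real (S n x))) <= (\<Sum>k<n. (1/2)^k)" for n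
 proof (induction n)
  case 0
  have "norm (abs_l2 (%x::'a. 0 :: complex)) = 0" by (subst norm_abs_l2) (auto simp: L2_zero)
  then show ?case by (simp add: S_def L2_zero)
 next
  case (Suc n)
  let ?d = "%x. complex_of_real (cmod (f (Suc n) x - f n x))"
  have d: "?d : L2" by (rule L2_bound[OF _ L2_diff[OF f(1) f(1)], where C = 1]) auto
  have "norm (abs_l2 ?d) = norm (X (r (Suc n)) - X (r n))"
   by (simp add: f(2) abs_l2_diff f(1) norm_abs_l2 L2_diff d)
  then have "norm (abs_l2 ?d) <= (1/2)^n" using step[of n] by simp
  moreover have "abs_l2 (%x. complex_of_real (S (Suc n) x)) = abs_l2 (%x. complex_of_real (S n x)) + abs_l2 ?d"
   using Suc d by (simp add: abs_l2_add S_def)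
  ultimately show ?case
   using Suc d L2_add[of "%x. complex_of_real (S n x)" ?d]
    norm_triangle_ineq[of "abs_l2 (%x. complex_of_real (S n x))" "abs_l2 ?d"]
   by (simp add: S_def)
 qed
 have gs: "(\<Sum>k<n. (1/2::real)^k) <= 2" for n
  using sum_le_suminf[of "%k. (1/2::real)^k" "{..<n}"] suminf_geometric[of "1/2::real"] by simp
 have "(\<integral>\<^sup>+x. ennreal ((S n x)^2) \<partial>lebesgue) <= ennreal 4" for n
 proof -
  have "norm (abs_l2 (%x. complex_of_real (S n x))) <= 2" using S[of n] gs[of n] by linarith
  then have "(LINT x|lebesgue. (S n x)^2) <= 2^2" using S[of n] by (auto simp: norm_abs_l2 dest: sqrt_le_D)
  then have "ennreal (LINT x|lebesgue. (S n x)^2) <= ennreal 4" by (intro ennreal_leI) simp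
  then show ?thesis using L2D(2)[OF S[THEN conjunct1], of n]
   by (subst nn_integral_eq_integral) auto
 qed
 then have "liminf (%n. \<integral>\<^sup>+x. ennreal ((S n x)^2) \<partial>lebesgue) <= ennreal 4"
  by (intro Liminf_le always_eventually allI) simp
 moreover have "(\<integral>\<^sup>+x. liminf (%n. ennreal ((S n x)^2)) \<partial>lebesgue) <= liminf (%n. \<integral>\<^sup>+x. ennreal ((S n x)^2) \<partial>lebesgue)"
  by (rule nn_integral_liminf) measurable
 ultimately have "(\<integral>\<^sup>+x. liminf (%n. ennreal ((S n x)^2)) \<partial>lebesgue) <= ennreal 4"
  by (rule order_trans[rotated])
 also have "... < \<infinity>" by simp
 finally have fin: "(\<integral>\<^sup>+x. liminf (%n. ennreal ((S n x)^2)) \<partial>lebesgue) ~= \<infinity>" by (rule less_imp_neq)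
 have "(%x. liminf (%n. ennreal ((S n x)^2))) : borel_measurable lebesgue" by measurable
 from nn_integral_PInf_AE[OF this fin] have "AE x in lebesgue. liminf (%n. ennreal ((S n x)^2)) ~= \<infinity>" .
 then have conv: "AE x in lebesgue. convergent (%k. f k x)"
 proof eventually_elim
  case (elim x)
  \<comment> \<open>The partial sums increase in \<open>n\<close>; if they were unbounded, their
    squares would tend to infinity, against the finite liminf.\<close>
  have "EX B. ALL n. S n x <= B"
  proof (rule ccontr)
   assume "\<not> (EX B. ALL n. S n x <= B)"
   then have unb: "EX n. S n x > B" for B by (meson not_le)
   have mono: "S n x <= S m x" if "n <= m" for n m
    unfolding S_def using that by (intro sum_mono2) auto
   have "(%n. ennreal ((S n x)^2)) \<longlonglongrightarrow> \<infinity>"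
    unfolding infinity_ennreal_def
   proof (rule tendsto_top_iff_ennreal[THEN iffD2], intro allI impI)
    fix l :: real
    obtain n where n: "S n x > max 1 l" using unb by blast
    have "l < (S m x)^2" if "m >= n" for m
    proof -
     have "S m x > max 1 l" using n mono[OF that] by linarith
     then have "S m x * 1 <= S m x * S m x" by (intro mult_left_mono) auto
     then show ?thesis using \<open>S m x > max 1 l\<close> unfolding power2_eq_square by linarith
    qed
    moreover assume "0 <= l"
    ultimately show "\<forall>\<^sub>F m in sequentially. ennreal l < ennreal ((S m x)^2)"
     by (intro eventually_sequentiallyI[of n]) (auto simp: ennreal_less_iff)
   qed
   then have "liminf (%n. ennreal ((S n x)^2)) = \<infinity>" by (intro lim_imp_Liminf) auto
   then show False using elim by simp
  qed
  then obtain B where B: "!!n. S n x <= B" by auto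
  have "summable (%k. cmod (f (Suc k) x - f k x))"
   by (rule summableI_nonneg_bounded[where x = B]) (use B in \<open>auto simp: S_def\<close>)
  then have "summable (%k. f (Suc k) x - f k x)" by (rule summable_norm_cancel)
  then show "convergent (%k. f k x)"
   unfolding summable_iff_convergent sum_lessThan_telescope[of "%k. f k x"] convergent_diff_const_right_iff .
 qed
 define g where "g x = lim (%k. f k x)" for x
 have gm[measurable]: "g : borel_measurable lebesgue"
  unfolding g_def[abs_def] by (rule borel_measurable_lim_metric) measurable
 have lim: "AE x in lebesgue. (%k. f k x) \<longlonglongrightarrow> g x"
  using conv by eventually_elim (simp add: g_def convergent_LIMSEQ_iff)
 have close: "(%x. g x - f k x) : L2 & norm (abs_l2 (%x. g x - f k x)) <= (1/2)^k" for k
 proof -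
  have a: "(%x. f (m + k) x - f k x) : L2" for m by (intro L2_diff f)
  have b: "norm (abs_l2 (%x. f (m + k) x - f k x)) <= (1/2)^k" for m
  proof -
   have "N k <= r (m + k)" using rN(1)[of k] lift_Suc_mono_le[of r k "m + k", OF rN(2)] by linarith
   then have "norm (X (r (m + k)) - X (r k)) < (1/2)^k" using rN(1)[of k] by (intro N) auto
   then show ?thesis by (simp only: f(2) abs_l2_diff[OF f(1) f(1)] less_imp_le)
  qed
  have c: "AE x in lebesgue. (%m. f (m + k) x - f k x) \<longlonglongrightarrow> g x - f k x"
   using lim by eventually_elim (rule tendsto_diff[OF LIMSEQ_ignore_initial_segment tendsto_const])
  have d: "(%x. g x - f k x) : borel_measurable lebesgue" by measurable
  show ?thesis using L2_Fatou[OF a d c b] by (intro conjI)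
 qed
 have g: "g : L2" using L2_add[OF close[THEN conjunct1] f(1), of 0 0] by simp
 have "(%k. X (r k)) \<longlonglongrightarrow> abs_l2 g"
 proof (subst LIM_zero_iff[symmetric], rule Lim_null_comparison)
  have "norm (X (r k) - abs_l2 g) <= (1/2)^k" for k
   using close[of k] by (subst norm_minus_commute) (simp only: f(2) abs_l2_diff[OF g f(1)])
  then show "\<forall>\<^sub>F k in sequentially. norm (X (r k) - abs_l2 g) <= (1/2)^k" by simp
  show "(%k. (1/2::real)^k) \<longlonglongrightarrow> 0" by (intro LIMSEQ_power_zero) simp
 qed
 have "X \<longlonglongrightarrow> abs_l2 g"
 proof (subst LIM_zero_iff[symmetric], rule metric_LIMSEQ_I)
  fix e :: real assume e: "0 < e"
  obtain k0 where k0: "!!k. k >= k0 ==> norm (X (r k) - abs_l2 g) < e / 2"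
   using LIMSEQ_D[OF \<open>(%k. X (r k)) \<longlonglongrightarrow> abs_l2 g\<close>, of "e/2"] e by auto
  obtain k1 where k1: "(1/2::real)^k1 < e / 2" using real_arch_pow_inv[of "e/2" "1/2"] e by auto
  define k where "k = max k0 k1"
  have "(1/2::real)^k <= (1/2)^k1" by (intro power_decreasing) (auto simp: k_def)
  have "dist (X n - abs_l2 g) 0 < e" if "n >= N k" for n
  proof -
   have "norm (X n - X (r k)) < (1/2)^k" using that rN(1)[of k] by (intro N) auto
   moreover have "norm (X (r k) - abs_l2 g) < e / 2" by (rule k0) (simp add: k_def)
   moreover have "norm (X n - abs_l2 g) <= norm (X n - X (r k)) + norm (X (r k) - abs_l2 g)"
    by (rule order_trans[OF _ norm_triangle_ineq]) simp
   ultimately have "norm (X n - abs_l2 g) < e" using \<open>(1/2::real)^k <= (1/2)^k1\<close> k1 by linarith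
   then show ?thesis by simp
  qed
  then show "EX no. \<forall>n\<ge>no. dist (X n - abs_l2 g) 0 < e" by blast
 qed
 then show "convergent X" by (auto simp: convergent_def)
qed


text \<open>The representing vector minimizes \<open>J\<close>. The parallelogram law makes a
  minimizing sequence Cauchy, and the vanishing first variation at the minimizer is the claimed
  identity.\<close>

theorem Riesz_representation:
 fixes \<phi> :: "'h::{real_inner, complete_space} => real"
 assumes "bounded_linear \<phi>"
 shows "EX w. ALL x. \<phi> x = inner w x"
proof -
 interpret bounded_linear \<phi> by fact
 obtain K where K: "!!x. norm (\<phi> x) <= norm x * K" "0 <= K" using nonneg_bounded by blast
 define J where "J x = inner x x - 2 * \<phi> x" for x
 have J_ge: "- K\<^sup>2 <= J x" for x
 proof -
  have "\<phi> x <= norm x * K" using K(1)[of x] by simp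
  moreover have "0 <= (norm x - K)^2" by simp
  ultimately show ?thesis
   unfolding J_def power2_norm_eq_inner[symmetric] by (simp add: power2_eq_square algebra_simps)
 qed
 define m where "m = (INF x. J x)"
 have bdd: "bdd_below (range J)" using J_ge by (auto simp: bdd_below_def)
 have mJ: "m <= J x" for x unfolding m_def by (rule cINF_lower[OF bdd]) simp
 have "EX x. J x < m + 1 / Suc n" for n
  using cINF_less_iff[OF _ bdd, of "m + 1 / Suc n"] unfolding m_def by auto
 then obtain X where X: "!!n. J (X n) < m + 1 / Suc n" by metis
 have par: "(norm (x - y))^2 = 2 * J x + 2 * J y - 4 * J ((1/2) *\<^sub>R (x + y))" for x y
 proof -
  have "\<phi> ((1/2) *\<^sub>R (x + y)) = (\<phi> x + \<phi> y) / 2" by (simp only: scaleR add) simp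
  moreover have "inner ((1/2) *\<^sub>R (x + y)) ((1/2) *\<^sub>R (x + y)) = (norm (x + y))^2 / 4"
   unfolding power2_norm_eq_inner[symmetric] norm_scaleR by (simp add: power_mult_distrib power2_eq_square)
  ultimately have "J ((1/2) *\<^sub>R (x + y)) = (norm (x + y))^2 / 4 - (\<phi> x + \<phi> y)"
   unfolding J_def by simp
  moreover have "J z = (norm z)^2 - 2 * \<phi> z" for z by (simp add: J_def power2_norm_eq_inner)
  ultimately show ?thesis using dot_norm[of x y] dot_norm_neg[of x y] by simp
 qed
 have close: "(norm (X k - X l))^2 <= 4 / Suc n" if "k >= n" "l >= n" for k l n
 proof -
  have "1 / real (Suc k) <= 1 / real (Suc n)" "1 / real (Suc l) <= 1 / real (Suc n)"
   using that by (auto intro!: divide_left_mono)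
  moreover have "4 / real (Suc n) = 4 * (1 / real (Suc n))" by simp
  ultimately show ?thesis
   using X[of k] X[of l] mJ[of "(1/2) *\<^sub>R (X k + X l)"] unfolding par by linarith
 qed
 have "Cauchy X"
 proof (rule CauchyI)
  fix e :: real assume e: "0 < e"
  obtain n where n: "1 / real (Suc n) < e^2 / 4" using nat_approx_posE[of "e^2/4"] e by auto
  have "norm (X k - X l) < e" if "k >= n" "l >= n" for k l
  proof -
   have "(norm (X k - X l))^2 < e^2" using close[OF that] n by simp
   then show ?thesis using e by (simp add: power2_less_imp_less)
  qed
  then show "EX M. \<forall>k\<ge>M. \<forall>l\<ge>M. norm (X k - X l) < e" by blast
 qed
 then obtain w where w: "X \<longlonglongrightarrow> w" by (auto simp: Cauchy_convergent_iff convergent_def)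
 have "(%n. J (X n)) \<longlonglongrightarrow> J w"
  unfolding J_def by (intro tendsto_intros w tendsto)
 moreover have "(%n. m + 1 / Suc n) \<longlonglongrightarrow> m + 0"
  by (intro tendsto_intros LIMSEQ_Suc lim_1_over_n)
 ultimately have Jw: "J w <= m"
  using X by (intro LIMSEQ_le[where X = "%n. J (X n)"]) (auto intro: less_imp_le)
 have "\<phi> x = inner w x" for x
 proof (rule ccontr)
  assume ne: "\<phi> x ~= inner w x"
  define a where "a = inner w x - \<phi> x"
  have "0 <= 2 * t * a + t^2 * inner x x" for t
  proof -
   have "J w <= J (w + t *\<^sub>R x)" using Jw mJ order_trans by blast
   moreover have "\<phi> (w + t *\<^sub>R x) = \<phi> w + t * \<phi> x" by (simp only: scaleR add) simp
   moreover have "inner (w + t *\<^sub>R x) (w + t *\<^sub>R x) = inner w w + 2 * t * inner w x + t^2 * inner x x"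
    using inner_commute[of x w] by (simp add: inner_add_left inner_add_right power2_eq_square distrib_left)
   moreover have "2 * t * a = 2 * t * inner w x - 2 * (t * \<phi> x)" by (simp add: a_def right_diff_distrib)
   ultimately show ?thesis unfolding J_def by linarith
  qed
  note pos = this
  \<comment> \<open>The natural step length divides \<open>a\<close> by the squared norm of
    \<open>x\<close>; the extra 1 keeps the divisor positive for \<open>x = 0\<close> and still
    makes the variation negative.\<close>
  define b where "b = inner x x + 1"
  have b: "b >= 1" by (simp add: b_def)
  have "0 <= 2 * (- a / b) * a + (- a / b)^2 * (b - 1)" using pos[of "- a / b"] by (simp add: b_def)
  also have "... <= 2 * (- a / b) * a + (- a / b)^2 * b" by (intro add_left_mono mult_left_mono) auto
  also have "... = - (a^2 / b)" using b by (simp add: power2_eq_square)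
  finally have "a^2 / b <= 0" by simp
  moreover have "0 < a^2 / b" using ne b by (intro divide_pos_pos) (auto simp: a_def)
  ultimately show False by simp
 qed
 then show ?thesis by blast
qed

section \<open>Finite sequence norms with reciprocal exponents: Hoelder, duality, mixed
  norms\<close>

definition lpn :: "real => 'i set => ('i => real) => real" where
 "lpn rho I a = (if rho = 0 then Max (insert 0 (a ` I)) else (SUM i:I. a i powr (1 / rho)) powr rho)"

lemma lpn_nonneg: "finite I ==> 0 <= lpn rho I a"
 by (auto simp: lpn_def)

lemma lpn_mono:
 assumes "finite I" "0 <= rho" "!!i. i : I ==> 0 <= a i" "!!i. i : I ==> a i <= b i"
 shows "lpn rho I a <= lpn rho I b"
proof (cases "rho = 0")
 case True
 have "Max (insert 0 (a ` I)) <= Max (insert 0 (b ` I))"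
 proof (intro Max.boundedI)
  fix y assume "y : insert 0 (a ` I)"
  then consider "y = 0" | i where "i : I" "y = a i" by auto
  then show "y <= Max (insert 0 (b ` I))"
  proof cases
   case 2
   then have "y <= b i" "b i <= Max (insert 0 (b ` I))" using assms by auto
   then show ?thesis by linarith
  qed (use assms in auto)
 qed (use assms in auto)
 then show ?thesis using True by (simp add: lpn_def)
next
 case False
 then show ?thesis using assms unfolding lpn_def
  by (auto intro!: powr_mono2 sum_mono sum_nonneg)
qed

lemma lpn_member:
 assumes "finite I" "0 <= rho" "!!i. i : I ==> 0 <= a i" "j : I"
 shows "a j <= lpn rho I a"
proof (cases "rho = 0")
 case True
 then show ?thesis using assms by (auto simp: lpn_def)
next
 case False
 have "a j powr (1 / rho) <= (SUM i:I. a i powr (1 / rho))"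
  using assms by (intro member_le_sum) auto
 then have "(a j powr (1 / rho)) powr rho <= lpn rho I a"
  using False assms unfolding lpn_def by (auto intro!: powr_mono2)
 then show ?thesis using assms(3)[OF assms(4)] False by (simp add: powr_powr)
qed

lemma lpn_scale:
 assumes "finite I" "0 <= rho" "0 <= c" "!!i. i : I ==> 0 <= a i"
 shows "lpn rho I (%i. c * a i) = c * lpn rho I a"
proof (cases "rho = 0")
 case True
 have "Max ((%x. c * x) ` insert 0 (a ` I)) = c * Max (insert 0 (a ` I))"
  by (rule mono_Max_commute[symmetric]) (use assms in \<open>auto simp: mono_def intro: mult_left_mono\<close>)
 moreover have "(%x. c * x) ` insert 0 (a ` I) = insert 0 ((%i. c * a i) ` I)" by (auto simp: image_image)
 ultimately show ?thesis using True by (simp add: lpn_def)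
next
 case False
 have "(SUM i:I. (c * a i) powr (1 / rho)) = c powr (1 / rho) * (SUM i:I. a i powr (1 / rho))"
  using assms by (simp add: powr_mult sum_distrib_left)
 then show ?thesis using False assms by (simp add: lpn_def powr_mult powr_powr sum_nonneg)
qed

text \<open>Raising entries to a power rescales the reciprocal exponent. This is what turns
  Hoelder's inequality into log-convexity in \<open>lpn_convex\<close>.\<close>

lemma lpn_powr:
 assumes "finite I" "0 <= rho" "0 < theta" "!!i. i : I ==> 0 <= a i"
 shows "lpn (theta * rho) I (%i. a i powr theta) = lpn rho I a powr theta"
proof (cases "rho = 0")
 case True
 show ?thesis
 proof (rule antisym)
  show "lpn (theta * rho) I (%i. a i powr theta) <= lpn rho I a powr theta"
   using True lpn_member[of I 0 a] assms by (auto simp: lpn_def[of 0 _ "%i. a i powr theta"] intro!: powr_mono2)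
  have "Max (insert 0 (a ` I)) : insert 0 (a ` I)" using assms by (intro Max_in) auto
  then have "lpn 0 I a = 0 \<or> (EX i:I. lpn 0 I a = a i)" by (auto simp: lpn_def)
  then show "lpn rho I a powr theta <= lpn (theta * rho) I (%i. a i powr theta)"
   using True lpn_member[of I 0 "%i. a i powr theta"] lpn_nonneg[of I 0 "%i. a i powr theta"] assms by auto
 qed
next
 case False
 have "a i powr (theta / (theta * rho)) = a i powr (1 / rho)" for i using assms by simp
 then show ?thesis using False assms by (simp add: lpn_def powr_powr mult.commute)
qed

lemma lpn_one: "finite I ==> (!!i. i : I ==> 0 <= a i) ==> lpn 1 I a = (SUM i:I. a i)"
 by (simp add: lpn_def sum_nonneg)

lemma lpn_half:
 assumes "finite I" "!!i. i : I ==> 0 <= a i"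
 shows "lpn (1/2) I a = L2_set a I"
proof -
 have "(SUM i:I. a i powr 2) = (SUM i:I. (a i)^2)" using assms by (intro sum.cong) auto
 then show ?thesis by (simp add: lpn_def L2_set_def powr_half_sqrt sum_nonneg)
qed

text \<open>Young's inequality with weights \<open>rho / s\<close> and \<open>rho' / s\<close>,
  applied to terms normalized by \<open>S\<close> and \<open>T\<close>. An infinite exponent is a
  pointwise bound by the maximum.\<close>

lemma lpn_Holder:
 assumes I: "finite I" and "0 <= rho" "0 <= rho'" and nn: "!!i. i : I ==> 0 <= a i" "!!i. i : I ==> 0 <= b i"
 shows "lpn (rho + rho') I (%i. a i * b i) <= lpn rho I a * lpn rho' I b"
proof -
 have zero: "lpn rho' I (%i. a i * b i) <= lpn 0 I a * lpn rho' I b"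
  if "0 <= rho'" and nn: "!!i. i : I ==> 0 <= a i" "!!i. i : I ==> 0 <= b i" for rho' :: real and a b
 proof -
  have "lpn rho' I (%i. a i * b i) <= lpn rho' I (%i. lpn 0 I a * b i)"
   using that I lpn_member[of I 0 a] by (intro lpn_mono mult_right_mono mult_nonneg_nonneg) auto
  also have "... = lpn 0 I a * lpn rho' I b"
   using that I by (intro lpn_scale lpn_nonneg) auto
  finally show ?thesis .
 qed
 consider "rho = 0" | "rho' = 0" | "0 < rho" "0 < rho'" using assms by linarith
 then show ?thesis
 proof cases
  case 1 then show ?thesis using zero[OF assms(3) nn] by simp
 next
  case 2 then show ?thesis using zero[OF assms(2) nn(2) nn(1)] by (simp add: mult.commute)
 next
  case 3
  define s where "s = rho + rho'"
  have s: "s > 0" using 3 by (simp add: s_def)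
  then have s: "s > 0" "rho / s + rho' / s = 1" by (simp_all add: s_def add_divide_distrib[symmetric])
  define S where "S = (SUM i:I. a i powr (1 / rho))"
  define T where "T = (SUM i:I. b i powr (1 / rho'))"
  have ST: "0 <= S" "0 <= T" by (auto simp: S_def T_def sum_nonneg)
  have "(SUM i:I. (a i * b i) powr (1 / s)) <= S powr (rho / s) * T powr (rho' / s)"
  proof (cases "S = 0 \<or> T = 0")
   case True
   then have "ALL i:I. a i * b i = 0"
    using I by (auto simp: S_def T_def sum_nonneg_eq_0_iff)
   then have "(SUM i:I. (a i * b i) powr (1 / s)) = 0" by (intro sum.neutral) simp
   then show ?thesis by simp
  next
   case False
   then have ST: "0 < S" "0 < T" using ST by auto
   have "(a i * b i) powr (1 / s) <= S powr (rho / s) * T powr (rho' / s)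
     * ((rho / s) * (a i powr (1 / rho) / S) + (rho' / s) * (b i powr (1 / rho') / T))" if i: "i : I" for i
   proof (cases "a i = 0 \<or> b i = 0")
    case True
    then show ?thesis using 3 s ST by (auto intro!: mult_nonneg_nonneg add_nonneg_nonneg)
   next
    case False
    then have ab: "0 < a i" "0 < b i" using nn[OF i] by auto
    have "(a i powr (1 / rho) / S) powr (rho / s) * (b i powr (1 / rho') / T) powr (rho' / s)
      <= (rho / s) * (a i powr (1 / rho) / S) + (rho' / s) * (b i powr (1 / rho') / T)"
     using s 3 ST ab by (intro Youngs_inequality_0) auto
    moreover have "(a i powr (1 / rho) / S) powr (rho / s) * (b i powr (1 / rho') / T) powr (rho' / s)
      = (a i * b i) powr (1 / s) / (S powr (rho / s) * T powr (rho' / s))"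
     using ab ST 3 by (simp add: powr_divide powr_powr powr_mult)
    ultimately show ?thesis using ST by (simp add: field_simps)
   qed
   then have "(SUM i:I. (a i * b i) powr (1 / s)) <= (SUM i:I. S powr (rho / s) * T powr (rho' / s)
     * ((rho / s) * (a i powr (1 / rho) / S) + (rho' / s) * (b i powr (1 / rho') / T)))"
    by (rule sum_mono)
   also have "... = S powr (rho / s) * T powr (rho' / s) * ((rho / s) * (S / S) + (rho' / s) * (T / T))"
    unfolding sum_distrib_left[symmetric] sum.distrib sum_divide_distrib[symmetric] S_def[symmetric] T_def[symmetric] ..
   also have "... = S powr (rho / s) * T powr (rho' / s)" using ST s by simp
   finally show ?thesis .
  qed
  then have "(SUM i:I. (a i * b i) powr (1 / s)) powr s <= (S powr (rho / s) * T powr (rho' / s)) powr s"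
   using s by (intro powr_mono2 sum_nonneg) auto
  also have "... = S powr rho * T powr rho'" using s by (simp add: powr_mult powr_powr)
  finally show ?thesis using 3 s by (simp add: lpn_def S_def T_def s_def[symmetric])
 qed
qed

lemma lpn_sum_le:
 assumes "finite I" "0 <= rho" "rho <= 1" "!!i. i : I ==> 0 <= a i" "!!i. i : I ==> 0 <= b i"
 shows "(SUM i:I. a i * b i) <= lpn rho I a * lpn (1 - rho) I b"
 using lpn_Holder[of I rho "1 - rho" a b] assms by (simp add: lpn_one)

lemma lpn_convex:
 assumes "finite I" "0 <= rho\<^sub>1" "0 <= rho\<^sub>0" "0 < theta" "theta < 1" "!!i. i : I ==> 0 <= a i" "!!i. i : I ==> 0 <= b i"
 shows "lpn (theta * rho\<^sub>1 + (1 - theta) * rho\<^sub>0) I (%i. a i powr theta * b i powr (1 - theta))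
  <= lpn rho\<^sub>1 I a powr theta * lpn rho\<^sub>0 I b powr (1 - theta)"
 using lpn_Holder[of I "theta * rho\<^sub>1" "(1 - theta) * rho\<^sub>0" "%i. a i powr theta" "%i. b i powr (1 - theta)"] assms
 by (simp add: lpn_powr)

text \<open>For finite families the duality is attained: by the power \<open>1 / rho - 1\<close> of
  \<open>a\<close>, normalized, or at the ends by the indicator of a maximal entry
  (\<open>rho = 0\<close>) and by the constant 1 (\<open>rho = 1\<close>).\<close>

lemma lpn_dual:
 assumes I: "finite I" and rho: "0 <= rho" "rho <= 1" and nn: "!!i. i : I ==> 0 <= a i"
 shows "EX b. (ALL i. 0 <= b i) & lpn (1 - rho) I b <= 1 & (SUM i:I. a i * b i) = lpn rho I a"
proof (cases "ALL i:I. a i = 0")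
 case True
 then have "lpn rho I a = lpn rho I (%i. 0 * 1)" unfolding lpn_def by (auto cong: image_cong sum.cong)
 also have "... = 0" by (subst lpn_scale) (use I rho in auto)
 finally have "lpn rho I a = 0" .
 moreover have "lpn (1 - rho) I (%i. 0 * 1) = 0" by (subst lpn_scale) (use I rho in auto)
 ultimately show ?thesis by (intro exI[of _ "%i. 0"]) auto
next
 case nz: False
 consider "rho = 0" | "rho = 1" | "0 < rho" "rho < 1" using rho by linarith
 then show ?thesis
 proof cases
  case 1
  have "Max (insert 0 (a ` I)) : insert 0 (a ` I)" using I by (intro Max_in) auto
  then have "lpn 0 I a = 0 \<or> (EX i:I. lpn 0 I a = a i)" by (auto simp: lpn_def)
  moreover have "lpn 0 I a ~= 0"
  proof
   assume "lpn 0 I a = 0"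
   then have "a i = 0" if "i : I" for i using lpn_member[of I 0 a i] I nn that by fastforce
   then show False using nz by blast
  qed
  ultimately obtain i where i: "i : I" "lpn 0 I a = a i" by auto
  let ?b = "%j. if j = i then 1 else 0 :: real"
  have "lpn 1 I ?b = 1" using I i by (subst lpn_one) auto
  moreover have "(SUM j:I. a j * ?b j) = (SUM j:I. if j = i then a j else 0)" by (intro sum.cong) auto
  then have "(SUM j:I. a j * ?b j) = a i" using I i by simp
  ultimately show ?thesis using 1 i by (intro exI[of _ ?b]) auto
 next
  case 2
  have "lpn 0 I (%i. 1) <= 1" using I by (auto simp: lpn_def)
  then show ?thesis using 2 I nn by (intro exI[of _ "%i. 1"]) (auto simp: lpn_one)
 next
  case 3
  define S where "S = (SUM i:I. a i powr (1 / rho))"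
  obtain j where j: "j : I" "a j ~= 0" using nz by auto
  have S: "0 < S" unfolding S_def by (rule sum_pos2[OF I j(1)]) (use j in auto)
  define b where "b i = a i powr (1 / rho - 1) / S powr (1 - rho)" for i
  have "(SUM i:I. b i powr (1 / (1 - rho))) = (SUM i:I. a i powr (1 / rho) / S)"
  proof (rule sum.cong[OF refl])
   fix i
   have "(1 / rho - 1) * (1 / (1 - rho)) = 1 / rho" using 3 by (simp add: field_simps)
   then show "b i powr (1 / (1 - rho)) = a i powr (1 / rho) / S"
    unfolding b_def using 3 S by (simp add: powr_divide powr_powr)
  qed
  also have "... = 1" using S by (simp add: sum_divide_distrib[symmetric] S_def[symmetric])
  finally have 1: "lpn (1 - rho) I b = 1" using 3 by (simp add: lpn_def)
  have "(SUM i:I. a i * b i) = (SUM i:I. a i powr (1 / rho) / S powr (1 - rho))"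
  proof (rule sum.cong[OF refl])
   fix i assume "i : I"
   then have "a i * a i powr (1 / rho - 1) = a i powr (1 / rho)"
    using nn powr_add[of "a i" 1 "1 / rho - 1"] by simp
   then show "a i * b i = a i powr (1 / rho) / S powr (1 - rho)" by (simp add: b_def)
  qed
  also have "... = S / S powr (1 - rho)" by (simp add: sum_divide_distrib[symmetric] S_def[symmetric])
  also have "... = S powr rho" using S powr_diff[of S 1 "1 - rho"] by simp
  finally have "(SUM i:I. a i * b i) = lpn rho I a" using 3 by (simp add: lpn_def S_def)
  then show ?thesis using 1 by (intro exI[of _ b]) (auto simp: b_def)
 qed
qed

text \<open>The inclusion of sequence spaces over counting measure: every entry is at most the
  larger norm \<open>M\<close>, so the surplus power is bounded by a power of
  \<open>M\<close>.\<close>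

lemma lpn_antimono:
 assumes I: "finite I" and rho: "0 <= rho" "rho <= rho'" and nn: "!!i. i : I ==> 0 <= a i"
 shows "lpn rho I a <= lpn rho' I a"
proof (cases "rho = 0 \<or> rho = rho'")
 case True
 then show ?thesis using lpn_member[OF I _ nn, of "rho'"] lpn_nonneg[OF I, of rho' a] rho I
  by (auto simp: lpn_def[of 0])
next
 case False
 then have p: "0 < rho" "rho < rho'" using rho by auto
 define M where "M = lpn rho' I a"
 have M: "0 <= M" "!!i. i : I ==> a i <= M"
  using lpn_nonneg[OF I] lpn_member[OF I _ nn, of rho'] rho by (auto simp: M_def)
 have "(SUM i:I. a i powr (1 / rho)) <= (SUM i:I. M powr (1 / rho - 1 / rho') * a i powr (1 / rho'))"
 proof (rule sum_mono)
  fix i assume i: "i : I"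
  have "a i powr (1 / rho) = a i powr (1 / rho - 1 / rho') * a i powr (1 / rho')" by (simp add: powr_add[symmetric])
  also have "... <= M powr (1 / rho - 1 / rho') * a i powr (1 / rho')"
   using p M(2)[OF i] nn[OF i] by (intro mult_right_mono powr_mono2) (auto simp: frac_le)
  finally show "a i powr (1 / rho) <= M powr (1 / rho - 1 / rho') * a i powr (1 / rho')" .
 qed
 also have "... = M powr (1 / rho - 1 / rho') * M powr (1 / rho')"
  using p by (simp add: sum_distrib_left[symmetric] M_def lpn_def powr_powr sum_nonneg)
 also have "... = M powr (1 / rho)" by (simp add: powr_add[symmetric])
 finally have "(SUM i:I. a i powr (1 / rho)) powr rho <= (M powr (1 / rho)) powr rho"
  using p by (intro powr_mono2 sum_nonneg) auto
 also have "... = M" using p M by (simp add: powr_powr)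
 finally show ?thesis using p by (simp add: lpn_def M_def)
qed

lemma lpn_subset:
 assumes "finite J" "I <= J" "0 <= rho"
 shows "lpn rho I a <= lpn rho J a"
proof (cases "rho = 0")
 case True
 have "Max (insert 0 (a ` I)) <= Max (insert 0 (a ` J))"
  using assms by (intro Max_mono) auto
 then show ?thesis using True by (simp add: lpn_def)
next
 case False
 then show ?thesis using assms by (auto simp: lpn_def intro!: powr_mono2 sum_mono2 sum_nonneg)
qed

lemma lpn_cong: "I = J ==> (!!i. i : J ==> a i = b i) ==> lpn rho I a = lpn rho J b"
 by (auto simp: lpn_def cong: image_cong sum.cong)

definition mix :: "real => real => 'i set => 'k set => ('i => 'k => real) => real" where
 "mix alpha rho N K a = lpn alpha N (%n. lpn rho K (a n))"

lemma mix_nonneg: "finite N ==> 0 <= mix alpha rho N K a"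
 by (simp add: mix_def lpn_nonneg)

lemma mix_mono:
 assumes "finite N" "finite K" "0 <= alpha" "0 <= rho"
  "!!n k. n : N ==> k : K ==> 0 <= a n k" "!!n k. n : N ==> k : K ==> a n k <= b n k"
 shows "mix alpha rho N K a <= mix alpha rho N K b"
 unfolding mix_def using assms by (intro lpn_mono lpn_nonneg) auto

lemma mix_sum_le:
 assumes "finite N" "finite K" "0 <= alpha" "alpha <= 1" "0 <= rho" "rho <= 1"
  "!!n k. n : N ==> k : K ==> 0 <= a n k" "!!n k. n : N ==> k : K ==> 0 <= b n k"
 shows "(SUM n:N. SUM k:K. a n k * b n k) <= mix alpha rho N K a * mix (1 - alpha) (1 - rho) N K b"
proof -
 have "(SUM n:N. SUM k:K. a n k * b n k) <= (SUM n:N. lpn rho K (a n) * lpn (1 - rho) K (b n))"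
  using assms by (intro sum_mono lpn_sum_le) auto
 also have "... <= mix alpha rho N K a * mix (1 - alpha) (1 - rho) N K b"
  unfolding mix_def using assms by (intro lpn_sum_le lpn_nonneg) auto
 finally show ?thesis .
qed

text \<open>Dualize in \<open>k\<close> for each \<open>n\<close>, then dualize the resulting
  sequence in \<open>n\<close>, and multiply the two extremizers.\<close>

lemma mix_dual:
 assumes N: "finite N" and K: "finite K" and "0 <= alpha" "alpha <= 1" "0 <= rho" "rho <= 1"
  and nn: "!!n k. n : N ==> k : K ==> 0 <= a n k"
 shows "EX b. (ALL n k. 0 <= b n k) & mix (1 - alpha) (1 - rho) N K b <= 1 &
  (SUM n:N. SUM k:K. a n k * b n k) = mix alpha rho N K a"
proof -
 have "EX b. n : N --> (ALL k. 0 <= b k) & lpn (1 - rho) K b <= 1 & (SUM k:K. a n k * b k) = lpn rho K (a n)" for n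
  using lpn_dual[OF K, of rho "a n"] assms by auto
 then obtain b where b: "!!n. n : N ==> (ALL k. 0 <= b n k) & lpn (1 - rho) K (b n) <= 1 & (SUM k:K. a n k * b n k) = lpn rho K (a n)"
  by metis
 obtain c where c: "ALL n. 0 <= c n" "lpn (1 - alpha) N c <= 1" "(SUM n:N. lpn rho K (a n) * c n) = mix alpha rho N K a"
  using lpn_dual[OF N, of alpha "%n. lpn rho K (a n)"] assms lpn_nonneg[OF K] unfolding mix_def by metis
 define e where "e n k = (if n : N then c n * b n k else 0)" for n k
 have "mix (1 - alpha) (1 - rho) N K e = lpn (1 - alpha) N (%n. c n * lpn (1 - rho) K (b n))"
  unfolding mix_def
 proof (rule lpn_cong[OF refl])
  fix n assume n: "n : N"
  have "lpn (1 - rho) K (e n) = lpn (1 - rho) K (%k. c n * b n k)"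
   by (rule lpn_cong) (auto simp: e_def n)
  also have "... = c n * lpn (1 - rho) K (b n)" using assms c b[OF n] by (intro lpn_scale) auto
  finally show "lpn (1 - rho) K (e n) = c n * lpn (1 - rho) K (b n)" .
 qed
 also have "... <= lpn (1 - alpha) N c"
  using assms b c lpn_nonneg[OF K] by (intro lpn_mono mult_nonneg_nonneg mult_left_le) auto
 finally have "mix (1 - alpha) (1 - rho) N K e <= 1" using c by simp
 moreover have "(SUM n:N. SUM k:K. a n k * e n k) = (SUM n:N. lpn rho K (a n) * c n)"
 proof (rule sum.cong[OF refl])
  fix n assume n: "n : N"
  have "(SUM k:K. a n k * e n k) = (SUM k:K. a n k * b n k) * c n"
   unfolding sum_distrib_right using n by (intro sum.cong) (auto simp: e_def)
  then show "(SUM k:K. a n k * e n k) = lpn rho K (a n) * c n" using b[OF n] by simp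
 qed
 moreover have "ALL n k. 0 <= e n k" using b c by (auto simp: e_def)
 ultimately show ?thesis using c by (intro exI[of _ e]) auto
qed

lemma mix_convex:
 assumes "finite N" "finite K" "0 <= alpha\<^sub>1" "0 <= alpha\<^sub>0" "0 <= rho\<^sub>1" "0 <= rho\<^sub>0" "0 < theta" "theta < 1"
  "!!n k. n : N ==> k : K ==> 0 <= a n k"
 shows "mix (theta * alpha\<^sub>1 + (1 - theta) * alpha\<^sub>0) (theta * rho\<^sub>1 + (1 - theta) * rho\<^sub>0) N K a
  <= mix alpha\<^sub>1 rho\<^sub>1 N K a powr theta * mix alpha\<^sub>0 rho\<^sub>0 N K a powr (1 - theta)"
proof -
 let ?alpha = "theta * alpha\<^sub>1 + (1 - theta) * alpha\<^sub>0" and ?rho = "theta * rho\<^sub>1 + (1 - theta) * rho\<^sub>0"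
 have nn: "0 <= ?alpha" "0 <= ?rho" using assms by auto
 have "mix ?alpha ?rho N K a <= lpn ?alpha N (%n. lpn rho\<^sub>1 K (a n) powr theta * lpn rho\<^sub>0 K (a n) powr (1 - theta))"
  unfolding mix_def
 proof (rule lpn_mono)
  fix n assume n: "n : N"
  have "lpn ?rho K (a n) = lpn ?rho K (%k. a n k powr theta * a n k powr (1 - theta))"
   using assms n by (intro lpn_cong) (auto simp: powr_add[symmetric])
  also have "... <= lpn rho\<^sub>1 K (a n) powr theta * lpn rho\<^sub>0 K (a n) powr (1 - theta)"
   using assms n by (intro lpn_convex) auto
  finally show "lpn ?rho K (a n) <= lpn rho\<^sub>1 K (a n) powr theta * lpn rho\<^sub>0 K (a n) powr (1 - theta)" .
 qed (use assms nn lpn_nonneg in auto)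
 also have "... <= mix alpha\<^sub>1 rho\<^sub>1 N K a powr theta * mix alpha\<^sub>0 rho\<^sub>0 N K a powr (1 - theta)"
  unfolding mix_def using assms lpn_nonneg[of K] by (intro lpn_convex) auto
 finally show ?thesis .
qed

text \<open>Against nonnegative tests, a bound on the functional with coefficients \<open>z\<close>
  is a bound on the dual norm of the positive part \<open>w\<close>. Two such bounds concern one and
  the same \<open>w\<close>, so log-convexity of the mixed norm interpolates them without loss in
  \<open>C\<close>.\<close>

lemma mix_interpolate:
 assumes N: "finite N" and K: "finite K"
  and e: "0 <= alpha\<^sub>1" "alpha\<^sub>1 <= 1" "0 <= alpha\<^sub>0" "alpha\<^sub>0 <= 1" "0 <= rho\<^sub>1" "rho\<^sub>1 <= 1" "0 <= rho\<^sub>0" "rho\<^sub>0 <= 1" "0 <= theta" "theta <= 1" and C: "0 <= C"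
  and b1: "!!g. (!!n k. 0 <= g n k) ==> (SUM n:N. SUM k:K. g n k * z n k) <= C * mix (1 - alpha\<^sub>1) (1 - rho\<^sub>1) N K g"
  and b0: "!!g. (!!n k. 0 <= g n k) ==> (SUM n:N. SUM k:K. g n k * z n k) <= C * mix (1 - alpha\<^sub>0) (1 - rho\<^sub>0) N K g"
  and g: "!!n k. 0 <= g n k"
 shows "(SUM n:N. SUM k:K. g n k * z n k)
  <= C * mix (1 - (theta * alpha\<^sub>1 + (1 - theta) * alpha\<^sub>0)) (1 - (theta * rho\<^sub>1 + (1 - theta) * rho\<^sub>0)) N K g"
proof -
 consider "theta = 0" | "theta = 1" | "0 < theta" "theta < 1" using e by linarith
 then show ?thesis
 proof cases
  case 1 then show ?thesis using b0[OF g] by simp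
 next
  case 2 then show ?thesis using b1[OF g] by simp
 next
  case 3
  define w where "w n k = max 0 (z n k)" for n k
  have w: "0 <= w n k" "z n k <= w n k" for n k by (auto simp: w_def)
  have out: "mix alpha rho N K w <= C" if e: "0 <= alpha" "alpha <= 1" "0 <= rho" "rho <= 1"
   and b: "!!g. (!!n k. 0 <= g n k) ==> (SUM n:N. SUM k:K. g n k * z n k) <= C * mix (1 - alpha) (1 - rho) N K g" for alpha rho
  proof -
   obtain h where h: "ALL n k. 0 <= h n k" "mix (1 - alpha) (1 - rho) N K h <= 1"
     "(SUM n:N. SUM k:K. w n k * h n k) = mix alpha rho N K w"
    using mix_dual[OF N K e, of w] w by metis
   \<comment> \<open>Switching the test off where \<open>z\<close> is not positive turns the sum
     against \<open>w\<close> back into a sum against \<open>z\<close>.\<close>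
   define h' where "h' n k = (if 0 < z n k then h n k else 0)" for n k
   have "(SUM n:N. SUM k:K. w n k * h n k) = (SUM n:N. SUM k:K. h' n k * z n k)"
    by (intro sum.cong refl) (auto simp: h'_def w_def max_def)
   also have "... <= C * mix (1 - alpha) (1 - rho) N K h'" using h by (intro b) (auto simp: h'_def)
   also have "... <= C * mix (1 - alpha) (1 - rho) N K h"
    using h e C N K by (intro mult_left_mono mix_mono) (auto simp: h'_def)
   also have "... <= C" using h C by (intro mult_left_le) auto
   finally show ?thesis using h by simp
  qed
  let ?alpha = "theta * alpha\<^sub>1 + (1 - theta) * alpha\<^sub>0" and ?rho = "theta * rho\<^sub>1 + (1 - theta) * rho\<^sub>0"
  have le: "0 <= ?alpha" "0 <= ?rho" "?alpha <= 1" "?rho <= 1" using e 3 by (auto intro!: convex_bound_le)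
  have "mix ?alpha ?rho N K w <= mix alpha\<^sub>1 rho\<^sub>1 N K w powr theta * mix alpha\<^sub>0 rho\<^sub>0 N K w powr (1 - theta)"
   using N K e 3 w by (intro mix_convex) auto
  also have "... <= C powr theta * C powr (1 - theta)"
   using out[OF e(1,2,5,6) b1] out[OF e(3,4,7,8) b0] 3 mix_nonneg[OF N]
   by (intro mult_mono powr_mono2) auto
  also have "... = C" using C by (simp add: powr_add[symmetric])
  finally have *: "mix ?alpha ?rho N K w <= C" .
  have "(SUM n:N. SUM k:K. g n k * z n k) <= (SUM n:N. SUM k:K. w n k * g n k)"
   using g w by (intro sum_mono) (simp add: mult.commute mult_left_mono)
  also have "... <= mix ?alpha ?rho N K w * mix (1 - ?alpha) (1 - ?rho) N K g"
   using N K le g w by (intro mix_sum_le) auto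
  also have "... <= C * mix (1 - ?alpha) (1 - ?rho) N K g"
   using * mix_nonneg[OF N] by (intro mult_right_mono) auto
  finally show ?thesis .
 qed
qed

text \<open>Cauchy-Schwarz over pairs of indices after splitting the kernel into two square roots;
  one factor is summed by rows, the other by columns.\<close>

lemma Schur_test:
 fixes x :: "'i => real" and y :: "'j => real"
 assumes I: "finite I" and J: "finite J" and M: "0 <= M"
  and nn: "!!i j. i : I ==> j : J ==> 0 <= kappa i j"
  and row: "!!i. i : I ==> (SUM j:J. kappa i j) <= M" and col: "!!j. j : J ==> (SUM i:I. kappa i j) <= M"
 shows "(SUM i:I. SUM j:J. kappa i j * x i * y j) <= M * L2_set x I * L2_set y J"
proof -
 have "(SUM i:I. SUM j:J. kappa i j * x i * y j)
   <= (SUM p:I \<times> J. \<bar>sqrt (kappa (fst p) (snd p)) * x (fst p)\<bar> * \<bar>sqrt (kappa (fst p) (snd p)) * y (snd p)\<bar>)"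
  unfolding sum.cartesian_product
 proof (rule sum_mono)
  fix p assume "p : I \<times> J"
  then have "0 <= kappa (fst p) (snd p)" using nn by auto
  then have "kappa (fst p) (snd p) * x (fst p) * y (snd p)
   = (sqrt (kappa (fst p) (snd p)) * sqrt (kappa (fst p) (snd p))) * x (fst p) * y (snd p)" by simp
  also have "... = (sqrt (kappa (fst p) (snd p)) * x (fst p)) * (sqrt (kappa (fst p) (snd p)) * y (snd p))"
   by (simp only: ac_simps)
  also have "... <= \<bar>sqrt (kappa (fst p) (snd p)) * x (fst p)\<bar> * \<bar>sqrt (kappa (fst p) (snd p)) * y (snd p)\<bar>"
   unfolding abs_mult[symmetric] by (rule abs_ge_self)
  finally show "(case p of (i, j) => kappa i j * x i * y j)
   <= \<bar>sqrt (kappa (fst p) (snd p)) * x (fst p)\<bar> * \<bar>sqrt (kappa (fst p) (snd p)) * y (snd p)\<bar>"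
   by (simp add: case_prod_beta)
 qed
 also have "... <= L2_set (%p. sqrt (kappa (fst p) (snd p)) * x (fst p)) (I \<times> J)
   * L2_set (%p. sqrt (kappa (fst p) (snd p)) * y (snd p)) (I \<times> J)"
  by (rule L2_set_mult_ineq)
 also have "... <= (sqrt M * L2_set x I) * (sqrt M * L2_set y J)"
 proof (rule mult_mono)
  have "(SUM p:I \<times> J. (sqrt (kappa (fst p) (snd p)) * x (fst p))^2) = (SUM i:I. SUM j:J. kappa i j * (x i)^2)"
   unfolding sum.cartesian_product using nn by (intro sum.cong refl) (auto simp: power_mult_distrib)
  also have "... <= (SUM i:I. M * (x i)^2)"
   unfolding sum_distrib_right[symmetric] using row by (intro sum_mono mult_right_mono) auto
  finally show "L2_set (%p. sqrt (kappa (fst p) (snd p)) * x (fst p)) (I \<times> J) <= sqrt M * L2_set x I"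
   unfolding L2_set_def real_sqrt_mult[symmetric] sum_distrib_left by (rule real_sqrt_le_mono)
  have "(SUM p:I \<times> J. (sqrt (kappa (fst p) (snd p)) * y (snd p))^2) = (SUM i:I. SUM j:J. kappa i j * (y j)^2)"
   unfolding sum.cartesian_product using nn by (intro sum.cong refl) (auto simp: power_mult_distrib)
  also have "... = (SUM j:J. SUM i:I. kappa i j * (y j)^2)" by (rule sum.swap)
  also have "... <= (SUM j:J. M * (y j)^2)"
   unfolding sum_distrib_right[symmetric] using col by (intro sum_mono mult_right_mono) auto
  finally show "L2_set (%p. sqrt (kappa (fst p) (snd p)) * y (snd p)) (I \<times> J) <= sqrt M * L2_set y J"
   unfolding L2_set_def real_sqrt_mult[symmetric] sum_distrib_left by (rule real_sqrt_le_mono)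
 qed (use M in \<open>auto simp: L2_set_nonneg\<close>)
 also have "... = (sqrt M * sqrt M) * L2_set x I * L2_set y J" by (simp only: ac_simps)
 also have "... = M * L2_set x I * L2_set y J" using M by simp
 finally show ?thesis .
qed

section \<open>Geometric and power sums over integers\<close>

lemma sum_geometric_dist_int:
 fixes r :: real and c :: int
 assumes S: "finite S" and r: "0 < r" "r < 1"
 shows "(SUM i:S. r ^ nat \<bar>i - c\<bar>) <= 2 / (1 - r)"
proof -
 have g: "(SUM n:T. r ^ n) <= 1 / (1 - r)" if "finite T" for T
  using sum_le_suminf[of "%n. r ^ n" T] suminf_geometric[of r] summable_geometric[of r] that r by simp
 define P where "P = {i\<in>S. c <= i}" define Q where "Q = {i\<in>S. i < c}"
 have PQ: "S = P \<union> Q" "P \<inter> Q = {}" "finite P" "finite Q" using S by (auto simp: P_def Q_def)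
 have "(SUM i:P. r ^ nat \<bar>i - c\<bar>) = (SUM n:(%i. nat \<bar>i - c\<bar>) ` P. r ^ n)"
  by (subst sum.reindex) (auto simp: inj_on_def P_def)
 moreover have "(SUM i:Q. r ^ nat \<bar>i - c\<bar>) = (SUM n:(%i. nat \<bar>i - c\<bar>) ` Q. r ^ n)"
  by (subst sum.reindex) (auto simp: inj_on_def Q_def)
 ultimately show ?thesis
  using PQ g[of "(%i. nat \<bar>i - c\<bar>) ` P"] g[of "(%i. nat \<bar>i - c\<bar>) ` Q"] by (simp add: sum.union_disjoint)
qed

text \<open>Rounding the real centre \<open>u\<close> down changes a distance by at most 1, which
  costs \<open>2 powr b\<close>; what remains is a two-sided geometric series.\<close>

lemma sum_geometric_dist:
 fixes b u :: real
 assumes S: "finite (S :: nat set)" and b: "0 < b"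
 shows "(SUM i:S. 2 powr (- b * \<bar>real i - u\<bar>)) <= 2 powr b * (2 / (1 - 2 powr (- b)))"
proof -
 have "(SUM i:S. 2 powr (- b * \<bar>real i - u\<bar>)) <= (SUM i:S. 2 powr b * (2 powr (- b)) ^ nat \<bar>int i - (floor (u))\<bar>)"
 proof (rule sum_mono)
  fix i
  have "\<bar>real_of_int (int i - (floor (u)))\<bar> - 1 <= \<bar>real i - u\<bar>" by simp linarith
  then have "- b * \<bar>real i - u\<bar> <= b + - b * \<bar>real_of_int (int i - (floor (u)))\<bar>"
   using b mult_left_mono[of "\<bar>real_of_int (int i - (floor (u)))\<bar> - 1" "\<bar>real i - u\<bar>" b] by (simp add: algebra_simps)
  then have "2 powr (- b * \<bar>real i - u\<bar>) <= 2 powr (b + - b * \<bar>real_of_int (int i - (floor (u)))\<bar>)" by simp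
  also have "... = 2 powr b * (2 powr (- b)) ^ nat \<bar>int i - (floor (u))\<bar>"
   unfolding powr_add powr_powr[symmetric] by (simp add: powr_realpow[symmetric])
  finally show "2 powr (- b * \<bar>real i - u\<bar>) <= 2 powr b * (2 powr (- b)) ^ nat \<bar>int i - (floor (u))\<bar>" .
 qed
 also have "... = 2 powr b * (SUM i:int ` S. (2 powr (- b)) ^ nat \<bar>i - (floor (u))\<bar>)"
  by (simp add: sum_distrib_left sum.reindex inj_on_def)
 also have "... <= 2 powr b * (2 / (1 - 2 powr (- b)))"
  using S powr_less_mono[of "- b" 0 2] b by (intro mult_left_mono sum_geometric_dist_int) auto
 finally show ?thesis .
qed

lemma powr_diff_lower:
 fixes x a :: real
 assumes "1 <= x" "a < 1" "0 < a"
 shows "(1 - a) * x powr (- a) <= x powr (1 - a) - (x - 1) powr (1 - a)"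
proof (cases "x = 1")
 case True then show ?thesis using assms by simp
next
 case False
 have "EX z. x - 1 < z & z < x & x powr (1 - a) - (x - 1) powr (1 - a) = (x - (x - 1)) * ((1 - a) * z powr (1 - a - 1))"
  using assms False by (intro MVT2) (auto intro!: derivative_eq_intros)
 then obtain z where z: "x - 1 < z" "z < x" "x powr (1 - a) - (x - 1) powr (1 - a) = (1 - a) * z powr (- a)" by auto
 have "x powr (- a) <= z powr (- a)" using z assms by (intro powr_mono2') auto
 then show ?thesis using z assms by simp
qed

lemma sum_powr_le:
 fixes a :: real
 assumes "0 < a" "a < 1"
 shows "(SUM h:{1..m}. real h powr (- a)) <= real m powr (1 - a) / (1 - a)"
proof (induction m)
 case (Suc m)
 have "(1 - a) * real (Suc m) powr (- a) <= real (Suc m) powr (1 - a) - real m powr (1 - a)"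
  using powr_diff_lower[of "real (Suc m)" a] assms by simp
 then have "real (Suc m) powr (- a) <= real (Suc m) powr (1 - a) / (1 - a) - real m powr (1 - a) / (1 - a)"
  unfolding diff_divide_distrib[symmetric] using assms by (simp add: pos_le_divide_eq mult.commute)
 then show ?case using Suc by simp
qed simp

text \<open>A telescoping comparison with the integral of the power. The factor
  \<open>2 powr s\<close> comes from replacing the intermediate point \<open>z < h + 1\<close> by
  \<open>2 * h\<close>.\<close>

lemma sum_powr_tail:
 fixes s R :: real and S :: "nat set"
 assumes "1 < s" "1 <= R" "finite S" "!!h. h : S ==> R <= real h"
 shows "(SUM h:S. real h powr (- s)) <= 2 powr s / (s - 1) * R powr (1 - s)"
proof -
 define f where "f h = 2 powr s / (s - 1) * real h powr (1 - s)" for h :: nat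
 have step: "real h powr (- s) <= f h - f (Suc h)" if h: "1 <= h" for h
 proof -
  have "EX z. real h < z & z < real h + 1 & (real h + 1) powr (1 - s) - real h powr (1 - s)
    = (real h + 1 - real h) * ((1 - s) * z powr (1 - s - 1))"
   using h by (intro MVT2) (auto intro!: derivative_eq_intros)
  then obtain z where z: "real h < z" "z < real h + 1"
    "(real h + 1) powr (1 - s) - real h powr (1 - s) = (1 - s) * z powr (- s)" by auto
  have "(2 * real h) powr (- s) <= z powr (- s)" using z h assms by (intro powr_mono2') auto
  then have "2 powr (- s) * real h powr (- s) <= z powr (- s)" by (simp add: powr_mult)
  from mult_left_mono[OF this, of "2 powr s"]
  have "real h powr (- s) <= 2 powr s * z powr (- s)" by (simp add: mult.assoc[symmetric] powr_add[symmetric])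
  moreover have "f h - f (Suc h) = 2 powr s / (s - 1) * - ((real h + 1) powr (1 - s) - real h powr (1 - s))"
   unfolding f_def of_nat_Suc by (simp only: right_diff_distrib minus_diff_eq add.commute)
  then have "f h - f (Suc h) = (2 powr s / (s - 1) * (s - 1)) * z powr (- s)"
   unfolding z(3) by (simp only: minus_mult_left minus_diff_eq mult.assoc)
  then have "f h - f (Suc h) = 2 powr s * z powr (- s)" using assms by simp
  ultimately show ?thesis by simp
 qed
 define m where "m = nat \<lceil>R\<rceil>"
 have m: "1 <= m" "R <= real m" using assms by (auto simp: m_def) linarith
 have "(SUM h:S. real h powr (- s)) <= (SUM h:{m..m + Max (insert 0 S)}. real h powr (- s))"
 proof (rule sum_mono2)
  show "S <= {m..m + Max (insert 0 S)}"
  proof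
   fix h assume h: "h : S"
   then have "h <= Max (insert 0 S)" "m <= h" using assms by (auto simp: m_def nat_le_iff ceiling_le_iff)
   then show "h : {m..m + Max (insert 0 S)}" by auto
  qed
 qed auto
 also have "... <= (SUM h:{m..m + Max (insert 0 S)}. f h - f (Suc h))"
  using m by (intro sum_mono step) auto
 also have "... = f m - f (Suc (m + Max (insert 0 S)))"
  using sum_Suc_diff[of m "m + Max (insert 0 S)" "%h. - f h"] by simp
 also have "... <= f m" using assms by (simp add: f_def)
 also have "... <= 2 powr s / (s - 1) * R powr (1 - s)"
  unfolding f_def using assms m by (intro mult_left_mono powr_mono2') auto
 finally show ?thesis .
qed

lemma sum_int_split:
 fixes f :: "nat => real"
 assumes "finite E" "0 \<notin> E" and nn: "!!h. 0 <= f h"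
 shows "(SUM h:E. f (nat \<bar>h\<bar>)) <= 2 * (SUM h:(%h. nat \<bar>h\<bar>) ` E. f h)"
proof -
 define P where "P = {h\<in>E. 0 < h}" define Q where "Q = {h\<in>E. h < 0}"
 have PQ: "E = P \<union> Q" "P \<inter> Q = {}" "finite P" "finite Q" using assms by (auto simp: P_def Q_def, metis linorder_cases)
 have "(SUM i:P. f (nat \<bar>i\<bar>)) = (SUM n:(%i. nat \<bar>i\<bar>) ` P. f n)"
  by (subst sum.reindex) (auto simp: inj_on_def P_def)
 also have "... <= (SUM h:(%h. nat \<bar>h\<bar>) ` E. f h)" using assms PQ by (intro sum_mono2) auto
 finally have 1: "(SUM i:P. f (nat \<bar>i\<bar>)) <= (SUM h:(%h. nat \<bar>h\<bar>) ` E. f h)" .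
 have "(SUM i:Q. f (nat \<bar>i\<bar>)) = (SUM n:(%i. nat \<bar>i\<bar>) ` Q. f n)"
  by (subst sum.reindex) (auto simp: inj_on_def Q_def)
 also have "... <= (SUM h:(%h. nat \<bar>h\<bar>) ` E. f h)" using assms PQ by (intro sum_mono2) auto
 finally show ?thesis using 1 PQ by (simp add: sum.union_disjoint)
qed

text \<open>The worst set of given size clusters around 0: points within \<open>R\<close> are
  compared with the full interval, and each of the at most \<open>R\<close> remaining points
  contributes at most \<open>R powr (- a)\<close>.\<close>

lemma sum_powr_card:
 fixes a R :: real
 assumes a: "0 < a" "a < 1" and E: "finite E" "0 \<notin> E" "real (card E) <= R" "1 <= R"
 shows "(SUM h:E. real_of_int \<bar>h\<bar> powr (- a)) <= (2 / (1 - a) + 1) * R powr (1 - a)"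
proof -
 define P where "P = {h\<in>E. real_of_int \<bar>h\<bar> <= R}" define Q where "Q = {h\<in>E. R < real_of_int \<bar>h\<bar>}"
 have PQ: "E = P \<union> Q" "P \<inter> Q = {}" "finite P" "finite Q" "0 \<notin> P" using E by (auto simp: P_def Q_def)
 have "(SUM h:P. real_of_int \<bar>h\<bar> powr (- a)) = (SUM h:P. real (nat \<bar>h\<bar>) powr (- a))" by simp
 also have "... <= 2 * (SUM h:(%h. nat \<bar>h\<bar>) ` P. real h powr (- a))" using PQ by (intro sum_int_split) auto
 also have "... <= 2 * (SUM h:{1..nat (floor (R))}. real h powr (- a))"
 proof (intro mult_left_mono sum_mono2)
  show "(%h. nat \<bar>h\<bar>) ` P <= {1..nat (floor (R))}"
  proof
   fix n assume "n : (%h. nat \<bar>h\<bar>) ` P"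
   then obtain h where h: "h : P" "n = nat \<bar>h\<bar>" by auto
   have "\<bar>h\<bar> <= (floor (R))" using h(1) by (simp add: P_def le_floor_iff)
   moreover have "h ~= 0" using h(1) PQ(5) by blast
   ultimately show "n : {1..nat (floor (R))}" unfolding h(2) atLeastAtMost_iff by linarith
  qed
 qed auto
 also have "... <= 2 * (real (nat (floor (R))) powr (1 - a) / (1 - a))" using a by (intro mult_left_mono sum_powr_le) auto
 also have "... <= 2 * (R powr (1 - a) / (1 - a))"
  using a E by (intro mult_left_mono divide_right_mono powr_mono2) auto
 finally have 1: "(SUM h:P. real_of_int \<bar>h\<bar> powr (- a)) <= 2 / (1 - a) * R powr (1 - a)" by simp
 have "(SUM h:Q. real_of_int \<bar>h\<bar> powr (- a)) <= (SUM h:Q. R powr (- a))"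
  using E a by (intro sum_mono powr_mono2') (auto simp: Q_def)
 also have "... <= R * R powr (- a)"
  using E PQ card_mono[of E Q] by (auto intro!: mult_right_mono)
 also have "... = R powr (1 - a)" using E powr_add[of R 1 "- a"] by simp
 finally show ?thesis using 1 PQ by (simp add: sum.union_disjoint distrib_right)
qed

section \<open>Dyadic blocks and interpolation by the crossover of two bounds\<close>

text \<open>Decreasing rearrangement: level \<open>i\<close> collects the ranks 2^i - 1 to 2^(i+1) -
  2, and \<open>c i\<close> is the largest value there. The last clause is Cauchy condensation and
  holds for all \<open>p\<close> with the same levels.\<close>

lemma dyadic_atoms:
 fixes v :: "'k => real"
 assumes K: "finite K" and nn: "!!k. k : K ==> 0 <= v k"
 shows "EX part c. (ALL i. 0 <= c i) & (ALL k:K. v k <= c (part k)) & (ALL k:K. part k < card K) &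
  (ALL i. card {k\<in>K. part k = i} <= 2 ^ i) &
  (ALL p>0. (\<Sum>i<card K. 2 ^ i * c i powr p) <= 2 * (SUM k:K. v k powr p))"
proof -
 obtain ys where ys: "set ys = K" "distinct ys" using finite_distinct_list[OF K] by auto
 define xs where "xs = sort_key (%k. - v k) ys"
 have xs: "set xs = K" "distinct xs" "sorted (map (%k. - v k) xs)" using ys by (auto simp: xs_def)
 have len: "length xs = card K" using xs distinct_card by metis
 have dec: "v (xs ! j) <= v (xs ! i)" if "i <= j" "j < length xs" for i j
  using sorted_nth_mono[OF xs(3), of i j] that by simp
 have bij: "bij_betw ((!) xs) {..<length xs} K" using xs by (intro bij_betw_nth) auto
 define pos where "pos = inv_into {..<length xs} ((!) xs)"
 have pos: "pos k < length xs" "xs ! pos k = k" if "k : K" for k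
  using that bij bij_betw_inv_into_right[OF bij] inv_into_into[of k "(!) xs" "{..<length xs}"]
  by (auto simp: pos_def bij_betw_def)
 \<comment> \<open>Ranks count from 0; the \<open>Suc\<close> puts rank 0 into level 0 and makes
   each level a dyadic interval.\<close>
 define part where "part k = floor_log (Suc (pos k))" for k
 define c where "c i = (if 2 ^ i - 1 < length xs then v (xs ! (2 ^ i - 1)) else 0)" for i
 have pl: "2 ^ part k <= Suc (pos k)" "Suc (pos k) < 2 * 2 ^ part k" for k
  using floor_log_exp2_le[of "Suc (pos k)"] floor_log_exp2_gt[of "Suc (pos k)"] by (auto simp: part_def)
 have c0: "0 <= c i" for i using xs nn nth_mem[of "2 ^ i - 1" xs] by (auto simp: c_def)
 have vc: "v k <= c (part k)" if "k : K" for k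
 proof -
  have "2 ^ part k - 1 <= pos k" using pl(1)[of k] by simp
  then show ?thesis using dec[of "2 ^ part k - 1" "pos k"] pos[OF that] by (simp add: c_def)
 qed
 have part_less: "part k < card K" if "k : K" for k
 proof -
  have "part k < 2 ^ part k" by simp
  then show ?thesis using pl(1)[of k] pos(1)[OF that] len by linarith
 qed
 have cardle: "card {k\<in>K. part k = i} <= 2 ^ i" for i
 proof -
  have "inj_on pos {k\<in>K. part k = i}" using pos by (metis (no_types, lifting) inj_onI mem_Collect_eq)
  moreover have "pos ` {k\<in>K. part k = i} <= {2 ^ i - 1..<2 ^ i - 1 + 2 ^ i}"
  proof
   fix j assume "j : pos ` {k\<in>K. part k = i}"
   then obtain k where k: "part k = i" "j = pos k" by auto
   then show "j : {2 ^ i - 1..<2 ^ i - 1 + 2 ^ i}" using pl[of k] by auto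
  qed
  ultimately have "card {k\<in>K. part k = i} <= card {2 ^ i - 1..<2 ^ i - 1 + 2 ^ i :: nat}"
   by (intro card_inj_on_le) auto
  then show ?thesis by simp
 qed
 have sum: "(\<Sum>i<card K. 2 ^ i * c i powr p) <= 2 * (SUM k:K. v k powr p)" if p: "0 < p" for p
 proof -
  define w where "w j = (if j < length xs then v (xs ! j) powr p else 0)" for j
  have w: "0 <= w j" for j by (simp add: w_def)
  have wdec: "w j <= w i" if "i <= j" for i j
   using that dec[OF that] p nn xs nth_mem[of j xs] by (auto simp: w_def intro!: powr_mono2)
  have cw: "c i powr p = w (2 ^ i - 1)" for i by (simp add: c_def w_def)
  \<comment> \<open>Condensation: the last entry of the block from 2^n to 2^(n+1) - 1 is its
    smallest, and it is weighted by twice the length of that block.\<close>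
  have cond: "(\<Sum>i<Suc n. 2 ^ i * w (2 ^ i - 1)) <= 2 * (\<Sum>j<2 ^ n. w j)" for n
  proof (induction n)
   case 0 show ?case using w[of 0] by simp
  next
   case (Suc n)
   have "(\<Sum>j<2 ^ Suc n. w j) = (\<Sum>j<2 ^ n. w j) + (SUM j:{2 ^ n..<2 ^ Suc n}. w j)"
    unfolding lessThan_atLeast0 by (rule sum.atLeastLessThan_concat[symmetric]) simp_all
   moreover have "(SUM j:{2 ^ n..<2 ^ Suc n :: nat}. w (2 ^ Suc n - 1)) <= (SUM j:{2 ^ n..<2 ^ Suc n}. w j)"
    by (intro sum_mono wdec) auto
   then have "2 ^ n * w (2 ^ Suc n - 1) <= (SUM j:{2 ^ n..<2 ^ Suc n}. w j)" by simp
   ultimately show ?case using Suc by simp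
  qed
  have "(\<Sum>j<n. w j) <= (SUM k:K. v k powr p)" for n
  proof -
   have "(\<Sum>j<n. w j) = (SUM j:{..<n} \<inter> {..<length xs}. w j)"
    by (rule sum.mono_neutral_right) (auto simp: w_def)
   also have "... <= (\<Sum>j<length xs. w j)" using w by (intro sum_mono2) auto
   also have "... = (\<Sum>j<length xs. v (xs ! j) powr p)" by (intro sum.cong) (auto simp: w_def)
   also have "... = (SUM k:K. v k powr p)" by (rule sum.reindex_bij_betw[OF bij])
   finally show ?thesis .
  qed
  from order_trans[OF cond mult_left_mono[OF this]]
  have "(\<Sum>i<Suc (card K). 2 ^ i * w (2 ^ i - 1)) <= 2 * (SUM k:K. v k powr p)" by simp
  moreover have "0 <= 2 ^ card K * w (2 ^ card K - 1)" using w by simp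
  ultimately show ?thesis by (simp add: cw)
 qed
 show ?thesis using c0 vc part_less cardle sum by (intro exI[of _ part] exI[of _ c]) auto
qed

text \<open>The coefficient \<open>a i\<close> absorbs the size 2^((1-rho) i) of a level, so that
  its norm is at most twice that of \<open>v\<close>. Since \<open>rho <= 1/2\<close>, the exponent
  1 / (1 - rho) is at most 2, which also controls the square sum that Schur's test consumes.\<close>

lemma dyadic_atoms_lpn:
 fixes v :: "'k => real"
 assumes K: "finite K" and nn: "!!k. k : K ==> 0 <= v k" and rho: "0 <= rho" "rho <= 1/2"
 shows "EX part a. (ALL i. 0 <= a i) & (ALL k:K. part k < card K) &
  (ALL k:K. v k <= a (part k) * 2 powr (- (1 - rho) * part k)) &
  (ALL i. card {k\<in>K. part k = i} <= 2 ^ i) & L2_set a {..<card K} <= 2 * lpn (1 - rho) K v"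
proof -
 obtain part c where pc': "(ALL i. 0 <= c i) & (ALL k:K. v k <= c (part k)) & (ALL k:K. part k < card K) &
  (ALL i. card {k\<in>K. part k = i} <= 2 ^ i) &
  (ALL p>0. (\<Sum>i<card K. 2 ^ i * c i powr p) <= 2 * (SUM k:K. v k powr p))"
  using dyadic_atoms[of K v] K nn by blast
 then have pc: "!!i. 0 <= c i" "!!k. k : K ==> v k <= c (part k)" "ALL k:K. part k < card K"
  "ALL i. card {k\<in>K. part k = i} <= 2 ^ i"
  "!!p. 0 < p ==> (\<Sum>i<card K. 2 ^ i * c i powr p) <= 2 * (SUM k:K. v k powr p)" by blast+
 define a where "a i = c i * 2 powr ((1 - rho) * i)" for i :: nat
 have a: "0 <= a i" "c i = a i * 2 powr (- (1 - rho) * i)" for i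
 proof -
  show "0 <= a i" using pc(1) by (simp add: a_def)
  have "2 powr ((1 - rho) * i) * 2 powr (- (1 - rho) * i) = (1::real)"
   by (simp only: powr_add[symmetric] mult_minus_left add.right_inverse) simp
  then show "c i = a i * 2 powr (- (1 - rho) * i)" by (simp only: a_def mult.assoc mult_1_right)
 qed
 define p where "p = 1 / (1 - rho)"
 have p: "0 < p" "1 <= p" using rho by (auto simp: p_def)
 have "L2_set a {..<card K} = lpn (1/2) {..<card K} a" using a by (intro lpn_half[symmetric]) auto
 also have "... <= lpn (1 - rho) {..<card K} a" using a rho by (intro lpn_antimono) auto
 also have "... = (\<Sum>i<card K. 2 ^ i * c i powr p) powr (1 - rho)"
  using rho by (simp add: lpn_def a_def powr_mult powr_powr p_def powr_realpow[symmetric] mult.commute)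
 also have "... <= (2 * (SUM k:K. v k powr p)) powr (1 - rho)"
  using pc(5)[OF p(1)] rho by (intro powr_mono2 sum_nonneg) auto
 also have "... = 2 powr (1 - rho) * lpn (1 - rho) K v"
  using rho by (simp add: powr_mult lpn_def p_def)
 also have "... <= 2 powr 1 * lpn (1 - rho) K v"
  using rho lpn_nonneg[OF K] by (intro mult_right_mono powr_mono) auto
 finally have "L2_set a {..<card K} <= 2 * lpn (1 - rho) K v" by simp
 moreover have "ALL k:K. v k <= a (part k) * 2 powr (- (1 - rho) * part k)" using pc(2) unfolding a(2) by blast
 ultimately show ?thesis using pc(3,4) a(1) by blast
qed

text \<open>The constant of \<open>sum_geometric_dist\<close>. It blows up as \<open>b\<close>
  decreases to 0, so every interpolation below must stay strictly inside its range of
  exponents.\<close>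

definition geoC :: "real => real" where "geoC b = 2 powr b * (2 / (1 - 2 powr (- b)))"

lemma geoC_nonneg: "0 < b ==> 0 <= geoC b"
 using powr_less_mono[of "- b" 0 2] by (simp add: geoC_def)

lemma inner_sums_le:
 fixes x :: "'k => 'h::real_inner" and y :: "'l => 'h"
 assumes "!!k l. k : P ==> l : Q ==> \<bar>inner (x k) (y l)\<bar> <= D * norm (x k) * norm (y l)"
 shows "\<bar>inner (SUM k:P. x k) (SUM l:Q. y l)\<bar> <= D * (SUM k:P. norm (x k)) * (SUM l:Q. norm (y l))"
proof -
 have "\<bar>inner (SUM k:P. x k) (SUM l:Q. y l)\<bar> <= (SUM k:P. SUM l:Q. \<bar>inner (x k) (y l)\<bar>)"
 proof -
  have "inner (SUM k:P. x k) (SUM l:Q. y l) = (SUM k:P. SUM l:Q. inner (x k) (y l))"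
   unfolding inner_sum_left inner_sum_right by (rule sum.swap)
  then show ?thesis by (auto intro!: order_trans[OF sum_abs] sum_mono)
 qed
 also have "... <= (SUM k:P. SUM l:Q. D * norm (x k) * norm (y l))"
  by (intro sum_mono assms)
 also have "... = D * (SUM k:P. norm (x k)) * (SUM l:Q. norm (y l))"
  unfolding sum_distrib_left[of D "%k. norm (x k)" P] sum_product ..
 finally show ?thesis .
qed

lemma norm_sum_orthogonal:
 fixes x :: "'k => 'h::real_inner"
 assumes "finite P" "!!k l. k : P ==> l : P ==> k ~= l ==> inner (x k) (x l) = 0"
 shows "norm (SUM k:P. x k) = L2_set (%k. norm (x k)) P"
proof -
 have "(norm (SUM k:P. x k))^2 = (SUM k:P. SUM l:P. inner (x k) (x l))"
  unfolding power2_norm_eq_inner inner_sum_left inner_sum_right by (rule sum.swap)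
 also have "... = (SUM k:P. SUM l:P. if l = k then inner (x k) (x k) else 0)"
  using assms by (intro sum.cong) auto
 also have "... = (SUM k:P. (norm (x k))^2)" using assms by (simp add: power2_norm_eq_inner)
 finally show ?thesis unfolding L2_set_def by (metis norm_ge_zero real_sqrt_unique)
qed

text \<open>A block has at most 2^i members of norm at most a_i 2^(-(1-rho) i). Orthogonality
  charges the square root of that count to the Hilbert norm, the triangle inequality charges the
  full count to the l1 size. For \<open>rho\<close> strictly between 0 and 1/2 the first decays in
  \<open>i\<close> and the second grows, and this opposition drives the interpolations.\<close>

lemma atom_decomposition:
 fixes x :: "'k => 'h::real_inner"
 assumes K: "finite K" and rho: "0 <= rho" "rho <= 1/2"
  and orth: "!!k l. k : K ==> l : K ==> k ~= l ==> inner (x k) (x l) = 0"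
 shows "EX X a. (ALL i. 0 <= a i) & (SUM k:K. x k) = (\<Sum>i<card K. X i) &
  (ALL i. norm (X i) <= a i * 2 powr (- (1/2 - rho) * real i)) &
  (ALL i. \<exists>P\<subseteq>K. X i = (SUM k:P. x k) & (SUM k:P. norm (x k)) <= a i * 2 powr (rho * real i)) &
  L2_set a {..<card K} <= 2 * lpn (1 - rho) K (%k. norm (x k))"
proof -
 obtain part a where pa: "(ALL i. 0 <= a i) & (ALL k:K. part k < card K) &
  (ALL k:K. norm (x k) <= a (part k) * 2 powr (- (1 - rho) * part k)) &
  (ALL i. card {k\<in>K. part k = i} <= 2 ^ i) & L2_set a {..<card K} <= 2 * lpn (1 - rho) K (%k. norm (x k))"
  using dyadic_atoms_lpn[OF K _ rho, of "%k. norm (x k)"] by auto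
 define P where "P i = {k\<in>K. part k = i}" for i
 define X where "X i = (SUM k:P i. x k)" for i
 have P: "finite (P i)" "P i <= K" "real (card (P i)) <= 2 powr i" for i
 proof -
  show "finite (P i)" "P i <= K" using K by (auto simp: P_def)
  have "card (P i) <= 2 ^ i" using pa by (simp add: P_def)
  then have "real (card (P i)) <= real (2 ^ i)" by (simp only: of_nat_le_iff)
  then show "real (card (P i)) <= 2 powr i" by (simp add: powr_realpow)
 qed
 have nb: "norm (x k) <= a i * 2 powr (- (1 - rho) * i)" if "k : P i" for i k
  using pa that by (auto simp: P_def)
 have a0: "0 <= a i" for i using pa by blast
 have sum: "(SUM k:K. x k) = (\<Sum>i<card K. X i)"
  unfolding X_def P_def using K pa by (intro sum.group[symmetric]) auto
 have l2: "norm (X i) <= a i * 2 powr (- (1/2 - rho) * real i)" for i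
 proof -
  have "norm (X i) = L2_set (%k. norm (x k)) (P i)"
   unfolding X_def using P orth by (intro norm_sum_orthogonal) blast+
  also have "... <= L2_set (%k. a i * 2 powr (- (1 - rho) * i)) (P i)" using nb by (intro L2_set_mono) auto
  also have "... = sqrt (card (P i)) * (a i * 2 powr (- (1 - rho) * i))"
   using a0[of i] by (simp add: L2_set_constant)
  also have "... <= sqrt (2 powr i) * (a i * 2 powr (- (1 - rho) * i))"
   using a0[of i] P by (intro mult_right_mono real_sqrt_le_mono) auto
  also have "... = a i * (2 powr (i / 2) * 2 powr (- (1 - rho) * i))"
   by (simp add: powr_half_sqrt[symmetric] powr_powr)
  also have "... = a i * 2 powr (- (1/2 - rho) * real i)"
   unfolding powr_add[symmetric] by (simp add: algebra_simps)
  finally show ?thesis .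
 qed
 have l1: "(SUM k:P i. norm (x k)) <= a i * 2 powr (rho * real i)" for i
 proof -
  have "(SUM k:P i. norm (x k)) <= card (P i) * (a i * 2 powr (- (1 - rho) * i))"
   using nb by (intro sum_bounded_above) auto
  also have "... <= 2 powr i * (a i * 2 powr (- (1 - rho) * i))"
   using a0[of i] P by (intro mult_right_mono) auto
  also have "... = a i * (2 powr i * 2 powr (- (1 - rho) * i))" by simp
  also have "... = a i * 2 powr (rho * real i)"
   unfolding powr_add[symmetric] by (simp add: algebra_simps)
  finally show ?thesis .
 qed
 show ?thesis
 proof (intro exI[of _ X] exI[of _ a] conjI allI)
  show "\<exists>P\<subseteq>K. X i = (SUM k:P. x k) & (SUM k:P. norm (x k)) <= a i * 2 powr (rho * real i)" for i
   using l1 P(2) by (intro exI[of _ "P i"]) (simp add: X_def)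
 qed (use a0 sum l2 pa in auto)
qed

text \<open>Stands in for Riesz-Thorin. For blocks at levels i and l, Cauchy-Schwarz gives
  2^(-(1/2-rho)(i+l)) and the hypothesis on \<open>D\<close> gives D 2^(rho(i+l)). They cross at one
  value of i + l, and on either side the better bound decays geometrically.\<close>

lemma fixed_time_interpolation:
 fixes x y :: "'k => 'h::real_inner"
 assumes K: "finite K" and rho: "0 < rho" "rho < 1/2" and D: "0 < D"
  and ox: "!!k l. k : K ==> l : K ==> k ~= l ==> inner (x k) (x l) = 0"
  and oy: "!!k l. k : K ==> l : K ==> k ~= l ==> inner (y k) (y l) = 0"
  and bd: "!!k l. k : K ==> l : K ==> \<bar>inner (x k) (y l)\<bar> <= D * norm (x k) * norm (y l)"
 shows "\<bar>inner (SUM k:K. x k) (SUM k:K. y k)\<bar> <= 4 * geoC (min rho (1/2 - rho)) * D powr (1 - 2 * rho)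
  * lpn (1 - rho) K (%k. norm (x k)) * lpn (1 - rho) K (%k. norm (y k))"
proof -
 have rho': "0 <= rho" "rho <= 1/2" using rho by auto
 define eps where "eps = min rho (1/2 - rho)"
 have eps: "0 < eps" "eps <= rho" "eps <= 1/2 - rho" using rho by (auto simp: eps_def)
 obtain X a where X: "(ALL i. 0 <= a i) & (SUM k:K. x k) = (\<Sum>i<card K. X i) &
  (ALL i. norm (X i) <= a i * 2 powr (- (1/2 - rho) * real i)) &
  (ALL i. \<exists>P\<subseteq>K. X i = (SUM k:P. x k) & (SUM k:P. norm (x k)) <= a i * 2 powr (rho * real i)) &
  L2_set a {..<card K} <= 2 * lpn (1 - rho) K (%k. norm (x k))"
  using atom_decomposition[of K rho x, OF K rho' ox] by blast
 obtain Y b where Y: "(ALL i. 0 <= b i) & (SUM k:K. y k) = (\<Sum>i<card K. Y i) &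
  (ALL i. norm (Y i) <= b i * 2 powr (- (1/2 - rho) * real i)) &
  (ALL i. \<exists>P\<subseteq>K. Y i = (SUM k:P. y k) & (SUM k:P. norm (y k)) <= b i * 2 powr (rho * real i)) &
  L2_set b {..<card K} <= 2 * lpn (1 - rho) K (%k. norm (y k))"
  using atom_decomposition[of K rho y, OF K rho' oy] by blast
 have a0: "0 <= a i" and b0: "0 <= b i" for i using X Y by auto
 \<comment> \<open>The crossover level sum, at which 2^(-s0/2) equals \<open>D\<close>; both bounds
   are then \<open>D powr (1 - 2 * rho)\<close>.\<close>
 define s0 where "s0 = - 2 * log 2 D"
 have Ds: "D = 2 powr (- s0 / 2)" using D by (simp add: s0_def)
 define kappa where "kappa i l = D powr (1 - 2 * rho) * 2 powr (- eps * \<bar>real i - (s0 - real l)\<bar>)" for i l :: nat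
 have Dp: "D powr (1 - 2 * rho) = 2 powr (- (1/2 - rho) * s0)"
  unfolding Ds powr_powr by (simp add: algebra_simps)
 have pair: "\<bar>inner (X i) (Y l)\<bar> <= kappa i l * a i * b l" for i l
 proof (cases "s0 <= real i + real l")
  case True
  have "\<bar>inner (X i) (Y l)\<bar> <= norm (X i) * norm (Y l)" by (rule Cauchy_Schwarz_ineq2)
  also have "... <= (a i * 2 powr (- (1/2 - rho) * real i)) * (b l * 2 powr (- (1/2 - rho) * real l))"
   using X Y by (intro mult_mono) auto
  also have "... = (2 powr (- (1/2 - rho) * real i) * 2 powr (- (1/2 - rho) * real l)) * a i * b l" by (simp only: ac_simps)
  also have "... = 2 powr (- (1/2 - rho) * s0 + - (1/2 - rho) * (real i + real l - s0)) * a i * b l"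
   unfolding powr_add[symmetric] by (simp add: algebra_simps add_divide_distrib)
  also have "... <= 2 powr (- (1/2 - rho) * s0 + - eps * \<bar>real i - (s0 - real l)\<bar>) * a i * b l"
  proof -
   have "eps * (real i + real l - s0) <= (1/2 - rho) * (real i + real l - s0)"
    using True eps by (intro mult_right_mono) auto
   moreover have "\<bar>real i - (s0 - real l)\<bar> = real i + real l - s0" using True by simp
   ultimately have "- (1/2 - rho) * (real i + real l - s0) <= - eps * \<bar>real i - (s0 - real l)\<bar>"
    by (simp only: minus_mult_left[symmetric] neg_le_iff_le)
   then show ?thesis using a0 b0 by (intro mult_right_mono powr_mono add_left_mono) auto
  qed
  also have "... = kappa i l * a i * b l" by (simp only: kappa_def Dp powr_add)
  finally show ?thesis .
 next
  case False
  obtain P where P: "P <= K" "X i = (SUM k:P. x k)" "(SUM k:P. norm (x k)) <= a i * 2 powr (rho * real i)" using X by blast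
  obtain Q where Q: "Q <= K" "Y l = (SUM k:Q. y k)" "(SUM k:Q. norm (y k)) <= b l * 2 powr (rho * real l)" using Y by blast
  have "\<bar>inner (X i) (Y l)\<bar> <= D * (SUM k:P. norm (x k)) * (SUM k:Q. norm (y k))"
   unfolding P(2) Q(2) using P Q bd by (intro inner_sums_le) blast
  also have "... <= D * (a i * 2 powr (rho * real i)) * (b l * 2 powr (rho * real l))"
   using D P Q a0 b0 by (intro mult_mono mult_left_mono) (auto intro: sum_nonneg)
  also have "... = (D * (2 powr (rho * real i) * 2 powr (rho * real l))) * a i * b l" by (simp only: ac_simps)
  also have "... = 2 powr (- (1/2 - rho) * s0 + - rho * (s0 - (real i + real l))) * a i * b l"
   unfolding Ds powr_add[symmetric] by (simp add: algebra_simps add_divide_distrib)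
  also have "... <= 2 powr (- (1/2 - rho) * s0 + - eps * \<bar>real i - (s0 - real l)\<bar>) * a i * b l"
  proof -
   have "eps * (s0 - (real i + real l)) <= rho * (s0 - (real i + real l))"
    using False eps by (intro mult_right_mono) auto
   moreover have "\<bar>real i - (s0 - real l)\<bar> = s0 - (real i + real l)" using False by simp
   ultimately show ?thesis using a0 b0 by (intro mult_right_mono powr_mono) auto
  qed
  also have "... = kappa i l * a i * b l" by (simp only: kappa_def Dp powr_add)
  finally show ?thesis .
 qed
 have rows: "(\<Sum>i<card K. kappa i l) <= D powr (1 - 2 * rho) * geoC eps" for l
  unfolding kappa_def sum_distrib_left[symmetric] geoC_def
  using eps by (intro mult_left_mono sum_geometric_dist) auto
 have sym: "kappa i l = kappa l i" for i l
 proof -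
  have "\<bar>real i - (s0 - real l)\<bar> = \<bar>real l - (s0 - real i)\<bar>" by linarith
  then show ?thesis by (simp only: kappa_def)
 qed
 have cols: "(\<Sum>l<card K. kappa i l) <= D powr (1 - 2 * rho) * geoC eps" for i
  unfolding sym[of i] by (rule rows)
 have kappa0: "0 <= kappa i l" for i l by (simp add: kappa_def)
 have "\<bar>inner (SUM k:K. x k) (SUM k:K. y k)\<bar> = \<bar>\<Sum>i<card K. \<Sum>l<card K. inner (X i) (Y l)\<bar>"
  using X Y by (simp add: inner_sum_left inner_sum_right sum.swap[of "%i l. inner (X l) (Y i)"])
 also have "... <= (\<Sum>i<card K. \<Sum>l<card K. kappa i l * a i * b l)"
  using pair by (intro order_trans[OF sum_abs] sum_mono) auto
 also have "... <= D powr (1 - 2 * rho) * geoC eps * L2_set a {..<card K} * L2_set b {..<card K}"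
  using rows cols kappa0 geoC_nonneg[OF eps(1)] by (intro Schur_test) auto
 also have "... <= D powr (1 - 2 * rho) * geoC eps * (2 * lpn (1 - rho) K (%k. norm (x k))) * (2 * lpn (1 - rho) K (%k. norm (y k)))"
  using X Y geoC_nonneg[OF eps(1)] lpn_nonneg[OF K] by (intro mult_mono mult_nonneg_nonneg L2_set_nonneg) auto
 finally show ?thesis by (simp add: eps_def[symmetric] ac_simps)
qed

text \<open>Both sequences are replaced by their dyadic levels. The interaction of two levels is
  bounded by 2^(-alpha |i-l|) times the normalized coefficients, and Schur's test sums over the
  levels.\<close>

lemma discrete_Hardy_Littlewood_Sobolev:
 fixes u v :: "int => real"
 assumes N: "finite N" and alpha: "0 < alpha" "alpha < 1/2" and u: "!!n. 0 <= u n" and v: "!!n. 0 <= v n"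
 shows "(SUM n:N. SUM m:N. real_of_int \<bar>n - m\<bar> powr (- (2 * alpha)) * u n * v m)
  <= 4 * (2 / (1 - 2 * alpha) + 1) * geoC alpha * lpn (1 - alpha) N u * lpn (1 - alpha) N v"
proof -
 have alpha': "0 <= alpha" "alpha <= 1/2" using alpha by auto
 define c where "c = 2 / (1 - 2 * alpha) + 1"
 have c: "0 <= c" using alpha by (simp add: c_def)
 obtain pu a where pu: "(ALL i. 0 <= a i) & (ALL k:N. pu k < card N) &
  (ALL k:N. u k <= a (pu k) * 2 powr (- (1 - alpha) * pu k)) &
  (ALL i. card {k\<in>N. pu k = i} <= 2 ^ i) & L2_set a {..<card N} <= 2 * lpn (1 - alpha) N u"
  using dyadic_atoms_lpn[OF N _ alpha', of u] u by blast
 obtain pv b where pv: "(ALL i. 0 <= b i) & (ALL k:N. pv k < card N) &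
  (ALL k:N. v k <= b (pv k) * 2 powr (- (1 - alpha) * pv k)) &
  (ALL i. card {k\<in>N. pv k = i} <= 2 ^ i) & L2_set b {..<card N} <= 2 * lpn (1 - alpha) N v"
  using dyadic_atoms_lpn[OF N _ alpha', of v] v by blast
 have a0: "0 <= a i" and b0: "0 <= b i" for i using pu pv by auto
 define E where "E i = {n\<in>N. pu n = i}" for i
 define F where "F i = {n\<in>N. pv n = i}" for i
 define w where "w n m = real_of_int \<bar>n - m\<bar> powr (- (2 * alpha))" for n m
 have w0: "0 <= w n m" "w n m = w m n" for n m by (simp_all add: w_def abs_minus_commute)
 have cardE: "real (card (E i)) <= 2 powr i" "real (card (F i)) <= 2 powr i" and finE: "finite (E i)" "finite (F i)" for i
 proof -
  have "card (E i) <= 2 ^ i" "card (F i) <= 2 ^ i" using pu pv by (auto simp: E_def F_def)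
  then have "real (card (E i)) <= real (2 ^ i)" "real (card (F i)) <= real (2 ^ i)" by (simp_all only: of_nat_le_iff)
  then show "real (card (E i)) <= 2 powr i" "real (card (F i)) <= 2 powr i" by (simp_all add: powr_realpow)
  show "finite (E i)" "finite (F i)" using N by (auto simp: E_def F_def)
 qed
 have one: "(SUM n:G. w n m) <= c * (2 powr i) powr (1 - 2 * alpha)"
  if G: "finite G" "real (card G) <= 2 powr real i" for G m and i :: nat
 proof -
  \<comment> \<open>The term \<open>n = m\<close> is 0 because \<open>0 powr x\<close> is 0, so the
    kernel has no diagonal.\<close>
  have "(SUM n:G. w n m) = (SUM n:G - {m}. w n m)"
   using G by (intro sum.mono_neutral_right) (auto simp: w_def)
  also have "... = (SUM h:(%n. n - m) ` (G - {m}). real_of_int \<bar>h\<bar> powr (- (2 * alpha)))"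
   by (subst sum.reindex) (auto simp: inj_on_def w_def)
  also have "... <= (2 / (1 - 2 * alpha) + 1) * (2 powr i) powr (1 - 2 * alpha)"
  proof (rule sum_powr_card)
   have "card ((%n. n - m) ` (G - {m})) <= card G"
    using G by (intro order_trans[OF card_image_le] card_mono) auto
   then show "real (card ((%n. n - m) ` (G - {m}))) <= 2 powr i" using G by linarith
   show "1 <= 2 powr real i" by (rule ge_one_powr_ge_zero) auto
  qed (use G alpha in auto)
  finally show ?thesis by (simp add: c_def)
 qed
 define U where "U i = a i * 2 powr (- (1 - alpha) * real i)" for i
 define V where "V i = b i * 2 powr (- (1 - alpha) * real i)" for i
 have UV0: "0 <= U i" "0 <= V i" for i using a0 b0 by (auto simp: U_def V_def)
 define kappa where "kappa i l = c * 2 powr (- alpha * \<bar>real i - real l\<bar>)" for i l :: nat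
 \<comment> \<open>Sum over the larger of the two level sets by \<open>one\<close> and count the
   smaller; the powers of 2 then combine to
   \<open>- alpha * \<bar>real i - real l\<bar>\<close>.\<close>
 have W: "(SUM n:E i. SUM m:F l. w n m) * U i * V l <= kappa i l * a i * b l" for i l
 proof (cases "l <= i")
  case True
  have "(SUM n:E i. SUM m:F l. w n m) = (SUM m:F l. SUM n:E i. w n m)" by (rule sum.swap)
  also have "... <= (SUM m:F l. c * (2 powr i) powr (1 - 2 * alpha))" by (intro sum_mono one finE cardE)
  also have "... <= 2 powr l * (c * (2 powr i) powr (1 - 2 * alpha))"
   using c cardE[of l] by (auto intro!: mult_right_mono)
  finally have "(SUM n:E i. SUM m:F l. w n m) * U i * V l <= 2 powr l * (c * (2 powr i) powr (1 - 2 * alpha)) * U i * V l"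
   using UV0 by (intro mult_right_mono)
  also have "... = c * (2 powr l * 2 powr (i * (1 - 2 * alpha)) * 2 powr (- (1 - alpha) * i) * 2 powr (- (1 - alpha) * l)) * a i * b l"
   unfolding U_def V_def powr_powr by (simp only: ac_simps)
  also have "... = kappa i l * a i * b l"
   unfolding kappa_def powr_add[symmetric] using True by (simp add: algebra_simps of_nat_diff)
  finally show ?thesis .
 next
  case False
  have "(SUM n:E i. SUM m:F l. w n m) = (SUM n:E i. SUM m:F l. w m n)" by (simp only: w0(2))
  also have "... <= (SUM n:E i. c * (2 powr l) powr (1 - 2 * alpha))" by (intro sum_mono one finE cardE)
  also have "... <= 2 powr i * (c * (2 powr l) powr (1 - 2 * alpha))"
   using c cardE[of i] by (auto intro!: mult_right_mono)
  finally have "(SUM n:E i. SUM m:F l. w n m) * U i * V l <= 2 powr i * (c * (2 powr l) powr (1 - 2 * alpha)) * U i * V l"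
   using UV0 by (intro mult_right_mono)
  also have "... = c * (2 powr i * 2 powr (l * (1 - 2 * alpha)) * 2 powr (- (1 - alpha) * i) * 2 powr (- (1 - alpha) * l)) * a i * b l"
   unfolding U_def V_def powr_powr by (simp only: ac_simps)
  also have "... = kappa i l * a i * b l"
   unfolding kappa_def powr_add[symmetric] using False by (simp add: algebra_simps)
  finally show ?thesis .
 qed
 have "(SUM n:N. SUM m:N. w n m * u n * v m) <= (SUM n:N. SUM m:N. w n m * U (pu n) * V (pv m))"
  using pu pv w0 u v UV0 by (intro sum_mono mult_mono mult_nonneg_nonneg) (auto simp: U_def V_def)
 also have "... = (\<Sum>i<card N. SUM n:E i. \<Sum>l<card N. SUM m:F l. w n m * U (pu n) * V (pv m))"
 proof -
  have "(SUM m:N. w n m * U (pu n) * V (pv m)) = (\<Sum>l<card N. SUM m:F l. w n m * U (pu n) * V (pv m))" for n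
   unfolding F_def using N pv by (intro sum.group[symmetric]) auto
  moreover have "(SUM n:N. h n) = (\<Sum>i<card N. SUM n:E i. h n)" for h :: "int => real"
   unfolding E_def using N pu by (intro sum.group[symmetric]) auto
  ultimately show ?thesis by simp
 qed
 also have "... = (\<Sum>i<card N. \<Sum>l<card N. (SUM n:E i. SUM m:F l. w n m) * U i * V l)"
 proof (rule sum.cong[OF refl])
  fix i
  have "(SUM n:E i. \<Sum>l<card N. SUM m:F l. w n m * U (pu n) * V (pv m))
    = (\<Sum>l<card N. SUM n:E i. SUM m:F l. w n m * U (pu n) * V (pv m))" by (rule sum.swap)
  also have "... = (\<Sum>l<card N. SUM n:E i. SUM m:F l. w n m * U i * V l)"
   by (intro sum.cong refl) (auto simp: E_def F_def)
  also have "... = (\<Sum>l<card N. (SUM n:E i. SUM m:F l. w n m) * U i * V l)"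
   by (simp only: sum_distrib_right)
  finally show "(SUM n:E i. \<Sum>l<card N. SUM m:F l. w n m * U (pu n) * V (pv m))
    = (\<Sum>l<card N. (SUM n:E i. SUM m:F l. w n m) * U i * V l)" .
 qed
 also have "... <= (\<Sum>i<card N. \<Sum>l<card N. kappa i l * a i * b l)" by (intro sum_mono W)
 also have "... <= c * geoC alpha * L2_set a {..<card N} * L2_set b {..<card N}"
 proof (rule Schur_test)
  have rows: "(\<Sum>i<card N. kappa i l) <= c * geoC alpha" for l
   unfolding kappa_def sum_distrib_left[symmetric] geoC_def
   using alpha c by (intro mult_left_mono sum_geometric_dist) auto
  show "(\<Sum>i<card N. kappa i l) <= c * geoC alpha" for l by (rule rows)
  show "(\<Sum>l<card N. kappa i l) <= c * geoC alpha" for i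
   using rows[of i] by (simp only: kappa_def abs_minus_commute)
 qed (use c geoC_nonneg[OF alpha(1)] in \<open>auto simp: kappa_def\<close>)
 also have "... <= c * geoC alpha * (2 * lpn (1 - alpha) N u) * (2 * lpn (1 - alpha) N v)"
  using pu pv c geoC_nonneg[OF alpha(1)] lpn_nonneg[OF N] by (intro mult_mono mult_nonneg_nonneg L2_set_nonneg) auto
 finally show ?thesis unfolding w_def c_def[symmetric] by (simp add: ac_simps)
qed

lemma sum_int_powr_tail:
 fixes s R :: real and E :: "int set"
 assumes "1 < s" "1 <= R" "finite E" "!!h. h : E ==> R <= real_of_int \<bar>h\<bar>"
 shows "(SUM h:E. real_of_int \<bar>h\<bar> powr (- s)) <= 2 * (2 powr s / (s - 1)) * R powr (1 - s)"
proof -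
 have "0 \<notin> E" using assms by force
 have "(SUM h:E. real_of_int \<bar>h\<bar> powr (- s)) = (SUM h:E. real (nat \<bar>h\<bar>) powr (- s))" by simp
 also have "... <= 2 * (SUM h:(%h. nat \<bar>h\<bar>) ` E. real h powr (- s))"
  using \<open>0 \<notin> E\<close> assms by (intro sum_int_split) auto
 also have "... <= 2 * (2 powr s / (s - 1) * R powr (1 - s))"
  using assms by (intro mult_left_mono sum_powr_tail) auto
 finally show ?thesis by simp
qed

lemma card_int_window:
 fixes n :: int and R :: real
 assumes "finite J" "0 <= R"
 shows "real (card {m\<in>J. real_of_int \<bar>n - m\<bar> <= R}) <= 2 * R + 1"
proof -
 have "card {m\<in>J. real_of_int \<bar>n - m\<bar> <= R} <= card {n - (floor (R))..n + (floor (R))}"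
 proof (rule card_mono)
  show "{m\<in>J. real_of_int \<bar>n - m\<bar> <= R} <= {n - (floor (R))..n + (floor (R))}"
  proof
   fix m assume "m : {m\<in>J. real_of_int \<bar>n - m\<bar> <= R}"
   then have "\<bar>n - m\<bar> <= (floor (R))" by (simp add: le_floor_iff)
   then show "m : {n - (floor (R))..n + (floor (R))}" unfolding atLeastAtMost_iff by linarith
  qed
 qed simp
 also have "card {n - (floor (R))..n + (floor (R))} = nat (2 * (floor (R)) + 1)" by simp
 finally have "real (card {m\<in>J. real_of_int \<bar>n - m\<bar> <= R}) <= real (nat (2 * (floor (R)) + 1))" by (simp only: of_nat_le_iff)
 also have "... = 2 * real_of_int (floor (R)) + 1" using assms by simp
 finally show ?thesis by linarith
qed

text \<open>The strict inequality removes the centre, so no additive 1 appears, in contrast to the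
  two-sided window.\<close>

lemma card_int_one_sided:
 fixes n :: int and R :: real
 assumes "0 <= R"
 shows "real (card {m\<in>J. m < n & real_of_int (n - m) <= R}) <= R"
  and "real (card {m\<in>J. n < m & real_of_int (m - n) <= R}) <= R"
proof -
 have "card {m\<in>J. m < n & real_of_int (n - m) <= R} <= card {n - (floor (R))..<n}"
 proof (rule card_mono)
  show "{m\<in>J. m < n & real_of_int (n - m) <= R} <= {n - (floor (R))..<n}"
  proof
   fix m assume m: "m : {m\<in>J. m < n & real_of_int (n - m) <= R}"
   then have "n - m <= (floor (R))" by (simp only: mem_Collect_eq le_floor_iff)
   then show "m : {n - (floor (R))..<n}" using m by simp
  qed
 qed simp
 then have "real (card {m\<in>J. m < n & real_of_int (n - m) <= R}) <= real (nat (floor (R)))" by simp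
 then show "real (card {m\<in>J. m < n & real_of_int (n - m) <= R}) <= R" using assms by linarith
 have "card {m\<in>J. n < m & real_of_int (m - n) <= R} <= card {n<..n + (floor (R))}"
 proof (rule card_mono)
  show "{m\<in>J. n < m & real_of_int (m - n) <= R} <= {n<..n + (floor (R))}"
  proof
   fix m assume m: "m : {m\<in>J. n < m & real_of_int (m - n) <= R}"
   then have "m - n <= (floor (R))" by (simp only: mem_Collect_eq le_floor_iff)
   then show "m : {n<..n + (floor (R))}" using m by simp
  qed
 qed simp
 then have "real (card {m\<in>J. n < m & real_of_int (m - n) <= R}) <= real (nat (floor (R)))" by simp
 then show "real (card {m\<in>J. n < m & real_of_int (m - n) <= R}) <= R" using assms by linarith
qed

lemma tail_row:
 fixes n :: int and s R :: real
 assumes "1 < s" "1 <= R" "finite J"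
 shows "(SUM m:J. if R < real_of_int \<bar>n - m\<bar> then real_of_int \<bar>n - m\<bar> powr (- s) else 0)
  <= 2 * (2 powr s / (s - 1)) * R powr (1 - s)"
proof -
 have "(SUM m:J. if R < real_of_int \<bar>n - m\<bar> then real_of_int \<bar>n - m\<bar> powr (- s) else 0)
   = (SUM m:{m\<in>J. R < real_of_int \<bar>n - m\<bar>}. real_of_int \<bar>n - m\<bar> powr (- s))"
  by (rule sum.inter_filter[symmetric]) fact
 also have "... = (SUM h:(%m. n - m) ` {m\<in>J. R < real_of_int \<bar>n - m\<bar>}. real_of_int \<bar>h\<bar> powr (- s))"
  by (subst sum.reindex) (auto simp: inj_on_def)
 also have "... <= 2 * (2 powr s / (s - 1)) * R powr (1 - s)"
  using assms by (intro sum_int_powr_tail) auto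
 finally show ?thesis .
qed

text \<open>The constant of \<open>tail_row\<close> at \<open>s = d / 2\<close>; the tail converges
  from dimension 3 on, which is the range of the endpoint estimate.\<close>

definition tailC :: "nat => real" where "tailC d = 2 * (2 powr (d / 2) / (d / 2 - 1))"

lemma tailC_nonneg: "3 <= d ==> 0 <= tailC d" by (simp add: tailC_def)

section \<open>The endpoint: energy of one dyadic level and interaction of two levels\<close>

text \<open>A single level is summable in time at the endpoint. Up to distance \<open>R\<close> the
  Hilbert bound \<open>1 / R\<close> is used on about 2R terms, beyond it the dispersive bound,
  whose tail exactly compensates the growth 2^(2 rho i).\<close>

lemma dyadic_block_energy:
 fixes X :: "int => 'h::real_inner"
 assumes J: "finite J" and d: "3 <= d" and A: "0 <= A" and i: "0 <= i" and a: "!!n. 0 <= a n"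
  and rho: "rho = 1/2 - 1 / real d"
  and n2: "!!n. n : J ==> norm (X n) <= a n * 2 powr (- (1 / d) * i)"
  and n1: "!!n m. n : J ==> m : J ==> n ~= m ==> \<bar>inner (X n) (X m)\<bar> <= A * real_of_int \<bar>n - m\<bar> powr (- (d / 2))
    * (a n * 2 powr (rho * i)) * (a m * 2 powr (rho * i))"
 shows "(norm (SUM n:J. X n))^2 <= (3 + A * tailC d) * (SUM n:J. (a n)^2)"
proof -
 \<comment> \<open>The distance at which the dispersive factor |n-m|^(-d/2) 2^(2 rho i) equals the
   Hilbert factor 2^(-2i/d), given \<open>rho = 1/2 - 1/d\<close>.\<close>
 define R where "R = 2 powr (2 * i / d)"
 have R: "1 <= R" using i d by (auto simp: R_def intro: ge_one_powr_ge_zero)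
 have Ri: "2 powr (- (1 / d) * i) * 2 powr (- (1 / d) * i) = 1 / R"
  unfolding R_def powr_add[symmetric] by (simp add: powr_minus_divide[symmetric])
 have R1: "R powr (1 - d / 2) * (2 powr (rho * i) * 2 powr (rho * i)) = 1"
 proof -
  have "2 * i / d * (1 - d / 2) + (rho * i + rho * i) = 0"
   using d unfolding rho by (simp add: field_simps)
  then show ?thesis unfolding R_def powr_powr powr_add[symmetric] by simp
 qed
 define kappa where "kappa n m = (if real_of_int \<bar>n - m\<bar> <= R then 1 / R
  else A * real_of_int \<bar>n - m\<bar> powr (- (d / 2)) * (2 powr (rho * i) * 2 powr (rho * i)))" for n m
 have kappa0: "0 <= kappa n m" for n m using A R by (simp add: kappa_def)
 have pair: "inner (X n) (X m) <= kappa n m * a n * a m" if "n : J" "m : J" for n m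
 proof (cases "real_of_int \<bar>n - m\<bar> <= R")
  case True
  have "inner (X n) (X m) <= norm (X n) * norm (X m)" by (rule norm_cauchy_schwarz)
  also have "... <= (a n * 2 powr (- (1 / d) * i)) * (a m * 2 powr (- (1 / d) * i))"
   using n2 that a by (intro mult_mono) auto
  also have "... = (2 powr (- (1 / d) * i) * 2 powr (- (1 / d) * i)) * a n * a m" by (simp only: ac_simps)
  finally show ?thesis using True by (simp only: Ri kappa_def if_True)
 next
  case False
  then have "n ~= m" using R by auto
  then have "inner (X n) (X m) <= A * real_of_int \<bar>n - m\<bar> powr (- (d / 2))
    * (a n * 2 powr (rho * i)) * (a m * 2 powr (rho * i))" using n1[OF that] by linarith
  also have "... = A * real_of_int \<bar>n - m\<bar> powr (- (d / 2)) * (2 powr (rho * i) * 2 powr (rho * i)) * a n * a m"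
   by (simp only: ac_simps)
  finally show ?thesis using False by (simp only: kappa_def if_False)
 qed
 have row: "(SUM m:J. kappa n m) <= 3 + A * tailC d" for n
 proof -
  have "kappa n m = (if real_of_int \<bar>n - m\<bar> <= R then 1 / R else 0) +
   A * (2 powr (rho * i) * 2 powr (rho * i)) * (if R < real_of_int \<bar>n - m\<bar> then real_of_int \<bar>n - m\<bar> powr (- (d / 2)) else 0)" for m
   by (auto simp: kappa_def)
  then have "(SUM m:J. kappa n m) = (SUM m:J. if real_of_int \<bar>n - m\<bar> <= R then 1 / R else 0) +
   A * (2 powr (rho * i) * 2 powr (rho * i)) * (SUM m:J. if R < real_of_int \<bar>n - m\<bar> then real_of_int \<bar>n - m\<bar> powr (- (d / 2)) else 0)"
   by (simp only: sum.distrib sum_distrib_left)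
  also have "(SUM m:J. if real_of_int \<bar>n - m\<bar> <= R then 1 / R else 0) = real (card {m\<in>J. real_of_int \<bar>n - m\<bar> <= R}) * (1 / R)"
   using J by (simp add: sum.inter_filter[symmetric])
  also have "... <= (2 * R + 1) * (1 / R)" using R by (intro mult_right_mono card_int_window J) auto
  also have "... <= 3" using R by (simp add: field_simps)
  also have "A * (2 powr (rho * i) * 2 powr (rho * i)) * (SUM m:J. if R < real_of_int \<bar>n - m\<bar> then real_of_int \<bar>n - m\<bar> powr (- (d / 2)) else 0)
    <= A * (2 powr (rho * i) * 2 powr (rho * i)) * (2 * (2 powr (d / 2) / (d / 2 - 1)) * R powr (1 - d / 2))"
   using A d R J by (intro mult_left_mono tail_row) auto
  also have "... = A * tailC d * (R powr (1 - d / 2) * (2 powr (rho * i) * 2 powr (rho * i)))"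
   unfolding tailC_def by (simp only: ac_simps)
  also have "... = A * tailC d" by (simp only: R1 mult_1_right)
  finally show ?thesis by simp
 qed
 have "(norm (SUM n:J. X n))^2 = (SUM n:J. SUM m:J. inner (X n) (X m))"
  unfolding power2_norm_eq_inner inner_sum_left inner_sum_right by (rule sum.swap)
 also have "... <= (SUM n:J. SUM m:J. kappa n m * a n * a m)" by (intro sum_mono pair)
 also have "... <= (3 + A * tailC d) * L2_set a J * L2_set a J"
 proof (rule Schur_test[OF J J])
  show "0 <= 3 + A * tailC d" using A tailC_nonneg[OF d] by simp
  show "(SUM n:J. kappa n m) <= 3 + A * tailC d" for m
   using row[of m] by (simp only: kappa_def abs_minus_commute)
 qed (use row kappa0 in auto)
 also have "... = (3 + A * tailC d) * (SUM n:J. (a n)^2)"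
  by (simp add: L2_set_def sum_nonneg mult.assoc)
 finally show ?thesis .
qed

text \<open>For each \<open>m\<close> the energy hypothesis treats all its neighbours
  \<open>n\<close> as one sum. Cauchy-Schwarz in \<open>m\<close> then counts each \<open>n\<close>
  at most \<open>R\<close> times under a square root, which gives sqrt R in place of R.\<close>

lemma near_diagonal_bound:
 fixes X Y :: "int => 'h::real_inner"
 assumes N: "finite N" and C: "0 <= C" and R: "0 <= R" and \<beta>: "0 <= \<beta>" and b: "!!m. 0 <= b m"
  and en: "!!J. J <= N ==> (norm (SUM n:J. X n))\<^sup>2 <= C * (SUM n:J. (a n)^2)"
  and Y: "!!m. m : N ==> norm (Y m) <= \<beta> * b m"
  and card: "!!n. n : N ==> real (card {m\<in>N. S n m}) <= R"
 shows "\<bar>SUM n:N. SUM m:{m\<in>N. S n m}. inner (X n) (Y m)\<bar> <= sqrt C * sqrt R * \<beta> * L2_set a N * L2_set b N"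
proof -
 have "(SUM n:N. SUM m:{m\<in>N. S n m}. inner (X n) (Y m)) = (SUM m:N. inner (SUM n:{n\<in>N. S n m}. X n) (Y m))"
  unfolding inner_sum_left by (rule sum.swap_restrict[OF N N])
 then have "\<bar>SUM n:N. SUM m:{m\<in>N. S n m}. inner (X n) (Y m)\<bar> <= (SUM m:N. \<bar>inner (SUM n:{n\<in>N. S n m}. X n) (Y m)\<bar>)"
  by (simp only: sum_abs)
 also have "... <= (SUM m:N. \<bar>sqrt C * \<beta> * L2_set a {n\<in>N. S n m}\<bar> * \<bar>b m\<bar>)"
 proof (rule sum_mono)
  fix m assume m: "m : N"
  have "norm (SUM n:{n\<in>N. S n m}. X n) <= sqrt C * L2_set a {n\<in>N. S n m}"
   using en[of "{n\<in>N. S n m}"] unfolding L2_set_def real_sqrt_mult[symmetric] by (intro real_le_rsqrt) auto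
  then have "\<bar>inner (SUM n:{n\<in>N. S n m}. X n) (Y m)\<bar> <= (sqrt C * L2_set a {n\<in>N. S n m}) * (\<beta> * b m)"
   using Y[OF m] by (intro order_trans[OF Cauchy_Schwarz_ineq2] mult_mono) (auto simp: C L2_set_nonneg)
  also have "... = \<bar>sqrt C * \<beta> * L2_set a {n\<in>N. S n m}\<bar> * \<bar>b m\<bar>"
   using C \<beta> b by (simp add: L2_set_nonneg ac_simps)
  finally show "\<bar>inner (SUM n:{n\<in>N. S n m}. X n) (Y m)\<bar> <= \<bar>sqrt C * \<beta> * L2_set a {n\<in>N. S n m}\<bar> * \<bar>b m\<bar>" .
 qed
 also have "... <= L2_set (%m. sqrt C * \<beta> * L2_set a {n\<in>N. S n m}) N * L2_set b N" by (rule L2_set_mult_ineq)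
 also have "... = sqrt C * \<beta> * L2_set (%m. L2_set a {n\<in>N. S n m}) N * L2_set b N"
  using C \<beta> by (simp add: L2_set_right_distrib)
 also have "... <= sqrt C * \<beta> * (sqrt R * L2_set a N) * L2_set b N"
 proof (intro mult_right_mono mult_left_mono)
  have "(SUM m:N. (L2_set a {n\<in>N. S n m})^2) = (SUM m:N. SUM n:{n\<in>N. S n m}. (a n)^2)"
   by (simp add: L2_set_def sum_nonneg)
  also have "... = (SUM n:N. SUM m:{m\<in>N. S n m}. (a n)^2)" by (rule sum.swap_restrict[OF N N, symmetric])
  also have "... = (SUM n:N. real (card {m\<in>N. S n m}) * (a n)^2)" by simp
  also have "... <= (SUM n:N. R * (a n)^2)" using card by (intro sum_mono mult_right_mono) auto
  finally show "L2_set (%m. L2_set a {n\<in>N. S n m}) N <= sqrt R * L2_set a N"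
   unfolding L2_set_def[of _ N] real_sqrt_mult[symmetric] sum_distrib_left by (rule real_sqrt_le_mono)
 qed (use C \<beta> in \<open>auto simp: L2_set_nonneg\<close>)
 also have "... = sqrt C * sqrt R * \<beta> * L2_set a N * L2_set b N" by (simp only: ac_simps)
 finally show ?thesis .
qed

lemma far_diagonal_bound:
 fixes X Y :: "int => 'h::real_inner"
 assumes N: "finite N" and d: "3 <= d" and B: "0 <= B" and R: "1 <= R" and a: "!!n. 0 <= a n" and b: "!!m. 0 <= b m"
  and pair: "!!n m. n : N ==> m : N ==> n ~= m ==>
   \<bar>inner (X n) (Y m)\<bar> <= B * real_of_int \<bar>n - m\<bar> powr (- (d / 2)) * a n * b m"
  and S: "!!n m. S n m ==> R < real_of_int \<bar>n - m\<bar>"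
 shows "\<bar>SUM n:N. SUM m:{m\<in>N. S n m}. inner (X n) (Y m)\<bar> <= B * tailC d * R powr (1 - d / 2) * L2_set a N * L2_set b N"
proof -
 define kappa where "kappa n m = (if R < real_of_int \<bar>n - m\<bar> then real_of_int \<bar>n - m\<bar> powr (- (d / 2)) else 0)" for n m
 have "\<bar>SUM n:N. SUM m:{m\<in>N. S n m}. inner (X n) (Y m)\<bar> <= (SUM n:N. SUM m:{m\<in>N. S n m}. \<bar>inner (X n) (Y m)\<bar>)"
  by (intro order_trans[OF sum_abs] sum_mono) simp
 also have "... <= (SUM n:N. SUM m:{m\<in>N. S n m}. B * (kappa n m * a n * b m))"
 proof (intro sum_mono)
  fix n m assume n: "n : N" and m: "m : {m\<in>N. S n m}"
  then have R': "R < real_of_int \<bar>n - m\<bar>" using S by blast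
  then have "n ~= m" using R by auto
  then have "\<bar>inner (X n) (Y m)\<bar> <= B * real_of_int \<bar>n - m\<bar> powr (- (d / 2)) * a n * b m" using n m pair by blast
  also have "... = B * (kappa n m * a n * b m)" using R' by (simp add: kappa_def mult.assoc)
  finally show "\<bar>inner (X n) (Y m)\<bar> <= B * (kappa n m * a n * b m)" .
 qed
 also have "... <= (SUM n:N. SUM m:N. B * (kappa n m * a n * b m))"
  using N a b B by (intro sum_mono sum_mono2) (auto simp: kappa_def)
 also have "... = B * (SUM n:N. SUM m:N. kappa n m * a n * b m)" by (simp only: sum_distrib_left)
 also have "... <= B * (tailC d * R powr (1 - d / 2) * L2_set a N * L2_set b N)"
 proof (intro mult_left_mono B Schur_test N)
  have row: "(SUM m:N. kappa n m) <= tailC d * R powr (1 - d / 2)" for n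
   unfolding kappa_def tailC_def using d R N by (intro tail_row) auto
  show "(SUM m:N. kappa n m) <= tailC d * R powr (1 - d / 2)" for n by (rule row)
  show "(SUM n:N. kappa n m) <= tailC d * R powr (1 - d / 2)" for m
   using row[of m] by (simp only: kappa_def abs_minus_commute)
 qed (use tailC_nonneg[OF d] in \<open>auto simp: kappa_def\<close>)
 finally show ?thesis by (simp add: mult.assoc)
qed

definition orth_family :: "int set => 'k set => (int => 'k => 'h::real_inner) => bool" where
 "orth_family N K x \<longleftrightarrow> (ALL n:N. ALL k:K. ALL l:K. k ~= l --> inner (x n k) (x n l) = 0)"

text \<open>The space cells \<open>k\<close> and \<open>l\<close> are arbitrary, equal ones
  included, while \<open>n = m\<close> is excluded because within one time cell the elapsed time may
  vanish.\<close>

definition dispersive :: "real => nat => int set => 'k set => (int => 'k => 'h::real_inner) => (int => 'k => 'h) => bool" where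
 "dispersive A d N K x y \<longleftrightarrow> (ALL n:N. ALL m:N. ALL k:K. ALL l:K. n ~= m -->
  \<bar>inner (x n k) (y m l)\<bar> <= A * real_of_int \<bar>n - m\<bar> powr (- (d / 2)) * norm (x n k) * norm (y m l))"

lemma dispersive_commute:
 assumes "dispersive A d N K x y" shows "dispersive A d N K y x"
 unfolding dispersive_def
proof (intro ballI impI)
 fix n m k l assume nm: "n : N" "m : N" "k : K" "l : K" "n ~= m"
 then have "\<bar>inner (x m l) (y n k)\<bar> <= A * real_of_int \<bar>m - n\<bar> powr (- (d / 2)) * norm (x m l) * norm (y n k)"
  using assms[unfolded dispersive_def, rule_format, of m n l k] by simp
 then show "\<bar>inner (y n k) (x m l)\<bar> <= A * real_of_int \<bar>n - m\<bar> powr (- (d / 2)) * norm (y n k) * norm (x m l)"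
  by (simp only: inner_commute[of "y n k"] abs_minus_commute[of n m] mult.assoc mult.commute[of "norm (y n k)"])
qed

text \<open>Every time is decomposed on its own. At the endpoint the time exponent is 2 as well, so
  the square sums over times and over levels may be exchanged.\<close>

lemma family_atoms:
 fixes x :: "int => 'k => 'h::real_inner"
 assumes K: "finite K" and N: "finite N" and rho: "0 <= rho" "rho <= 1/2" and orth: "orth_family N K x"
 shows "EX X a. (ALL n i. 0 <= a n i) & (ALL n:N. (SUM k:K. x n k) = (\<Sum>i<card K. X n i)) &
  (ALL n:N. ALL i. norm (X n i) <= a n i * 2 powr (- (1/2 - rho) * real i)) &
  (ALL n:N. ALL i. \<exists>P\<subseteq>K. X n i = (SUM k:P. x n k) & (SUM k:P. norm (x n k)) <= a n i * 2 powr (rho * real i)) &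
  L2_set (%i. L2_set (%n. a n i) N) {..<card K} <= 2 * mix (1/2) (1 - rho) N K (%n k. norm (x n k))"
proof -
 have "EX X a. n : N --> (ALL i. 0 <= a i) & (SUM k:K. x n k) = (\<Sum>i<card K. X i) &
  (ALL i. norm (X i) <= a i * 2 powr (- (1/2 - rho) * real i)) &
  (ALL i. \<exists>P\<subseteq>K. X i = (SUM k:P. x n k) & (SUM k:P. norm (x n k)) <= a i * 2 powr (rho * real i)) &
  L2_set a {..<card K} <= 2 * lpn (1 - rho) K (%k. norm (x n k))" for n
  using atom_decomposition[OF K rho, of "x n"] orth unfolding orth_family_def by blast
 then obtain X a where Xa: "n : N --> (ALL i. 0 <= a n i) & (SUM k:K. x n k) = (\<Sum>i<card K. X n i) &
  (ALL i. norm (X n i) <= a n i * 2 powr (- (1/2 - rho) * real i)) &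
  (ALL i. \<exists>P\<subseteq>K. X n i = (SUM k:P. x n k) & (SUM k:P. norm (x n k)) <= a n i * 2 powr (rho * real i)) &
  L2_set (a n) {..<card K} <= 2 * lpn (1 - rho) K (%k. norm (x n k))" for n by metis
 define b where "b n i = (if n : N then a n i else 0)" for n i
 have "(\<Sum>i<card K. (L2_set (%n. b n i) N)^2) = (\<Sum>i<card K. SUM n:N. (a n i)^2)"
  by (simp add: L2_set_def sum_nonneg b_def)
 also have "... = (SUM n:N. (L2_set (a n) {..<card K})^2)"
  by (subst sum.swap) (simp add: L2_set_def sum_nonneg)
 also have "... <= (SUM n:N. (2 * lpn (1 - rho) K (%k. norm (x n k)))^2)"
  using Xa by (intro sum_mono power_mono) (auto simp: L2_set_nonneg)
 finally have "L2_set (%i. L2_set (%n. b n i) N) {..<card K} <= L2_set (%n. 2 * lpn (1 - rho) K (%k. norm (x n k))) N"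
  unfolding L2_set_def[of _ "{..<card K}"] L2_set_def[of "%n. 2 * lpn (1 - rho) K (%k. norm (x n k))"] by (rule real_sqrt_le_mono)
 also have "... = 2 * mix (1/2) (1 - rho) N K (%n k. norm (x n k))"
  unfolding mix_def by (subst lpn_half[OF N]) (auto simp: L2_set_right_distrib lpn_nonneg K)
 finally have sum: "L2_set (%i. L2_set (%n. b n i) N) {..<card K} <= 2 * mix (1/2) (1 - rho) N K (%n k. norm (x n k))" .
 show ?thesis
 proof (intro exI[of _ X] exI[of _ b] conjI ballI allI)
  fix n i assume n: "n : N"
  show "norm (X n i) <= b n i * 2 powr (- (1/2 - rho) * real i)" using Xa[of n] n by (simp add: b_def)
  show "\<exists>P\<subseteq>K. X n i = (SUM k:P. x n k) & (SUM k:P. norm (x n k)) <= b n i * 2 powr (rho * real i)"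
   using Xa[of n] n by (simp add: b_def)
 qed (use Xa sum in \<open>auto simp: b_def\<close>)
qed

text \<open>Keel-Tao for levels i and l: near terms use the energy of the lower level against the
  small norm of the higher one, far terms use dispersion. Both leave 2^(-|i-l|/(4d)), which Schur's
  test sums. The restriction \<open>m < n\<close> is harmless, since the near and far bounds hold
  for any selected set of pairs.\<close>

lemma endpoint_diagonal:
 fixes x y :: "int => 'k => 'h::real_inner"
 assumes K: "finite K" and N: "finite N" and d: "3 <= d" and A: "0 <= A" and rho: "rho = 1/2 - 1 / real d"
  and ox: "orth_family N K x" and oy: "orth_family N K y"
  and xx: "dispersive A d N K x x" and yy: "dispersive A d N K y y" and xy: "dispersive A d N K x y"
 shows "\<bar>SUM n:N. SUM m:{m\<in>N. m < n}. inner (SUM k:K. x n k) (SUM k:K. y m k)\<bar>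
  <= 4 * (sqrt (3 + A * tailC d) + A * tailC d) * geoC (1 / (4 * real d))
   * mix (1/2) (1 - rho) N K (%n k. norm (x n k)) * mix (1/2) (1 - rho) N K (%n k. norm (y n k))"
proof -
 have rho': "0 <= rho" "rho <= 1/2" and drho: "1/2 - rho = 1 / d" using d by (auto simp: rho field_simps)
 obtain X a where X: "(ALL n i. 0 <= a n i) & (ALL n:N. (SUM k:K. x n k) = (\<Sum>i<card K. X n i)) &
  (ALL n:N. ALL i. norm (X n i) <= a n i * 2 powr (- (1/2 - rho) * real i)) &
  (ALL n:N. ALL i. \<exists>P\<subseteq>K. X n i = (SUM k:P. x n k) & (SUM k:P. norm (x n k)) <= a n i * 2 powr (rho * real i)) &
  L2_set (%i. L2_set (%n. a n i) N) {..<card K} <= 2 * mix (1/2) (1 - rho) N K (%n k. norm (x n k))"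
  using family_atoms[OF K N rho' ox] by blast
 obtain Y b where Y: "(ALL n i. 0 <= b n i) & (ALL n:N. (SUM k:K. y n k) = (\<Sum>i<card K. Y n i)) &
  (ALL n:N. ALL i. norm (Y n i) <= b n i * 2 powr (- (1/2 - rho) * real i)) &
  (ALL n:N. ALL i. \<exists>P\<subseteq>K. Y n i = (SUM k:P. y n k) & (SUM k:P. norm (y n k)) <= b n i * 2 powr (rho * real i)) &
  L2_set (%i. L2_set (%n. b n i) N) {..<card K} <= 2 * mix (1/2) (1 - rho) N K (%n k. norm (y n k))"
  using family_atoms[OF K N rho' oy] by blast
 have a0: "0 <= a n i" and b0: "0 <= b n i" for n i using X Y by auto
 have X4: "\<exists>P\<subseteq>K. X n i = (SUM k:P. x n k) & (SUM k:P. norm (x n k)) <= a n i * 2 powr (rho * real i)" if "n : N" for n i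
  using X that by blast
 have Y4: "\<exists>P\<subseteq>K. Y n i = (SUM k:P. y n k) & (SUM k:P. norm (y n k)) <= b n i * 2 powr (rho * real i)" if "n : N" for n i
  using Y that by blast
 have X3: "norm (X n i) <= a n i * 2 powr (- (1 / d) * real i)" if "n : N" for n i
  using X that unfolding drho by simp
 have Y3: "norm (Y n i) <= b n i * 2 powr (- (1 / d) * real i)" if "n : N" for n i
  using Y that unfolding drho by simp
 \<comment> \<open>The triangle inequality inside both blocks, stated for general families because
   it serves x with x, y with y and x with y.\<close>
 have pairs: "\<bar>inner (Z n i) (W m l)\<bar> <= A * real_of_int \<bar>n - m\<bar> powr (- (d / 2)) * (e n i * 2 powr (rho * i)) * (f m l * 2 powr (rho * l))"
  if zw: "dispersive A d N K z w" and n: "n : N" "m : N" "n ~= m"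
   and Z: "\<exists>P\<subseteq>K. Z n i = (SUM k:P. z n k) & (SUM k:P. norm (z n k)) <= e n i * 2 powr (rho * real i)"
   and W: "\<exists>P\<subseteq>K. W m l = (SUM k:P. w m k) & (SUM k:P. norm (w m k)) <= f m l * 2 powr (rho * real l)"
   and e: "0 <= e n i" for Z W n m i l e f and z w :: "int => 'k => 'h"
 proof -
  obtain P where P: "P <= K" "Z n i = (SUM k:P. z n k)" "(SUM k:P. norm (z n k)) <= e n i * 2 powr (rho * real i)" using Z by blast
  obtain Q where Q: "Q <= K" "W m l = (SUM k:Q. w m k)" "(SUM k:Q. norm (w m k)) <= f m l * 2 powr (rho * real l)" using W by blast
  have "\<bar>inner (Z n i) (W m l)\<bar> <= (A * real_of_int \<bar>n - m\<bar> powr (- (d / 2))) * (SUM k:P. norm (z n k)) * (SUM k:Q. norm (w m k))"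
   unfolding P(2) Q(2) using zw n P(1) Q(1) unfolding dispersive_def by (intro inner_sums_le) blast
  also have "... <= (A * real_of_int \<bar>n - m\<bar> powr (- (d / 2))) * (e n i * 2 powr (rho * i)) * (f m l * 2 powr (rho * l))"
   using P Q A e by (intro mult_mono mult_left_mono) (auto intro: sum_nonneg)
  finally show ?thesis .
 qed
 define CT where "CT = 3 + A * tailC d"
 have CT: "0 <= CT" using A tailC_nonneg[OF d] by (simp add: CT_def)
 have eX: "(norm (SUM n:J. X n i))^2 <= CT * (SUM n:J. (a n i)^2)" if "J <= N" for J i
  unfolding CT_def
 proof (rule dyadic_block_energy[where i = "real i" and rho = rho, OF _ d A _ _ rho])
  show "norm (X n i) <= a n i * 2 powr (- (1 / d) * real i)" if "n : J" for n
   using that \<open>J <= N\<close> by (intro X3) auto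
  show "\<bar>inner (X n i) (X m i)\<bar> <= A * real_of_int \<bar>n - m\<bar> powr (- (d / 2)) * (a n i * 2 powr (rho * real i)) * (a m i * 2 powr (rho * real i))"
   if "n : J" "m : J" "n ~= m" for n m
  proof -
   have nm: "n : N" "m : N" using that \<open>J <= N\<close> by auto
   show ?thesis by (rule pairs[where Z = X and W = X and e = a and f = a, OF xx nm that(3) X4[OF nm(1)] X4[OF nm(2)] a0])
  qed
 qed (use that N finite_subset a0 in auto)
 have eY: "(norm (SUM n:J. Y n i))^2 <= CT * (SUM n:J. (b n i)^2)" if "J <= N" for J i
  unfolding CT_def
 proof (rule dyadic_block_energy[where i = "real i" and rho = rho, OF _ d A _ _ rho])
  show "norm (Y n i) <= b n i * 2 powr (- (1 / d) * real i)" if "n : J" for n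
   using that \<open>J <= N\<close> by (intro Y3) auto
  show "\<bar>inner (Y n i) (Y m i)\<bar> <= A * real_of_int \<bar>n - m\<bar> powr (- (d / 2)) * (b n i * 2 powr (rho * real i)) * (b m i * 2 powr (rho * real i))"
   if "n : J" "m : J" "n ~= m" for n m
  proof -
   have nm: "n : N" "m : N" using that \<open>J <= N\<close> by auto
   show ?thesis by (rule pairs[where Z = Y and W = Y and e = b and f = b, OF yy nm that(3) Y4[OF nm(1)] Y4[OF nm(2)] b0])
  qed
 qed (use that N finite_subset b0 in auto)
 define ax where "ax i = L2_set (%n. a n i) N" for i
 define bx where "bx i = L2_set (%n. b n i) N" for i
 have ab0: "0 <= ax i" "0 <= bx i" for i by (auto simp: ax_def bx_def L2_set_nonneg)
 define T where "T i l = (SUM n:N. SUM m:{m\<in>N. m < n}. inner (X n i) (Y m l))" for i l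
 define kappa where "kappa i l = (sqrt CT + A * tailC d) * 2 powr (- (1 / (4 * real d)) * \<bar>real i - real l\<bar>)" for i l :: nat
 have TT: "\<bar>T i l\<bar> <= kappa i l * ax i * bx l" for i l
 proof -
  define s where "s = real (max i l)"
  define t where "t = real (min i l)"
  have st: "s - t = \<bar>real i - real l\<bar>" "s + t = real i + real l" "t <= s" "0 <= t" by (auto simp: s_def t_def)
  \<comment> \<open>With the cut at 2^((s+t)/d) the far bound would have no decay in s - t, with the
    cut at 2^(2s/d) the near bound would have none. Their geometric mean leaves decay to
    both.\<close>
  define R where "R = 2 powr ((3 * s + t) / (2 * d))"
  have R: "1 <= R" using st d by (auto simp: R_def intro!: ge_one_powr_ge_zero)
  have split: "T i l = (SUM n:N. SUM m:{m\<in>N. m < n & real_of_int (n - m) <= R}. inner (X n i) (Y m l))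
    + (SUM n:N. SUM m:{m\<in>N. m < n & R < real_of_int (n - m)}. inner (X n i) (Y m l))"
   unfolding T_def sum.distrib[symmetric]
  proof (rule sum.cong[OF refl])
   fix n
   have eq: "{m\<in>N. m < n & real_of_int (n - m) <= R} \<union> {m\<in>N. m < n & R < real_of_int (n - m)} = {m\<in>N. m < n}" by auto
   show "(SUM m:{m\<in>N. m < n}. inner (X n i) (Y m l)) = (SUM m:{m\<in>N. m < n & real_of_int (n - m) <= R}. inner (X n i) (Y m l))
    + (SUM m:{m\<in>N. m < n & R < real_of_int (n - m)}. inner (X n i) (Y m l))"
    unfolding eq[symmetric] by (rule sum.union_disjoint) (use N in auto)
  qed
  have near: "\<bar>SUM n:N. SUM m:{m\<in>N. m < n & real_of_int (n - m) <= R}. inner (X n i) (Y m l)\<bar>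
    <= sqrt CT * sqrt R * 2 powr (- (1 / d) * s) * ax i * bx l"
  \<comment> \<open>The higher level has the smaller norms; the energy bound goes to the other
    family, after exchanging the two sums when \<open>i\<close> is the higher level.\<close>
  proof (cases "i <= l")
   case True
   then have s: "s = real l" by (simp add: s_def)
   show ?thesis unfolding ax_def bx_def s
   proof (rule near_diagonal_bound[OF N CT])
    show "norm (Y m l) <= 2 powr (- (1 / d) * real l) * b m l" if "m : N" for m
     using Y3[OF that] by (simp add: mult.commute)
    show "real (card {m\<in>N. m < n & real_of_int (n - m) <= R}) <= R" for n
     using R by (intro card_int_one_sided) auto
   qed (use R eX b0 in auto)
  next
   case False
   then have s: "s = real i" by (simp add: s_def)
   have "(SUM n:N. SUM m:{m\<in>N. m < n & real_of_int (n - m) <= R}. inner (X n i) (Y m l))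
     = (SUM m:N. SUM n:{n\<in>N. m < n & real_of_int (n - m) <= R}. inner (Y m l) (X n i))"
    unfolding inner_commute[of "Y _ l"] by (rule sum.swap_restrict[OF N N])
   moreover have "\<bar>SUM m:N. SUM n:{n\<in>N. m < n & real_of_int (n - m) <= R}. inner (Y m l) (X n i)\<bar>
     <= sqrt CT * sqrt R * 2 powr (- (1 / d) * s) * bx l * ax i"
    unfolding ax_def bx_def s
   proof (rule near_diagonal_bound[OF N CT])
    show "norm (X m i) <= 2 powr (- (1 / d) * real i) * a m i" if "m : N" for m
     using X3[OF that] by (simp add: mult.commute)
    show "real (card {m\<in>N. n < m & real_of_int (m - n) <= R}) <= R" for n
     using R by (intro card_int_one_sided) auto
   qed (use R eY a0 in auto)
   ultimately show ?thesis by (simp add: ac_simps)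
  qed
  have far: "\<bar>SUM n:N. SUM m:{m\<in>N. m < n & R < real_of_int (n - m)}. inner (X n i) (Y m l)\<bar>
    <= A * (2 powr (rho * i) * 2 powr (rho * l)) * tailC d * R powr (1 - d / 2) * ax i * bx l"
   unfolding ax_def bx_def
  proof (rule far_diagonal_bound[OF N d _ R])
   show "\<bar>inner (X n i) (Y m l)\<bar> <= A * (2 powr (rho * i) * 2 powr (rho * l)) * real_of_int \<bar>n - m\<bar> powr (- (d / 2)) * a n i * b m l"
    if "n : N" "m : N" "n ~= m" for n m
   proof -
    have "\<bar>inner (X n i) (Y m l)\<bar> <= A * real_of_int \<bar>n - m\<bar> powr (- (d / 2)) * (a n i * 2 powr (rho * i)) * (b m l * 2 powr (rho * l))"
     by (rule pairs[where Z = X and W = Y and e = a and f = b, OF xy that X4[OF that(1)] Y4[OF that(2)] a0])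
    then show ?thesis by (simp only: ac_simps)
   qed
  qed (use A a0 b0 in auto)
  have e1: "sqrt R * 2 powr (- (1 / d) * s) = 2 powr (- (1 / (4 * real d)) * \<bar>real i - real l\<bar>)"
  proof -
   have "(3 * s + t) / (2 * d) * (1 / 2) + - (1 / d) * s = - (1 / (4 * real d)) * (s - t)" using d by (simp add: field_simps)
   then show ?thesis
    unfolding powr_half_sqrt[symmetric, OF order_trans[OF zero_le_one R]] unfolding R_def powr_powr powr_add[symmetric] st(1) by simp
  qed
  have e2: "(2 powr (rho * i) * 2 powr (rho * l)) * R powr (1 - d / 2) <= 2 powr (- (1 / (4 * real d)) * \<bar>real i - real l\<bar>)"
  proof -
   have "rho * i + rho * l + (3 * s + t) / (2 * d) * (1 - d / 2) = rho * (s + t) + (3 * s + t) / (2 * d) * (1 - d / 2)"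
    by (simp add: st(2) distrib_left)
   also have "... = - ((d - 2) / (4 * d)) * (s - t)" using d unfolding rho by (simp add: field_simps)
   also have "... <= - (1 / (4 * real d)) * (s - t)"
    using d st by (intro mult_right_mono) (auto simp: divide_simps)
   finally show ?thesis unfolding R_def powr_powr powr_add[symmetric] st(1)[symmetric] by (intro powr_mono) auto
  qed
  have "\<bar>T i l\<bar> <= sqrt CT * sqrt R * 2 powr (- (1 / d) * s) * ax i * bx l
   + A * (2 powr (rho * i) * 2 powr (rho * l)) * tailC d * R powr (1 - d / 2) * ax i * bx l"
   using near far unfolding split by linarith
  also have "... = sqrt CT * (sqrt R * 2 powr (- (1 / d) * s)) * ax i * bx l
   + A * tailC d * ((2 powr (rho * i) * 2 powr (rho * l)) * R powr (1 - d / 2)) * ax i * bx l"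
   by (simp only: ac_simps)
  also have "... <= sqrt CT * (2 powr (- (1 / (4 * real d)) * \<bar>real i - real l\<bar>)) * ax i * bx l
   + A * tailC d * (2 powr (- (1 / (4 * real d)) * \<bar>real i - real l\<bar>)) * ax i * bx l"
   using e2 A tailC_nonneg[OF d] ab0 unfolding e1 by (intro add_left_mono mult_right_mono mult_left_mono) auto
  also have "... = kappa i l * ax i * bx l" by (simp only: kappa_def distrib_right)
  finally show ?thesis .
 qed
 have c: "0 <= sqrt CT + A * tailC d" using A tailC_nonneg[OF d] CT by simp
 have d4: "0 < 1 / (4 * real d)" using d by simp
 have "(SUM n:N. SUM m:{m\<in>N. m < n}. inner (SUM k:K. x n k) (SUM k:K. y m k))
   = (SUM n:N. SUM m:{m\<in>N. m < n}. \<Sum>i<card K. \<Sum>l<card K. inner (X n i) (Y m l))"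
 proof (intro sum.cong refl)
  fix n m assume "n : N" "m : {m\<in>N. m < n}"
  then have "inner (SUM k:K. x n k) (SUM k:K. y m k) = inner (\<Sum>i<card K. X n i) (\<Sum>l<card K. Y m l)" using X Y by auto
  also have "... = (\<Sum>i<card K. \<Sum>l<card K. inner (X n i) (Y m l))"
   unfolding inner_sum_left inner_sum_right by (rule sum.swap)
  finally show "inner (SUM k:K. x n k) (SUM k:K. y m k) = (\<Sum>i<card K. \<Sum>l<card K. inner (X n i) (Y m l))" .
 qed
 also have "... = (SUM n:N. \<Sum>i<card K. \<Sum>l<card K. SUM m:{m\<in>N. m < n}. inner (X n i) (Y m l))"
  by (intro sum.cong refl) (subst sum.swap, intro sum.cong refl, rule sum.swap)
 also have "... = (\<Sum>i<card K. \<Sum>l<card K. T i l)"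
  unfolding T_def by (subst sum.swap, intro sum.cong refl, rule sum.swap)
 finally have "\<bar>SUM n:N. SUM m:{m\<in>N. m < n}. inner (SUM k:K. x n k) (SUM k:K. y m k)\<bar> <= (\<Sum>i<card K. \<Sum>l<card K. \<bar>T i l\<bar>)"
  by (auto intro!: order_trans[OF sum_abs] sum_mono)
 also have "... <= (\<Sum>i<card K. \<Sum>l<card K. kappa i l * ax i * bx l)" by (intro sum_mono TT)
 also have "... <= (sqrt CT + A * tailC d) * geoC (1 / (4 * real d)) * L2_set ax {..<card K} * L2_set bx {..<card K}"
 proof (rule Schur_test)
  have rows: "(\<Sum>i<card K. kappa i l) <= (sqrt CT + A * tailC d) * geoC (1 / (4 * real d))" for l
   unfolding kappa_def sum_distrib_left[symmetric] geoC_def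
   using d4 c by (intro mult_left_mono sum_geometric_dist) auto
  show "(\<Sum>i<card K. kappa i l) <= (sqrt CT + A * tailC d) * geoC (1 / (4 * real d))" for l by (rule rows)
  show "(\<Sum>l<card K. kappa i l) <= (sqrt CT + A * tailC d) * geoC (1 / (4 * real d))" for i
   using rows[of i] by (simp only: kappa_def abs_minus_commute)
 qed (use c geoC_nonneg[OF d4] in \<open>auto simp: kappa_def\<close>)
 also have "... <= (sqrt CT + A * tailC d) * geoC (1 / (4 * real d)) * (2 * mix (1/2) (1 - rho) N K (%n k. norm (x n k)))
   * (2 * mix (1/2) (1 - rho) N K (%n k. norm (y n k)))"
  using X Y c geoC_nonneg[OF d4] mix_nonneg[OF N] unfolding ax_def bx_def
  by (intro mult_mono mult_nonneg_nonneg L2_set_nonneg) auto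
 finally have bound: "\<bar>SUM n:N. SUM m:{m\<in>N. m < n}. inner (SUM k:K. x n k) (SUM k:K. y m k)\<bar>
  <= (sqrt CT + A * tailC d) * geoC (1 / (4 * real d)) * (2 * mix (1/2) (1 - rho) N K (%n k. norm (x n k)))
   * (2 * mix (1/2) (1 - rho) N K (%n k. norm (y n k)))" .
 have "c * g * (2 * u) * (2 * v) = 4 * c * g * u * v" for c g u v :: real by simp
 with bound show ?thesis unfolding CT_def by (simp only:)
qed

section \<open>Bilinear estimates: equal exponents first, then two independent pairs\<close>

lemma norm_block_le:
 fixes x :: "int => 'k => 'h::real_inner"
 assumes K: "finite K" and o: "orth_family N K x" and n: "n : N"
 shows "norm (SUM k:K. x n k) = lpn (1/2) K (%k. norm (x n k))"
 using norm_sum_orthogonal[OF K, of "x n"] o n by (simp add: lpn_half[OF K] orth_family_def)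

lemma diagonal_sum_le:
 fixes x y :: "int => 'k => 'h::real_inner"
 assumes K: "finite K" and N: "finite N" and e: "0 <= alpha" "alpha <= 1/2" "0 <= rho" "rho <= 1/2" "0 <= alpha'" "alpha' <= 1/2" "0 <= rho'" "rho' <= 1/2"
  and o: "orth_family N K x" "orth_family N K y" and D: "D <= N"
 shows "(SUM n:D. \<bar>inner (SUM k:K. x n k) (SUM k:K. y n k)\<bar>)
  <= mix (1 - alpha) (1 - rho) N K (%n k. norm (x n k)) * mix (1 - alpha') (1 - rho') N K (%n k. norm (y n k))"
proof -
 have l2: "L2_set (%n. norm (SUM k:K. z n k)) N <= mix (1 - alpha) (1 - rho) N K (%n k. norm (z n k))"
  if "orth_family N K z" "0 <= alpha" "alpha <= 1/2" "0 <= rho" "rho <= 1/2" for z :: "int => 'k => 'h" and alpha rho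
 proof -
  have "L2_set (%n. norm (SUM k:K. z n k)) N = lpn (1/2) N (%n. norm (SUM k:K. z n k))"
   by (rule lpn_half[OF N, symmetric]) simp
  also have "... <= lpn (1 - alpha) N (%n. norm (SUM k:K. z n k))" using that by (intro lpn_antimono N) auto
  also have "... <= mix (1 - alpha) (1 - rho) N K (%n k. norm (z n k))"
   unfolding mix_def using that norm_block_le[OF K that(1)]
   by (intro lpn_mono N) (auto intro!: lpn_antimono lpn_nonneg K)
  finally show ?thesis .
 qed
 have "(SUM n:D. \<bar>inner (SUM k:K. x n k) (SUM k:K. y n k)\<bar>) <= (SUM n:N. \<bar>inner (SUM k:K. x n k) (SUM k:K. y n k)\<bar>)"
  using D N by (intro sum_mono2) auto
 also have "... <= (SUM n:N. \<bar>norm (SUM k:K. x n k)\<bar> * \<bar>norm (SUM k:K. y n k)\<bar>)"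
  by (intro sum_mono) (simp add: Cauchy_Schwarz_ineq2)
 also have "... <= L2_set (%n. norm (SUM k:K. x n k)) N * L2_set (%n. norm (SUM k:K. y n k)) N"
  by (rule L2_set_mult_ineq)
 also have "... <= mix (1 - alpha) (1 - rho) N K (%n k. norm (x n k)) * mix (1 - alpha') (1 - rho') N K (%n k. norm (y n k))"
  using l2[OF o(1), of alpha rho] l2[OF o(2), of alpha' rho'] e by (intro mult_mono L2_set_nonneg mix_nonneg N) auto
 finally show ?thesis .
qed

text \<open>Interpolated dispersion between two times decays like |n-m|^(-2 alpha), because (d/2)(1
  - 2 rho) = 2 alpha, and the Hardy-Littlewood-Sobolev sum applies. At \<open>rho = 0\<close> the
  dispersive bound is used as it stands; the absolute value around \<open>geoC\<close> keeps the
  constant nonnegative there.\<close>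

lemma nonendpoint_diagonal:
 fixes x y :: "int => 'k => 'h::real_inner"
 assumes K: "finite K" and N: "finite N" and A: "0 < A" and rho: "0 <= rho" "rho < 1/2"
  and alpha: "alpha = d / 4 - d * rho / 2" "0 < alpha" "alpha < 1/2"
  and ox: "orth_family N K x" and oy: "orth_family N K y" and xy: "dispersive A d N K x y"
 shows "\<bar>SUM n:N. SUM m:{m\<in>N. m < n}. inner (SUM k:K. x n k) (SUM k:K. y m k)\<bar>
  <= (A + 4 * \<bar>geoC (min rho (1/2 - rho))\<bar> * A powr (1 - 2 * rho)) * (4 * (2 / (1 - 2 * alpha) + 1) * geoC alpha)
   * mix (1 - alpha) (1 - rho) N K (%n k. norm (x n k)) * mix (1 - alpha) (1 - rho) N K (%n k. norm (y n k))"
proof -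
 define F where "F = A + 4 * \<bar>geoC (min rho (1/2 - rho))\<bar> * A powr (1 - 2 * rho)"
 define u where "u n = lpn (1 - rho) K (%k. norm (x n k))" for n
 define v where "v n = lpn (1 - rho) K (%k. norm (y n k))" for n
 have uv: "0 <= u n" "0 <= v n" for n by (auto simp: u_def v_def lpn_nonneg[OF K])
 have F: "0 <= F" using A by (simp add: F_def)
 have pair: "\<bar>inner (SUM k:K. x n k) (SUM k:K. y m k)\<bar> <= F * (real_of_int \<bar>n - m\<bar> powr (- (2 * alpha)) * u n * v m)"
  if n: "n : N" "m : N" "n ~= m" for n m
 proof (cases "rho = 0")
  case True
  have "\<bar>inner (SUM k:K. x n k) (SUM k:K. y m k)\<bar> <= (A * real_of_int \<bar>n - m\<bar> powr (- (d / 2))) * (SUM k:K. norm (x n k)) * (SUM k:K. norm (y m k))"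
   using xy n unfolding dispersive_def by (intro inner_sums_le) blast
  also have "... = A * (real_of_int \<bar>n - m\<bar> powr (- (2 * alpha)) * u n * v m)"
   using True by (simp add: u_def v_def lpn_one[OF K] alpha(1) mult.assoc)
  also have "... <= F * (real_of_int \<bar>n - m\<bar> powr (- (2 * alpha)) * u n * v m)"
   using uv by (intro mult_right_mono mult_nonneg_nonneg) (auto simp: F_def)
  finally show ?thesis .
 next
  case False
  then have rho': "0 < rho" using rho by simp
  define D where "D = A * real_of_int \<bar>n - m\<bar> powr (- (d / 2))"
  have D: "0 < D" using A n by (simp add: D_def)
  have e: "- (d / 2) * (1 - 2 * rho) = - (2 * alpha)" unfolding alpha(1) by (simp add: algebra_simps)
  have Dp: "D powr (1 - 2 * rho) = A powr (1 - 2 * rho) * real_of_int \<bar>n - m\<bar> powr (- (2 * alpha))"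
   unfolding D_def powr_mult powr_powr e ..
  have "\<bar>inner (SUM k:K. x n k) (SUM k:K. y m k)\<bar> <= 4 * geoC (min rho (1/2 - rho)) * D powr (1 - 2 * rho) * u n * v m"
   unfolding u_def v_def
  proof (rule fixed_time_interpolation[OF K rho' rho(2) D])
   show "\<bar>inner (x n k) (y m l)\<bar> <= D * norm (x n k) * norm (y m l)" if "k : K" "l : K" for k l
    using xy n that unfolding dispersive_def D_def by blast
  qed (use ox oy n in \<open>auto simp: orth_family_def\<close>)
  also have "... = (4 * geoC (min rho (1/2 - rho)) * A powr (1 - 2 * rho)) * (real_of_int \<bar>n - m\<bar> powr (- (2 * alpha)) * u n * v m)"
   unfolding Dp by (simp only: ac_simps)
  also have "... <= F * (real_of_int \<bar>n - m\<bar> powr (- (2 * alpha)) * u n * v m)"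
  proof (intro mult_right_mono)
   have "4 * geoC (min rho (1/2 - rho)) * A powr (1 - 2 * rho) <= 4 * \<bar>geoC (min rho (1/2 - rho))\<bar> * A powr (1 - 2 * rho)"
    by (intro mult_right_mono) auto
   then show "4 * geoC (min rho (1/2 - rho)) * A powr (1 - 2 * rho) <= F" using A unfolding F_def by linarith
  qed (use uv in auto)
  finally show ?thesis .
 qed
 have "\<bar>SUM n:N. SUM m:{m\<in>N. m < n}. inner (SUM k:K. x n k) (SUM k:K. y m k)\<bar>
   <= (SUM n:N. SUM m:{m\<in>N. m < n}. F * (real_of_int \<bar>n - m\<bar> powr (- (2 * alpha)) * u n * v m))"
  by (intro order_trans[OF sum_abs] sum_mono pair) auto
 also have "... <= (SUM n:N. SUM m:N. F * (real_of_int \<bar>n - m\<bar> powr (- (2 * alpha)) * u n * v m))"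
  using N F uv by (intro sum_mono sum_mono2) auto
 also have "... = F * (SUM n:N. SUM m:N. real_of_int \<bar>n - m\<bar> powr (- (2 * alpha)) * u n * v m)"
  by (simp only: sum_distrib_left)
 also have "... <= F * (4 * (2 / (1 - 2 * alpha) + 1) * geoC alpha * lpn (1 - alpha) N u * lpn (1 - alpha) N v)"
  using F uv alpha N by (intro mult_left_mono discrete_Hardy_Littlewood_Sobolev) auto
 finally show ?thesis unfolding F_def u_def v_def mix_def by (simp only: mult.assoc)
qed

definition strict_form :: "int set => 'k set => (int => 'k => 'h::real_inner) => (int => 'k => 'h) => real" where
 "strict_form N K x y = (SUM n:N. SUM m:{m\<in>N. m < n}. inner (SUM k:K. x n k) (SUM k:K. y m k))"

definition diagonal_exponents :: "nat => real => real => bool" where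
 "diagonal_exponents d alpha rho \<longleftrightarrow> 1 <= d & 0 <= rho & rho < 1/2 & alpha = d / 4 - d * rho / 2 & 0 < alpha &
  (alpha < 1/2 \<or> (3 <= d & alpha = 1/2))"

lemma diagonal_estimate:
 assumes A: "0 < A" and e: "diagonal_exponents d alpha rho"
 shows "\<exists>C\<ge>0. ALL N K (x :: int => 'k => 'h::real_inner) y. finite N --> finite K --> orth_family N K x --> orth_family N K y -->
  dispersive A d N K x x --> dispersive A d N K y y --> dispersive A d N K x y -->
  \<bar>strict_form N K x y\<bar> <= C * mix (1 - alpha) (1 - rho) N K (%n k. norm (x n k)) * mix (1 - alpha) (1 - rho) N K (%n k. norm (y n k))"
proof (cases "alpha < 1/2")
 case True
 define C where "C = (A + 4 * \<bar>geoC (min rho (1/2 - rho))\<bar> * A powr (1 - 2 * rho)) * (4 * (2 / (1 - 2 * alpha) + 1) * geoC alpha)"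
 have "0 <= C" unfolding C_def using A e True geoC_nonneg[of alpha] by (auto simp: diagonal_exponents_def intro!: mult_nonneg_nonneg add_nonneg_nonneg)
 moreover have "\<bar>strict_form N K x y\<bar> <= C * mix (1 - alpha) (1 - rho) N K (%n k. norm (x n k)) * mix (1 - alpha) (1 - rho) N K (%n k. norm (y n k))"
  if "finite N" "finite K" "orth_family N K x" "orth_family N K y" "dispersive A d N K x y" for N K and x y :: "int => 'k => 'h"
  unfolding strict_form_def C_def using that e True A unfolding diagonal_exponents_def by (intro nonendpoint_diagonal) auto
 ultimately show ?thesis by blast
next
 case False
 then have d: "3 <= d" and alpha: "alpha = 1/2" and rho: "rho = 1/2 - 1 / d" using e by (auto simp: diagonal_exponents_def field_simps)
 define C where "C = 4 * (sqrt (3 + A * tailC d) + A * tailC d) * geoC (1 / (4 * real d))"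
 have "0 <= C" unfolding C_def using A d geoC_nonneg[of "1 / (4 * d)"] tailC_nonneg[OF d] by (auto intro!: mult_nonneg_nonneg add_nonneg_nonneg)
 moreover have "\<bar>strict_form N K x y\<bar> <= C * mix (1 - alpha) (1 - rho) N K (%n k. norm (x n k)) * mix (1 - alpha) (1 - rho) N K (%n k. norm (y n k))"
  if "finite N" "finite K" "orth_family N K x" "orth_family N K y" "dispersive A d N K x x" "dispersive A d N K y y" "dispersive A d N K x y"
  for N K and x y :: "int => 'k => 'h"
  using endpoint_diagonal[OF that(2,1) d _ rho that(3-7)] A unfolding strict_form_def C_def alpha by simp
 ultimately show ?thesis by blast
qed

lemma orth_family_scale: "orth_family N K x ==> orth_family N K (%n k. g n k *\<^sub>R x n k)"
 by (simp add: orth_family_def)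

lemma dispersive_scale_left:
 assumes "dispersive A d N K x y" shows "dispersive A d N K (%n k. g n k *\<^sub>R x n k) y"
 unfolding dispersive_def
proof (intro ballI impI)
 fix n m k l assume nm: "n : N" "m : N" "k : K" "l : K" "n ~= m"
 then have "\<bar>g n k\<bar> * \<bar>inner (x n k) (y m l)\<bar> <= \<bar>g n k\<bar> * (A * real_of_int \<bar>n - m\<bar> powr (- (d / 2)) * norm (x n k) * norm (y m l))"
  using assms unfolding dispersive_def by (intro mult_left_mono) auto
 then show "\<bar>inner (g n k *\<^sub>R x n k) (y m l)\<bar> <= A * real_of_int \<bar>n - m\<bar> powr (- (d / 2)) * norm (g n k *\<^sub>R x n k) * norm (y m l)"
  by (simp only: inner_scaleR_left abs_mult norm_scaleR ac_simps)
qed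

lemma dispersive_scale_right: "dispersive A d N K x y ==> dispersive A d N K x (%n k. g n k *\<^sub>R y n k)"
 using dispersive_commute dispersive_scale_left by blast

lemma orth_family_subset: "orth_family N K x ==> N' <= N ==> orth_family N' K x"
 unfolding orth_family_def by blast

lemma dispersive_subset: "dispersive A d N K x y ==> N' <= N ==> dispersive A d N' K x y"
 unfolding dispersive_def by blast

text \<open>With the directions of the vectors frozen, the form is a linear functional of their
  norms, as \<open>mix_interpolate\<close> requires; closure of \<open>P\<close> under scaling lets
  the norms vary freely. The second endpoint is the dual of the pair (infinity, 2).\<close>

lemma family_interpolation:
 fixes x :: "int => 'k => 'h::real_inner" and v :: "int => 'h"
 assumes N: "finite N" and K: "finite K"
  and e: "0 <= alpha\<^sub>1" "alpha\<^sub>1 <= 1" "0 <= rho\<^sub>1" "rho\<^sub>1 <= 1" "0 <= theta" "theta <= 1" and C: "0 <= C"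
  and P: "P x" "!!x g. P x ==> P (%n k. g n k *\<^sub>R x n k)"
  and b1: "!!x. P x ==> (SUM n:N. inner (SUM k:K. x n k) (v n)) <= C * mix (1 - alpha\<^sub>1) (1 - rho\<^sub>1) N K (%n k. norm (x n k))"
  and b0: "!!x. P x ==> (SUM n:N. inner (SUM k:K. x n k) (v n)) <= C * mix 1 (1/2) N K (%n k. norm (x n k))"
 shows "\<bar>SUM n:N. inner (SUM k:K. x n k) (v n)\<bar>
  <= C * mix (1 - theta * alpha\<^sub>1) (1 - (theta * rho\<^sub>1 + (1 - theta) / 2)) N K (%n k. norm (x n k))"
proof -
 have *: "(SUM n:N. inner (SUM k:K. x n k) (v n)) <= C * mix (1 - theta * alpha\<^sub>1) (1 - (theta * rho\<^sub>1 + (1 - theta) / 2)) N K (%n k. norm (x n k))"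
  if x: "P x" for x
 proof -
  define z where "z n k = inner (x n k) (v n) / norm (x n k)" for n k
  have bound: "(SUM n:N. SUM k:K. g n k * z n k) <= C * mix alpha rho N K g"
   if g: "!!n k. 0 <= g n k" and e: "0 <= alpha" "0 <= rho"
    and b: "!!x. P x ==> (SUM n:N. inner (SUM k:K. x n k) (v n)) <= C * mix alpha rho N K (%n k. norm (x n k))" for g alpha rho
  proof -
   have "(SUM n:N. SUM k:K. g n k * z n k) = (SUM n:N. inner (SUM k:K. (g n k / norm (x n k)) *\<^sub>R x n k) (v n))"
    by (simp add: inner_sum_left z_def)
   also have "... <= C * mix alpha rho N K (%n k. norm ((g n k / norm (x n k)) *\<^sub>R x n k))"
    by (rule b[OF P(2)[OF x]])
   also have "... <= C * mix alpha rho N K g"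
    using g e C N K by (intro mult_left_mono mix_mono) auto
   finally show ?thesis .
  qed
  have "(SUM n:N. SUM k:K. norm (x n k) * z n k)
    <= C * mix (1 - (theta * alpha\<^sub>1 + (1 - theta) * 0)) (1 - (theta * rho\<^sub>1 + (1 - theta) * (1/2))) N K (%n k. norm (x n k))"
   by (rule mix_interpolate[OF N K]) (use e C bound[OF _ _ _ b1] bound[OF _ _ _ b0] in auto)
  moreover have "(SUM n:N. SUM k:K. norm (x n k) * z n k) = (SUM n:N. inner (SUM k:K. x n k) (v n))"
   unfolding inner_sum_left by (intro sum.cong refl) (auto simp: z_def)
  ultimately show ?thesis by simp
 qed
 \<comment> \<open>Scaling by -1 stays in \<open>P\<close>, so the one-sided bound yields the
   absolute value.\<close>
 have "P (%n k. (- 1) *\<^sub>R x n k)" using P(2)[OF P(1), of "%_ _. - 1"] .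
 from *[OF this] *[OF P(1)] show ?thesis by (simp add: sum_negf)
qed

lemma mix_subset:
 assumes "finite N" "finite K" "N' <= N" "0 <= alpha"
 shows "mix alpha rho N' K a <= mix alpha rho N K a"
 unfolding mix_def using assms by (intro lpn_subset)

text \<open>A TT* argument: the squared norm is twice the strict form plus equal-time terms, which
  gives \<open>theta = 1\<close>. The triangle inequality in time gives \<open>theta = 0\<close>.
  Testing against one unit vector makes both statements about a functional, and these
  interpolate.\<close>

lemma norm_estimate:
 assumes A: "0 < A" and e: "diagonal_exponents d alpha rho" and theta: "0 <= theta" "theta <= 1"
 shows "\<exists>C\<ge>0. ALL N K (x :: int => 'k => 'h::real_inner). finite N --> finite K --> orth_family N K x --> dispersive A d N K x x -->
  norm (SUM n:N. SUM k:K. x n k) <= C * mix (1 - theta * alpha) (1 - (theta * rho + (1 - theta) / 2)) N K (%n k. norm (x n k))"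
proof -
 have e': "0 <= alpha" "alpha <= 1/2" "0 <= rho" "rho <= 1/2" using e by (auto simp: diagonal_exponents_def)
 obtain C where C: "0 <= C" "!!N K (x :: int => 'k => 'h::real_inner) y. finite N ==> finite K ==> orth_family N K x ==> orth_family N K y ==>
  dispersive A d N K x x ==> dispersive A d N K y y ==> dispersive A d N K x y ==>
  \<bar>strict_form N K x y\<bar> <= C * mix (1 - alpha) (1 - rho) N K (%n k. norm (x n k)) * mix (1 - alpha) (1 - rho) N K (%n k. norm (y n k))"
  using diagonal_estimate[OF A e] by blast
 \<comment> \<open>The square root serves \<open>theta = 1\<close>; the added 1 makes the constant
   at least 1 for the triangle inequality at \<open>theta = 0\<close>.\<close>
 define C' where "C' = sqrt (1 + 2 * C) + 1"
 have C': "0 <= C'" "1 <= C'" using C by (auto simp: C'_def)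
 have "norm (SUM n:N. SUM k:K. x n k) <= C' * mix (1 - theta * alpha) (1 - (theta * rho + (1 - theta) / 2)) N K (%n k. norm (x n k))"
  if N: "finite N" and K: "finite K" and x: "orth_family N K x" "dispersive A d N K x x" for N K and x :: "int => 'k => 'h"
 proof -
  have one: "norm (SUM n:N. SUM k:K. z n k) <= C' * mix (1 - alpha) (1 - rho) N K (%n k. norm (z n k))"
   if z: "orth_family N K z" "dispersive A d N K z z" for z :: "int => 'k => 'h"
  proof -
   let ?M = "mix (1 - alpha) (1 - rho) N K (%n k. norm (z n k))"
   define Z where "Z n = (SUM k:K. z n k)" for n
   have "(norm (SUM n:N. Z n))^2 = (SUM n:N. SUM m:N. inner (Z n) (Z m))"
    unfolding power2_norm_eq_inner inner_sum_left inner_sum_right by (rule sum.swap)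
   also have "... = (SUM n:N. (SUM m:{m\<in>N. m < n}. inner (Z n) (Z m)) + (SUM m:{m\<in>N. n < m}. inner (Z n) (Z m)) + inner (Z n) (Z n))"
   proof (rule sum.cong[OF refl])
    fix n assume n: "n : N"
    have eq: "{m\<in>N. m < n} \<union> {m\<in>N. n < m} \<union> {n} = N" using n by auto
    have "(SUM m:{m\<in>N. m < n} \<union> {m\<in>N. n < m} \<union> {n}. inner (Z n) (Z m))
      = (SUM m:{m\<in>N. m < n}. inner (Z n) (Z m)) + (SUM m:{m\<in>N. n < m}. inner (Z n) (Z m)) + inner (Z n) (Z n)"
     using N by (subst sum.union_disjoint, auto)+
    then show "(SUM m:N. inner (Z n) (Z m))
      = (SUM m:{m\<in>N. m < n}. inner (Z n) (Z m)) + (SUM m:{m\<in>N. n < m}. inner (Z n) (Z m)) + inner (Z n) (Z n)"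
     by (simp only: eq)
   qed
   also have "... = strict_form N K z z + (SUM n:N. SUM m:{m\<in>N. n < m}. inner (Z n) (Z m)) + (SUM n:N. inner (Z n) (Z n))"
    by (simp only: strict_form_def Z_def sum.distrib)
   finally have "(norm (SUM n:N. Z n))^2 = strict_form N K z z + (SUM n:N. SUM m:{m\<in>N. n < m}. inner (Z n) (Z m)) + (SUM n:N. inner (Z n) (Z n))" .
   moreover have "(SUM n:N. SUM m:{m\<in>N. n < m}. inner (Z n) (Z m)) = (SUM n:N. SUM m:{m\<in>N. n < m}. inner (Z m) (Z n))"
    by (intro sum.cong refl inner_commute)
   moreover have "(SUM n:N. SUM m:{m\<in>N. n < m}. inner (Z m) (Z n)) = strict_form N K z z"
    unfolding strict_form_def Z_def by (rule sum.swap_restrict[OF N N])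
   moreover have "(SUM n:N. inner (Z n) (Z n)) <= (SUM n:N. \<bar>inner (Z n) (Z n)\<bar>)" by (intro sum_mono) simp
   moreover have "(SUM n:N. \<bar>inner (Z n) (Z n)\<bar>) <= ?M * ?M" unfolding Z_def using e' z by (intro diagonal_sum_le K N) auto
   moreover have "strict_form N K z z <= C * (?M * ?M)" using C(2)[OF N K z(1) z(1) z(2) z(2) z(2)] by (simp only: mult.assoc abs_le_iff)
   moreover have "(1 + 2 * C) * (?M * ?M) = ?M * ?M + 2 * (C * (?M * ?M))" by (simp add: distrib_right)
   ultimately have "(norm (SUM n:N. Z n))^2 <= (1 + 2 * C) * (?M * ?M)" by linarith
   then have "norm (SUM n:N. Z n) <= sqrt ((1 + 2 * C) * (?M * ?M))" by (rule real_le_rsqrt)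
   also have "... = sqrt (1 + 2 * C) * ?M" using mix_nonneg[OF N, of "1 - alpha" "1 - rho" K "%n k. norm (z n k)"] by (simp add: real_sqrt_mult)
   also have "... <= C' * ?M" using mix_nonneg[OF N] by (intro mult_right_mono) (auto simp: C'_def)
   finally show ?thesis by (simp only: Z_def)
  qed
  have zero: "norm (SUM n:N. SUM k:K. z n k) <= C' * mix 1 (1/2) N K (%n k. norm (z n k))"
   if z: "orth_family N K z" for z :: "int => 'k => 'h"
  proof -
   have "norm (SUM n:N. SUM k:K. z n k) <= (SUM n:N. lpn (1/2) K (%k. norm (z n k)))"
    using norm_block_le[OF K z] by (intro order_trans[OF norm_sum sum_mono]) auto
   also have "... = 1 * mix 1 (1/2) N K (%n k. norm (z n k))"
    unfolding mix_def using lpn_nonneg[OF K] by (subst lpn_one[OF N]) auto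
   also have "... <= C' * mix 1 (1/2) N K (%n k. norm (z n k))" using C' mix_nonneg[OF N] by (intro mult_right_mono) auto
   finally show ?thesis .
  qed
  define w where "w = sgn (SUM n:N. SUM k:K. x n k)"
  have w: "norm w <= 1" by (simp add: w_def norm_sgn)
  have iw: "(SUM n:N. inner (SUM k:K. z n k) w) <= norm (SUM n:N. SUM k:K. z n k)" for z :: "int => 'k => 'h"
  proof -
   have "inner (SUM n:N. SUM k:K. z n k) w <= norm (SUM n:N. SUM k:K. z n k) * norm w" by (rule norm_cauchy_schwarz)
   also have "... <= norm (SUM n:N. SUM k:K. z n k)" using w by (intro mult_left_le) auto
   finally show ?thesis by (simp only: inner_sum_left)
  qed
  have "\<bar>SUM n:N. inner (SUM k:K. x n k) w\<bar> <= C' * mix (1 - theta * alpha) (1 - (theta * rho + (1 - theta) / 2)) N K (%n k. norm (x n k))"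
  proof (rule family_interpolation[OF N K, where P = "%z. orth_family N K z & dispersive A d N K z z"])
   show "orth_family N K (%n k. g n k *\<^sub>R z n k) & dispersive A d N K (%n k. g n k *\<^sub>R z n k) (%n k. g n k *\<^sub>R z n k)"
    if "orth_family N K z & dispersive A d N K z z" for z :: "int => 'k => 'h" and g
    using that orth_family_scale dispersive_scale_left dispersive_scale_right by blast
   show "(SUM n:N. inner (SUM k:K. z n k) w) <= C' * mix (1 - alpha) (1 - rho) N K (%n k. norm (z n k))"
    if "orth_family N K z & dispersive A d N K z z" for z :: "int => 'k => 'h"
    using order_trans[OF iw one] that by blast
   show "(SUM n:N. inner (SUM k:K. z n k) w) <= C' * mix 1 (1/2) N K (%n k. norm (z n k))"
    if "orth_family N K z & dispersive A d N K z z" for z :: "int => 'k => 'h"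
    using order_trans[OF iw zero] that by blast
  qed (use e' theta C' x in auto)
  moreover have "(SUM n:N. inner (SUM k:K. x n k) w) = norm (SUM n:N. SUM k:K. x n k)"
  proof -
   define s where "s = (SUM n:N. SUM k:K. x n k)"
   have "inner s (sgn s) = norm s"
    by (cases "s = 0") (simp_all add: sgn_div_norm power2_norm_eq_inner[symmetric] power2_eq_square)
   then show ?thesis unfolding w_def s_def[symmetric] inner_sum_left[symmetric] .
  qed
  ultimately show ?thesis by simp
 qed
 then show ?thesis using C' by blast
qed

text \<open>One variable is interpolated at a time. At the l1(l2) end of one variable the other
  enters only through sums over later or earlier times, and \<open>norm_estimate\<close> bounds
  these uniformly. \<open>D\<close> is arbitrary because equal-time terms are summed with absolute
  values.\<close>

theorem bilinear_estimate:
 assumes A: "0 < A" and e: "diagonal_exponents d alpha rho" and theta: "0 <= theta" "theta <= 1" and theta': "0 <= theta'" "theta' <= 1"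
 shows "\<exists>C\<ge>0. ALL N K D (x :: int => 'k => 'h::real_inner) y. finite N --> finite K --> orth_family N K x --> orth_family N K y -->
  dispersive A d N K x x --> dispersive A d N K y y --> dispersive A d N K x y -->
  \<bar>SUM n:N. SUM m:{m\<in>N. m < n \<or> (m = n & n : D)}. inner (SUM k:K. x n k) (SUM k:K. y m k)\<bar>
   <= C * mix (1 - theta * alpha) (1 - (theta * rho + (1 - theta) / 2)) N K (%n k. norm (x n k))
    * mix (1 - theta' * alpha) (1 - (theta' * rho + (1 - theta') / 2)) N K (%n k. norm (y n k))"
proof -
 have e': "0 <= alpha" "alpha <= 1/2" "0 <= rho" "rho <= 1/2" using e by (auto simp: diagonal_exponents_def)
 have le: "0 <= t * alpha" "t * alpha <= 1/2" "0 <= t * rho + (1 - t) / 2" "t * rho + (1 - t) / 2 <= 1/2" if "0 <= t" "t <= 1" for t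
 proof -
  show "0 <= t * alpha" "0 <= t * rho + (1 - t) / 2" using that e' by auto
  show "t * alpha <= 1/2" using mult_left_le_one_le[of alpha t] that e' by linarith
  have "t * rho <= t * (1/2)" using that e' by (intro mult_left_mono) auto
  then show "t * rho + (1 - t) / 2 <= 1/2" by (simp add: field_simps)
 qed
 obtain C1 where C1: "0 <= C1" "!!N K (x :: int => 'k => 'h::real_inner) y. finite N ==> finite K ==> orth_family N K x ==> orth_family N K y ==>
  dispersive A d N K x x ==> dispersive A d N K y y ==> dispersive A d N K x y ==>
  \<bar>strict_form N K x y\<bar> <= C1 * mix (1 - alpha) (1 - rho) N K (%n k. norm (x n k)) * mix (1 - alpha) (1 - rho) N K (%n k. norm (y n k))"
  using diagonal_estimate[OF A e] by blast
 obtain C2 where C2: "0 <= C2" "!!N K (x :: int => 'k => 'h::real_inner). finite N ==> finite K ==> orth_family N K x ==> dispersive A d N K x x ==>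
  norm (SUM n:N. SUM k:K. x n k) <= C2 * mix (1 - 1 * alpha) (1 - (1 * rho + (1 - 1) / 2)) N K (%n k. norm (x n k))"
  using norm_estimate[OF A e, of 1] by auto
 obtain C3 where C3: "0 <= C3" "!!N K (x :: int => 'k => 'h::real_inner). finite N ==> finite K ==> orth_family N K x ==> dispersive A d N K x x ==>
  norm (SUM n:N. SUM k:K. x n k) <= C3 * mix (1 - theta' * alpha) (1 - (theta' * rho + (1 - theta') / 2)) N K (%n k. norm (x n k))"
  using norm_estimate[OF A e theta'] by blast
 define C where "C = C1 + C2 + C3"
 have C: "0 <= C" "C1 <= C" "C2 <= C" "C3 <= C" using C1 C2 C3 by (auto simp: C_def)
 have "\<bar>SUM n:N. SUM m:{m\<in>N. m < n \<or> (m = n & n : D)}. inner (SUM k:K. x n k) (SUM k:K. y m k)\<bar>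
   <= (C + 1) * mix (1 - theta * alpha) (1 - (theta * rho + (1 - theta) / 2)) N K (%n k. norm (x n k))
    * mix (1 - theta' * alpha) (1 - (theta' * rho + (1 - theta') / 2)) N K (%n k. norm (y n k))"
  if N: "finite N" and K: "finite K" and ox: "orth_family N K x" and oy: "orth_family N K y"
   and xx: "dispersive A d N K x x" and yy: "dispersive A d N K y y" and xy: "dispersive A d N K x y"
  for N K D and x y :: "int => 'k => 'h"
 proof -
  define My where "My = mix (1 - theta' * alpha) (1 - (theta' * rho + (1 - theta') / 2)) N K (%n k. norm (y n k))"
  have My: "0 <= My" by (simp add: My_def mix_nonneg N)
  define P where "P z \<longleftrightarrow> orth_family N K z & dispersive A d N K z z & dispersive A d N K z y" for z :: "int => 'k => 'h"
  have Ps: "P (%n k. g n k *\<^sub>R z n k)" if "P z" for z g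
   using that unfolding P_def using orth_family_scale dispersive_scale_left dispersive_scale_right by blast
  have sf: "strict_form N K z w = (SUM n:N. inner (SUM k:K. z n k) (SUM m:{m\<in>N. m < n}. SUM k:K. w m k))" for z w :: "int => 'k => 'h"
   unfolding strict_form_def by (simp only: inner_sum_right)
  have sf': "strict_form N K z w = (SUM m:N. inner (SUM k:K. w m k) (SUM n:{n\<in>N. m < n}. SUM k:K. z n k))" for z w :: "int => 'k => 'h"
  proof -
   have "strict_form N K z w = (SUM m:N. SUM n:{n\<in>N. m < n}. inner (SUM k:K. z n k) (SUM k:K. w m k))"
    unfolding strict_form_def by (rule sum.swap_restrict[OF N N])
   also have "... = (SUM m:N. SUM n:{n\<in>N. m < n}. inner (SUM k:K. w m k) (SUM k:K. z n k))"
    by (intro sum.cong refl inner_commute)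
   finally show ?thesis by (simp only: inner_sum_right)
  qed
  have low: "(SUM n:N. inner (SUM k:K. z n k) (V n)) <= B * mix 1 (1/2) N K (%n k. norm (z n k))"
   if z: "orth_family N K z" and V: "!!n. n : N ==> norm (V n) <= B" for z :: "int => 'k => 'h" and V B
  proof -
   have "(SUM n:N. inner (SUM k:K. z n k) (V n)) <= (SUM n:N. lpn (1/2) K (%k. norm (z n k)) * B)"
    using V norm_block_le[OF K z] lpn_nonneg[OF K]
    by (intro sum_mono order_trans[OF norm_cauchy_schwarz] mult_mono) auto
   also have "... = B * mix 1 (1/2) N K (%n k. norm (z n k))"
    unfolding mix_def sum_distrib_right[symmetric] using lpn_nonneg[OF K] by (subst lpn_one[OF N]) auto
   finally show ?thesis .
  qed
  \<comment> \<open>Moves \<open>y\<close> along its segment while \<open>z\<close> stays at the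
    common pair; the other end is controlled by \<open>C2\<close>.\<close>
  have step1: "\<bar>strict_form N K z y\<bar> <= C * mix (1 - alpha) (1 - rho) N K (%n k. norm (z n k)) * My" if z: "P z" for z
  proof -
   let ?M = "mix (1 - alpha) (1 - rho) N K (%n k. norm (z n k))"
   have M: "0 <= ?M" by (simp add: mix_nonneg N)
   have oz: "orth_family N K z" "dispersive A d N K z z" "dispersive A d N K z y" using z by (auto simp: P_def)
   show ?thesis unfolding sf' My_def
   proof (rule family_interpolation[OF N K e'(1) _ e'(3) _ theta', where
      P = "%w. orth_family N K w & dispersive A d N K w w & dispersive A d N K z w"])
    show "orth_family N K (%n k. g n k *\<^sub>R w n k) & dispersive A d N K (%n k. g n k *\<^sub>R w n k) (%n k. g n k *\<^sub>R w n k) &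
      dispersive A d N K z (%n k. g n k *\<^sub>R w n k)"
     if "orth_family N K w & dispersive A d N K w w & dispersive A d N K z w" for w :: "int => 'k => 'h" and g
     using that orth_family_scale dispersive_scale_left dispersive_scale_right by blast
    fix w :: "int => 'k => 'h" assume w: "orth_family N K w & dispersive A d N K w w & dispersive A d N K z w"
    have "\<bar>strict_form N K z w\<bar> <= C1 * ?M * mix (1 - alpha) (1 - rho) N K (%n k. norm (w n k))"
     using w oz by (intro C1 N K) auto
    also have "... <= C * ?M * mix (1 - alpha) (1 - rho) N K (%n k. norm (w n k))"
     using C M by (intro mult_right_mono mix_nonneg N) auto
    finally show "(SUM m:N. inner (SUM k:K. w m k) (SUM n:{n\<in>N. m < n}. SUM k:K. z n k)) <= C * ?M * mix (1 - alpha) (1 - rho) N K (%n k. norm (w n k))"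
     unfolding sf' by linarith
    show "(SUM m:N. inner (SUM k:K. w m k) (SUM n:{n\<in>N. m < n}. SUM k:K. z n k)) <= C * ?M * mix 1 (1/2) N K (%n k. norm (w n k))"
    proof (rule low)
     fix m
     have sub: "{n\<in>N. m < n} <= N" by auto
     have "norm (SUM n:{n\<in>N. m < n}. SUM k:K. z n k) <= C2 * mix (1 - 1 * alpha) (1 - (1 * rho + (1 - 1) / 2)) {n\<in>N. m < n} K (%n k. norm (z n k))"
      using oz N K orth_family_subset[OF _ sub] dispersive_subset[OF _ sub] by (intro C2) auto
     also have "... <= C2 * ?M" using C2 e' mix_subset[OF N K sub] by (intro mult_left_mono) auto
     also have "... <= C * ?M" using C M by (intro mult_right_mono) auto
     finally show "norm (SUM n:{n\<in>N. m < n}. SUM k:K. z n k) <= C * ?M" .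
    qed (use w in auto)
   qed (use e' C M oy yy oz in auto)
  qed
  \<comment> \<open>Now \<open>y\<close> has its final exponents and \<open>x\<close> moves; the
    other end is controlled by \<open>C3\<close>, which belongs to those exponents of
    \<open>y\<close>.\<close>
  have step2: "\<bar>strict_form N K x y\<bar> <= C * My * mix (1 - theta * alpha) (1 - (theta * rho + (1 - theta) / 2)) N K (%n k. norm (x n k))"
   unfolding sf
  proof (rule family_interpolation[OF N K e'(1) _ e'(3) _ theta, where P = P])
   show "P (%n k. g n k *\<^sub>R z n k)" if "P z" for z g using Ps[OF that] .
   fix z assume z: "P z"
   show "(SUM n:N. inner (SUM k:K. z n k) (SUM m:{m\<in>N. m < n}. SUM k:K. y m k)) <= C * My * mix (1 - alpha) (1 - rho) N K (%n k. norm (z n k))"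
    using step1[OF z] unfolding sf by (simp only: ac_simps abs_le_iff)
   show "(SUM n:N. inner (SUM k:K. z n k) (SUM m:{m\<in>N. m < n}. SUM k:K. y m k)) <= C * My * mix 1 (1/2) N K (%n k. norm (z n k))"
   proof (rule low)
    fix n
    have sub: "{m\<in>N. m < n} <= N" by auto
    have "norm (SUM m:{m\<in>N. m < n}. SUM k:K. y m k) <= C3 * mix (1 - theta' * alpha) (1 - (theta' * rho + (1 - theta') / 2)) {m\<in>N. m < n} K (%n k. norm (y n k))"
     using oy yy N K orth_family_subset[OF _ sub] dispersive_subset[OF _ sub] by (intro C3) auto
    also have "... <= C3 * My" unfolding My_def using C3 le(2)[OF theta'] mix_subset[OF N K sub] by (intro mult_left_mono) auto
    also have "... <= C * My" using C My by (intro mult_right_mono) auto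
    finally show "norm (SUM m:{m\<in>N. m < n}. SUM k:K. y m k) <= C * My" .
   qed (use z in \<open>auto simp: P_def\<close>)
  qed (use e' C My ox xx xy in \<open>auto simp: P_def\<close>)
  define Mx where "Mx = mix (1 - theta * alpha) (1 - (theta * rho + (1 - theta) / 2)) N K (%n k. norm (x n k))"
  have "(SUM n:N. SUM m:{m\<in>N. m < n \<or> (m = n & n : D)}. inner (SUM k:K. x n k) (SUM k:K. y m k))
    = (SUM n:N. (SUM m:{m\<in>N. m < n}. inner (SUM k:K. x n k) (SUM k:K. y m k)) + (if n : D then inner (SUM k:K. x n k) (SUM k:K. y n k) else 0))"
  proof (rule sum.cong[OF refl])
   fix n assume n: "n : N"
   have "{m\<in>N. m < n \<or> (m = n & n : D)} = (if n : D then insert n {m\<in>N. m < n} else {m\<in>N. m < n})" using n by auto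
   then show "(SUM m:{m\<in>N. m < n \<or> (m = n & n : D)}. inner (SUM k:K. x n k) (SUM k:K. y m k))
     = (SUM m:{m\<in>N. m < n}. inner (SUM k:K. x n k) (SUM k:K. y m k)) + (if n : D then inner (SUM k:K. x n k) (SUM k:K. y n k) else 0)"
    using N by simp
  qed
  also have "... = strict_form N K x y + (SUM n:{n\<in>N. n : D}. inner (SUM k:K. x n k) (SUM k:K. y n k))"
   unfolding sum.distrib strict_form_def[symmetric] using N by (simp only: sum.inter_filter)
  finally have "\<bar>SUM n:N. SUM m:{m\<in>N. m < n \<or> (m = n & n : D)}. inner (SUM k:K. x n k) (SUM k:K. y m k)\<bar>
    <= \<bar>strict_form N K x y\<bar> + (SUM n:{n\<in>N. n : D}. \<bar>inner (SUM k:K. x n k) (SUM k:K. y n k)\<bar>)"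
   using sum_abs[of "%n. inner (SUM k:K. x n k) (SUM k:K. y n k)" "{n\<in>N. n : D}"] by linarith
  also have "... <= C * My * Mx + Mx * My"
   unfolding My_def Mx_def using step2[unfolded My_def] le[OF theta] le[OF theta']
   by (intro add_mono diagonal_sum_le K N ox oy) auto
  also have "... = (C + 1) * Mx * My" by (simp add: algebra_simps)
  finally show ?thesis by (simp only: Mx_def My_def)
 qed
 then show ?thesis using C(1) by (intro exI[of _ "C + 1"]) auto
qed

section \<open>Gaussian integrals and the oscillatory kernel\<close>

lemma cis_borel [measurable]: "cis : borel_measurable borel"
 unfolding cis_conv_exp by (intro borel_measurable_continuous_onI continuous_intros)

lemma cnj_borel [measurable]: "cnj : borel_measurable borel"
 by (intro borel_measurable_continuous_onI continuous_intros)

text \<open>The characteristic function of the standard normal law, with the variable rescaled by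
  \<open>c\<close>.\<close>

lemma gaussian_1d:
 fixes s eps :: real
 assumes e: "0 < eps"
 shows "integrable lborel (%x::real. complex_of_real (exp (- eps * x^2)) * cis (s * x))"
  and "(CLINT x|lborel. complex_of_real (exp (- eps * x^2)) * cis (s * x)) = complex_of_real (sqrt (pi / eps) * exp (- s\<^sup>2 / (4 * eps)))"
proof -
 let ?f = "%x::real. complex_of_real (exp (- eps * x^2)) * cis (s * x)"
 define c where "c = 1 / sqrt (2 * eps)"
 have c: "c > 0" "c ~= 0" "eps * c^2 = 1 / 2" using e by (auto simp: c_def power_divide)
 have fc: "?f (0 + c * x) = complex_of_real (sqrt (2 * pi)) * (std_normal_density x *\<^sub>R iexp ((s * c) * x))" for x
 proof -
  have "- eps * (c * x)^2 = - (x^2 / 2)" using c(3) by (simp add: power_mult_distrib mult.assoc[symmetric])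
  then show ?thesis
   by (simp add: std_normal_density_def cis_conv_exp scaleR_conv_of_real mult.assoc mult.left_commute of_real_mult[symmetric] del: of_real_mult)
 qed
 have i: "integrable lborel (%x. std_normal_density x *\<^sub>R iexp ((s * c) * x))"
 proof (rule Bochner_Integration.integrable_bound[OF integrable_normal_density[of 1 0]])
  show "AE x in lborel. norm (std_normal_density x *\<^sub>R iexp ((s * c) * x)) <= norm (std_normal_density x)"
   by (simp add: norm_exp_i_times)
 qed measurable
 then have ic: "integrable lborel (%x. ?f (0 + c * x))" unfolding fc by (intro integrable_mult_right)
 have "integrable lborel (%x. ?f (0 + c * (- 0 / c + (1 / c) * x)))"
  using lborel_integrable_real_affine[OF ic, of "1 / c" "- 0 / c"] c by simp
 then show "integrable lborel ?f" using c by simp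
 have "(CLINT x|lborel. ?f x) = \<bar>c\<bar> *\<^sub>R (CLINT x|lborel. ?f (0 + c * x))" by (rule lborel_integral_real_affine[OF c(2)])
 also have "(CLINT x|lborel. ?f (0 + c * x)) = complex_of_real (sqrt (2 * pi)) * (CLINT x|lborel. std_normal_density x *\<^sub>R iexp ((s * c) * x))"
  unfolding fc by (rule integral_mult_right_zero)
 also have "(CLINT x|lborel. std_normal_density x *\<^sub>R iexp ((s * c) * x)) = char std_normal_distribution (s * c)"
  unfolding char_def by (subst integral_density) auto
 also have "... = complex_of_real (exp (- ((s * c)^2) / 2))" by (simp only: char_std_normal_distribution)
 finally have *: "(CLINT x|lborel. ?f x) = complex_of_real (c * sqrt (2 * pi) * exp (- ((s * c)^2) / 2))"
  using c by (simp add: scaleR_conv_of_real mult.assoc)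
 have "c * sqrt (2 * pi) = sqrt (pi / eps)"
  using e by (simp add: c_def real_sqrt_divide real_sqrt_mult)
 moreover have "- ((s * c)^2) / 2 = - s\<^sup>2 / (4 * eps)" using e by (simp add: c_def power_mult_distrib power_divide)
 ultimately show "(CLINT x|lborel. ?f x) = complex_of_real (sqrt (pi / eps) * exp (- s\<^sup>2 / (4 * eps)))"
  unfolding * by simp
qed

lemma cis_sum: "finite I ==> cis (SUM i:I. f i) = (\<Prod>i\<in>I. cis (f i))"
 by (induction I rule: finite_induct) (auto simp: cis_mult[symmetric])

lemma gaussian_nd:
 fixes w :: "'a::euclidean_space" and eps :: real
 assumes e: "0 < eps"
 shows "integrable lborel (%x::'a. complex_of_real (exp (- eps * (norm x)^2)) * cis (x \<bullet> w))"
  and "(CLINT x|lborel. complex_of_real (exp (- eps * (norm (x::'a))^2)) * cis (x \<bullet> w))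
   = complex_of_real ((pi / eps) powr (DIM('a) / 2) * exp (- (norm w)\<^sup>2 / (4 * eps)))"
proof -
 interpret product_sigma_finite "%_::'a. lborel :: real measure" by standard
 let ?f = "%x::'a. complex_of_real (exp (- eps * (norm x)^2)) * cis (x \<bullet> w)"
 let ?T = "%f::'a => real. SUM b:Basis. f b *\<^sub>R b"
 have T: "?T : measurable (\<Pi>\<^sub>M b\<in>Basis. lborel) borel" by measurable
 have fm: "?f : borel_measurable borel" by measurable
 have coord: "?T f \<bullet> b = f b" if "b : Basis" for f b using that by simp
 have n2: "(norm x)^2 = (SUM b:Basis. (x \<bullet> b)^2)" for x :: 'a
  unfolding power2_norm_eq_inner euclidean_inner[of x x] by (simp add: power2_eq_square)
 have fT: "?f (?T f) = (\<Prod>b\<in>Basis. complex_of_real (exp (- eps * (f b)^2)) * cis ((w \<bullet> b) * f b))" for f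
 proof -
  have "exp (- eps * (norm (?T f))^2) = (\<Prod>b\<in>Basis. exp (- eps * (f b)^2))"
   unfolding n2 sum_distrib_left exp_sum[OF finite_Basis, symmetric] by (simp add: coord)
  moreover have "?T f \<bullet> w = (SUM b:Basis. (w \<bullet> b) * f b)"
   by (simp add: inner_sum_left inner_commute[of w] mult.commute)
  ultimately show ?thesis by (simp add: cis_sum prod.distrib)
 qed
 have "integrable (\<Pi>\<^sub>M b\<in>Basis. lborel) (%f. ?f (?T f))"
  unfolding fT by (intro product_integrable_prod gaussian_1d e) simp
 then show "integrable lborel ?f"
  by (subst lborel_eq) (simp only: integrable_distr_eq[OF T fm])
 have "(CLINT x|lborel. ?f x) = (CLINT f|(\<Pi>\<^sub>M b\<in>Basis. lborel). ?f (?T f))"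
  by (subst lborel_eq) (rule integral_distr[OF T fm])
 also have "... = (\<Prod>b\<in>Basis. CLINT x|lborel. complex_of_real (exp (- eps * x^2)) * cis ((w \<bullet> b) * x))"
  unfolding fT by (intro product_integral_prod gaussian_1d e) simp
 also have "... = (\<Prod>b\<in>(Basis::'a set). complex_of_real (sqrt (pi / eps) * exp (- (w \<bullet> b)\<^sup>2 / (4 * eps))))"
  by (simp only: gaussian_1d(2)[OF e])
 also have "... = complex_of_real ((\<Prod>b\<in>(Basis::'a set). sqrt (pi / eps)) * (\<Prod>b\<in>Basis. exp (- (w \<bullet> b)\<^sup>2 / (4 * eps))))"
  by (simp only: of_real_prod prod.distrib[symmetric])
 also have "(\<Prod>b\<in>Basis. exp (- (w \<bullet> b)\<^sup>2 / (4 * eps))) = exp (- (norm w)\<^sup>2 / (4 * eps))"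
  unfolding n2 exp_sum[OF finite_Basis, symmetric] by (simp add: sum_negf sum_divide_distrib)
 also have "(\<Prod>b\<in>(Basis::'a set). sqrt (pi / eps)) = (pi / eps) powr (DIM('a) / 2)"
  using e by (simp add: powr_half_sqrt[symmetric] powr_powr powr_realpow[symmetric])
 finally show "(CLINT x|lborel. ?f x) = complex_of_real ((pi / eps) powr (DIM('a) / 2) * exp (- (norm w)\<^sup>2 / (4 * eps)))" .
qed

lemma gaussian_real:
 fixes eps :: real
 assumes e: "0 < eps"
 shows "integrable lborel (%x::'a::euclidean_space. exp (- eps * (norm x)^2))"
  and "(LINT x|lborel. exp (- eps * (norm (x::'a))^2)) = (pi / eps) powr (DIM('a) / 2)"
proof -
 have i: "integrable lborel (%x::'a. complex_of_real (exp (- eps * (norm x)^2)))"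
  using gaussian_nd(1)[OF e, of "0::'a"] by simp
 then show "integrable lborel (%x::'a. exp (- eps * (norm x)^2))"
  unfolding complex_of_real_integrable_eq .
 have "complex_of_real (LINT x|lborel. exp (- eps * (norm (x::'a))^2)) = complex_of_real ((pi / eps) powr (DIM('a) / 2))"
  using gaussian_nd(2)[OF e, of "0::'a"] by (simp only: integral_complex_of_real[symmetric] inner_zero_right cis_zero) simp
 then show "(LINT x|lborel. exp (- eps * (norm (x::'a))^2)) = (pi / eps) powr (DIM('a) / 2)"
  by (simp only: of_real_eq_iff)
qed

lemma lborel_translate:
 fixes g :: "'a::euclidean_space => 'b::{banach, second_countable_topology}"
 assumes [measurable]: "g : borel_measurable borel"
 shows "integrable lborel (%u. g (c + u)) \<longleftrightarrow> integrable lborel g" "(LINT u|lborel. g (c + u)) = (LINT u|lborel. g u)"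
proof -
 have m: "(+) c : measurable lborel borel" by measurable
 show "integrable lborel (%u. g (c + u)) \<longleftrightarrow> integrable lborel g"
  using integrable_distr_eq[OF m assms] by (simp add: lborel_distr_plus)
 show "(LINT u|lborel. g (c + u)) = (LINT u|lborel. g u)"
  using integral_distr[OF m assms] by (simp add: lborel_distr_plus)
qed

lemma integrable_product_bound:
 fixes f :: "'a::euclidean_space \<times> 'b::euclidean_space => complex"
 assumes a: "integrable lborel a" and b: "integrable lborel b" and f: "f : borel_measurable (lborel \<Otimes>\<^sub>M lborel)"
  and bd: "!!x y. cmod (f (x, y)) <= a x * b y"
 shows "integrable (lborel \<Otimes>\<^sub>M lborel) f"
proof (rule Bochner_Integration.integrable_bound)
 have [measurable]: "a : borel_measurable lborel" "b : borel_measurable lborel" using a b by auto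
 show "integrable (lborel \<Otimes>\<^sub>M lborel) (%p. a (fst p) * b (snd p))"
 proof (rule lborel_pair.Fubini_integrable)
  show "integrable lborel (%x. LINT y|lborel. norm (a (fst (x, y)) * b (snd (x, y))))"
   using a by (simp add: abs_mult)
  show "AE x in lborel. integrable lborel (%y. a (fst (x, y)) * b (snd (x, y)))"
   using b by simp
 qed measurable
 have "cmod (f p) <= norm (a (fst p) * b (snd p))" for p
  using bd[of "fst p" "snd p"] by simp
 then show "AE p in lborel \<Otimes>\<^sub>M lborel. norm (f p) <= norm (a (fst p) * b (snd p))" by simp
qed (rule f)

text \<open>The complex Gaussian is never evaluated. The squared modulus of the integral is a double
  integral over a point \<open>eta\<close> and a difference \<open>u\<close>, where the quadratic
  phase becomes linear about the midpoint; the inner integral is then a real Gaussian with linear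
  phase. The bound is uniform in \<open>eps\<close>.\<close>

lemma oscillatory_gaussian_bound:
 fixes y :: "'a::euclidean_space" and eps tau :: real
 assumes e: "0 < eps" and t: "tau ~= 0"
 shows "cmod (CLINT x|lborel. complex_of_real (exp (- eps * (norm x)^2)) * cis (y \<bullet> x - tau * (norm x)^2)) <= (pi / \<bar>tau\<bar>) powr (DIM('a) / 2)"
proof -
 define g where "g x = complex_of_real (exp (- eps * (norm x)^2)) * cis (y \<bullet> x - tau * (norm x)^2)" for x :: 'a
 have [measurable]: "g : borel_measurable borel" unfolding g_def by measurable
 have ng: "cmod (g x) = exp (- eps * (norm x)^2)" for x by (simp add: g_def norm_mult)
 have gi: "integrable lborel g"
  by (rule Bochner_Integration.integrable_bound[OF gaussian_real(1)[OF e]]) (auto simp: ng)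
 define J where "J = (CLINT x|lborel. g x)"
 define d where "d = real DIM('a)"
 define K where "K = (pi / (2 * eps)) powr (d / 2)"
 \<comment> \<open>The total decay rate in \<open>u\<close>: \<open>eps / 2\<close> from the
   amplitudes, the rest from the inner integral. Since
   \<open>2 * eps * \<beta> = eps^2 + tau^2\<close>, the regularization only improves the
   bound.\<close>
 define \<beta> where "\<beta> = eps / 2 + tau^2 / (2 * eps)"
 have \<beta>: "0 < \<beta>" using e by (auto simp: \<beta>_def intro: add_pos_nonneg)
 define P where "P u = complex_of_real (exp (- eps * (norm u)^2 / 2)) * cis (y \<bullet> u)" for u :: 'a
 define G where "G u = (%z::'a. complex_of_real (exp (- (2 * eps) * (norm z)^2)) * cis (z \<bullet> ((- 2 * tau) *\<^sub>R u)))" for u :: 'a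
 have Gm[measurable]: "G u : borel_measurable borel" for u unfolding G_def by measurable
 \<comment> \<open>The squared norms of \<open>eta + u\<close> and \<open>eta\<close> differ by 2u
   paired with their midpoint, and add up to twice the squared midpoint plus half the square of
   \<open>u\<close>.\<close>
 have prod: "g (eta + u) * cnj (g eta) = P u * G u ((1/2) *\<^sub>R u + eta)" for eta u
 proof -
  have 1: "(norm (eta + u))^2 = (norm eta)^2 + 2 * (eta \<bullet> u) + (norm u)^2"
   by (simp add: power2_norm_eq_inner inner_add_left inner_add_right inner_commute)
  have 2: "(norm ((1/2) *\<^sub>R u + eta))^2 = (norm eta)^2 + eta \<bullet> u + (norm u)^2 / 4"
   by (simp add: power2_norm_eq_inner inner_add_left inner_add_right inner_commute)
  have 3: "((1/2) *\<^sub>R u + eta) \<bullet> ((- 2 * tau) *\<^sub>R u) = - tau * (norm u)^2 - 2 * tau * (eta \<bullet> u)"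
   by (simp add: power2_norm_eq_inner inner_add_left inner_commute algebra_simps)
  have a: "exp (- eps * (norm (eta + u))^2) * exp (- eps * (norm eta)^2)
    = exp (- eps * (norm u)^2 / 2) * exp (- (2 * eps) * (norm ((1/2) *\<^sub>R u + eta))^2)"
   unfolding exp_add[symmetric] 1 2 by (simp add: algebra_simps)
  have b: "cis (y \<bullet> (eta + u) - tau * (norm (eta + u))^2) * cis (- (y \<bullet> eta - tau * (norm eta)^2))
    = cis (y \<bullet> u) * cis (((1/2) *\<^sub>R u + eta) \<bullet> ((- 2 * tau) *\<^sub>R u))"
   unfolding cis_mult 1 3 by (simp add: inner_add_right algebra_simps)
  have "g (eta + u) * cnj (g eta) = complex_of_real (exp (- eps * (norm (eta + u))^2) * exp (- eps * (norm eta)^2))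
    * (cis (y \<bullet> (eta + u) - tau * (norm (eta + u))^2) * cis (- (y \<bullet> eta - tau * (norm eta)^2)))"
   by (simp only: g_def complex_cnj_mult complex_cnj_complex_of_real cis_cnj of_real_mult ac_simps)
  then show ?thesis unfolding a b by (simp only: P_def G_def of_real_mult ac_simps)
 qed
 have Gint: "(CLINT z|lborel. G u z) = complex_of_real (K * exp (- tau\<^sup>2 * (norm u)^2 / (2 * eps)))" for u
 proof -
  have "(CLINT z|lborel. G u z) = complex_of_real ((pi / (2 * eps)) powr (DIM('a) / 2) * exp (- (norm ((- 2 * tau) *\<^sub>R u))\<^sup>2 / (4 * (2 * eps))))"
   unfolding G_def using e by (intro gaussian_nd(2)) auto
  moreover have "- (norm ((- 2 * tau) *\<^sub>R u))\<^sup>2 / (4 * (2 * eps)) = - tau\<^sup>2 * (norm u)^2 / (2 * eps)"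
   using e by (simp add: power_mult_distrib field_simps)
  ultimately show ?thesis by (simp only: K_def d_def)
 qed
 have I: "integrable (lborel \<Otimes>\<^sub>M lborel) (%(eta, u). g (eta + u) * cnj (g eta))"
 proof (rule lborel_pair.Fubini_integrable)
  show "(%(eta, u). g (eta + u) * cnj (g eta)) : borel_measurable (lborel \<Otimes>\<^sub>M lborel)" by measurable
  have "(LINT u|lborel. norm (case (eta, u) of (eta, u) => g (eta + u) * cnj (g eta))) = (LINT u|lborel. cmod (g u)) * cmod (g eta)" for eta
   using lborel_translate(2)[of "%u. cmod (g u)" eta] by (simp add: norm_mult)
  then show "integrable lborel (%eta. LINT u|lborel. norm (case (eta, u) of (eta, u) => g (eta + u) * cnj (g eta)))"
   using gi by (simp add: integrable_norm)
  show "AE eta in lborel. integrable lborel (%u. case (eta, u) of (eta, u) => g (eta + u) * cnj (g eta))"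
   using gi by (simp add: lborel_translate)
 qed
 have "complex_of_real ((cmod J)^2) = J * cnj J" by (rule complex_norm_square)
 also have "... = (CLINT eta|lborel. J * cnj (g eta))" unfolding J_def by simp
 also have "... = (CLINT eta|lborel. CLINT u|lborel. g (eta + u) * cnj (g eta))"
  unfolding J_def by (intro Bochner_Integration.integral_cong refl) (simp add: lborel_translate(2))
 also have "... = (CLINT u|lborel. CLINT eta|lborel. g (eta + u) * cnj (g eta))"
  by (rule lborel_pair.Fubini_integral[symmetric]) (rule I)
 also have "... = (CLINT u|lborel. P u * complex_of_real (K * exp (- tau\<^sup>2 * (norm u)^2 / (2 * eps))))"
  unfolding prod by (simp add: lborel_translate(2)[OF Gm] Gint)
 finally have "(cmod J)^2 = cmod (CLINT u|lborel. P u * complex_of_real (K * exp (- tau\<^sup>2 * (norm u)^2 / (2 * eps))))"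
  by (metis norm_of_real abs_of_nonneg zero_le_power2)
 also have "... <= (LINT u|lborel. K * exp (- \<beta> * (norm (u::'a))^2))"
 proof (rule integral_norm_bound[THEN order_trans], rule eq_refl, rule Bochner_Integration.integral_cong[OF refl])
  fix u :: 'a
  have "- eps * (norm u)^2 / 2 + - tau\<^sup>2 * (norm u)^2 / (2 * eps) = - \<beta> * (norm u)^2"
   by (simp add: \<beta>_def algebra_simps)
  then have "exp (- eps * (norm u)^2 / 2) * exp (- tau\<^sup>2 * (norm u)^2 / (2 * eps)) = exp (- \<beta> * (norm u)^2)"
   by (simp only: exp_add[symmetric])
  moreover have "0 <= K" by (simp add: K_def)
  ultimately show "norm (P u * complex_of_real (K * exp (- tau\<^sup>2 * (norm u)^2 / (2 * eps)))) = K * exp (- \<beta> * (norm u)^2)"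
   by (simp add: P_def norm_mult mult.left_commute)
 qed
 also have "... = K * (pi / \<beta>) powr (d / 2)"
  using gaussian_real(2)[OF \<beta>, where 'a='a] by (simp add: d_def)
 also have "... = (pi / (2 * eps) * (pi / \<beta>)) powr (d / 2)" by (simp only: K_def powr_mult)
 also have "... <= ((pi / \<bar>tau\<bar>)^2) powr (d / 2)"
 proof (rule powr_mono2)
  have "pi / (2 * eps) * (pi / \<beta>) = pi^2 / (2 * eps * \<beta>)" by (simp add: power2_eq_square)
  also have "2 * eps * \<beta> = eps^2 + tau^2" using e by (simp add: \<beta>_def field_simps power2_eq_square)
  also have "pi^2 / (eps^2 + tau^2) <= pi^2 / tau^2" using e t by (intro divide_left_mono) (auto intro!: mult_pos_pos add_nonneg_pos)
  finally show "pi / (2 * eps) * (pi / \<beta>) <= (pi / \<bar>tau\<bar>)^2" by (simp add: power_divide)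
 qed (use e \<beta> in \<open>auto simp: d_def\<close>)
 also have "... = ((pi / \<bar>tau\<bar>) powr (d / 2))^2"
  by (simp only: power2_eq_square powr_mult)
 finally have "(cmod J)^2 <= ((pi / \<bar>tau\<bar>) powr (d / 2))^2" .
 then have "cmod J <= (pi / \<bar>tau\<bar>) powr (d / 2)" by (rule power2_le_imp_le) simp
 then show ?thesis by (simp only: J_def g_def d_def)
qed

section \<open>Borel representatives and continuity of translations\<close>

text \<open>Squeeze \<open>A\<close> between a compact \<open>K\<close> and an open
  \<open>U\<close>. A shift shorter than the distance from \<open>K\<close> to the complement of
  \<open>U\<close> keeps \<open>K\<close> inside \<open>U\<close>, and what \<open>A\<close> loses
  lies in \<open>U\<close> minus the shifted \<open>K\<close>.\<close>

lemma translated_indicator_small: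
 fixes A :: "'a::euclidean_space set"
 assumes A: "A : sets lborel" "bounded A" and e: "0 < (e::real)"
 shows "EX delta>0. ALL z. norm z < delta --> measure lborel (A - {x. x + z : A}) <= e"
proof -
 have AL: "A : sets lebesgue" using A by auto
 obtain U where U: "open U" "A <= U" "(U - A) : lmeasurable" "emeasure lebesgue (U - A) < ennreal (e/2)"
  using sets_lebesgue_outer_open[OF AL, of "e/2"] e by auto
 obtain K where K: "closed K" "K <= A" "(A - K) : lmeasurable" "emeasure lebesgue (A - K) < ennreal (e/2)"
  using sets_lebesgue_inner_closed[OF AL, of "e/2"] e by auto
 have cK: "compact K" using K A bounded_subset compact_eq_bounded_closed by blast
 obtain delta where delta: "0 < delta" "!!x z. x : K ==> norm z < delta ==> x + z : U"
 proof (cases "K = {} \<or> U = UNIV")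
  case True then show ?thesis by (intro that[of 1]) auto
 next
  case False
  have "closed (- U)" "K \<inter> - U = {}" using U K by auto
  then have "0 < setdist K (- U)" using False cK setdist_gt_0_compact_closed[OF cK, of "- U"] by auto
  moreover have "x + z : U" if "x : K" "norm z < setdist K (- U)" for x z
  proof (rule ccontr)
   assume "x + z \<notin> U"
   then have "setdist K (- U) <= dist x (x + z)" using that by (intro setdist_le_dist) auto
   then show False using that by (simp add: dist_norm)
  qed
  ultimately show ?thesis by (intro that[of "setdist K (- U)"]) auto
 qed
 have fin: "emeasure lborel B < \<infinity>" if "B : sets lborel" "bounded B" for B :: "'a set"
  using that emeasure_bounded_finite by blast
 have "measure lborel (A - {x. x + z : A}) <= e" if z: "norm z < delta" for z
 proof -
  define K' where "K' = {x. x + z : K}"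
  have K'U: "K' <= U"
  proof
   fix x assume "x : K'"
   then have "(x + z) + - z : U" by (intro delta) (use z in \<open>auto simp: K'_def\<close>)
   then show "x : U" by simp
  qed
  have [measurable]: "K : sets borel" "U : sets borel" "A : sets borel" using K U A by auto
  have mK': "K' : sets borel" unfolding K'_def by measurable
  have mT: "{x. x + z : A} : sets borel" by measurable
  have eK: "emeasure lborel K' = emeasure lborel K"
  proof -
   have "emeasure lborel K = emeasure (distr lborel borel ((+) z)) K" by (simp add: lborel_distr_plus)
   also have "... = emeasure lborel K'" by (subst emeasure_distr) (auto simp: K'_def vimage_def add.commute)
   finally show ?thesis by simp
  qed
  have KA: "emeasure lborel (U - K') <= ennreal e"
  proof -
   have "emeasure lborel K < \<infinity>" using cK by (intro fin) (auto intro: compact_imp_bounded)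
   have "emeasure lborel (U - K) <= emeasure lborel (U - A) + emeasure lborel (A - K)"
    using K U by (intro order_trans[OF emeasure_mono emeasure_subadditive]) auto
   also have "... <= ennreal (e/2) + ennreal (e/2)"
    using U(4) K(4) by (intro add_mono) auto
   also have "... = ennreal e" using e by (simp add: ennreal_plus[symmetric] del: ennreal_plus)
   finally have UK: "emeasure lborel (U - K) <= ennreal e" .
   have "emeasure lborel (U - K') = emeasure lborel U - emeasure lborel K'"
    using \<open>emeasure lborel K < \<infinity>\<close> eK K'U mK' by (intro emeasure_Diff) auto
   also have "... = emeasure lborel (U - K)"
    unfolding eK using \<open>emeasure lborel K < \<infinity>\<close> K U by (intro emeasure_Diff[symmetric]) auto
   finally show ?thesis using UK by simp
  qed
  have "A - {x. x + z : A} <= U - K'" using U K by (auto simp: K'_def)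
  moreover have "U - K' : sets lborel" using mK' U by auto
  ultimately have "emeasure lborel (A - {x. x + z : A}) <= emeasure lborel (U - K')" by (rule emeasure_mono)
  from order_trans[OF this KA] show ?thesis unfolding measure_def using e by (intro enn2real_leI) auto
 qed
 then show ?thesis using delta(1) by blast
qed

text \<open>Fubini arguments need joint measurability for the product sigma-algebra, which Borel
  functions provide for expressions such as \<open>f (z + x)\<close> and Lebesgue measurable ones in
  general do not.\<close>

lemma complex_borel_rep:
 fixes f :: "'a::euclidean_space => complex"
 assumes f: "f : borel_measurable lebesgue"
 shows "EX g:borel_measurable borel. AE x in lebesgue. f x = g x"
proof -
 have "(%x. Re (f x)) : borel_measurable lebesgue" "(%x. Im (f x)) : borel_measurable lebesgue"
  using f by measurable
 from this[THEN completion_ex_borel_measurable_real]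
 obtain r i where r: "r : borel_measurable lborel" "AE x in lborel. Re (f x) = r x"
  and i: "i : borel_measurable lborel" "AE x in lborel. Im (f x) = i x" by blast
 have [measurable]: "r : borel_measurable borel" "i : borel_measurable borel" using r i by auto
 have "AE x in lborel. f x = complex_of_real (r x) + \<i> * complex_of_real (i x)"
  using r(2) i(2) by eventually_elim (simp add: complex_eq_iff)
 then have "AE x in lebesgue. f x = complex_of_real (r x) + \<i> * complex_of_real (i x)"
  by (rule AE_completion)
 moreover have "(%x. complex_of_real (r x) + \<i> * complex_of_real (i x)) : borel_measurable borel" by measurable
 ultimately show ?thesis by (rule bexI)
qed

lemma borel_lebesgue: "f : borel_measurable borel ==> f : borel_measurable lebesgue"
 by (simp add: measurable_completion)

lemma l2_borel_rep: "EX f:borel_measurable borel. f : L2 & abs_l2 f = v"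
proof -
 obtain g where g: "g : borel_measurable borel" "AE x in lebesgue. rep_l2 v x = g x"
  using complex_borel_rep[of "rep_l2 v"] by auto
 have gl: "g : borel_measurable lebesgue" using g(1) by (rule borel_lebesgue)
 have "g : L2"
  by (rule L2_bound[OF gl rep_l2_in[of v], where C = 1]) (use g(2) in \<open>auto elim: eventually_mono\<close>)
 moreover have "abs_l2 g = abs_l2 (rep_l2 v)"
  using g(2) \<open>g : L2\<close> by (subst abs_l2_eq_iff) (auto elim: eventually_mono)
 ultimately show ?thesis using g(1) by auto
qed

lemma L2_lborel:
 assumes f: "f : borel_measurable borel"
 shows "f : L2 \<longleftrightarrow> integrable lborel (%x. (cmod (f x))^2)"
proof -
 have "(%x. (cmod (f x))^2) : borel_measurable lborel" using f by measurable
 then show ?thesis using f by (simp add: L2_iff borel_lebesgue integrable_completion)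
qed

lemma norm_abs_l2_lborel:
 assumes f: "f : borel_measurable borel" "f : L2"
 shows "norm (abs_l2 f) = sqrt (LINT x|lborel. (cmod (f x))^2)"
proof -
 have "(%x. (cmod (f x))^2) : borel_measurable lborel" using f by measurable
 then show ?thesis using f by (simp add: norm_abs_l2 integral_completion)
qed

lemma L2_translate:
 fixes f :: "'a::euclidean_space => complex"
 assumes f: "f : borel_measurable borel" "f : L2"
 shows "(%x. f (z + x)) : borel_measurable borel" "(%x. f (z + x)) : L2"
  "norm (abs_l2 (%x. f (z + x))) = norm (abs_l2 f)"
proof -
 note [measurable] = f(1)
 show m: "(%x. f (z + x)) : borel_measurable borel" by measurable
 have m2: "(%x. (cmod (f x))^2) : borel_measurable borel" by measurable
 show L: "(%x. f (z + x)) : L2"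
  using f lborel_translate(1)[OF m2, of z] by (simp add: L2_lborel m)
 show "norm (abs_l2 (%x. f (z + x))) = norm (abs_l2 f)"
  using lborel_translate(2)[OF m2, of z] by (simp add: norm_abs_l2_lborel m L f)
qed

lemma indicator_translation_continuous:
 fixes A :: "'a::euclidean_space set"
 assumes A: "A : sets borel" "bounded A" and e: "0 < e"
 shows "EX delta>0. ALL z. norm z < delta --> norm (abs_l2 (%x. c * indicator A (z + x)) - abs_l2 (%x. c * indicator A x)) <= e"
proof -
 note [measurable] = A(1)
 obtain R where "ALL x:A. norm x <= R" using A(2) by (auto simp: bounded_iff)
 then have R: "A <= cball 0 R" by auto
 define e' where "e' = e^2 / (2 * ((cmod c)^2 + 1))"
 have e': "0 < e'" using e by (auto simp: e'_def intro!: divide_pos_pos mult_pos_pos add_nonneg_pos)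
 obtain delta where delta: "0 < delta" "!!z. norm z < delta ==> measure lborel (A - {x. x + z : A}) <= e'"
  using translated_indicator_small[of A e'] A e' by auto
 have iA: "(%x. c * indicator A x) : borel_measurable borel" by measurable
 have LA: "(%x. c * indicator A x) : L2" using R A by (intro L2_bounded_indicator[of A R]) auto
 have fin: "emeasure lborel B < \<infinity>" if "B <= A" for B
  using emeasure_bounded_finite[of B] bounded_subset[OF A(2) that] by auto
 have "norm (abs_l2 (%x. c * indicator A (z + x)) - abs_l2 (%x. c * indicator A x)) <= e" if z: "norm z < delta" for z
 proof -
  define B where "B = A - {x. x + z : A}"
  define D where "D = {x. z + x : A} - A"
  have Bm[measurable]: "B : sets borel" unfolding B_def by measurable
  have Dm[measurable]: "D : sets borel" unfolding D_def by measurable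
  define D' where "D' = A - {x. x + - z : A}"
  have D'm[measurable]: "D' : sets borel" unfolding D'_def by measurable
  have mB: "measure lborel B <= e'" "measure lborel D' <= e'" using delta(2)[of z] delta(2)[of "- z"] z by (auto simp: B_def D'_def)
  have ind: "(%x. indicator D' (z + x) :: real) = indicator D"
   by (auto simp: D'_def D_def indicator_def fun_eq_iff add.commute)
  have fB: "integrable lborel (indicator B :: 'a => real)" "integrable lborel (indicator D' :: 'a => real)"
   using fin[of B] fin[of D'] by (auto simp: B_def D'_def intro!: integrable_real_indicator)
  have fD: "integrable lborel (indicator D :: 'a => real)" "(LINT x|lborel. (indicator D x :: real)) <= e'"
   using lborel_translate[of "indicator D' :: 'a => real" z] fB mB unfolding ind by auto
  have "(norm (abs_l2 (%x. c * indicator A (z + x)) - abs_l2 (%x. c * indicator A x)))^2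
    = (LINT x|lborel. (cmod (c * indicator A (z + x) - c * indicator A x))^2)"
   using L2_translate[OF iA LA, of z] LA iA by (simp add: abs_l2_diff norm_abs_l2_lborel L2_diff)
  also have "... = (LINT x|lborel. (cmod c)^2 * (indicator B x + indicator D x))"
   by (intro Bochner_Integration.integral_cong refl)
    (auto simp: indicator_def B_def D_def norm_mult power_mult_distrib add.commute)
  also have "... = (cmod c)^2 * (measure lborel B + (LINT x|lborel. indicator D x))"
   using fB fD by simp
  also have "... <= (cmod c)^2 * (e' + e')" using mB fD by (intro mult_left_mono add_mono) auto
  also have "... <= ((cmod c)^2 + 1) * (2 * e')" using e' by (simp add: algebra_simps)
  also have "... = e^2"
  proof -
   have "(cmod c)^2 + 1 ~= 0" using zero_le_power2[of "cmod c"] by linarith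
   moreover have "a * (2 * (e^2 / (2 * a))) = e^2" if "a ~= 0" for a :: real using that by simp
   ultimately show ?thesis unfolding e'_def by blast
  qed
  finally have "(norm (abs_l2 (%x. c * indicator A (z + x)) - abs_l2 (%x. c * indicator A x)))^2 <= e^2" .
  then show ?thesis by (rule power2_le_imp_le) (use e in simp)
 qed
 then show ?thesis using delta(1) by blast
qed

text \<open>The statement exhibits a Borel representative because translates are formed on
  functions, not on classes. Closedness is a three-epsilon argument resting on translation
  invariance of the norm.\<close>

lemma l2_translation_continuous:
 fixes v :: "'a::euclidean_space l2"
 shows "EX f:borel_measurable borel. f : L2 & abs_l2 f = v &
  (ALL e>0. EX delta>0. ALL z. norm z < delta --> norm (abs_l2 (%x. f (z + x)) - v) <= e)" (is "?P v")
proof (induction v rule: l2_induct)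
 case closed
 show ?case unfolding closed_sequential_limits
 proof (intro allI impI, elim conjE)
  fix V and v :: "'a l2" assume V: "ALL n. V n : {v. ?P v}" "V \<longlonglongrightarrow> v"
  obtain f where f: "f : borel_measurable borel" "f : L2" "abs_l2 f = v" using l2_borel_rep by blast
  have "EX delta>0. ALL z. norm z < delta --> norm (abs_l2 (%x. f (z + x)) - v) <= e" if e: "0 < e" for e
  proof -
   obtain n where n: "norm (V n - v) < e / 3" using LIMSEQ_D[OF V(2), of "e/3"] e by auto
   obtain h where h: "h : borel_measurable borel" "h : L2" "abs_l2 h = V n"
    and hc: "ALL e>0. EX delta>0. ALL z. norm z < delta --> norm (abs_l2 (%x. h (z + x)) - V n) <= e" using V(1) by blast
   have "0 < e / 3" using e by simp
   then obtain delta where delta: "0 < delta" "!!z. norm z < delta ==> norm (abs_l2 (%x. h (z + x)) - V n) <= e / 3"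
    using hc by blast
   have "norm (abs_l2 (%x. f (z + x)) - v) <= e" if z: "norm z < delta" for z
   proof -
    have bm: "(%x. h x - f x) : borel_measurable borel" using f h by measurable
    have "norm (abs_l2 (%x. h (z + x)) - abs_l2 (%x. f (z + x))) = norm (V n - v)"
     using L2_translate(3)[OF bm, of z] L2_translate(2)[OF f(1,2), of z] L2_translate(2)[OF h(1,2), of z] f h
     by (simp add: abs_l2_diff L2_diff f(3)[symmetric] h(3)[symmetric] del: f(3) h(3))
    moreover have "norm (abs_l2 (%x. f (z + x)) - v) <= norm (abs_l2 (%x. h (z + x)) - abs_l2 (%x. f (z + x)))
      + norm (abs_l2 (%x. h (z + x)) - V n) + norm (V n - v)"
     using norm_triangle_ineq4[of "abs_l2 (%x. h (z + x)) - v" "abs_l2 (%x. h (z + x)) - abs_l2 (%x. f (z + x))"]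
      norm_triangle_ineq[of "abs_l2 (%x. h (z + x)) - V n" "V n - v"] by simp
    ultimately show ?thesis using delta(2)[OF z] n by linarith
   qed
   then show ?thesis using delta(1) by blast
  qed
  then show "v : {v. ?P v}" using f by blast
 qed
next
 case (add v w)
 obtain f where f: "f : borel_measurable borel" "f : L2" "abs_l2 f = v"
  and fc: "!!e. e > 0 ==> EX delta>0. ALL z. norm z < delta --> norm (abs_l2 (%x. f (z + x)) - v) <= e" using add(1) by blast
 obtain h where h: "h : borel_measurable borel" "h : L2" "abs_l2 h = w"
  and hc: "!!e. e > 0 ==> EX delta>0. ALL z. norm z < delta --> norm (abs_l2 (%x. h (z + x)) - w) <= e" using add(2) by blast
 have "EX delta>0. ALL z. norm z < delta --> norm (abs_l2 (%x. f (z + x) + h (z + x)) - (v + w)) <= e" if e: "0 < e" for e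
 proof -
  have e2: "0 < e / 2" using e by simp
  obtain delta1 where 1: "0 < delta1" "!!z. norm z < delta1 ==> norm (abs_l2 (%x. f (z + x)) - v) <= e / 2" using fc[OF e2] by blast
  obtain delta2 where 2: "0 < delta2" "!!z. norm z < delta2 ==> norm (abs_l2 (%x. h (z + x)) - w) <= e / 2" using hc[OF e2] by blast
  have "norm (abs_l2 (%x. f (z + x) + h (z + x)) - (v + w)) <= e" if z: "norm z < min delta1 delta2" for z
  proof -
   have eq: "abs_l2 (%x. f (z + x) + h (z + x)) - (v + w) = (abs_l2 (%x. f (z + x)) - v) + (abs_l2 (%x. h (z + x)) - w)"
    using L2_translate(2)[OF f(1,2), of z] L2_translate(2)[OF h(1,2), of z] by (simp add: abs_l2_add[symmetric])
   have "norm (abs_l2 (%x. f (z + x)) - v) <= e / 2" "norm (abs_l2 (%x. h (z + x)) - w) <= e / 2"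
    using 1(2)[of z] 2(2)[of z] z by auto
   then show ?thesis unfolding eq
    using norm_triangle_ineq[of "abs_l2 (%x. f (z + x)) - v" "abs_l2 (%x. h (z + x)) - w"] by linarith
  qed
  then show ?thesis using 1(1) 2(1) by (intro exI[of _ "min delta1 delta2"]) auto
 qed
 moreover have "(%x. f x + h x) : borel_measurable borel" using f h by measurable
 ultimately show ?case using f h by (intro bexI[of _ "%x. f x + h x"]) (auto simp: L2_add abs_l2_add[symmetric])
next
 case (indicator c A R)
 have "(indicator A :: 'a => real) : borel_measurable lebesgue" using indicator by measurable
 then obtain g where g: "g : borel_measurable lborel" "AE x in lborel. indicat_real A x = g x"
  using completion_ex_borel_measurable_real[of "indicator A" lborel] by blast
 define B where "B = {x. g x = 1} \<inter> cball 0 R"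
 have [measurable]: "g : borel_measurable borel" using g by simp
 have B: "B : sets borel" "bounded B" "B <= cball 0 R"
  unfolding B_def by (measurable, auto intro: bounded_subset[OF bounded_cball])
 have LB: "(%x. c * indicator B x) : L2" using B by (intro L2_bounded_indicator[of B R]) auto
 have LA: "(%x. c * indicator A x) : L2" using indicator by (intro L2_bounded_indicator[of A R]) auto
 have "AE x in lborel. c * indicator A x = c * indicator B x"
  using g(2) by eventually_elim (use indicator in \<open>auto simp: B_def indicator_def split: if_splits\<close>)
 then have "AE x in lebesgue. c * indicator A x = c * indicator B x" by (rule AE_completion)
 then have eq: "abs_l2 (%x. c * indicator A x) = abs_l2 (%x. c * indicator B x)" using LA LB by (simp add: abs_l2_eq_iff)
 have "(%x. c * indicator B x) : borel_measurable borel" using B by measurable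
 then show ?case unfolding eq using LB indicator_translation_continuous[OF B(1,2), of _ c] by blast
qed

text \<open>The real Cauchy-Schwarz inequality after rotating \<open>f\<close> by the phase of the
  pairing.\<close>

lemma L2_inner_bound:
 assumes "f : L2" "h : L2" shows "cmod (L2_inner f h) <= norm (abs_l2 f) * norm (abs_l2 h)"
proof -
 define z where "z = L2_inner f h"
 define c where "c = cnj (sgn z)"
 have "Re (L2_inner (%x. c * f x) h) = cmod z"
 proof -
  have "L2_inner (%x. c * f x) h = c * z" unfolding L2_inner_def z_def by (simp add: mult.assoc)
  also have "... = complex_of_real (cmod z)"
   by (cases "z = 0") (simp_all add: c_def sgn_eq complex_norm_square[symmetric] power2_eq_square mult.commute[of "cnj z"])
  finally show ?thesis by simp
 qed
 then have "cmod z = inner (abs_l2 (%x. c * f x)) (abs_l2 h)" using assms by (simp add: inner_abs_l2 L2_cmult)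
 also have "... <= norm (abs_l2 (%x. c * f x)) * norm (abs_l2 h)" by (rule norm_cauchy_schwarz)
 also have "... <= norm (abs_l2 f) * norm (abs_l2 h)"
 proof (rule mult_right_mono)
  have "cmod c <= 1" by (simp add: c_def norm_sgn)
  then have "(LINT x|lebesgue. (cmod (c * f x))^2) <= (LINT x|lebesgue. (cmod (f x))^2)"
   using L2D(2)[OF assms(1)] L2D(2)[OF L2_cmult[OF assms(1), of c]]
   by (intro integral_mono) (auto simp: norm_mult intro!: power_mono mult_left_le_one_le)
  then show "norm (abs_l2 (%x. c * f x)) <= norm (abs_l2 f)" using assms by (simp add: norm_abs_l2 L2_cmult)
 qed simp
 finally show ?thesis by (simp add: z_def)
qed

section \<open>Regularized pairing and Plancherel's theorem\<close>

lemma fourier_integral_lborel: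
 assumes [measurable]: "f : borel_measurable borel"
 shows "fourier_integral f xi = (CLINT x|lborel. f x * cis (- 2 * pi * (x \<bullet> xi)))"
 unfolding fourier_integral_def by (rule integral_completion) measurable

lemma fourier_integral_borel:
 fixes f :: "'a::euclidean_space => complex"
 assumes [measurable]: "f : borel_measurable borel"
 shows "fourier_integral f : borel_measurable borel"
proof -
 have "fourier_integral f = (%xi. CLINT x|lborel. f x * cis (- 2 * pi * (x \<bullet> xi)))"
  by (rule ext) (rule fourier_integral_lborel[OF assms])
 moreover have "(%xi. CLINT x|lborel. f x * cis (- 2 * pi * (x \<bullet> xi))) : borel_measurable borel" by measurable
 ultimately show ?thesis by simp
qed

lemma fourier_integral_bound:
 assumes "f : borel_measurable borel"
 shows "cmod (fourier_integral f xi) <= (LINT x|lborel. cmod (f x))"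
 unfolding fourier_integral_lborel[OF assms]
 by (rule order_trans[OF integral_norm_bound]) (simp add: norm_mult)

text \<open>The Gaussian weight makes the frequency integral absolutely convergent, so Fubini
  applies. One identity serves two ends: \<open>tau = 0\<close> leads to Plancherel,
  \<open>tau\<close> nonzero to the dispersive estimate.\<close>

lemma regularized_pairing:
 fixes f h :: "'a::euclidean_space => complex"
 assumes fm: "f : borel_measurable borel" and hm: "h : borel_measurable borel"
  and f: "integrable lborel f" and h: "integrable lborel h" and e: "0 < eps"
 shows "(CLINT xi|lborel. complex_of_real (exp (- eps * (norm xi)^2)) * cis (- tau * (norm xi)^2) * (fourier_integral f xi * cnj (fourier_integral h xi)))
  = (CLINT p|lborel. f (fst p) * cnj (h (snd p)) *
    (CLINT xi|lborel. complex_of_real (exp (- eps * (norm xi)^2)) * cis (((2 * pi) *\<^sub>R (snd p - fst p)) \<bullet> xi - tau * (norm xi)^2)))"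
  and "integrable lborel (%p. f (fst p) * cnj (h (snd p)))"
proof -
 note [measurable] = fm hm
 have G: "integrable (lborel \<Otimes>\<^sub>M lborel) (%p. f (fst p) * cnj (h (snd p)))"
  using f h by (intro integrable_product_bound[of "%x. cmod (f x)" "%x. cmod (h x)"]) (auto simp: norm_mult)
 then show G': "integrable lborel (%p. f (fst p) * cnj (h (snd p)))" by (simp add: lborel_prod)
 define W where "W xi = complex_of_real (exp (- eps * (norm xi)^2)) * cis (- tau * (norm xi)^2)" for xi :: 'a
 have [measurable]: "W : borel_measurable borel" unfolding W_def by measurable
 have nW: "cmod (W xi) = exp (- eps * (norm xi)^2)" for xi by (simp add: W_def norm_mult)
 define \<Phi> where "\<Phi> p = f (fst p) * cnj (h (snd p))" for p
 define \<Delta> where "\<Delta> p = (2 * pi) *\<^sub>R (snd p - fst p)" for p :: "'a \<times> 'a"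
 have [measurable]: "\<Phi> : borel_measurable borel" using borel_measurable_integrable[OF G'] by (simp add: \<Phi>_def[abs_def])
 have [measurable]: "\<Delta> : borel_measurable borel"
  unfolding \<Delta>_def by (intro borel_measurable_continuous_onI continuous_intros)
 define H where "H xi p = \<Phi> p * cis (\<Delta> p \<bullet> xi)" for xi :: 'a and p
 have pr: "fourier_integral f xi * cnj (fourier_integral h xi) = (CLINT p|lborel. H xi p)" for xi
 proof -
  define F1 where "F1 x = f x * cis (- 2 * pi * (x \<bullet> xi))" for x
  define F2 where "F2 x = h x * cis (- 2 * pi * (x \<bullet> xi))" for x
  have [measurable]: "F1 : borel_measurable borel" "F2 : borel_measurable borel" unfolding F1_def F2_def by measurable
  have I: "integrable (lborel \<Otimes>\<^sub>M lborel) (%(x, y). F1 x * cnj (F2 y))"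
   using f h by (intro integrable_product_bound[of "%x. cmod (f x)" "%x. cmod (h x)"]) (auto simp: norm_mult F1_def F2_def)
  have "fourier_integral f xi * cnj (fourier_integral h xi) = (CLINT x|lborel. F1 x) * cnj (CLINT y|lborel. F2 y)"
   by (simp only: fourier_integral_lborel fm hm F1_def F2_def)
  also have "... = (CLINT x|lborel. CLINT y|lborel. F1 x * cnj (F2 y))"
   by simp
  also have "... = (CLINT p|lborel \<Otimes>\<^sub>M lborel. case p of (x, y) => F1 x * cnj (F2 y))"
   by (rule lborel_pair.integral_fst) (rule I)
  also have "... = (CLINT p|lborel. H xi p)"
   unfolding lborel_prod
  proof (rule Bochner_Integration.integral_cong[OF refl])
   fix p :: "'a \<times> 'a"
   have "cis (- 2 * pi * (fst p \<bullet> xi)) * cis (- (- 2 * pi * (snd p \<bullet> xi))) = cis (((2 * pi) *\<^sub>R (snd p - fst p)) \<bullet> xi)"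
    unfolding cis_mult by (simp add: inner_diff_left algebra_simps)
   then show "(case p of (x, y) => F1 x * cnj (F2 y)) = H xi p"
    unfolding H_def \<Phi>_def \<Delta>_def F1_def F2_def case_prod_beta complex_cnj_mult cis_cnj by (simp only: ac_simps)
  qed
  finally show ?thesis .
 qed
 have I: "integrable (lborel \<Otimes>\<^sub>M lborel) (%(xi, p). W xi * H xi p)"
 proof (rule integrable_product_bound[OF gaussian_real(1)[OF e]])
  show "integrable lborel (%p. cmod (f (fst p) * cnj (h (snd p))))" using G' by simp
  show "(%(xi, p). W xi * H xi p) : borel_measurable (lborel \<Otimes>\<^sub>M lborel)" unfolding H_def by measurable
 qed (simp add: norm_mult nW H_def \<Phi>_def)
 have "(CLINT xi|lborel. W xi * (fourier_integral f xi * cnj (fourier_integral h xi))) = (CLINT xi|lborel. CLINT p|lborel. W xi * H xi p)"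
  unfolding pr by simp
 also have "... = (CLINT p|lborel. CLINT xi|lborel. W xi * H xi p)"
  by (rule lborel_pair.Fubini_integral[symmetric]) (rule I)
 also have "... = (CLINT p|lborel. f (fst p) * cnj (h (snd p)) *
    (CLINT xi|lborel. complex_of_real (exp (- eps * (norm xi)^2)) * cis (((2 * pi) *\<^sub>R (snd p - fst p)) \<bullet> xi - tau * (norm xi)^2)))"
 proof (rule Bochner_Integration.integral_cong[OF refl])
  fix p
  have "(CLINT xi|lborel. W xi * H xi p) = (CLINT xi|lborel. f (fst p) * cnj (h (snd p)) *
    (complex_of_real (exp (- eps * (norm xi)^2)) * cis (((2 * pi) *\<^sub>R (snd p - fst p)) \<bullet> xi - tau * (norm xi)^2)))"
  proof (rule Bochner_Integration.integral_cong[OF refl])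
   fix xi
   have eq: "cis (- tau * (norm xi)^2) * cis (((2 * pi) *\<^sub>R (snd p - fst p)) \<bullet> xi) = cis (((2 * pi) *\<^sub>R (snd p - fst p)) \<bullet> xi - tau * (norm xi)^2)"
    unfolding cis_mult by simp
   show "W xi * H xi p = f (fst p) * cnj (h (snd p)) *
    (complex_of_real (exp (- eps * (norm xi)^2)) * cis (((2 * pi) *\<^sub>R (snd p - fst p)) \<bullet> xi - tau * (norm xi)^2))"
    unfolding W_def H_def \<Phi>_def \<Delta>_def eq[symmetric] by (simp only: ac_simps)
  qed
  then show "(CLINT xi|lborel. W xi * H xi p) = f (fst p) * cnj (h (snd p)) *
    (CLINT xi|lborel. complex_of_real (exp (- eps * (norm xi)^2)) * cis (((2 * pi) *\<^sub>R (snd p - fst p)) \<bullet> xi - tau * (norm xi)^2))"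
   by simp
 qed
 finally show "(CLINT xi|lborel. complex_of_real (exp (- eps * (norm xi)^2)) * cis (- tau * (norm xi)^2) * (fourier_integral f xi * cnj (fourier_integral h xi)))
  = (CLINT p|lborel. f (fst p) * cnj (h (snd p)) *
    (CLINT xi|lborel. complex_of_real (exp (- eps * (norm xi)^2)) * cis (((2 * pi) *\<^sub>R (snd p - fst p)) \<bullet> xi - tau * (norm xi)^2)))"
  by (simp only: W_def)
qed

lemma regularized_dispersive:
 fixes f h :: "'a::euclidean_space => complex"
 assumes fm: "f : borel_measurable borel" and hm: "h : borel_measurable borel"
  and f: "integrable lborel f" and h: "integrable lborel h" and e: "0 < eps" and t: "tau ~= 0"
 shows "cmod (CLINT xi|lborel. complex_of_real (exp (- eps * (norm xi)^2)) * cis (- tau * (norm xi)^2) * (fourier_integral f xi * cnj (fourier_integral h xi)))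
  <= (pi / \<bar>tau\<bar>) powr (DIM('a) / 2) * (LINT x|lborel. cmod (f x)) * (LINT x|lborel. cmod (h x))"
proof -
 note [measurable] = fm hm
 define B where "B = (pi / \<bar>tau\<bar>) powr (DIM('a) / 2)"
 define J where "J p = (CLINT xi|lborel. complex_of_real (exp (- eps * (norm xi)^2)) * cis (((2 * pi) *\<^sub>R (snd p - fst p)) \<bullet> xi - tau * (norm xi)^2))"
  for p :: "'a \<times> 'a"
 have J: "cmod (J p) <= B" for p unfolding J_def B_def by (rule oscillatory_gaussian_bound[OF e t])
 define \<Delta> where "\<Delta> p = (2 * pi) *\<^sub>R (snd p - fst p)" for p :: "'a \<times> 'a"
 have [measurable]: "\<Delta> : borel_measurable borel"
  unfolding \<Delta>_def by (intro borel_measurable_continuous_onI continuous_intros)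
 have Jm: "J : borel_measurable borel" unfolding J_def \<Delta>_def[symmetric] by measurable
 have G: "integrable lborel (%p. f (fst p) * cnj (h (snd p)))" by (rule regularized_pairing(2)[OF fm hm f h e])
 have "cmod (CLINT p|lborel. f (fst p) * cnj (h (snd p)) * J p) <= (LINT p|lborel. cmod (f (fst p) * cnj (h (snd p)) * J p))"
  by (rule integral_norm_bound)
 also have "... <= (LINT p|lborel. cmod (f (fst p) * cnj (h (snd p))) * B)"
 proof (rule integral_mono)
  show i: "integrable lborel (%p. cmod (f (fst p) * cnj (h (snd p))) * B)" using G by simp
  show "cmod (f (fst p) * cnj (h (snd p)) * J p) <= cmod (f (fst p) * cnj (h (snd p))) * B" for p
   unfolding norm_mult[of _ "J p"] by (intro mult_left_mono J) simp
  then show "integrable lborel (%p. cmod (f (fst p) * cnj (h (snd p)) * J p))"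
   using borel_measurable_integrable[OF G] Jm
   by (intro Bochner_Integration.integrable_bound[OF i] AE_I2) (auto simp: B_def)
 qed
 also have "... = (LINT p|(lborel \<Otimes>\<^sub>M lborel). (case p of (x, y) => cmod (f x) * cmod (h y))) * B"
  unfolding lborel_prod by (simp add: norm_mult case_prod_beta)
 also have "(LINT p|(lborel \<Otimes>\<^sub>M lborel). (case p of (x, y) => cmod (f x) * cmod (h y))) = (LINT x|lborel. LINT y|lborel. cmod (f x) * cmod (h y))"
 proof (rule lborel_pair.integral_fst[symmetric])
  show "integrable (lborel \<Otimes>\<^sub>M lborel) (%(x, y). cmod (f x) * cmod (h y))"
   using integrable_norm[OF G] unfolding lborel_prod by (simp add: norm_mult case_prod_unfold)
 qed
 also have "... = (LINT x|lborel. cmod (f x)) * (LINT x|lborel. cmod (h x))" by simp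
 finally show ?thesis unfolding regularized_pairing(1)[OF fm hm f h e] J_def[symmetric] B_def by (simp add: ac_simps)
qed

lemma integral_lebesgue_borel:
 fixes f :: "'a::euclidean_space => complex"
 assumes "f : borel_measurable borel" shows "(CLINT x|lebesgue. f x) = (CLINT x|lborel. f x)"
 using assms by (intro integral_completion) simp

lemma l2_translation_continuous':
 fixes f :: "'a::euclidean_space => complex"
 assumes f: "f : borel_measurable borel" "f : L2" and e: "0 < e"
 shows "EX delta>0. ALL z. norm z < delta --> norm (abs_l2 (%x. f (z + x) - f x)) <= e"
proof -
 obtain g where g: "g : borel_measurable borel" "g : L2" "abs_l2 g = abs_l2 f"
  and gc: "ALL e>0. EX delta>0. ALL z. norm z < delta --> norm (abs_l2 (%x. g (z + x)) - abs_l2 f) <= e"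
  using l2_translation_continuous[of "abs_l2 f"] by blast
 have "abs_l2 (%x. f (z + x) - f x) = abs_l2 (%x. g (z + x)) - abs_l2 f" for z
 proof -
  have m: "(%x. f x - g x) : borel_measurable borel" using f g by measurable
  have "norm (abs_l2 (%x. f (z + x) - g (z + x))) = norm (abs_l2 (%x. f x - g x))"
   using L2_translate(3)[OF m L2_diff[OF f(2) g(2)], of z] .
  also have "... = 0" unfolding abs_l2_diff[OF f(2) g(2), symmetric] by (simp add: g(3))
  finally have "abs_l2 (%x. f (z + x)) = abs_l2 (%x. g (z + x))"
   unfolding abs_l2_diff[OF L2_translate(2)[OF f] L2_translate(2)[OF g(1,2)], symmetric] by simp
  moreover have "abs_l2 (%x. f (z + x) - f x) = abs_l2 (%x. f (z + x)) - abs_l2 f"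
   by (rule abs_l2_diff[OF L2_translate(2)[OF f] f(2), symmetric])
  ultimately show ?thesis by simp
 qed
 then show ?thesis using gc e by auto
qed

text \<open>At \<open>tau = 0\<close> the kernel is a Gaussian approximate identity \<open>k\<close>
  tested against the autocorrelation \<open>A\<close>, whose value at 0 is the squared norm and
  which is continuous there because translations are.\<close>

lemma plancherel_regularized:
 fixes f :: "'a::euclidean_space => complex"
 assumes fm: "f : borel_measurable borel" and f: "integrable lborel f" "f : L2"
 shows "(%n. CLINT xi|lborel. complex_of_real (exp (- (1 / real (Suc n)) * (norm xi)^2) * (cmod (fourier_integral f xi))^2))
  \<longlonglongrightarrow> complex_of_real ((norm (abs_l2 f))^2)"
proof (rule LIMSEQ_I)
 fix r :: real assume r: "0 < r"
 note [measurable] = fm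
 define S where "S = (norm (abs_l2 f))^2"
 define d where "d = real DIM('a)"
 define A where "A z = (CLINT x|lborel. f x * cnj (f (z + x)))" for z
 have [measurable]: "A : borel_measurable borel" unfolding A_def by measurable
 have Ain: "A z = L2_inner f (%x. f (z + x))" for z
  unfolding A_def L2_inner_def by (rule integral_lebesgue_borel[symmetric]) measurable
 have A0: "A 0 = complex_of_real S"
 proof -
  have "A 0 = (CLINT x|lborel. complex_of_real ((cmod (f x))^2))"
   unfolding A_def by (intro Bochner_Integration.integral_cong refl) (simp only: complex_norm_square add_0)
  also have "... = complex_of_real (LINT x|lborel. (cmod (f x))^2)" by (rule integral_complex_of_real)
  also have "(LINT x|lborel. (cmod (f x))^2) = S"
   unfolding S_def norm_abs_l2_lborel[OF fm f(2)] by simp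
  finally show ?thesis .
 qed
 have Ad: "cmod (A z - A 0) <= norm (abs_l2 f) * norm (abs_l2 (%x. f (z + x) - f x))" for z
 proof -
  have "A z - A 0 = L2_inner f (%x. f (z + x) - f x)"
  proof -
   have "L2_inner f (%x. f (z + x)) - L2_inner f (%x. f x) = (CLINT x|lebesgue. f x * cnj (f (z + x)) - f x * cnj (f x))"
    unfolding L2_inner_def using L2_integrable_mult[OF f(2) L2_translate(2)[OF fm f(2), of z]] L2_integrable_mult[OF f(2) f(2)]
    by (rule Bochner_Integration.integral_diff[symmetric])
   then show ?thesis unfolding Ain by (simp add: L2_inner_def right_diff_distrib)
  qed
  then show ?thesis using L2_inner_bound[OF f(2) L2_diff[OF L2_translate(2)[OF fm f(2), of z] f(2)]] by simp
 qed
 have Abd: "cmod (A z - A 0) <= 2 * S" for z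
 proof -
  have "norm (abs_l2 (%x. f (z + x) - f x)) <= norm (abs_l2 (%x. f (z + x))) + norm (abs_l2 f)"
   unfolding abs_l2_diff[OF L2_translate(2)[OF fm f(2)] f(2), symmetric] by (rule norm_triangle_ineq4)
  then have "norm (abs_l2 (%x. f (z + x) - f x)) <= 2 * norm (abs_l2 f)" using L2_translate(3)[OF fm f(2), of z] by simp
  then have "norm (abs_l2 f) * norm (abs_l2 (%x. f (z + x) - f x)) <= norm (abs_l2 f) * (2 * norm (abs_l2 f))"
   by (intro mult_left_mono) auto
  then show ?thesis using Ad[of z] by (simp add: S_def power2_eq_square)
 qed
 define e where "e = r / 4"
 have e: "0 < e" using r by (simp add: e_def)
 have "0 < e / (norm (abs_l2 f) + 1)" using e by (intro divide_pos_pos add_nonneg_pos) auto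
 from l2_translation_continuous'[OF fm f(2) this]
 obtain delta where delta: "0 < delta" "!!z. norm z < delta ==> norm (abs_l2 (%x. f (z + x) - f x)) <= e / (norm (abs_l2 f) + 1)" by blast
 \<comment> \<open>A quadratic majorant replaces splitting the integral: from distance
   \<open>delta\<close> on, the crude bound 2S is already below its second term, so the second
   moment of \<open>k\<close> decides.\<close>
 have Ae: "cmod (A z - A 0) <= e + 2 * S / delta^2 * (norm z)^2" for z
 proof (cases "norm z < delta")
  case True
  have "cmod (A z - A 0) <= norm (abs_l2 f) * (e / (norm (abs_l2 f) + 1))"
   using Ad[of z] delta(2)[OF True] by (meson mult_left_mono norm_ge_zero order_trans)
  also have "... = norm (abs_l2 f) / (norm (abs_l2 f) + 1) * e" by simp
  also have "... <= 1 * e"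
   using e add_nonneg_pos[of "norm (abs_l2 f)" 1] by (intro mult_right_mono) (auto simp: pos_divide_le_eq)
  finally have "cmod (A z - A 0) <= e" by simp
  moreover have "0 <= 2 * S / delta^2 * (norm z)^2" by (simp add: S_def)
  ultimately show ?thesis by linarith
 next
  case False
  then have "1 <= (norm z)^2 / delta^2" using delta(1) by (simp add: power_mono)
  then have "2 * S * 1 <= 2 * S * ((norm z)^2 / delta^2)" by (intro mult_left_mono) (auto simp: S_def)
  then show ?thesis using Abd[of z] e by simp
 qed
 \<comment> \<open>\<open>2 * S / delta^2\<close> is from the majorant, \<open>2 / pi^2\<close> from
   2 / b with b = pi^2 / eps, and the last factor from integrating a Gaussian of half the
   rate.\<close>
 define Q where "Q = 2 * S / delta^2 * (2 / pi^2) * 2 powr (d / 2)"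
 have Q: "0 <= Q" by (simp add: Q_def S_def)
 have main: "cmod ((CLINT xi|lborel. complex_of_real (exp (- eps * (norm xi)^2) * (cmod (fourier_integral f xi))^2)) - complex_of_real S) <= e + Q * eps"
  if eps: "0 < eps" for eps
 proof -
  define K0 where "K0 = (pi / eps) powr (d / 2)"
  have K0: "0 <= K0" by (simp add: K0_def)
  define b where "b = pi^2 / eps"
  have b: "0 < b" using eps by (simp add: b_def)
  define k where "k z = K0 * exp (- b * (norm z)^2)" for z :: 'a
  have [measurable]: "k : borel_measurable borel" unfolding k_def by measurable
  have k0: "0 <= k z" "k z <= K0" for z using K0 b by (auto simp: k_def intro!: mult_left_le)
  have ki: "integrable lborel k" unfolding k_def by (intro integrable_mult_right gaussian_real b)
  have kI: "(LINT z|lborel. k z) = 1"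
  proof -
   have "(LINT z|lborel. k z) = K0 * (pi / b) powr (d / 2)"
    unfolding k_def using gaussian_real(2)[OF b, where 'a='a] by (simp add: d_def)
   also have "... = (pi / eps * (pi / b)) powr (d / 2)" by (simp only: K0_def powr_mult)
   also have "pi / eps * (pi / b) = 1" using eps by (simp add: b_def power2_eq_square)
   finally show ?thesis by simp
  qed
  have Jk: "(CLINT xi|lborel. complex_of_real (exp (- eps * (norm xi)^2)) * cis (((2 * pi) *\<^sub>R z) \<bullet> xi - 0 * (norm xi)^2)) = complex_of_real (k z)" for z :: 'a
  proof -
   have "- (norm ((2 * pi) *\<^sub>R z))\<^sup>2 / (4 * eps) = - b * (norm z)^2" using eps by (simp add: b_def power_mult_distrib field_simps)
   then show ?thesis
    using gaussian_nd(2)[OF eps, of "(2 * pi) *\<^sub>R z"] by (simp only: k_def K0_def d_def inner_commute[of _ "(2 * pi) *\<^sub>R z"] mult_zero_left diff_zero)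
  qed
  have "(CLINT xi|lborel. complex_of_real (exp (- eps * (norm xi)^2) * (cmod (fourier_integral f xi))^2))
    = (CLINT xi|lborel. complex_of_real (exp (- eps * (norm xi)^2)) * cis (- 0 * (norm xi)^2) * (fourier_integral f xi * cnj (fourier_integral f xi)))"
   by (intro Bochner_Integration.integral_cong refl) (simp only: of_real_mult complex_norm_square minus_zero mult_zero_left cis_zero mult_1_right)
  also have "... = (CLINT p|lborel. f (fst p) * cnj (f (snd p)) * complex_of_real (k (snd p - fst p)))"
   unfolding regularized_pairing(1)[OF fm fm f(1) f(1) eps] by (simp only: Jk)
  also have "... = (CLINT p|lborel \<Otimes>\<^sub>M lborel. case p of (x, y) => f x * cnj (f y) * complex_of_real (k (y - x)))"
   unfolding lborel_prod by (simp add: case_prod_beta)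
  also have "... = (CLINT x|lborel. CLINT y|lborel. f x * cnj (f y) * complex_of_real (k (y - x)))"
  proof (rule lborel_pair.integral_fst[symmetric])
   show "integrable (lborel \<Otimes>\<^sub>M lborel) (%(x, y). f x * cnj (f y) * complex_of_real (k (y - x)))"
   proof (rule integrable_product_bound[of "%x. K0 * cmod (f x)" "%x. cmod (f x)"])
    show "cmod (case (x, y) of (x, y) => f x * cnj (f y) * complex_of_real (k (y - x))) <= K0 * cmod (f x) * cmod (f y)" for x y
     using mult_left_mono[OF k0(2)[of "y - x"], of "cmod (f x) * cmod (f y)"] k0(1)[of "y - x"] by (simp add: norm_mult ac_simps)
    show "integrable lborel (%x. K0 * cmod (f x))" using f by simp
    show "integrable lborel (%x. cmod (f x))" using f by simp
    show "(%(x, y). f x * cnj (f y) * complex_of_real (k (y - x))) : borel_measurable (lborel \<Otimes>\<^sub>M lborel)" by measurable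
   qed
  qed
  also have "... = (CLINT x|lborel. CLINT z|lborel. f x * cnj (f (x + z)) * complex_of_real (k z))"
  proof (rule Bochner_Integration.integral_cong[OF refl])
   fix x
   show "(CLINT y|lborel. f x * cnj (f y) * complex_of_real (k (y - x))) = (CLINT z|lborel. f x * cnj (f (x + z)) * complex_of_real (k z))"
    using lborel_translate(2)[of "%y. f x * cnj (f y) * complex_of_real (k (y - x))" x] by simp
  qed
  also have "... = (CLINT z|lborel. CLINT x|lborel. f x * cnj (f (x + z)) * complex_of_real (k z))"
  proof (rule lborel_pair.Fubini_integral[symmetric])
   show "integrable (lborel \<Otimes>\<^sub>M lborel) (%(x, z). f x * cnj (f (x + z)) * complex_of_real (k z))"
   proof (rule lborel_pair.Fubini_integrable)
    have inner: "integrable lborel (%z. f x * cnj (f (x + z)) * complex_of_real (k z))" for x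
    proof (rule Bochner_Integration.integrable_bound)
     show "integrable lborel (%z. K0 * cmod (f x) * cmod (f (x + z)))"
      using lborel_translate(1)[OF fm, of x] f(1) by (intro integrable_mult_right integrable_norm) simp
     show "AE z in lborel. norm (f x * cnj (f (x + z)) * complex_of_real (k z)) <= norm (K0 * cmod (f x) * cmod (f (x + z)))"
      using mult_left_mono[OF k0(2), of "cmod (f x) * cmod (f (x + _))"] k0(1) K0 by (intro AE_I2) (simp add: norm_mult abs_mult ac_simps)
    qed measurable
    show "AE x in lborel. integrable lborel (%z. case (x, z) of (x, z) => f x * cnj (f (x + z)) * complex_of_real (k z))"
     using inner by simp
    show "integrable lborel (%x. LINT z|lborel. norm (case (x, z) of (x, z) => f x * cnj (f (x + z)) * complex_of_real (k z)))"
    proof (rule Bochner_Integration.integrable_bound)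
     show "integrable lborel (%x. K0 * (LINT z|lborel. cmod (f z)) * cmod (f x))" using f by simp
     have "(LINT z|lborel. norm (f x * cnj (f (x + z)) * complex_of_real (k z))) <= K0 * (LINT z|lborel. cmod (f z)) * cmod (f x)" for x
     proof -
      have "(LINT z|lborel. norm (f x * cnj (f (x + z)) * complex_of_real (k z))) <= (LINT z|lborel. K0 * cmod (f x) * cmod (f (x + z)))"
      proof (rule integral_mono)
       show "integrable lborel (%z. K0 * cmod (f x) * cmod (f (x + z)))"
        using lborel_translate(1)[OF fm, of x] f(1) by (intro integrable_mult_right integrable_norm) simp
       show "norm (f x * cnj (f (x + z)) * complex_of_real (k z)) <= K0 * cmod (f x) * cmod (f (x + z))" for z
        using mult_left_mono[OF k0(2)[of z], of "cmod (f x) * cmod (f (x + z))"] k0(1)[of z] by (simp add: norm_mult ac_simps)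
      qed (use inner in simp)
      also have "... = K0 * cmod (f x) * (LINT z|lborel. cmod (f z))"
       using lborel_translate(2)[of "%z. cmod (f z)" x] by simp
      finally show ?thesis by (simp add: ac_simps)
     qed
     then show "AE x in lborel. norm (LINT z|lborel. norm (case (x, z) of (x, z) => f x * cnj (f (x + z)) * complex_of_real (k z)))
       <= norm (K0 * (LINT z|lborel. cmod (f z)) * cmod (f x))"
      by (intro AE_I2) (auto intro: order_trans[OF _ abs_ge_self])
    qed measurable
   qed measurable
  qed
  also have "... = (CLINT z|lborel. A z * complex_of_real (k z))"
   unfolding A_def by (simp add: add.commute)
  finally have RA: "(CLINT xi|lborel. complex_of_real (exp (- eps * (norm xi)^2) * (cmod (fourier_integral f xi))^2)) = (CLINT z|lborel. A z * complex_of_real (k z))" .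
  have iA: "integrable lborel (%z. (A z - A 0) * complex_of_real (k z))"
  proof (rule Bochner_Integration.integrable_bound[OF integrable_mult_right[OF ki, of "2 * S"]])
   show "AE z in lborel. norm ((A z - A 0) * complex_of_real (k z)) <= norm (2 * S * k z)"
    using mult_right_mono[OF Abd k0(1)] k0(1) by (intro AE_I2) (simp add: norm_mult abs_mult S_def)
  qed measurable
  have i0: "integrable lborel (%z. A 0 * complex_of_real (k z))" using ki by simp
  have "(CLINT z|lborel. A z * complex_of_real (k z)) - complex_of_real S
    = (CLINT z|lborel. (A z - A 0) * complex_of_real (k z) + A 0 * complex_of_real (k z)) - complex_of_real S"
   by (simp add: algebra_simps)
  also have "... = (CLINT z|lborel. (A z - A 0) * complex_of_real (k z))"
   using iA i0 kI by (simp add: A0)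
  finally have "cmod ((CLINT z|lborel. A z * complex_of_real (k z)) - complex_of_real S) <= (LINT z|lborel. cmod ((A z - A 0) * complex_of_real (k z)))"
   by (simp only: integral_norm_bound)
  also have "... <= (LINT z|lborel. e * k z + 2 * S / delta^2 * (2 / b) * (K0 * exp (- (b / 2) * (norm z)^2)))"
  proof (rule integral_mono)
   show "integrable lborel (%z. cmod ((A z - A 0) * complex_of_real (k z)))" using iA by simp
   show "integrable lborel (%z::'a. e * k z + 2 * S / delta^2 * (2 / b) * (K0 * exp (- (b / 2) * (norm z)^2)))"
    using b by (intro Bochner_Integration.integrable_add integrable_mult_right ki gaussian_real) auto
   fix z :: 'a
   \<comment> \<open>Half of the Gaussian absorbs the second moment through y <= exp y.\<close>
   have "b / 2 * (norm z)^2 <= exp (b / 2 * (norm z)^2)" using exp_ge_add_one_self[of "b / 2 * (norm z)^2"] by linarith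
   then have "b / 2 * (norm z)^2 * exp (- b * (norm z)^2) <= exp (b / 2 * (norm z)^2) * exp (- b * (norm z)^2)" by (intro mult_right_mono) auto
   also have "... = exp (- (b / 2) * (norm z)^2)" by (simp add: exp_add[symmetric])
   finally have "(norm z)^2 * exp (- b * (norm z)^2) <= (2 / b) * exp (- (b / 2) * (norm z)^2)" using b by (simp add: field_simps)
   then have "(norm z)^2 * k z <= (2 / b) * (K0 * exp (- (b / 2) * (norm z)^2))"
    using mult_left_mono[OF _ K0] unfolding k_def by (metis (no_types, opaque_lifting) mult.left_commute)
   then have "2 * S / delta^2 * ((norm z)^2 * k z) <= 2 * S / delta^2 * ((2 / b) * (K0 * exp (- (b / 2) * (norm z)^2)))"
    by (intro mult_left_mono) (auto simp: S_def)
   moreover have "cmod ((A z - A 0) * complex_of_real (k z)) <= (e + 2 * S / delta^2 * (norm z)^2) * k z"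
    using mult_right_mono[OF Ae k0(1)] k0(1) by (simp add: norm_mult)
   ultimately show "cmod ((A z - A 0) * complex_of_real (k z)) <= e * k z + 2 * S / delta^2 * (2 / b) * (K0 * exp (- (b / 2) * (norm z)^2))"
    by (simp only: distrib_right mult.assoc)
  qed
  also have "... = e * (LINT z|lborel. k z) + 2 * S / delta^2 * (2 / b) * (K0 * (LINT z|lborel. exp (- (b / 2) * (norm (z::'a))^2)))"
   using ki gaussian_real(1)[of "b / 2", where 'a='a] b by simp
  also have "K0 * (LINT z|lborel. exp (- (b / 2) * (norm (z::'a))^2)) = 2 powr (d / 2)"
  proof -
   have b2: "0 < b / 2" using b by simp
   have "K0 * (LINT z|lborel. exp (- (b / 2) * (norm (z::'a))^2)) = K0 * (pi / (b / 2)) powr (d / 2)"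
    unfolding gaussian_real(2)[OF b2] d_def ..
   also have "... = (pi / eps * (pi / (b / 2))) powr (d / 2)" by (simp only: K0_def powr_mult)
   also have "pi / eps * (pi / (b / 2)) = 2" using eps by (simp add: b_def power2_eq_square)
   finally show ?thesis .
  qed
  also have "2 * S / delta^2 * (2 / b) * 2 powr (d / 2) = Q * eps" using eps by (simp add: Q_def b_def)
  finally show ?thesis unfolding RA kI by simp
 qed
 obtain n0 where n0: "1 / real (Suc n0) < r / (4 * (Q + 1))" using nat_approx_posE[of "r / (4 * (Q + 1))"] r Q by auto
 have "norm ((CLINT xi|lborel. complex_of_real (exp (- (1 / real (Suc n)) * (norm xi)^2) * (cmod (fourier_integral f xi))^2)) - complex_of_real S) < r"
  if "n >= n0" for n
 proof -
  have "1 / real (Suc n) <= 1 / real (Suc n0)" using that by (intro divide_left_mono) auto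
  then have "Q * (1 / real (Suc n)) <= (Q + 1) * (r / (4 * (Q + 1)))" using n0 Q by (intro mult_mono) auto
  also have "... = r / 4" using Q by (simp add: field_simps)
  finally have q: "Q * (1 / real (Suc n)) <= r / 4" .
  have "0 < 1 / real (Suc n)" by simp
  from main[OF this] show ?thesis using q r unfolding e_def by linarith
 qed
 then show "EX no. \<forall>n\<ge>no. norm ((CLINT xi|lborel. complex_of_real (exp (- (1 / real (Suc n)) * (norm xi)^2) * (cmod (fourier_integral f xi))^2)) - complex_of_real ((norm (abs_l2 f))^2)) < r"
  unfolding S_def by blast
qed

text \<open>The Gaussian weights increase to 1, so monotone convergence identifies the integral of
  the squared transform; its finiteness comes out of the same limit.\<close>

theorem plancherel:
 fixes f :: "'a::euclidean_space => complex"
 assumes fm: "f : borel_measurable borel" and f: "integrable lborel f" "f : L2"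
 shows "fourier_integral f : L2" "norm (abs_l2 (fourier_integral f)) = norm (abs_l2 f)"
proof -
 define F where "F = fourier_integral f"
 have Fm[measurable]: "F : borel_measurable borel" unfolding F_def by (rule fourier_integral_borel[OF fm])
 define B where "B = (LINT x|lborel. cmod (f x))"
 have FB: "cmod (F xi) <= B" for xi unfolding F_def B_def by (rule fourier_integral_bound[OF fm])
 define g where "g n xi = exp (- (1 / real (Suc n)) * (norm xi)^2) * (cmod (F xi))^2" for n and xi :: 'a
 have [measurable]: "g n : borel_measurable borel" for n unfolding g_def by measurable
 have g0: "0 <= g n xi" for n xi by (simp add: g_def)
 have gi: "integrable lborel (g n)" for n
 proof (rule Bochner_Integration.integrable_bound)
  show "integrable lborel (%xi::'a. B^2 * exp (- (1 / real (Suc n)) * (norm xi)^2))" by (intro integrable_mult_right gaussian_real) simp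
  have "(cmod (F xi))^2 <= B^2" for xi using FB by (intro power_mono) auto
  then show "AE xi in lborel. norm (g n xi) <= norm (B^2 * exp (- (1 / real (Suc n)) * (norm xi)^2))"
   by (intro AE_I2) (auto simp: g_def abs_mult mult.commute[of "B^2"] intro!: mult_left_mono)
 qed measurable
 have "(%n. Re (CLINT xi|lborel. complex_of_real (g n xi))) \<longlonglongrightarrow> Re (complex_of_real ((norm (abs_l2 f))^2))"
  using plancherel_regularized[OF fm f] unfolding g_def F_def by (rule tendsto_Re)
 then have lim: "(%n. LINT xi|lborel. g n xi) \<longlonglongrightarrow> (norm (abs_l2 f))\<^sup>2"
  by (simp only: integral_complex_of_real Re_complex_of_real)
 have "(%n. \<integral>\<^sup>+xi. ennreal (g n xi) \<partial>lborel) \<longlonglongrightarrow> (\<integral>\<^sup>+xi. ennreal ((cmod (F xi))^2) \<partial>lborel)"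
 proof (rule nn_integral_LIMSEQ)
  show "incseq (%n xi. ennreal (g n xi))"
  proof (rule incseq_SucI, rule le_funI, rule ennreal_leI)
   fix n and xi :: 'a
   have "1 / real (Suc (Suc n)) * (norm xi)^2 <= 1 / real (Suc n) * (norm xi)^2" by (intro mult_right_mono divide_left_mono) auto
   then show "g n xi <= g (Suc n) xi" unfolding g_def by (intro mult_right_mono) auto
  qed
  fix xi :: 'a
  have "(%n. exp (- (1 / real (Suc n)) * (norm xi)^2) * (cmod (F xi))^2) \<longlonglongrightarrow> exp (- 0 * (norm xi)^2) * (cmod (F xi))^2"
   by (intro tendsto_mult tendsto_exp tendsto_minus tendsto_const LIMSEQ_Suc lim_1_over_n)
  then show "(%n. ennreal (g n xi)) \<longlonglongrightarrow> ennreal ((cmod (F xi))^2)"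
   unfolding g_def by (intro tendsto_ennrealI) simp
 qed measurable
 moreover have "(%n. \<integral>\<^sup>+xi. ennreal (g n xi) \<partial>lborel) \<longlonglongrightarrow> ennreal ((norm (abs_l2 f))^2)"
  unfolding nn_integral_eq_integral[OF gi AE_I2[OF g0]] using lim by (rule tendsto_ennrealI)
 ultimately have eq: "(\<integral>\<^sup>+xi. ennreal ((cmod (F xi))^2) \<partial>lborel) = ennreal ((norm (abs_l2 f))^2)" by (rule LIMSEQ_unique)
 then have "(\<integral>\<^sup>+xi. ennreal ((cmod (F xi))^2) \<partial>lebesgue) <= ennreal ((norm (abs_l2 f))^2)" by (simp add: nn_integral_completion)
 from L2_of_nn_integral(1)[OF borel_lebesgue[OF Fm] this] have FL: "F : L2" by simp
 then show "fourier_integral f : L2" by (simp add: F_def)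
 have "ennreal (LINT xi|lborel. (cmod (F xi))^2) = ennreal ((norm (abs_l2 f))^2)"
  unfolding eq[symmetric] using FL by (intro nn_integral_eq_integral[symmetric]) (auto simp: L2_lborel)
 then have "(LINT xi|lborel. (cmod (F xi))^2) = (norm (abs_l2 f))^2" by (simp add: ennreal_inj)
 then show "norm (abs_l2 (fourier_integral f)) = norm (abs_l2 f)"
  using norm_abs_l2_lborel[OF Fm FL] by (simp add: F_def)
qed

section \<open>The Fourier transform on the Hilbert space and its inverse\<close>

definition trunc :: "nat => ('a::euclidean_space => complex) => 'a => complex" where
 "trunc n f x = indicator (cball 0 (real n)) x * f x"

lemma trunc_L2: "f : L2 ==> trunc n f : L2"
 unfolding trunc_def[abs_def]
proof (rule L2_mult_bounded[where C = 1])
 show "(%x. indicator (cball 0 (real n)) x :: complex) : borel_measurable lebesgue" by (intro borel_lebesgue borel_measurable_indicator) simp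
qed (auto simp: indicator_def)

lemma trunc_borel: "f : borel_measurable borel ==> trunc n f : borel_measurable borel"
 unfolding trunc_def[abs_def] by (intro borel_measurable_times borel_measurable_indicator) auto

lemma trunc_tendsto: "f : L2 ==> (%n. abs_l2 (trunc n f)) \<longlonglongrightarrow> abs_l2 f"
 unfolding trunc_def[abs_def] by (rule l2_truncation_tendsto)

lemma integrable_cut:
 assumes f: "f : borel_measurable borel" "f : L2" and A: "A : sets borel" "A <= cball 0 R"
 shows "integrable lborel (%x. indicator A x * f x)"
proof -
 have "(%x. 1 * indicator A x) : (L2 :: ('a => complex) set)" using A by (intro L2_bounded_indicator[of A R]) auto
 from L2_integrable_mult[OF f(2) this] have "integrable lebesgue (%x. f x * cnj (1 * indicator A x))" .
 moreover have "(%x. f x * cnj (1 * indicator A x)) = (%x. indicator A x * f x)" by (auto simp: indicator_def)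
 ultimately have "integrable lebesgue (%x. indicator A x * f x)" by (simp only:)
 moreover have "(%x. indicator A x * f x) : borel_measurable lborel" using f A by measurable
 ultimately show ?thesis by (simp add: integrable_completion)
qed

lemma trunc_integrable: "f : borel_measurable borel ==> f : L2 ==> integrable lborel (trunc n f)"
 unfolding trunc_def[abs_def] by (rule integrable_cut) auto

lemma fourier_integral_cong_AE:
 fixes f g :: "'a::euclidean_space => complex"
 assumes "f : borel_measurable lebesgue" "g : borel_measurable lebesgue" "AE x in lebesgue. f x = g x"
 shows "fourier_integral f = fourier_integral g"
proof
 fix xi :: 'a
 have c: "(%x. cis (- 2 * pi * (x \<bullet> xi))) : borel_measurable lebesgue" by (rule borel_lebesgue) measurable
 show "fourier_integral f xi = fourier_integral g xi"
  unfolding fourier_integral_def using assms c by (intro integral_cong_AE) (auto elim: eventually_mono)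
qed

lemma fourier_integral_diff:
 assumes "f : borel_measurable borel" "g : borel_measurable borel" "integrable lborel f" "integrable lborel g"
 shows "fourier_integral (%x. f x - g x) = (%xi. fourier_integral f xi - fourier_integral g xi)"
  and "fourier_integral (%x. f x + g x) = (%xi. fourier_integral f xi + fourier_integral g xi)"
proof -
 have i: "integrable lborel (%x. k x * cis (- 2 * pi * (x \<bullet> xi)))" if "k : borel_measurable borel" "integrable lborel k" for k and xi :: 'a
  by (rule Bochner_Integration.integrable_bound[OF that(2)]) (use that in \<open>auto simp: norm_mult\<close>)
 have m: "(%x. f x - g x) : borel_measurable borel" "(%x. f x + g x) : borel_measurable borel" using assms by measurable
 show "fourier_integral (%x. f x - g x) = (%xi. fourier_integral f xi - fourier_integral g xi)"
  using i[OF assms(1,3)] i[OF assms(2,4)]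
  by (intro ext) (simp add: fourier_integral_lborel m assms(1,2) left_diff_distrib)
 show "fourier_integral (%x. f x + g x) = (%xi. fourier_integral f xi + fourier_integral g xi)"
  using i[OF assms(1,3)] i[OF assms(2,4)]
  by (intro ext) (simp add: fourier_integral_lborel m assms(1,2) distrib_right)
qed

lemma plancherel_diff:
 assumes "f : borel_measurable borel" "g : borel_measurable borel" "integrable lborel f" "integrable lborel g" "f : L2" "g : L2"
 shows "norm (abs_l2 (fourier_integral f) - abs_l2 (fourier_integral g)) = norm (abs_l2 f - abs_l2 g)"
proof -
 have m: "(%x. f x - g x) : borel_measurable borel" using assms by measurable
 have "norm (abs_l2 (fourier_integral (%x. f x - g x))) = norm (abs_l2 (%x. f x - g x))"
  using assms by (intro plancherel(2) m L2_diff) auto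
 then show ?thesis
  using assms plancherel(1)[OF assms(1,3,5)] plancherel(1)[OF assms(2,4,6)]
  by (simp add: fourier_integral_diff abs_l2_diff)
qed

text \<open>Plancherel makes the transforms of the truncations Cauchy. Completeness then supplies a
  function with the defining property of \<open>fourier_L2\<close>, so the choice operator returns
  one as well.\<close>

lemma fourier_L2_limit:
 fixes f :: "'a::euclidean_space => complex"
 assumes f: "f : L2"
 shows "fourier_L2 f : L2" "!!n. fourier_integral (trunc n f) : L2"
  "(%n. abs_l2 (fourier_integral (trunc n f))) \<longlonglongrightarrow> abs_l2 (fourier_L2 f)"
proof -
 obtain g where g: "g : borel_measurable borel" "g : L2" "abs_l2 g = abs_l2 f" using l2_borel_rep by blast
 have ae: "AE x in lebesgue. f x = g x" using g(3) abs_l2_eq_iff[OF g(2) f] by (auto elim: eventually_mono)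
 have eq: "fourier_integral (trunc n f) = fourier_integral (trunc n g)" for n
  using ae by (intro fourier_integral_cong_AE L2D trunc_L2 f g) (auto simp: trunc_def elim: eventually_mono)
 note tg = trunc_borel[OF g(1)] trunc_integrable[OF g(1,2)] trunc_L2[OF g(2)]
 show FL: "fourier_integral (trunc n f) : L2" for n unfolding eq by (rule plancherel(1)[OF tg])
 have "Cauchy (%n. abs_l2 (fourier_integral (trunc n g)))"
 proof (rule CauchyI)
  fix e :: real assume e: "0 < e"
  have "Cauchy (%n. abs_l2 (trunc n g))" by (rule LIMSEQ_imp_Cauchy[OF trunc_tendsto[OF g(2)]])
  from CauchyD[OF this e] show "EX M. \<forall>m\<ge>M. \<forall>n\<ge>M. norm (abs_l2 (fourier_integral (trunc m g)) - abs_l2 (fourier_integral (trunc n g))) < e"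
   using plancherel_diff[OF tg(1) tg(1) tg(2) tg(2) tg(3) tg(3)] by simp
 qed
 then obtain w where w: "(%n. abs_l2 (fourier_integral (trunc n f))) \<longlonglongrightarrow> w"
  unfolding eq by (auto simp: Cauchy_convergent_iff convergent_def)
 have conv: "(%n. L2_norm (%xi. h xi - fourier_integral (%x. indicator (cball 0 (real n)) x * f x) xi)) \<longlonglongrightarrow> 0
   \<longleftrightarrow> (%n. abs_l2 (fourier_integral (trunc n f))) \<longlonglongrightarrow> abs_l2 h" if h: "h : L2" for h
 proof -
  have "L2_norm (%xi. h xi - fourier_integral (%x. indicator (cball 0 (real n)) x * f x) xi)
    = ennreal (norm (abs_l2 h - abs_l2 (fourier_integral (trunc n f))))" for n
   using L2_norm_abs[OF L2_diff[OF h FL[of n]]] abs_l2_diff[OF h FL[of n]] by (simp add: trunc_def[abs_def])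
  moreover have "(%n. ennreal (norm (abs_l2 h - abs_l2 (fourier_integral (trunc n f))))) \<longlonglongrightarrow> ennreal 0
    \<longleftrightarrow> (%n. norm (abs_l2 h - abs_l2 (fourier_integral (trunc n f)))) \<longlonglongrightarrow> 0"
   by (rule tendsto_ennreal_iff) auto
  moreover have "(%n. norm (abs_l2 h - abs_l2 (fourier_integral (trunc n f)))) \<longlonglongrightarrow> 0
    \<longleftrightarrow> (%n. abs_l2 (fourier_integral (trunc n f)) - abs_l2 h) \<longlonglongrightarrow> 0"
   unfolding norm_minus_commute[of "abs_l2 h"] by (rule tendsto_norm_zero_iff)
  ultimately show ?thesis using LIM_zero_iff[of "%n. abs_l2 (fourier_integral (trunc n f))" "abs_l2 h" sequentially] by simp
 qed
 define P where "P h \<longleftrightarrow> h : L2 & (%n. L2_norm (%xi. h xi - fourier_integral (%x. indicator (cball 0 (real n)) x * f x) xi)) \<longlonglongrightarrow> 0" for h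
 have "P (rep_l2 w)" unfolding P_def using conv[of "rep_l2 w"] w by simp
 then have "P (SOME h. P h)" by (rule someI[where P = P])
 moreover have "fourier_L2 f = (SOME h. P h)" unfolding fourier_L2_def P_def ..
 ultimately have "P (fourier_L2 f)" by simp
 then show "fourier_L2 f : L2" "(%n. abs_l2 (fourier_integral (trunc n f))) \<longlonglongrightarrow> abs_l2 (fourier_L2 f)"
  unfolding P_def using conv by auto
qed

definition fourier :: "'a::euclidean_space l2 => 'a l2" where "fourier v = abs_l2 (fourier_L2 (rep_l2 v))"

lemma fourier_limit:
 assumes f: "f : L2"
 shows "(%n. abs_l2 (fourier_integral (trunc n f))) \<longlonglongrightarrow> fourier (abs_l2 f)"
proof -
 have "AE x in lebesgue. f x = rep_l2 (abs_l2 f) x" using rep_abs_l2[OF f] by (auto elim: eventually_mono)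
 then have "fourier_integral (trunc n f) = fourier_integral (trunc n (rep_l2 (abs_l2 f)))" for n
  by (intro fourier_integral_cong_AE L2D trunc_L2 f rep_l2_in) (auto simp: trunc_def elim: eventually_mono)
 then show ?thesis using fourier_L2_limit(3)[of "rep_l2 (abs_l2 f)"] by (simp add: fourier_def)
qed

lemma fourier_abs: "f : L2 ==> abs_l2 (fourier_L2 f) = fourier (abs_l2 f)"
 using LIMSEQ_unique[OF fourier_L2_limit(3) fourier_limit] by blast

lemma norm_fourier: "norm (fourier v) = norm v"
proof -
 obtain f where f: "f : borel_measurable borel" "f : L2" "abs_l2 f = v" using l2_borel_rep by blast
 have "(%n. norm (abs_l2 (fourier_integral (trunc n f)))) \<longlonglongrightarrow> norm (fourier v)"
  using fourier_limit[OF f(2)] unfolding f(3) by (rule tendsto_norm)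
 moreover have "(%n. norm (abs_l2 (fourier_integral (trunc n f)))) \<longlonglongrightarrow> norm v"
  using tendsto_norm[OF trunc_tendsto[OF f(2)]] unfolding f(3)
  by (simp add: plancherel(2) trunc_borel trunc_integrable trunc_L2 f)
 ultimately show ?thesis by (rule LIMSEQ_unique)
qed

lemma fourier_integrable:
 assumes f: "f : borel_measurable borel" "integrable lborel f" "f : L2"
 shows "fourier (abs_l2 f) = abs_l2 (fourier_integral f)"
proof -
 have "(%n. abs_l2 (fourier_integral (trunc n f)) - abs_l2 (fourier_integral f)) \<longlonglongrightarrow> 0"
 proof (rule tendsto_norm_zero_cancel)
  have "(%n. norm (abs_l2 (trunc n f) - abs_l2 f)) \<longlonglongrightarrow> 0"
   using trunc_tendsto[OF f(3)] by (intro tendsto_norm_zero) (simp add: LIM_zero_iff)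
  then show "(%n. norm (abs_l2 (fourier_integral (trunc n f)) - abs_l2 (fourier_integral f))) \<longlonglongrightarrow> 0"
   using f by (simp add: plancherel_diff trunc_borel trunc_integrable trunc_L2)
 qed
 then have "(%n. abs_l2 (fourier_integral (trunc n f))) \<longlonglongrightarrow> abs_l2 (fourier_integral f)" by (simp add: LIM_zero_iff)
 then show ?thesis using fourier_limit[OF f(3)] LIMSEQ_unique by blast
qed

lemma fourier_diff: "fourier (v - w) = fourier v - fourier w"
proof -
 obtain f where f: "f : borel_measurable borel" "f : L2" "abs_l2 f = v" using l2_borel_rep by blast
 obtain g where g: "g : borel_measurable borel" "g : L2" "abs_l2 g = w" using l2_borel_rep by blast
 have fg: "(%x. f x - g x) : L2" by (rule L2_diff[OF f(2) g(2)])
 have "abs_l2 (fourier_integral (trunc n (%x. f x - g x))) = abs_l2 (fourier_integral (trunc n f)) - abs_l2 (fourier_integral (trunc n g))" for n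
 proof -
  have "trunc n (%x. f x - g x) = (%x. trunc n f x - trunc n g x)" by (rule ext) (simp add: trunc_def right_diff_distrib)
  then have "fourier_integral (trunc n (%x. f x - g x)) = (%xi. fourier_integral (trunc n f) xi - fourier_integral (trunc n g) xi)"
   using f g by (simp add: fourier_integral_diff trunc_borel trunc_integrable)
  then show ?thesis using fourier_L2_limit(2)[OF f(2), of n] fourier_L2_limit(2)[OF g(2), of n] by (simp add: abs_l2_diff)
 qed
 then have "(%n. abs_l2 (fourier_integral (trunc n f)) - abs_l2 (fourier_integral (trunc n g))) \<longlonglongrightarrow> fourier (abs_l2 (%x. f x - g x))"
  using fourier_limit[OF fg] by simp
 moreover have "(%n. abs_l2 (fourier_integral (trunc n f)) - abs_l2 (fourier_integral (trunc n g))) \<longlonglongrightarrow> fourier v - fourier w"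
  using fourier_limit[OF f(2)] fourier_limit[OF g(2)] unfolding f(3) g(3) by (rule tendsto_diff)
 ultimately have "fourier (abs_l2 (%x. f x - g x)) = fourier v - fourier w" by (rule LIMSEQ_unique)
 moreover have "abs_l2 (%x. f x - g x) = v - w" using abs_l2_diff[OF f(2) g(2)] unfolding f(3) g(3) by (rule sym)
 ultimately show ?thesis by simp
qed

lemma isometry_inner:
 fixes T :: "'h::real_inner => 'h"
 assumes d: "!!v w. T (v - w) = T v - T w" and n: "!!v. norm (T v) = norm v"
 shows "inner (T v) (T w) = inner v w"
 using dot_norm_neg[of "T v" "T w"] dot_norm_neg[of v w] by (simp add: d[symmetric] n)

definition conj_l2 :: "'a::euclidean_space l2 => 'a l2" where "conj_l2 v = abs_l2 (%x. cnj (rep_l2 v x))"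

lemma L2_cnj: "f : L2 ==> (%x. cnj (f x)) : L2"
 by (rule L2_bound[of _ f 1]) (auto intro: measurable_compose[OF _ cnj_borel] L2D)

lemma conj_l2_abs: "f : L2 ==> conj_l2 (abs_l2 f) = abs_l2 (%x. cnj (f x))"
 unfolding conj_l2_def using rep_abs_l2[of f] by (subst abs_l2_eq_iff) (auto intro: L2_cnj elim: eventually_mono)

lemma conj_l2_diff: "conj_l2 (v - w) = conj_l2 v - conj_l2 w"
proof -
 have "conj_l2 (abs_l2 (rep_l2 v) - abs_l2 (rep_l2 w)) = conj_l2 (abs_l2 (rep_l2 v)) - conj_l2 (abs_l2 (rep_l2 w))"
  by (simp only: abs_l2_diff rep_l2_in conj_l2_abs L2_diff L2_cnj complex_cnj_diff)
 then show ?thesis by simp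
qed

lemma norm_conj_l2: "norm (conj_l2 v) = norm v"
proof -
 have "norm (conj_l2 (abs_l2 (rep_l2 v))) = norm (abs_l2 (rep_l2 v))"
  by (simp only: conj_l2_abs rep_l2_in norm_abs_l2 L2_cnj complex_mod_cnj)
 then show ?thesis by simp
qed

text \<open>Conjugating before and after replaces the kernel by its conjugate: the inverse
  transform, which thereby inherits extension and isometry.\<close>

definition inv_fourier :: "'a::euclidean_space l2 => 'a l2" where "inv_fourier v = conj_l2 (fourier (conj_l2 v))"

lemma inv_fourier_diff: "inv_fourier (v - w) = inv_fourier v - inv_fourier w"
 by (simp add: inv_fourier_def conj_l2_diff fourier_diff)

lemma norm_inv_fourier: "norm (inv_fourier v) = norm v"
 by (simp add: inv_fourier_def norm_conj_l2 norm_fourier)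

lemma isometry_tendsto:
 fixes T :: "'h::real_inner => 'h"
 assumes d: "!!v w. T (v - w) = T v - T w" and n: "!!v. norm (T v) = norm v" and "X \<longlonglongrightarrow> v"
 shows "(%n. T (X n)) \<longlonglongrightarrow> T v"
proof -
 have "(%n. norm (T (X n) - T v)) \<longlonglongrightarrow> 0"
  unfolding d[symmetric] n using assms(3) by (intro tendsto_norm_zero) (simp add: LIM_zero_iff)
 then have "(%n. T (X n) - T v) \<longlonglongrightarrow> 0" by (rule tendsto_norm_zero_cancel)
 then show ?thesis by (simp add: LIM_zero_iff)
qed

text \<open>Fubini, as the Fourier kernel is symmetric in its two variables.\<close>

lemma multiplication_formula:
 fixes f k :: "'a::euclidean_space => complex"
 assumes fm: "f : borel_measurable borel" and km: "k : borel_measurable borel" and f: "integrable lborel f" and k: "integrable lborel k"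
 shows "(CLINT xi|lborel. fourier_integral f xi * k xi) = (CLINT x|lborel. f x * fourier_integral k x)"
proof -
 note [measurable] = fm km
 have I: "integrable (lborel \<Otimes>\<^sub>M lborel) (%(x, xi). f x * k xi * cis (- 2 * pi * (x \<bullet> xi)))"
  using f k by (intro integrable_product_bound[of "%x. cmod (f x)" "%x. cmod (k x)"]) (auto simp: norm_mult)
 have "(CLINT xi|lborel. fourier_integral f xi * k xi) = (CLINT xi|lborel. CLINT x|lborel. f x * k xi * cis (- 2 * pi * (x \<bullet> xi)))"
 proof (rule Bochner_Integration.integral_cong[OF refl])
  fix xi
  have "fourier_integral f xi * k xi = (CLINT x|lborel. f x * cis (- 2 * pi * (x \<bullet> xi)) * k xi)"
   unfolding fourier_integral_lborel[OF fm] by (rule integral_mult_left_zero[symmetric])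
  then show "fourier_integral f xi * k xi = (CLINT x|lborel. f x * k xi * cis (- 2 * pi * (x \<bullet> xi)))" by (simp only: ac_simps)
 qed
 also have "... = (CLINT x|lborel. CLINT xi|lborel. f x * k xi * cis (- 2 * pi * (x \<bullet> xi)))"
  by (rule lborel_pair.Fubini_integral) (rule I)
 also have "... = (CLINT x|lborel. f x * fourier_integral k x)"
 proof (rule Bochner_Integration.integral_cong[OF refl])
  fix x
  have "f x * fourier_integral k x = (CLINT xi|lborel. f x * (k xi * cis (- 2 * pi * (xi \<bullet> x))))"
   unfolding fourier_integral_lborel[OF km] by (rule integral_mult_right_zero[symmetric])
  then show "(CLINT xi|lborel. f x * k xi * cis (- 2 * pi * (x \<bullet> xi))) = f x * fourier_integral k x" by (simp only: mult.assoc inner_commute)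
 qed
 finally show ?thesis .
qed

lemma L2_inner_borel:
 assumes "f : borel_measurable borel" "h : borel_measurable borel"
 shows "L2_inner f h = (CLINT x|lborel. f x * cnj (h x))"
 unfolding L2_inner_def by (intro integral_lebesgue_borel borel_measurable_times assms(1) measurable_compose[OF assms(2) cnj_borel])

text \<open>On truncations this is the multiplication formula with the second factor conjugated;
  both sides are continuous.\<close>

lemma fourier_adjoint: "inner (fourier v) w = inner v (inv_fourier w)"
proof -
 obtain f where f: "f : borel_measurable borel" "f : L2" "abs_l2 f = v" using l2_borel_rep by blast
 obtain h where h: "h : borel_measurable borel" "h : L2" "abs_l2 h = w" using l2_borel_rep by blast
 have eq: "inner (fourier (abs_l2 (trunc n f))) (abs_l2 (trunc n h)) = inner (abs_l2 (trunc n f)) (inv_fourier (abs_l2 (trunc n h)))" for n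
 proof -
  define F where "F = trunc n f"
  define H where "H = trunc n h"
  have F: "F : borel_measurable borel" "integrable lborel F" "F : L2"
   using f by (auto simp: F_def trunc_borel trunc_integrable trunc_L2)
  have H: "H : borel_measurable borel" "integrable lborel H" "H : L2"
   using h by (auto simp: H_def trunc_borel trunc_integrable trunc_L2)
  define K where "K x = cnj (H x)" for x
  have K: "K : borel_measurable borel" "integrable lborel K" "K : L2"
   using H L2_cnj[OF H(3)] unfolding K_def[abs_def] by auto
  have "inv_fourier (abs_l2 H) = abs_l2 (%x. cnj (fourier_integral K x))"
   using plancherel(1)[OF K] by (simp add: inv_fourier_def conj_l2_abs H K_def[abs_def, symmetric] fourier_integrable[OF K])
  then have "inner (abs_l2 F) (inv_fourier (abs_l2 H)) = Re (L2_inner F (%x. cnj (fourier_integral K x)))"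
   using F plancherel(1)[OF K] by (simp add: inner_abs_l2 L2_cnj)
  also have "L2_inner F (%x. cnj (fourier_integral K x)) = (CLINT x|lborel. F x * fourier_integral K x)"
   using fourier_integral_borel[OF K(1)] F by (subst L2_inner_borel) (auto intro: measurable_compose[OF _ cnj_borel])
  also have "... = (CLINT xi|lborel. fourier_integral F xi * K xi)" by (rule multiplication_formula[symmetric]) (rule F K)+
  also have "... = L2_inner (fourier_integral F) H"
   using fourier_integral_borel[OF F(1)] H by (simp add: L2_inner_borel K_def)
  also have "Re ... = inner (fourier (abs_l2 F)) (abs_l2 H)"
   using F H plancherel(1)[OF F] by (simp add: inner_abs_l2 fourier_integrable)
  finally show ?thesis by (simp add: F_def H_def)
 qed
 have F: "(%n. abs_l2 (trunc n f)) \<longlonglongrightarrow> v" "(%n. abs_l2 (trunc n h)) \<longlonglongrightarrow> w"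
  using trunc_tendsto[OF f(2)] trunc_tendsto[OF h(2)] by (auto simp: f h)
 have "(%n. inner (fourier (abs_l2 (trunc n f))) (abs_l2 (trunc n h))) \<longlonglongrightarrow> inner (fourier v) w"
  by (rule tendsto_inner[OF isometry_tendsto[OF fourier_diff norm_fourier F(1)] F(2)])
 moreover have "(%n. inner (abs_l2 (trunc n f)) (inv_fourier (abs_l2 (trunc n h)))) \<longlonglongrightarrow> inner v (inv_fourier w)"
  by (rule tendsto_inner[OF F(1) isometry_tendsto[OF inv_fourier_diff norm_inv_fourier F(2)]])
 ultimately show ?thesis unfolding eq using LIMSEQ_unique by blast
qed

text \<open>Since \<open>fourier\<close> preserves inner products, its adjoint is a left inverse.
  The companion lemma uses that the adjoint preserves them too.\<close>

lemma inv_fourier_fourier: "inv_fourier (fourier v) = v"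
proof -
 have "inner x (inv_fourier (fourier v)) = inner x v" for x
  unfolding fourier_adjoint[symmetric] by (rule isometry_inner[OF fourier_diff norm_fourier])
 then have "inner (inv_fourier (fourier v) - v) (inv_fourier (fourier v) - v) = 0" by (simp add: inner_diff_right)
 then show ?thesis by simp
qed

lemma fourier_inv_fourier: "fourier (inv_fourier v) = v"
proof -
 have "inner (fourier (inv_fourier v)) x = inner v x" for x
  unfolding fourier_adjoint by (rule isometry_inner[OF inv_fourier_diff norm_inv_fourier])
 then have "inner (fourier (inv_fourier v) - v) (fourier (inv_fourier v) - v) = 0" by (simp add: inner_diff_left)
 then show ?thesis by simp
qed

section \<open>The propagator and its dispersive estimate\<close>

definition symbol :: "real => 'a::euclidean_space => complex" where
 "symbol t xi = cis (- 4 * pi^2 * t * (norm xi)^2)"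

definition multiplier :: "real => 'a::euclidean_space l2 => 'a l2" where
 "multiplier t v = abs_l2 (%xi. symbol t xi * rep_l2 v xi)"

lemma symbol_borel [measurable]: "symbol t : borel_measurable borel"
 unfolding symbol_def[abs_def] by measurable

lemma symbol_L2: "f : L2 ==> (%xi. symbol t xi * f xi) : L2"
 by (rule L2_mult_bounded[where C = 1]) (auto intro: borel_lebesgue simp: symbol_def)

lemma multiplier_abs: "f : L2 ==> multiplier t (abs_l2 f) = abs_l2 (%xi. symbol t xi * f xi)"
 unfolding multiplier_def using rep_abs_l2[of f] by (subst abs_l2_eq_iff) (auto intro: symbol_L2 elim: eventually_mono)

lemma multiplier_diff: "multiplier t (v - w) = multiplier t v - multiplier t w"
proof -
 have "multiplier t (abs_l2 (rep_l2 v) - abs_l2 (rep_l2 w)) = multiplier t (abs_l2 (rep_l2 v)) - multiplier t (abs_l2 (rep_l2 w))"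
  by (simp only: abs_l2_diff rep_l2_in multiplier_abs L2_diff symbol_L2 right_diff_distrib)
 then show ?thesis by simp
qed

lemma norm_multiplier: "norm (multiplier t v) = norm v"
proof -
 have "norm (multiplier t (abs_l2 (rep_l2 v))) = norm (abs_l2 (rep_l2 v))"
  by (simp only: multiplier_abs rep_l2_in norm_abs_l2 symbol_L2 norm_mult) (simp add: symbol_def)
 then show ?thesis by simp
qed

lemma multiplier_add: "multiplier s (multiplier t v) = multiplier (s + t) v"
proof -
 have "symbol s xi * (symbol t xi * c) = symbol (s + t) xi * c" for xi :: 'a and c
  unfolding symbol_def mult.assoc[symmetric] cis_mult by (simp add: algebra_simps)
 then have "multiplier s (multiplier t (abs_l2 (rep_l2 v))) = multiplier (s + t) (abs_l2 (rep_l2 v))"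
  by (simp only: multiplier_abs rep_l2_in symbol_L2)
 then show ?thesis by simp
qed

lemma multiplier_zero: "multiplier 0 v = v"
 by (simp add: multiplier_def symbol_def)

lemma multiplier_tendsto:
 assumes "X \<longlonglongrightarrow> t" shows "(%n. multiplier (X n) v) \<longlonglongrightarrow> multiplier t v"
 unfolding multiplier_def
proof (rule l2_dominated_convergence(3)[where C = 1 and w = "rep_l2 v"])
 show "AE x in lebesgue. (%k. symbol (X k) x * rep_l2 v x) \<longlonglongrightarrow> symbol t x * rep_l2 v x"
  unfolding symbol_def using assms
  by (intro AE_I2 tendsto_mult tendsto_const isCont_tendsto_compose[of _ cis]) (auto simp: cis_conv_exp[abs_def] intro!: continuous_intros tendsto_intros)
 show "(%x. symbol t x * rep_l2 v x) : borel_measurable lebesgue" by (rule L2D(1)[OF symbol_L2[OF rep_l2_in]])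
 show "(%x. symbol (X k) x * rep_l2 v x) : borel_measurable lebesgue" for k by (rule L2D(1)[OF symbol_L2[OF rep_l2_in]])
qed (auto simp: norm_mult symbol_def)

definition propagator :: "real => 'a::euclidean_space l2 => 'a l2" where
 "propagator t v = inv_fourier (multiplier t (fourier v))"

lemma propagator_diff: "propagator t (v - w) = propagator t v - propagator t w"
 by (simp add: propagator_def inv_fourier_diff multiplier_diff fourier_diff)

lemma norm_propagator: "norm (propagator t v) = norm v"
 by (simp add: propagator_def norm_inv_fourier norm_multiplier norm_fourier)

lemma propagator_add: "propagator s (propagator t v) = propagator (s + t) v"
 by (simp add: propagator_def fourier_inv_fourier multiplier_add)

lemma propagator_zero: "propagator 0 v = v"
 by (simp add: propagator_def multiplier_zero inv_fourier_fourier)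

lemma propagator_inner: "inner (propagator t v) (propagator t w) = inner v w"
 by (rule isometry_inner[OF propagator_diff norm_propagator])

lemma propagator_tendsto:
 assumes "X \<longlonglongrightarrow> t" shows "(%n. propagator (X n) v) \<longlonglongrightarrow> propagator t v"
 unfolding propagator_def
 by (rule isometry_tendsto[OF inv_fourier_diff norm_inv_fourier multiplier_tendsto[OF assms]])

text \<open>Fourier inversion shows that \<open>propagator\<close> provides a candidate for the
  choice in \<open>schrodinger\<close>; injectivity of the transform identifies the chosen function
  up to null sets.\<close>

lemma schrodinger_propagator:
 fixes f :: "'a::euclidean_space => complex"
 assumes f: "f : L2" shows "schrodinger t f : L2" "abs_l2 (schrodinger t f) = propagator t (abs_l2 f)"
proof -
 have iff: "(AE xi in lebesgue. fourier_L2 v xi = cis (- 4 * pi^2 * t * (norm xi)^2) * fourier_L2 f xi)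
   \<longleftrightarrow> fourier (abs_l2 v) = multiplier t (fourier (abs_l2 f))" if v: "v : L2" for v
  unfolding fourier_abs[OF v, symmetric] fourier_abs[OF f, symmetric] multiplier_abs[OF fourier_L2_limit(1)[OF f]]
  using abs_l2_eq_iff[OF fourier_L2_limit(1)[OF v] symbol_L2[OF fourier_L2_limit(1)[OF f], of t]] unfolding symbol_def by (rule sym)
 define P where "P v \<longleftrightarrow> v : L2 &
  (AE xi in lebesgue. fourier_L2 v xi = cis (- 4 * pi^2 * t * (norm xi)^2) * fourier_L2 f xi)" for v
 have "P (rep_l2 (propagator t (abs_l2 f)))"
  unfolding P_def using iff[of "rep_l2 (propagator t (abs_l2 f))"] by (simp add: propagator_def fourier_inv_fourier)
 then have "P (SOME v. P v)" by (rule someI[where P = P])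
 moreover have "schrodinger t f = (SOME v. P v)" unfolding schrodinger_def P_def ..
 ultimately have s: "P (schrodinger t f)" by simp
 then show "schrodinger t f : L2" by (simp add: P_def)
 have "fourier (abs_l2 (schrodinger t f)) = multiplier t (fourier (abs_l2 f))" using s iff unfolding P_def by blast
 then have "inv_fourier (fourier (abs_l2 (schrodinger t f))) = inv_fourier (multiplier t (fourier (abs_l2 f)))" by (rule arg_cong)
 then show "abs_l2 (schrodinger t f) = propagator t (abs_l2 f)"
  unfolding propagator_def by (simp only: inv_fourier_fourier)
qed

text \<open>Isometry moves the pairing to frequency, where the product of the two transforms is
  integrable; dominated convergence then removes the Gaussian weight from the regularized
  bound.\<close>

theorem propagator_dispersive:
 fixes f h :: "'a::euclidean_space => complex"
 assumes f: "f : borel_measurable borel" "integrable lborel f" "f : L2"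
  and h: "h : borel_measurable borel" "integrable lborel h" "h : L2" and t: "t ~= 0"
 shows "\<bar>inner (propagator t (abs_l2 f)) (abs_l2 h)\<bar> <= \<bar>t\<bar> powr (- (DIM('a) / 2)) * (LINT x|lborel. cmod (f x)) * (LINT x|lborel. cmod (h x))"
proof -
 define F where "F = fourier_integral f"
 define H where "H = fourier_integral h"
 have F: "F : borel_measurable borel" "F : L2" "fourier (abs_l2 f) = abs_l2 F"
  unfolding F_def using f by (auto simp: fourier_integral_borel plancherel fourier_integrable)
 have H: "H : borel_measurable borel" "H : L2" "fourier (abs_l2 h) = abs_l2 H"
  unfolding H_def using h by (auto simp: fourier_integral_borel plancherel fourier_integrable)
 note [measurable] = F(1) H(1)
 define B where "B = \<bar>t\<bar> powr (- (DIM('a) / 2)) * (LINT x|lborel. cmod (f x)) * (LINT x|lborel. cmod (h x))"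
 define tau where "tau = 4 * pi^2 * t"
 have tau: "tau ~= 0" using t by (simp add: tau_def)
 have sF: "(%xi. symbol t xi * F xi) : L2" by (rule symbol_L2[OF F(2)])
 define G where "G xi = symbol t xi * F xi * cnj (H xi)" for xi
 have [measurable]: "G : borel_measurable borel" unfolding G_def by measurable
 have Gi: "integrable lborel G"
 proof -
  have "integrable lebesgue G" using L2_integrable_mult[OF sF H(2)] by (simp add: G_def[abs_def])
  then show ?thesis by (simp add: integrable_completion)
 qed
 have "inner (propagator t (abs_l2 f)) (abs_l2 h) = inner (fourier (propagator t (abs_l2 f))) (fourier (abs_l2 h))"
  by (rule isometry_inner[OF fourier_diff norm_fourier, symmetric])
 also have "... = inner (abs_l2 (%xi. symbol t xi * F xi)) (abs_l2 H)"
  by (simp add: propagator_def fourier_inv_fourier F(3) H(3) multiplier_abs[OF F(2)])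
 also have "... = Re (CLINT xi|lborel. G xi)"
  using sF H by (simp add: inner_abs_l2 L2_inner_borel G_def)
 finally have eq: "inner (propagator t (abs_l2 f)) (abs_l2 h) = Re (CLINT xi|lborel. G xi)" .
 have lim: "(%n. CLINT xi|lborel. complex_of_real (exp (- (1 / real (Suc n)) * (norm xi)^2)) * G xi) \<longlonglongrightarrow> (CLINT xi|lborel. G xi)"
 proof (rule integral_dominated_convergence[where w = "%xi. cmod (G xi)"])
  show "AE xi in lborel. (%n. complex_of_real (exp (- (1 / real (Suc n)) * (norm xi)^2)) * G xi) \<longlonglongrightarrow> G xi"
  proof (rule AE_I2)
   fix xi :: 'a
   have "(%n. complex_of_real (exp (- (1 / real (Suc n)) * (norm xi)^2)) * G xi) \<longlonglongrightarrow> complex_of_real (exp (- 0 * (norm xi)^2)) * G xi"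
    by (intro tendsto_mult tendsto_of_real tendsto_exp tendsto_minus tendsto_const LIMSEQ_Suc lim_1_over_n)
   then show "(%n. complex_of_real (exp (- (1 / real (Suc n)) * (norm xi)^2)) * G xi) \<longlonglongrightarrow> G xi" by simp
  qed
  show "AE xi in lborel. norm (complex_of_real (exp (- (1 / real (Suc n)) * (norm xi)^2)) * G xi) <= cmod (G xi)" for n
   by (intro AE_I2) (simp add: norm_mult mult_left_le_one_le)
 qed (use Gi in auto)
 have bound: "cmod (CLINT xi|lborel. complex_of_real (exp (- (1 / real (Suc n)) * (norm xi)^2)) * G xi) <= B" for n
 proof -
  have "complex_of_real (exp (- (1 / real (Suc n)) * (norm xi)^2)) * G xi
    = complex_of_real (exp (- (1 / real (Suc n)) * (norm xi)^2)) * cis (- tau * (norm xi)^2) * (F xi * cnj (H xi))" for xi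
  proof -
   have "symbol t xi = cis (- tau * (norm xi)^2)" by (simp add: symbol_def tau_def)
   then show ?thesis by (simp only: G_def mult.assoc)
  qed
  then have eqG: "(%xi. complex_of_real (exp (- (1 / real (Suc n)) * (norm xi)^2)) * G xi)
    = (%xi. complex_of_real (exp (- (1 / real (Suc n)) * (norm xi)^2)) * cis (- tau * (norm xi)^2) * (F xi * cnj (H xi)))" by (rule ext)
  have "0 < 1 / real (Suc n)" by simp
  from regularized_dispersive[OF f(1) h(1) f(2) h(2) this tau]
  have "cmod (CLINT xi|lborel. complex_of_real (exp (- (1 / real (Suc n)) * (norm xi)^2)) * G xi)
    <= (pi / \<bar>tau\<bar>) powr (DIM('a) / 2) * (LINT x|lborel. cmod (f x)) * (LINT x|lborel. cmod (h x))"
   unfolding eqG F_def H_def .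
  also have "... <= B" unfolding B_def
  proof (intro mult_right_mono)
   \<comment> \<open>The exact kernel bound is (4 pi |t|)^(-d/2); the factor 4 pi is given
     away.\<close>
   have "pi / \<bar>tau\<bar> = 1 / (4 * pi * \<bar>t\<bar>)" by (simp add: tau_def abs_mult power2_eq_square)
   also have "... <= 1 / \<bar>t\<bar>" using t pi_gt3 by (intro divide_left_mono) (auto simp: mult_le_cancel_right1)
   finally have "(pi / \<bar>tau\<bar>) powr (DIM('a) / 2) <= (1 / \<bar>t\<bar>) powr (DIM('a) / 2)" by (intro powr_mono2) auto
   then show "(pi / \<bar>tau\<bar>) powr (DIM('a) / 2) <= \<bar>t\<bar> powr (- (DIM('a) / 2))" using t by (simp add: powr_divide powr_minus_divide)
  qed auto
  finally show ?thesis .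
 qed
 have "cmod (CLINT xi|lborel. G xi) <= B"
  by (rule LIMSEQ_le_const2[OF tendsto_norm[OF lim]]) (use bound in blast)
 then show ?thesis unfolding eq B_def[symmetric] using abs_Re_le_cmod order_trans by blast
qed

section \<open>Lebesgue norms by reciprocal exponent, and meshes\<close>

lemma ennreal_powr_ennreal: "0 <= a ==> ennreal_powr (ennreal a) s = ennreal (a powr s)"
 by (simp add: ennreal_powr_def)

lemma ennreal_powr_mono: "0 < s ==> x <= y ==> ennreal_powr x s <= ennreal_powr y s"
 by (cases x; cases y) (auto simp: ennreal_powr_def top_unique powr_mono2)

lemma ennreal_powr_powr: "0 < s ==> ennreal_powr (ennreal_powr x s) (1 / s) = x"
 by (cases x) (auto simp: ennreal_powr_def powr_powr)

lemma ennreal_powr_measurable [measurable]: "(%x. ennreal_powr x s) : borel_measurable borel"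
 unfolding ennreal_powr_def by measurable

text \<open>The case split is forced by \<open>1 / 0 = 0\<close> in the reals, where infinity is
  wanted.\<close>

definition expo :: "real => ennreal" where "expo rho = (if rho = 0 then \<infinity> else ennreal (1 / rho))"

lemma Lp_norm_expo:
 assumes "0 < rho"
 shows "Lp_norm (expo rho) h = ennreal_powr (\<integral>\<^sup>+x. ennreal_powr (h x) (1 / rho) \<partial>lebesgue) rho"
 using assms by (simp add: Lp_norm_def expo_def)

lemma Lp_norm_expo_le:
 assumes "0 < rho" "0 <= B" and le: "(\<integral>\<^sup>+x. ennreal_powr (h x) (1 / rho) \<partial>lebesgue) <= ennreal (B powr (1 / rho))"
 shows "Lp_norm (expo rho) h <= ennreal B"
proof -
 have "Lp_norm (expo rho) h <= ennreal_powr (ennreal (B powr (1 / rho))) rho"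
  unfolding Lp_norm_expo[OF assms(1)] by (rule ennreal_powr_mono[OF assms(1) le])
 also have "... = ennreal B" using assms by (simp add: ennreal_powr_ennreal powr_powr)
 finally show ?thesis .
qed

text \<open>The condition on \<open>h\<close> concerns the infinite exponent: \<open>esssup\<close>
  of a nonmeasurable function is \<open>top\<close> by definition.\<close>

lemma Lp_norm_mono:
 assumes "0 <= rho" "rho = 0 ==> h : borel_measurable lebesgue" "!!x. h x <= k x"
 shows "Lp_norm (expo rho) h <= Lp_norm (expo rho) k"
proof (cases "rho = 0")
 case True
 then show ?thesis using assms by (simp add: Lp_norm_def expo_def esssup_mono)
next
 case False
 then have rho: "0 < rho" using assms by simp
 show ?thesis unfolding Lp_norm_expo[OF rho] using assms rho
  by (intro ennreal_powr_mono nn_integral_mono) auto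
qed

lemma Lp_norm_cong_AE:
 assumes "0 < rho" "AE x in lebesgue. h x = k x"
 shows "Lp_norm (expo rho) h = Lp_norm (expo rho) k"
 unfolding Lp_norm_expo[OF assms(1)]
 by (intro arg_cong[where f = "%x. ennreal_powr x rho"] nn_integral_cong_AE) (use assms(2) in \<open>auto elim: eventually_mono\<close>)

lemma esssup_le_iff:
 fixes f :: "'a => ennreal"
 assumes f: "f : borel_measurable M"
 shows "esssup M f <= c \<longleftrightarrow> (AE x in M. f x <= c)"
 using esssup_I[OF f] esssup_AE[where M = M and f = f] by (auto elim!: eventually_mono intro: order_trans)

text \<open>Finite exponents are Tonelli. For the infinite one, the essential supremum of a section
  exceeds \<open>c\<close> exactly when the section of a Borel set has positive measure, and these
  measures depend measurably on \<open>t\<close>.\<close>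

lemma Lp_norm_borel:
 fixes A :: "'b::euclidean_space => 'a::euclidean_space => ennreal"
 assumes A: "(%(t, x). A t x) : borel_measurable (lborel \<Otimes>\<^sub>M lborel)" and rho: "0 <= rho"
 shows "(%t. Lp_norm (expo rho) (A t)) : borel_measurable borel"
proof -
 note [measurable] = A
 have sec: "A t : borel_measurable borel" for t
  using measurable_Pair2[OF A, of t] by simp
 show ?thesis
 proof (cases "rho = 0")
  case False
  then have r: "0 < rho" using rho by simp
  have "(\<integral>\<^sup>+x. ennreal_powr (A t x) (1 / rho) \<partial>lebesgue) = (\<integral>\<^sup>+x. ennreal_powr (A t x) (1 / rho) \<partial>lborel)" for t
   by (rule nn_integral_completion)
  moreover have "(%t. \<integral>\<^sup>+x. ennreal_powr (A t x) (1 / rho) \<partial>lborel) : borel_measurable lborel"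
   by measurable
  ultimately show ?thesis unfolding Lp_norm_expo[OF r] by simp
 next
  case True
  have "(%t. esssup lebesgue (A t)) : borel_measurable lborel"
  proof (rule borel_measurableI_greater)
   fix c
   define Q where "Q = {p : space (lborel \<Otimes>\<^sub>M lborel). c < (case p of (t, x) => A t x)}"
   have Q: "Q : sets (lborel \<Otimes>\<^sub>M lborel)" unfolding Q_def by measurable
   have "c < esssup lebesgue (A t) \<longleftrightarrow> 0 < emeasure lborel (Pair t -` Q)" for t
   proof -
    have AL: "A t : borel_measurable lebesgue" using sec by (simp add: measurable_completion)
    have "\<not> c < esssup lebesgue (A t) \<longleftrightarrow> (AE x in lebesgue. A t x <= c)"
     by (simp add: not_less esssup_le_iff[OF AL])
    also have "... \<longleftrightarrow> (AE x in lborel. A t x <= c)" using sec[of t]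
     by (intro AE_completion_iff)
    also have "... \<longleftrightarrow> emeasure lborel {x : space lborel. \<not> A t x <= c} = 0"
     using sec[of t] by (intro AE_iff_measurable[OF _ refl]) measurable
    also have "{x : space lborel. \<not> A t x <= c} = Pair t -` Q" by (auto simp: Q_def space_pair_measure not_le)
    finally show ?thesis by (auto simp: zero_less_iff_neq_zero)
   qed
   then have "{t : space lborel. c < esssup lebesgue (A t)} = {t : space lborel. 0 < emeasure lborel (Pair t -` Q)}" by simp
   also have "... : sets lborel"
    using sigma_finite_measure.measurable_emeasure_Pair[OF sigma_finite_lborel Q] by measurable
   finally show "{t : space lborel. c < esssup lebesgue (A t)} : sets lborel" .
  qed
  then show ?thesis using True by (simp add: Lp_norm_def expo_def)
 qed
qed

text \<open>\<open>c\<close> sends a point to the label of its cell. The common measure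
  \<open>m\<close> makes discrete norms rescaled integrals, and the diameter bound fits a whole cell
  into a ball where a window is bounded below.\<close>

definition mesh :: "real => real => ('a::euclidean_space => 'k) => bool" where
 "mesh delta m c \<longleftrightarrow> 0 < m & (ALL k. {x. c x = k} : sets borel) & (ALL x. emeasure lborel {y. c y = c x} = ennreal m)
  & (ALL x y. c x = c y --> dist x y < delta)"

lemma floor_eq_scaled:
 fixes t h :: real
 assumes "0 < h" shows "(floor (t / h)) = n \<longleftrightarrow> of_int n * h <= t & t < (of_int n + 1) * h"
 using assms by (simp add: floor_eq_iff pos_le_divide_eq pos_divide_less_eq)

lemma mesh_floor: assumes "0 < h" shows "mesh h h (%t::real. (floor (t / h)))"
proof -
 have I: "{t. (floor (t / h)) = n} = {of_int n * h..<(of_int n + 1) * h}" for n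
  using floor_eq_scaled[OF assms] by auto
 have "emeasure lborel {t. (floor (t / h)) = n} = ennreal h" for n
  unfolding I using assms by (subst emeasure_lborel_Ico) (auto simp: algebra_simps)
 moreover have "dist x y < h" if "(floor (x / h)) = (floor (y / h))" for x y
 proof -
  have "of_int (floor (y / h)) * h <= x & x < (of_int (floor (y / h)) + 1) * h" "of_int (floor (y / h)) * h <= y & y < (of_int (floor (y / h)) + 1) * h"
   using that floor_eq_scaled[OF assms, of x "(floor (y / h))"] floor_eq_scaled[OF assms, of y "(floor (y / h))"] by auto
  then show ?thesis by (auto simp: dist_real_def abs_if algebra_simps)
 qed
 ultimately show ?thesis unfolding mesh_def using assms by (auto simp: I)
qed

definition cell :: "real => 'a::euclidean_space => 'a" where
 "cell h x = (SUM b:Basis. of_int \<lfloor>x \<bullet> b / h\<rfloor> *\<^sub>R b)"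

lemma cell_eq:
 fixes x y :: "'a::euclidean_space"
 shows "cell h x = cell h y \<longleftrightarrow> (ALL b:Basis. \<lfloor>x \<bullet> b / h\<rfloor> = \<lfloor>y \<bullet> b / h\<rfloor>)"
proof -
 have "cell h x \<bullet> b = of_int \<lfloor>x \<bullet> b / h\<rfloor>" if "b : Basis" for x b :: 'a
  unfolding cell_def using that by (rule inner_sum_left_Basis)
 then show ?thesis by (subst euclidean_eq_iff) simp
qed

lemma mesh_cell:
 fixes h :: real
 assumes h: "0 < h"
 shows "mesh (DIM('a) * h) (h ^ DIM('a)) (cell h :: 'a::euclidean_space => 'a)"
proof -
 have "cell h : borel_measurable (borel :: 'a measure)" unfolding cell_def[abs_def] by measurable
 then have meas: "{x. cell h x = k} : sets borel" for k :: 'a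
  using measurable_sets[of "cell h" borel borel "{k}"] by (simp add: vimage_def)
 have "emeasure lborel {y. cell h y = cell h x} = ennreal (h ^ DIM('a))" for x :: 'a
 proof (rule antisym)
  define l :: 'a where "l = (SUM b:Basis. (of_int \<lfloor>x \<bullet> b / h\<rfloor> * h) *\<^sub>R b)"
  define u :: 'a where "u = (SUM b:Basis. ((of_int \<lfloor>x \<bullet> b / h\<rfloor> + 1) * h) *\<^sub>R b)"
  have lu: "l \<bullet> b = of_int \<lfloor>x \<bullet> b / h\<rfloor> * h" "u \<bullet> b = (of_int \<lfloor>x \<bullet> b / h\<rfloor> + 1) * h" if "b : Basis" for b
   unfolding l_def u_def by (simp_all only: inner_sum_left_Basis[OF that])
  have iff: "cell h y = cell h x \<longleftrightarrow> (ALL b:Basis. l \<bullet> b <= y \<bullet> b & y \<bullet> b < u \<bullet> b)" for y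
   unfolding cell_eq using lu floor_eq_scaled[OF h] by (auto simp: )
  have "l \<bullet> b <= u \<bullet> b" "(u - l) \<bullet> b = h" if "b : Basis" for b using lu[OF that] h by (auto simp: algebra_simps inner_diff_left)
  then have v: "emeasure lborel (cbox l u) = ennreal (h ^ DIM('a))" "emeasure lborel (box l u) = ennreal (h ^ DIM('a))"
   by (simp_all add: emeasure_lborel_cbox_eq emeasure_lborel_box_eq)
  have "emeasure lborel {y. cell h y = cell h x} <= emeasure lborel (cbox l u)"
   by (rule emeasure_mono) (auto simp: iff mem_box less_imp_le)
  then show "emeasure lborel {y. cell h y = cell h x} <= ennreal (h ^ DIM('a))" using v by simp
  have "emeasure lborel (box l u) <= emeasure lborel {y. cell h y = cell h x}"
   by (rule emeasure_mono) (use meas in \<open>auto simp: iff mem_box less_imp_le\<close>)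
  then show "ennreal (h ^ DIM('a)) <= emeasure lborel {y. cell h y = cell h x}" using v by simp
 qed
 moreover have "dist x y < DIM('a) * h" if "cell h x = cell h y" for x y :: 'a
 proof -
  have "norm (x - y) <= (SUM b:Basis. \<bar>(x - y) \<bullet> b\<bar>)" by (rule norm_le_l1)
  also have "... < (SUM b:(Basis :: 'a set). h)"
  proof (rule sum_strict_mono)
   fix b :: 'a assume "b : Basis"
   then have "\<lfloor>x \<bullet> b / h\<rfloor> = \<lfloor>y \<bullet> b / h\<rfloor>" using that by (simp add: cell_eq)
   then have "dist (x \<bullet> b) (y \<bullet> b) < h" using mesh_floor[OF h] by (simp add: mesh_def)
   then show "\<bar>(x - y) \<bullet> b\<bar> < h" by (simp add: dist_real_def inner_diff_left)
  qed auto
  finally show ?thesis by (simp add: dist_norm)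
 qed
 ultimately show ?thesis unfolding mesh_def using h meas by simp
qed

lemma emeasure_ball_le:
 fixes y :: "'a::euclidean_space"
 assumes "0 <= R" shows "emeasure lborel (ball y R) <= ennreal ((2 * R) ^ DIM('a))"
proof -
 have "ball y R <= cbox (y - R *\<^sub>R One) (y + R *\<^sub>R One)"
 proof
  fix x assume x: "x : ball y R"
  have "\<bar>(x - y) \<bullet> b\<bar> <= R" if "b : Basis" for b
   using Basis_le_norm[OF that, of "x - y"] x by (simp add: dist_norm norm_minus_commute)
  then show "x : cbox (y - R *\<^sub>R One) (y + R *\<^sub>R One)"
   by (force simp: mem_box inner_diff_left inner_add_left abs_le_iff)
 qed
 then have "emeasure lborel (ball y R) <= emeasure lborel (cbox (y - R *\<^sub>R One) (y + R *\<^sub>R One))" by (intro emeasure_mono) auto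
 also have "... = ennreal ((2 * R) ^ DIM('a))"
  using assms by (simp add: emeasure_lborel_cbox_eq inner_diff_left inner_add_left)
 finally show ?thesis .
qed

text \<open>The cells meeting a ball are disjoint, of equal measure, and contained in the ball
  enlarged by \<open>delta\<close>.\<close>

lemma mesh_card:
 fixes c :: "'a::euclidean_space => 'k"
 assumes c: "mesh delta m c" and R: "0 < R"
 shows "finite (c ` ball y R)" "real (card (c ` ball y R)) <= (2 * (R + delta)) ^ DIM('a) / m"
proof -
 have m: "0 < m" using c by (simp add: mesh_def)
 have "dist y y < delta" using c unfolding mesh_def by blast
 then have delta: "0 < delta" by simp
 have bd: "real (card T) <= (2 * (R + delta)) ^ DIM('a) / m" if T: "T <= c ` ball y R" "finite T" for T
 proof -
  have "ennreal (real (card T) * m) = (SUM k:T. emeasure lborel {x. c x = k})"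
  proof -
   have "emeasure lborel {x. c x = k} = ennreal m" if "k : T" for k using that T c by (auto simp: mesh_def)
   then have "(SUM k:T. emeasure lborel {x. c x = k}) = (SUM k:T. ennreal m)" by (intro sum.cong) auto
   then show ?thesis using m by (simp add: ennreal_mult' ennreal_of_nat_eq_real_of_nat)
  qed
  also have "... = emeasure lborel (\<Union>k\<in>T. {x. c x = k})"
   using T c by (intro sum_emeasure) (auto simp: mesh_def disjoint_family_on_def)
  also have "... <= emeasure lborel (ball y (R + delta))"
  proof (rule emeasure_mono)
   show "(\<Union>k\<in>T. {x. c x = k}) <= ball y (R + delta)"
   proof
    fix x assume "x : (\<Union>k\<in>T. {x. c x = k})"
    then obtain z where z: "dist y z < R" "c z = c x" using T by auto
    then have "dist z x < delta" using c by (auto simp: mesh_def)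
    with z show "x : ball y (R + delta)" using dist_triangle[of y x z] by simp
   qed
  qed simp
  also have "... <= ennreal ((2 * (R + delta)) ^ DIM('a))" using R delta by (intro emeasure_ball_le) auto
  finally have "real (card T) * m <= (2 * (R + delta)) ^ DIM('a)" using R delta by (simp add: ennreal_le_iff)
  then show ?thesis using m by (simp add: field_simps)
 qed
 define M where "M = nat (floor ((2 * (R + delta)) ^ DIM('a) / m))"
 have "card T <= M" if "T <= c ` ball y R" "finite T" for T
  using bd[OF that] unfolding M_def by linarith
 then have "finite (c ` ball y R) & card (c ` ball y R) <= M" by (intro finite_if_finite_subsets_card_bdd) auto
 then show "finite (c ` ball y R)" "real (card (c ` ball y R)) <= (2 * (R + delta)) ^ DIM('a) / m"
  using bd by auto
qed

text \<open>Discrete below continuous: \<open>y\<close> runs through a translated cell. The shift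
  \<open>z\<close> will be the centre of the ball where the window is large, so that the window at
  \<open>y\<close> sees the whole cell of \<open>z + y\<close>.\<close>

lemma mesh_input:
 fixes c :: "'a::euclidean_space => 'k"
 assumes c: "mesh delta m c" and K: "finite K" "K <= range c" and s: "0 < s"
  and le: "!!y. N (c (z + y)) <= A y"
 shows "(SUM k:K. ennreal m * ennreal_powr (N k) s) <= (\<integral>\<^sup>+y. ennreal_powr (A y) s \<partial>lebesgue)"
proof -
 define E where "E k = {y. c (z + y) = k}" for k
 have Q: "{x. c x = k} : sets borel" for k using c by (auto simp: mesh_def)
 have Ev: "E k = (+) z -` {x. c x = k}" for k by (auto simp: E_def)
 have Em: "E k : sets lborel" for k
  unfolding Ev using measurable_sets[of "(+) z" borel borel, OF _ Q[of k]] by simp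
 have EK: "emeasure lborel (E k) = ennreal m" if "k : K" for k
 proof -
  have "emeasure lborel {x. c x = k} = emeasure (distr lborel borel ((+) z)) {x. c x = k}" by (simp only: lborel_distr_plus)
  also have "... = emeasure lborel (E k)" using Q by (subst emeasure_distr) (auto simp: Ev)
  finally show ?thesis using that K c by (auto simp: mesh_def)
 qed
 have "(SUM k:K. ennreal m * ennreal_powr (N k) s) = (SUM k:K. \<integral>\<^sup>+y. ennreal_powr (N k) s * indicator (E k) y \<partial>lborel)"
  by (intro sum.cong refl) (simp add: nn_integral_cmult_indicator[OF Em] EK mult.commute)
 also have "... = (\<integral>\<^sup>+y. (SUM k:K. ennreal_powr (N k) s * indicator (E k) y) \<partial>lborel)"
  using Em by (intro nn_integral_sum[symmetric]) auto
 also have "... = (\<integral>\<^sup>+y. (SUM k:K. ennreal_powr (N k) s * indicator (E k) y) \<partial>lebesgue)"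
  by (rule nn_integral_completion[symmetric])
 also have "... <= (\<integral>\<^sup>+y. ennreal_powr (A y) s \<partial>lebesgue)"
 proof (rule nn_integral_mono)
  fix y
  have "(SUM k:K. ennreal_powr (N k) s * indicator (E k) y) = (SUM k:K. if k = c (z + y) then ennreal_powr (N k) s else 0)"
   by (intro sum.cong) (auto simp: E_def)
  also have "... <= ennreal_powr (N (c (z + y))) s" using K by (simp add: sum.delta)
  also have "... <= ennreal_powr (A y) s" by (rule ennreal_powr_mono[OF s le])
  finally show "(SUM k:K. ennreal_powr (N k) s * indicator (E k) y) <= ennreal_powr (A y) s" .
 qed
 finally show ?thesis .
qed

lemma Lp_norm_expo_leD:
 assumes "0 < rho" "0 <= X" "Lp_norm (expo rho) A <= ennreal X"
 shows "(\<integral>\<^sup>+x. ennreal_powr (A x) (1 / rho) \<partial>lebesgue) <= ennreal (X powr (1 / rho))"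
 using ennreal_powr_mono[OF _ assms(3)[unfolded Lp_norm_expo[OF assms(1)]], of "1 / rho"] assms
 by (simp add: ennreal_powr_powr ennreal_powr_ennreal)

lemma mesh_input_lpn:
 fixes c :: "'a::euclidean_space => 'k"
 assumes c: "mesh delta m c" and K: "finite K" and rho: "0 < rho" and N: "!!k. 0 <= N k" "!!k. k \<notin> range c ==> N k = 0"
  and le: "!!y. ennreal (N (c (z + y))) <= A y" and X: "0 <= X" "Lp_norm (expo rho) A <= ennreal X"
 shows "lpn rho K N <= m powr (- rho) * X"
proof -
 have m: "0 < m" using c by (simp add: mesh_def)
 define K' where "K' = K \<inter> range c"
 have "ennreal (m * (SUM k:K'. N k powr (1 / rho))) = (SUM k:K'. ennreal m * ennreal_powr (ennreal (N k)) (1 / rho))"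
  using m N by (simp add: ennreal_powr_ennreal sum_distrib_left ennreal_mult' sum_nonneg flip: sum_ennreal)
 also have "... <= (\<integral>\<^sup>+y. ennreal_powr (A y) (1 / rho) \<partial>lebesgue)"
  using K rho le by (intro mesh_input[OF c, where N = "%k. ennreal (N k)"]) (auto simp: K'_def)
 also have "... <= ennreal (X powr (1 / rho))" by (rule Lp_norm_expo_leD[OF rho X])
 finally have "m * (SUM k:K'. N k powr (1 / rho)) <= X powr (1 / rho)" by (simp add: ennreal_le_iff)
 moreover have "(SUM k:K'. N k powr (1 / rho)) = (SUM k:K. N k powr (1 / rho))"
  unfolding K'_def using K N rho by (intro sum.mono_neutral_left) auto
 ultimately have "(SUM k:K. N k powr (1 / rho)) <= X powr (1 / rho) / m" using m by (simp add: field_simps)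
 then have "(SUM k:K. N k powr (1 / rho)) powr rho <= (X powr (1 / rho) / m) powr rho"
  using rho by (intro powr_mono2) (auto intro: sum_nonneg)
 also have "... = m powr (- rho) * X" using m rho X by (simp add: powr_divide powr_powr powr_minus_divide)
 finally show ?thesis using rho by (simp add: lpn_def)
qed

text \<open>The first factor bounds the number of cells meeting a ball of radius \<open>R\<close>;
  the second is a bound for the volume of the enlarged ball, raised to the reciprocal exponent. They
  are the two losses of \<open>mesh_output\<close>.\<close>

definition mesh_const :: "nat => real => real => real => real => real" where
 "mesh_const d delta m R rho = (2 * (R + delta)) ^ d / m * ((2 * (R + delta)) ^ d) powr rho"

text \<open>Continuous below discrete: a local sum is at most the number of its cells times their
  local norm, which lets the power pass to single entries. Each cell is then charged to a ball of
  volume at most \<open>V\<close>. Exhaustion by finite sets of cells reduces the integral to finite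
  sums.\<close>

lemma mesh_output:
 fixes c :: "'a::euclidean_space => 'k"
 assumes c: "mesh delta m c" and R: "0 < R" and rho: "0 <= rho" and N: "!!k. 0 <= N k"
  and B: "!!K. finite K ==> lpn rho K N <= B"
  and A: "!!y. A y <= ennreal (SUM k:c ` ball y R. N k)"
  and meas: "rho = 0 ==> A : borel_measurable lebesgue"
 shows "Lp_norm (expo rho) A <= ennreal (mesh_const DIM('a) delta m R rho * B)"
proof -
 define V where "V = (2 * (R + delta)) ^ DIM('a)"
 define J where "J = V / m"
 have m: "0 < m" using c by (simp add: mesh_def)
 have "dist (0::'a) 0 < delta" using c unfolding mesh_def by blast
 then have delta: "0 < delta" by simp
 have V: "0 <= V" "0 <= J" using R delta m by (auto simp: V_def J_def)
 have mc: "mesh_const DIM('a) delta m R rho = J * V powr rho" by (simp add: mesh_const_def J_def V_def)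
 have B0: "0 <= B" using B[of "{}"] lpn_nonneg[of "{}" rho N] by simp
 define S where "S y = c ` ball y R" for y
 have S: "finite (S y)" "card (S y) <= J" for y
  using mesh_card[OF c R, of y] by (auto simp: S_def J_def V_def)
 have sumle: "(SUM k:S y. N k) <= J * lpn rho (S y) N" for y
 proof -
  have "(SUM k:S y. N k) <= (SUM k:S y. lpn rho (S y) N)" by (intro sum_mono lpn_member S rho N)
  also have "... <= J * lpn rho (S y) N" using S[of y] lpn_nonneg[of "S y" rho N] by (simp add: mult_right_mono)
  finally show ?thesis .
 qed
 show ?thesis
 proof (cases "rho = 0")
  case True
  have "A y <= ennreal (J * B)" for y
  proof -
   have "(SUM k:S y. N k) <= J * B" using sumle[of y] mult_left_mono[OF B[OF S(1)] V(2), of y] by linarith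
   then show ?thesis using A[of y] unfolding S_def by (meson ennreal_leI order_trans)
  qed
  then have "esssup lebesgue A <= ennreal (J * B)" by (intro esssup_I meas True AE_I2)
  moreover have "ennreal (J * B) <= ennreal (J * V powr rho * B)"
   using True R delta by (simp add: V_def)
  ultimately show ?thesis unfolding mc using True by (simp add: Lp_norm_def expo_def)
 next
  case False
  then have r: "0 < rho" using rho by simp
  define s where "s = 1 / rho"
  have s: "0 < s" using r by (simp add: s_def)
  have lp: "lpn rho K N powr s = (SUM k:K. N k powr s)" for K
   using r by (simp add: lpn_def s_def powr_powr sum_nonneg)
  \<comment> \<open>An arbitrary point of cell \<open>k\<close>; whenever \<open>ball y R\<close>
    meets the cell, \<open>y\<close> is within \<open>R + delta\<close> of it.\<close>
  define q where "q k = (SOME x. c x = k)" for k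
  define T where "T k = ball (q k) (R + delta)" for k
  have T: "y : T k" if k: "k : S y" for y k
  proof -
   obtain w where w: "dist y w < R" "c w = k" using k by (auto simp: S_def)
   then have "c (q k) = k" unfolding q_def by (metis (mono_tags, lifting) someI)
   then have "dist w (q k) < delta" using w c by (auto simp: mesh_def)
   then show ?thesis using w dist_triangle[of y "q k" w] by (simp add: T_def dist_commute)
  qed
  define K where "K n = c ` ball 0 (real n + 1 + R)" for n :: nat
  have K: "finite (K n)" for n
  proof -
   have "0 < real n + 1 + R" using R by simp
   then show ?thesis unfolding K_def by (rule mesh_card(1)[OF c])
  qed
  define D where "D n y = (SUM k:K n. ennreal (J powr s * N k powr s) * indicator (T k) y)" for n :: nat and y :: 'a
  have gb: "(%y. ennreal (J powr s * N k powr s) * indicator (T k) y) : borel_measurable lborel" for k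
  proof -
   have "T k : sets lborel" by (simp add: T_def)
   then show ?thesis by (intro borel_measurable_times_ennreal borel_measurable_const borel_measurable_indicator)
  qed
  have gm: "(%y. ennreal (J powr s * N k powr s) * indicator (T k) y) : borel_measurable lebesgue" for k
   by (rule measurable_completion[OF gb])
  have Dm: "D n : borel_measurable lebesgue" for n
   unfolding D_def[abs_def] by (rule borel_measurable_sum) (rule gm)
  have inc: "incseq D"
  proof (intro incseq_SucI le_funI)
   fix n y
   have "K n <= K (Suc n)" unfolding K_def by (intro image_mono subset_ball) simp
   then show "D n y <= D (Suc n) y" unfolding D_def by (intro sum_mono2 K) auto
  qed
  have AD: "ennreal_powr (A y) s <= (SUP n. D n y)" for y
  proof -
   obtain n :: nat where n: "norm y <= real n" using real_arch_simple by blast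
   have "S y <= K n" unfolding S_def K_def
   proof (intro image_mono subsetI)
    fix x assume "x : ball y R"
    then show "x : ball 0 (real n + 1 + R)" using n norm_triangle_sub[of x y] by (simp add: dist_norm norm_minus_commute)
   qed
   then have SK: "S y <= K n" .
   have "ennreal_powr (A y) s <= ennreal_powr (ennreal (SUM k:S y. N k)) s"
    using A[of y] s by (intro ennreal_powr_mono) (auto simp: S_def)
   also have "... = ennreal ((SUM k:S y. N k) powr s)" using N by (simp add: ennreal_powr_ennreal sum_nonneg)
   also have "... <= ennreal ((J * lpn rho (S y) N) powr s)"
    using sumle[of y] N s by (intro ennreal_leI powr_mono2) (auto intro: sum_nonneg)
   also have "(J * lpn rho (S y) N) powr s = (SUM k:S y. J powr s * N k powr s)"
    by (simp add: powr_mult lp sum_distrib_left)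
   also have "ennreal ... = (SUM k:S y. ennreal (J powr s * N k powr s))" by (rule sum_ennreal[symmetric]) auto
   also have "... = (SUM k:S y. ennreal (J powr s * N k powr s) * indicator (T k) y)"
    using T by (intro sum.cong) auto
   also have "... <= D n y" unfolding D_def by (intro sum_mono2 K SK) auto
   also have "... <= (SUP n. D n y)" by (rule SUP_upper) simp
   finally show ?thesis .
  qed
  have DI: "(\<integral>\<^sup>+y. D n y \<partial>lebesgue) <= ennreal (J powr s * V * B powr s)" for n
  proof -
   have "(\<integral>\<^sup>+y. D n y \<partial>lebesgue) = (SUM k:K n. \<integral>\<^sup>+y. ennreal (J powr s * N k powr s) * indicator (T k) y \<partial>lebesgue)"
    unfolding D_def by (rule nn_integral_sum) (rule gm)
   also have "... = (SUM k:K n. ennreal (J powr s * N k powr s) * emeasure lborel (T k))"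
    unfolding T_def by (intro sum.cong refl) (simp add: nn_integral_cmult_indicator)
   also have "... <= (SUM k:K n. ennreal (J powr s * N k powr s) * ennreal V)"
    unfolding T_def V_def using R delta by (intro sum_mono mult_left_mono emeasure_ball_le) auto
   also have "... = (SUM k:K n. ennreal (J powr s * N k powr s * V))"
    using V by (intro sum.cong refl) (simp add: ennreal_mult')
   also have "... = ennreal (SUM k:K n. J powr s * N k powr s * V)" using V by (intro sum_ennreal) auto
   also have "(SUM k:K n. J powr s * N k powr s * V) = J powr s * V * lpn rho (K n) N powr s"
    unfolding lp by (simp add: sum_distrib_left ac_simps)
   also have "... <= J powr s * V * B powr s"
    using B[OF K[of n]] lpn_nonneg[OF K, of rho n N] V s by (intro mult_left_mono powr_mono2) auto
   finally show ?thesis using ennreal_leI by blast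
  qed
  have "(\<integral>\<^sup>+y. ennreal_powr (A y) s \<partial>lebesgue) <= (\<integral>\<^sup>+y. (SUP n. D n y) \<partial>lebesgue)"
   by (intro nn_integral_mono AD)
  also have "... = (SUP n. \<integral>\<^sup>+y. D n y \<partial>lebesgue)" by (rule nn_integral_monotone_convergence_SUP[OF inc Dm])
  also have "... <= ennreal (J powr s * V * B powr s)" by (intro SUP_least DI)
  also have "J powr s * V * B powr s = (J * V powr rho * B) powr s"
   using V B0 r by (simp add: powr_mult powr_powr s_def)
  finally show ?thesis unfolding mc s_def using V B0 by (intro Lp_norm_expo_le r) auto
 qed
qed

section \<open>Cells and windows in space\<close>

definition mult :: "('a::euclidean_space => complex) => 'a l2 => 'a l2" where
 "mult m v = abs_l2 (%x. m x * rep_l2 v x)"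

definition bdd_multiplier :: "('a::euclidean_space => complex) => real => bool" where
 "bdd_multiplier m C \<longleftrightarrow> m : borel_measurable lebesgue & (ALL x. cmod (m x) <= C)"

lemma bdd_mult_L2: "bdd_multiplier m C ==> f : L2 ==> (%x. m x * f x) : L2"
 unfolding bdd_multiplier_def by (rule L2_mult_bounded) auto

lemma mult_abs:
 assumes m: "bdd_multiplier m C" and f: "f : L2"
 shows "mult m (abs_l2 f) = abs_l2 (%x. m x * f x)"
proof -
 have "AE x in lebesgue. m x * rep_l2 (abs_l2 f) x = m x * f x" using rep_abs_l2[OF f] by eventually_elim simp
 then show ?thesis unfolding mult_def using abs_l2_eq_iff[OF bdd_mult_L2[OF m] bdd_mult_L2[OF m f]] by simp
qed

lemma norm_abs_mono:
 assumes f: "f : L2" and h: "h : L2" and C: "0 <= C" and le: "!!x. cmod (f x) <= C * cmod (h x)"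
 shows "norm (abs_l2 f) <= C * norm (abs_l2 h)"
proof -
 have "(LINT x|lebesgue. (cmod (f x))^2) <= (LINT x|lebesgue. C^2 * (cmod (h x))^2)"
 proof (rule integral_mono)
  show "(cmod (f x))^2 <= C^2 * (cmod (h x))^2" for x
   using power_mono[OF le[of x], of 2] by (simp add: power_mult_distrib)
 qed (use f h in \<open>auto intro!: L2D\<close>)
 then have "sqrt (LINT x|lebesgue. (cmod (f x))^2) <= sqrt (C^2 * (LINT x|lebesgue. (cmod (h x))^2))" by simp
 then show ?thesis using C by (simp add: norm_abs_l2 f h real_sqrt_mult)
qed

lemma linear_mult:
 assumes m: "bdd_multiplier m C" shows "linear (mult m)"
proof (rule linearI)
 fix v w and r :: real
 have "mult m (abs_l2 (rep_l2 v) + abs_l2 (rep_l2 w)) = mult m (abs_l2 (rep_l2 v)) + mult m (abs_l2 (rep_l2 w))"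
  by (simp only: abs_l2_add rep_l2_in L2_add mult_abs[OF m] bdd_mult_L2[OF m] distrib_left)
 then show "mult m (v + w) = mult m v + mult m w" by simp
 have "mult m (r *\<^sub>R abs_l2 (rep_l2 v)) = r *\<^sub>R mult m (abs_l2 (rep_l2 v))"
  by (simp only: abs_l2_scaleR rep_l2_in L2_cmult mult_abs[OF m] bdd_mult_L2[OF m] mult.left_commute)
 then show "mult m (r *\<^sub>R v) = r *\<^sub>R mult m v" by simp
qed

lemma norm_mult_le:
 assumes m: "bdd_multiplier m C" shows "norm (mult m v) <= C * norm v"
proof -
 have "0 <= C" using m unfolding bdd_multiplier_def by (meson norm_ge_zero order_trans)
 then have "norm (mult m (abs_l2 (rep_l2 v))) <= C * norm (abs_l2 (rep_l2 v))"
  unfolding mult_abs[OF m rep_l2_in]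
  by (intro norm_abs_mono bdd_mult_L2[OF m]) (use m in \<open>auto simp: norm_mult bdd_multiplier_def intro!: mult_right_mono\<close>)
 then show ?thesis by simp
qed

text \<open>The orthogonal projection onto functions living on cell \<open>k\<close>, acting on
  classes.\<close>

definition cut :: "('a::euclidean_space => 'k) => 'k => 'a l2 => 'a l2" where
 "cut c k v = mult (indicator {x. c x = k}) v"

context
 fixes c :: "'a::euclidean_space => 'k" and delta m :: real
 assumes c: "mesh delta m c"
begin

lemma bdd_cell: "bdd_multiplier (indicator {x. c x = k}) 1"
proof -
 have "{x. c x = k} : sets borel" using c by (auto simp: mesh_def)
 then show ?thesis unfolding bdd_multiplier_def by (auto intro!: borel_lebesgue borel_measurable_indicator simp: indicator_def)
qed

lemma cut_abs: "f : L2 ==> cut c k (abs_l2 f) = abs_l2 (%x. indicator {x. c x = k} x * f x)"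
 unfolding cut_def by (rule mult_abs[OF bdd_cell])

lemma cut_L2: "f : L2 ==> (%x. indicator {x. c x = k} x * f x) : L2"
 by (rule bdd_mult_L2[OF bdd_cell])

lemma cut_scaleR: "cut c k (r *\<^sub>R v) = r *\<^sub>R cut c k v"
 unfolding cut_def by (rule linear_scale[OF linear_mult[OF bdd_cell]])

lemma cut_zero: "cut c k 0 = 0"
 using cut_scaleR[of k 0 0] by simp

lemma cut_cut: "cut c k (cut c l v) = (if k = l then cut c k v else 0)"
proof -
 have z: "abs_l2 (%x. 0) = (0 :: 'a l2)" by (simp add: zero_l2.abs_eq)
 have "cut c k (cut c l (abs_l2 (rep_l2 v))) = abs_l2 (%x. indicator {x. c x = k} x * (indicator {x. c x = l} x * rep_l2 v x))"
  by (simp only: cut_abs cut_L2 rep_l2_in)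
 also have "(%x. indicator {x. c x = k} x * (indicator {x. c x = l} x * rep_l2 v x))
   = (if k = l then (%x. indicator {x. c x = k} x * rep_l2 v x) else (%x. 0))"
  by (auto simp: indicator_def)
 also have "abs_l2 ... = (if k = l then cut c k (abs_l2 (rep_l2 v)) else 0)"
  using z cut_abs[OF rep_l2_in, of k v] by (cases "k = l") simp_all
 finally show ?thesis by simp
qed

lemma inner_cut: "inner (cut c k v) w = inner v (cut c k w)"
proof -
 have "L2_inner (%x. indicator {x. c x = k} x * rep_l2 v x) (rep_l2 w) = L2_inner (rep_l2 v) (%x. indicator {x. c x = k} x * rep_l2 w x)"
  unfolding L2_inner_def by (intro Bochner_Integration.integral_cong refl) (auto simp: indicator_def)
 then have "inner (cut c k (abs_l2 (rep_l2 v))) (abs_l2 (rep_l2 w)) = inner (abs_l2 (rep_l2 v)) (cut c k (abs_l2 (rep_l2 w)))"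
  by (simp only: cut_abs rep_l2_in inner_abs_l2 cut_L2)
 then show ?thesis by simp
qed

lemma inner_cut_cut: "inner (cut c k v) (cut c l w) = (if k = l then inner v (cut c l w) else 0)"
 by (simp add: inner_cut cut_cut)

lemma cut_outside: "k \<notin> range c ==> cut c k v = 0"
proof -
 assume "k \<notin> range c"
 then have "{x. c x = k} = {}" by auto
 then show ?thesis by (simp add: cut_def mult_def zero_l2.abs_eq)
qed

lemma norm_sum_cut:
 assumes "finite K" shows "norm (SUM k:K. cut c k v) = lpn (1/2) K (%k. norm (cut c k v))"
proof -
 have "(norm (SUM k:K. cut c k v))^2 = (SUM k:K. SUM l:K. inner (cut c l v) (cut c k v))"
  unfolding power2_norm_eq_inner inner_sum_left inner_sum_right ..
 also have "... = (SUM k:K. SUM l:K. if l = k then inner (cut c k v) (cut c k v) else 0)"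
  by (intro sum.cong refl) (auto simp: inner_cut_cut inner_cut cut_cut)
 also have "... = (SUM k:K. (norm (cut c k v))^2)"
  using assms by (simp add: sum.delta power2_norm_eq_inner)
 finally show ?thesis using assms by (simp add: lpn_half L2_set_def real_sqrt_unique)
qed

lemma abs_sum: "finite K ==> (!!k. k : K ==> f k : L2) ==> (%x. SUM k:K. f k x) : L2 & abs_l2 (%x. SUM k:K. f k x) = (SUM k:K. abs_l2 (f k :: 'a => complex))"
proof (induction K rule: finite_induct)
 case (insert k K)
 then have k: "f k : L2" and K: "(%x. SUM k:K. f k x) : L2" "abs_l2 (%x. SUM k:K. f k x) = (SUM k:K. abs_l2 (f k))" by auto
 then show ?case using insert.hyps L2_add[OF k K(1)] abs_l2_add[OF k K(1)] by simp
qed (simp add: L2_zero zero_l2.abs_eq)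

text \<open>Finitely many cells meet the ball supporting the multiplier, and on that ball their
  indicators add up to 1.\<close>

lemma sum_cut_eq:
 assumes f: "f : L2" and R: "0 < R" and supp: "!!x. x \<notin> ball y R ==> m' x = 0" and m': "bdd_multiplier m' M"
 shows "mult m' (SUM k:c ` ball y R. cut c k (abs_l2 f)) = mult m' (abs_l2 f)"
proof -
 define K where "K = c ` ball y R"
 have K: "finite K" unfolding K_def by (rule mesh_card(1)[OF c R])
 note S = abs_sum[OF K, of "%k x. indicator {x. c x = k} x * f x", OF cut_L2[OF f]]
 have "(SUM k:K. cut c k (abs_l2 f)) = abs_l2 (%x. SUM k:K. indicator {x. c x = k} x * f x)"
  using S cut_abs[OF f] by simp
 then have "mult m' (SUM k:K. cut c k (abs_l2 f)) = abs_l2 (%x. m' x * (SUM k:K. indicator {x. c x = k} x * f x))"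
  using mult_abs[OF m' conjunct1[OF S]] by (simp only:)
 also have "(%x. m' x * (SUM k:K. indicator {x. c x = k} x * f x)) = (%x. m' x * f x)"
 proof
  fix x
  show "m' x * (SUM k:K. indicator {x. c x = k} x * f x) = m' x * f x"
  proof (cases "x : ball y R")
   case True
   then have "c x : K" by (auto simp: K_def)
   have "(SUM k:K. indicator {x. c x = k} x * f x) = (SUM k:K. if k = c x then f x else 0)" by (intro sum.cong) auto
   then show ?thesis using K \<open>c x : K\<close> by simp
  qed (simp add: supp)
 qed
 finally show ?thesis unfolding K_def using mult_abs[OF m' f] by simp
qed

end

text \<open>The bound \<open>M\<close> with the support radius \<open>R\<close> serves the passage
  from discrete to continuous norms; the lower bound \<open>c0\<close> near \<open>x0\<close> serves
  the converse.\<close>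

definition window_bounds :: "('a::euclidean_space => complex) => real => real => real => real => 'a => bool" where
 "window_bounds \<gamma> M R eps c0 x0 \<longleftrightarrow> 0 < M & 0 < R & 0 < eps & 0 < c0 & continuous_on UNIV \<gamma> & (ALL x. cmod (\<gamma> x) <= M)
  & (ALL x. R <= norm x --> \<gamma> x = 0) & (ALL x. dist x x0 < eps --> c0 <= cmod (\<gamma> x))"

text \<open>Norm 1 forces a point where the window does not vanish, and continuity keeps half of
  that value nearby.\<close>

lemma window_bounds_exist:
 fixes \<gamma> :: "'a::euclidean_space => complex"
 assumes w: "window \<gamma>"
 shows "EX M R eps c0 x0. window_bounds \<gamma> M R eps c0 x0"
proof -
 define S where "S = closure {x. \<gamma> x ~= 0}"
 have "Ck 0 \<gamma>" using w unfolding window_def by blast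
 then have cont: "continuous_on UNIV \<gamma>" by simp
 have S: "compact S" using w by (simp add: window_def S_def)
 have out: "\<gamma> x = 0" if "x \<notin> S" for x using that closure_subset[of "{x. \<gamma> x ~= 0}"] by (auto simp: S_def)
 obtain b where b: "0 < b" "!!x. x : S ==> norm x <= b" using compact_imp_bounded[OF S] by (auto simp: bounded_pos)
 have "compact (\<gamma> ` S)" by (rule compact_continuous_image[OF continuous_on_subset[OF cont] S]) simp
 then obtain M where M: "0 < M" "!!x. x : S ==> cmod (\<gamma> x) <= M" using compact_imp_bounded by (force simp: bounded_pos)
 have "EX x0. \<gamma> x0 ~= 0"
 proof (rule ccontr)
  assume "\<not> (EX x0. \<gamma> x0 ~= 0)"
  then have "L2_norm \<gamma> = 0" by (simp add: L2_norm_nn ennreal_powr_def)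
  then show False using w by (simp add: window_def)
 qed
 then obtain x0 where x0: "\<gamma> x0 ~= 0" by blast
 have "isCont \<gamma> x0" using cont by (simp add: continuous_on_eq_continuous_at)
 then obtain eps where eps: "0 < eps" "!!x. dist x x0 < eps ==> dist (\<gamma> x) (\<gamma> x0) < cmod (\<gamma> x0) / 2"
  using x0 unfolding continuous_at_eps_delta by (metis half_gt_zero zero_less_norm_iff)
 have "cmod (\<gamma> x0) / 2 <= cmod (\<gamma> x)" if "dist x x0 < eps" for x
  using eps(2)[OF that] norm_triangle_ineq2[of "\<gamma> x0" "\<gamma> x"] by (simp add: dist_norm norm_minus_commute)
 moreover have "\<gamma> x = 0" if "b + 1 <= norm x" for x using b(2)[of x] that out[of x] by force
 moreover have "cmod (\<gamma> x) <= M" for x using M out by (cases "x : S") auto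
 ultimately have "window_bounds \<gamma> M (b + 1) eps (cmod (\<gamma> x0) / 2) x0"
  unfolding window_bounds_def using M(1) b(1) eps(1) x0 cont by auto
 then show ?thesis by blast
qed

definition win :: "('a::euclidean_space => complex) => 'a => 'a => complex" where
 "win \<gamma> y x = \<gamma> (x - y)"

lemma win_borel: "window_bounds \<gamma> M R eps c0 x0 ==> \<gamma> : borel_measurable borel"
 unfolding window_bounds_def by (blast intro: borel_measurable_continuous_onI)

lemma win_bdd:
 assumes "window_bounds \<gamma> M R eps c0 x0" shows "bdd_multiplier (win \<gamma> y) M"
proof -
 have [measurable]: "\<gamma> : borel_measurable borel" by (rule win_borel[OF assms])
 have "win \<gamma> y : borel_measurable lebesgue" unfolding win_def by (rule borel_lebesgue) measurable
 then show ?thesis using assms unfolding bdd_multiplier_def window_bounds_def by (simp add: win_def)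
qed

lemma space_norm_eq:
 assumes wb: "window_bounds \<gamma> M R eps c0 x0" and f: "f : L2"
 shows "amalgam_norm \<gamma> 2 p (%x. ennreal (cmod (f x))) = Lp_norm p (%y. ennreal (norm (mult (win \<gamma> y) (abs_l2 f))))"
proof -
 have "Lp_norm 2 (%x. ennreal (cmod (f x)) * ennreal (cmod (\<gamma> (x - y)))) = ennreal (norm (mult (win \<gamma> y) (abs_l2 f)))" for y
 proof -
  have "Lp_norm 2 (%x. ennreal (cmod (f x)) * ennreal (cmod (\<gamma> (x - y)))) = L2_norm (%x. win \<gamma> y x * f x)"
   unfolding L2_norm_def by (simp add: norm_mult ennreal_mult' win_def mult.commute)
  also have "... = ennreal (norm (mult (win \<gamma> y) (abs_l2 f)))"
   using L2_norm_abs[OF bdd_mult_L2[OF win_bdd[OF wb] f]] mult_abs[OF win_bdd[OF wb] f] by simp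
  finally show ?thesis .
 qed
 then show ?thesis by (simp add: amalgam_norm_def)
qed

text \<open>The cell of \<open>x0 + y\<close> has diameter below \<open>eps\<close>, so the window
  translated to \<open>y\<close> is at least \<open>c0\<close> on all of it.\<close>

lemma space_input_L2:
 fixes c :: "'a::euclidean_space => 'k"
 assumes wb: "window_bounds \<gamma> M R eps c0 x0" and c: "mesh delta m c" "delta <= eps" and f: "f : L2" and rho: "0 < rho"
  and X: "0 <= X" "amalgam_norm \<gamma> 2 (expo rho) (%x. ennreal (cmod (f x))) <= ennreal X" and K: "finite K"
 shows "lpn rho K (%k. norm (cut c k (abs_l2 f))) <= m powr (- rho) / c0 * X"
proof -
 have c0: "0 < c0" using wb by (simp add: window_bounds_def)
 have key: "c0 * norm (cut c (c (x0 + y)) (abs_l2 f)) <= norm (mult (win \<gamma> y) (abs_l2 f))" for y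
 proof -
  have "norm (abs_l2 (%x. indicator {x. c x = c (x0 + y)} x * f x)) <= 1 / c0 * norm (abs_l2 (%x. win \<gamma> y x * f x))"
  proof (rule norm_abs_mono[OF cut_L2[OF c(1) f] bdd_mult_L2[OF win_bdd[OF wb] f]])
   fix x
   have "c0 <= cmod (win \<gamma> y x)" if "c x = c (x0 + y)"
   proof -
    have "dist x (x0 + y) < eps" using c that unfolding mesh_def by (meson less_le_trans)
    then have "dist (x - y) x0 < eps" by (simp add: dist_norm algebra_simps)
    then show ?thesis using wb by (simp add: window_bounds_def win_def)
   qed
   then have "c0 * (indicator {x. c x = c (x0 + y)} x * cmod (f x)) <= cmod (win \<gamma> y x) * cmod (f x)"
    by (auto simp: indicator_def intro: mult_right_mono)
   then show "cmod (indicator {x. c x = c (x0 + y)} x * f x) <= 1 / c0 * cmod (win \<gamma> y x * f x)"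
    using c0 by (cases "c x = c (x0 + y)") (auto simp: norm_mult field_simps)
  qed (use c0 in simp)
  then show ?thesis using c0 by (simp add: cut_abs[OF c(1) f] mult_abs[OF win_bdd[OF wb] f] field_simps)
 qed
 have "lpn rho K (%k. c0 * norm (cut c k (abs_l2 f))) <= m powr (- rho) * X"
 proof (rule mesh_input_lpn[OF c(1) K rho, where z = x0 and A = "%y. ennreal (norm (mult (win \<gamma> y) (abs_l2 f)))"])
  show "ennreal (c0 * norm (cut c (c (x0 + y)) (abs_l2 f))) <= ennreal (norm (mult (win \<gamma> y) (abs_l2 f)))" for y
   by (rule ennreal_leI[OF key])
  show "Lp_norm (expo rho) (%y. ennreal (norm (mult (win \<gamma> y) (abs_l2 f)))) <= ennreal X"
   using X(2) unfolding space_norm_eq[OF wb f] .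
 qed (use c0 X cut_outside[OF c(1)] in auto)
 then have "c0 * lpn rho K (%k. norm (cut c k (abs_l2 f))) <= m powr (- rho) * X"
  using K rho c0 by (subst (asm) lpn_scale) auto
 then show ?thesis using c0 by (simp add: field_simps)
qed

text \<open>Here \<open>L2\<close> is a conclusion. Truncations in space and height obey the
  discrete bound; since \<open>1/2 <= rho\<close>, that norm dominates the l2 norm over cells and
  hence the full norm, and \<open>L2_Fatou\<close> passes to the limit.\<close>

lemma space_input:
 fixes c :: "'a::euclidean_space => 'k" and f :: "'a => complex"
 assumes wb: "window_bounds \<gamma> M R eps c0 x0" and c: "mesh delta m c" "delta <= eps" and f: "f : borel_measurable lebesgue" and rho: "1/2 <= rho"
  and X: "0 <= X" "amalgam_norm \<gamma> 2 (expo rho) (%x. ennreal (cmod (f x))) <= ennreal X"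
 shows "f : L2" "norm (abs_l2 f) <= m powr (- rho) / c0 * X"
proof -
 note [measurable] = f
 define F where "F n x = (indicator (cball 0 (real n)) x * (if cmod (f x) <= real n then f x else 0))" for n x
 have gm: "\<gamma> : borel_measurable lebesgue" by (rule borel_lebesgue[OF win_borel[OF wb]])
 have Fle: "cmod (F n x) <= cmod (f x)" for n x by (auto simp: F_def indicator_def)
 have i1: "(%x::'a. indicator (cball 0 (real n)) x :: complex) : borel_measurable lebesgue" for n
  by (intro borel_lebesgue borel_measurable_indicator) simp
 have i2: "(%x. if cmod (f x) <= real n then f x else 0) : borel_measurable lebesgue" for n by measurable
 have Fm: "F n : borel_measurable lebesgue" for n unfolding F_def[abs_def] by (rule borel_measurable_times[OF i1 i2])
 have F2: "F n : L2" for n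
  by (rule L2_bound[OF Fm L2_bounded_indicator[of "cball 0 (real n)" "real n" 1], where C = "real n"])
   (auto simp: F_def indicator_def)
 have FX: "amalgam_norm \<gamma> 2 (expo rho) (%x. ennreal (cmod (F n x))) <= ennreal X" for n
 proof (rule order_trans[OF _ X(2)])
  have two: "2 = expo (1/2)" by (simp add: expo_def)
  show "amalgam_norm \<gamma> 2 (expo rho) (%x. ennreal (cmod (F n x))) <= amalgam_norm \<gamma> 2 (expo rho) (%x. ennreal (cmod (f x)))"
   unfolding amalgam_norm_def two
  proof (rule Lp_norm_mono)
   fix y
   show "Lp_norm (expo (1/2)) (%x. ennreal (cmod (F n x)) * ennreal (cmod (\<gamma> (x - y))))
     <= Lp_norm (expo (1/2)) (%x. ennreal (cmod (f x)) * ennreal (cmod (\<gamma> (x - y))))"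
   proof (rule Lp_norm_mono)
    show "ennreal (cmod (F n x)) * ennreal (cmod (\<gamma> (x - y))) <= ennreal (cmod (f x)) * ennreal (cmod (\<gamma> (x - y)))" for x
     by (intro mult_right_mono ennreal_leI Fle) simp
   qed simp_all
  qed (use rho in auto)
 qed
 have "norm (abs_l2 (F n)) <= m powr (- rho) / c0 * X" for n
 proof -
  have R1: "(0::real) < real n + 1" by simp
  define K where "K = c ` ball 0 (real n + 1)"
  have K: "finite K" unfolding K_def by (rule mesh_card(1)[OF c(1) R1])
  define ind :: "'a => complex" where "ind = indicator (ball 0 (real n + 1))"
  have ind: "bdd_multiplier ind 1" unfolding bdd_multiplier_def ind_def
   by (auto intro!: borel_lebesgue borel_measurable_indicator simp: indicator_def)
  have "mult ind (abs_l2 (F n)) = abs_l2 (F n)"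
  proof -
   have "(%x. ind x * F n x) = F n" by (auto simp: ind_def F_def indicator_def)
   then show ?thesis using mult_abs[OF ind F2[of n]] by simp
  qed
  also have "mult ind (abs_l2 (F n)) = mult ind (SUM k:K. cut c k (abs_l2 (F n)))"
   unfolding K_def by (rule sum_cut_eq[OF c(1) F2 R1 _ ind, symmetric]) (simp add: ind_def)
  finally have "norm (abs_l2 (F n)) <= 1 * norm (SUM k:K. cut c k (abs_l2 (F n)))" using norm_mult_le[OF ind] by metis
  also have "... = lpn (1/2) K (%k. norm (cut c k (abs_l2 (F n))))" by (simp add: norm_sum_cut[OF c(1) K])
  also have "... <= lpn rho K (%k. norm (cut c k (abs_l2 (F n))))" using rho by (intro lpn_antimono K) auto
  also have "... <= m powr (- rho) / c0 * X" using rho by (intro space_input_L2[OF wb c F2 _ X(1) FX K]) simp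
  finally show ?thesis .
 qed
 note bound = this
 have lim: "AE x in lebesgue. (%n. F n x) \<longlonglongrightarrow> f x"
 proof (rule AE_I2)
  fix x :: 'a
  obtain n0 :: nat where n0: "max (norm x) (cmod (f x)) <= real n0" using real_arch_simple by blast
  have "F n x = f x" if "n >= n0" for n using n0 that by (auto simp: F_def indicator_def)
  then have "\<forall>\<^sub>F n in sequentially. F n x = f x" by (auto simp: eventually_sequentially)
  then show "(%n. F n x) \<longlonglongrightarrow> f x" by (rule tendsto_eventually)
 qed
 show "f : L2" "norm (abs_l2 f) <= m powr (- rho) / c0 * X"
  using L2_Fatou[of F f, OF F2 f lim bound] by auto
qed

lemma win_tendsto:
 assumes wb: "window_bounds \<gamma> M R eps c0 x0" and X: "X \<longlonglongrightarrow> y" and W: "W \<longlonglongrightarrow> w"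
 shows "(%n. mult (win \<gamma> (X n)) (W n)) \<longlonglongrightarrow> mult (win \<gamma> y) w"
proof -
 note b = win_bdd[OF wb]
 have 1: "(%n. mult (win \<gamma> (X n)) w) \<longlonglongrightarrow> mult (win \<gamma> y) w"
  unfolding mult_def
 proof (rule l2_dominated_convergence(3)[where C = M and w = "rep_l2 w"])
  have "isCont \<gamma> (x - y)" for x using wb by (simp add: window_bounds_def continuous_on_eq_continuous_at)
  then have "(%n. win \<gamma> (X n) x) \<longlonglongrightarrow> win \<gamma> y x" for x
   unfolding win_def by (rule isCont_tendsto_compose[OF _ tendsto_diff[OF tendsto_const X]])
  then show "AE x in lebesgue. (%n. win \<gamma> (X n) x * rep_l2 w x) \<longlonglongrightarrow> win \<gamma> y x * rep_l2 w x"
   by (intro AE_I2 tendsto_mult tendsto_const)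
  show "AE x in lebesgue. cmod (win \<gamma> (X k) x * rep_l2 w x) <= M * cmod (rep_l2 w x)" for k
   using b by (intro AE_I2) (auto simp: norm_mult bdd_multiplier_def intro!: mult_right_mono)
  show "(%x. win \<gamma> y x * rep_l2 w x) : borel_measurable lebesgue" by (rule L2D(1)[OF bdd_mult_L2[OF b rep_l2_in]])
  show "(%x. win \<gamma> (X k) x * rep_l2 w x) : borel_measurable lebesgue" for k by (rule L2D(1)[OF bdd_mult_L2[OF b rep_l2_in]])
 qed simp
 have "(%n. mult (win \<gamma> (X n)) (W n - w)) \<longlonglongrightarrow> 0"
 proof (rule Lim_null_comparison)
  show "\<forall>\<^sub>F n in sequentially. norm (mult (win \<gamma> (X n)) (W n - w)) <= M * norm (W n - w)"
   by (intro always_eventually allI norm_mult_le b)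
  have "(%n. M * norm (W n - w)) \<longlonglongrightarrow> M * norm (w - w)"
   by (rule tendsto_mult[OF tendsto_const tendsto_norm[OF tendsto_diff[OF W tendsto_const]]])
  then show "(%n. M * norm (W n - w)) \<longlonglongrightarrow> 0" by simp
 qed
 from tendsto_add[OF this 1] show ?thesis
  by (simp add: linear_add[OF linear_mult[OF b], symmetric])
qed

text \<open>Joint continuity in time and window position gives the product measurability that
  iterated norms require.\<close>

lemma win_norm_borel:
 fixes V :: "real => 'a::euclidean_space l2"
 assumes wb: "window_bounds \<gamma> M R eps c0 x0" and V: "!!X t. X \<longlonglongrightarrow> t ==> (%n. V (X n)) \<longlonglongrightarrow> V t"
 shows "(%(t, y). ennreal (norm (mult (win \<gamma> y) (V t)))) : borel_measurable (lborel \<Otimes>\<^sub>M lborel)"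
proof -
 have "continuous_on UNIV (%p. norm (mult (win \<gamma> (snd p)) (V (fst p))))"
  unfolding continuous_on_sequentially comp_def
 proof (intro allI ballI impI, elim conjE)
  fix X :: "nat => real \<times> 'a" and p assume "X \<longlonglongrightarrow> p"
  then show "(%n. norm (mult (win \<gamma> (snd (X n))) (V (fst (X n))))) \<longlonglongrightarrow> norm (mult (win \<gamma> (snd p)) (V (fst p)))"
   by (intro tendsto_norm win_tendsto[OF wb] V tendsto_fst tendsto_snd)
 qed
 then have "(%p. norm (mult (win \<gamma> (snd p)) (V (fst p)))) : borel_measurable borel" by (rule borel_measurable_continuous_onI)
 then have "(%p. ennreal (norm (mult (win \<gamma> (snd p)) (V (fst p))))) : borel_measurable borel" by measurable
 then show ?thesis by (simp add: lborel_prod case_prod_beta)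
qed

lemma space_output:
 fixes c :: "'a::euclidean_space => 'k"
 assumes wb: "window_bounds \<gamma> M R eps c0 x0" and c: "mesh delta m c" and rho: "0 <= rho"
  and B: "!!K. finite K ==> lpn rho K (%k. norm (cut c k v)) <= B"
 shows "Lp_norm (expo rho) (%y. ennreal (norm (mult (win \<gamma> y) v))) <= ennreal (mesh_const DIM('a) delta m R rho * (M * B))"
proof (rule mesh_output[OF c, where N = "%k. M * norm (cut c k v)"])
 have MR: "0 < M" "0 < R" using wb by (auto simp: window_bounds_def)
 then show "0 < R" "0 <= M * norm (cut c k v)" for k by auto
 show "0 <= rho" by fact
 show "lpn rho K (%k. M * norm (cut c k v)) <= M * B" if "finite K" for K
  using that MR rho B[OF that] by (subst lpn_scale) auto
 show "ennreal (norm (mult (win \<gamma> y) v)) <= ennreal (SUM k:c ` ball y R. M * norm (cut c k v))" for y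
 proof (rule ennreal_leI)
  have "mult (win \<gamma> y) v = mult (win \<gamma> y) (SUM k:c ` ball y R. cut c k v)"
   using sum_cut_eq[OF c rep_l2_in[of v] MR(2) _ win_bdd[OF wb], of y y] wb
   by (simp add: win_def window_bounds_def dist_norm norm_minus_commute not_less)
  then have "norm (mult (win \<gamma> y) v) <= M * norm (SUM k:c ` ball y R. cut c k v)"
   using norm_mult_le[OF win_bdd[OF wb]] by metis
  also have "... <= M * (SUM k:c ` ball y R. norm (cut c k v))" using MR by (intro mult_left_mono norm_sum) auto
  finally show "norm (mult (win \<gamma> y) v) <= (SUM k:c ` ball y R. M * norm (cut c k v))" by (simp add: sum_distrib_left)
 qed
 have "(%(t::real, y). ennreal (norm (mult (win \<gamma> y) v))) : borel_measurable (lborel \<Otimes>\<^sub>M lborel)"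
  by (rule win_norm_borel[OF wb]) simp
 from measurable_Pair2[OF this, of 0] have "(%y. ennreal (norm (mult (win \<gamma> y) v))) : borel_measurable lborel" by simp
 then show "(%y. ennreal (norm (mult (win \<gamma> y) v))) : borel_measurable lebesgue" by (rule measurable_completion)
qed

section \<open>Time cells: suprema by sampling\<close>

text \<open>The discrete form of an L^infinity amalgam norm in time: \<open>tau\<close> picks one
  time in every cell, and uniformity over the picks replaces the supremum over a cell. Finite index
  sets keep every norm a finite sum.\<close>

definition grand :: "real => ('a::euclidean_space => 'k) => real => real => (real => 'a l2) => real => bool" where
 "grand eta c alpha rho Z B \<longleftrightarrow> (ALL tau N K. finite N --> finite K --> (ALL n. (floor (tau n / eta)) = n) -->
  mix alpha rho N K (%n k. norm (cut c k (Z (tau n)))) <= B)"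

text \<open>In every time cell a sample within a factor 2 of the supremum is chosen, and the finite
  sets of space cells involved are united. The uniform bound applies to these samples at once, which
  gives the 2 in the conclusion.\<close>

lemma grand_sup:
 fixes c :: "'a::euclidean_space => 'b"
 assumes eta: "0 < eta" and alpha: "0 <= alpha" "0 <= rho" and g: "grand eta c alpha rho Z B"
 shows "EX a. (ALL n. 0 <= a n) & (ALL t K. finite K --> lpn rho K (%k. norm (cut c k (Z t))) <= a (floor (t / eta)))
  & (ALL N. finite N --> lpn alpha N a <= 2 * B)"
proof -
 define l where "l t K = lpn rho K (%k. norm (cut c k (Z t)))" for t K
 have l0: "0 <= l t K" if "finite K" for t K using that unfolding l_def by (rule lpn_nonneg)
 have tau0: "(floor ((of_int n * eta) / eta)) = n" for n using eta by simp
 have lB: "l t K <= B" if K: "finite K" for t K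
 proof -
  define tau where "tau n = (if n = (floor (t / eta)) then t else of_int n * eta)" for n
  have "ALL n. (floor (tau n / eta)) = n" using tau0 by (simp add: tau_def)
  then have m: "mix alpha rho {(floor (t / eta))} K (%n k. norm (cut c k (Z (tau n)))) <= B" using g K unfolding grand_def by blast
  have "l (tau (floor (t / eta))) K <= lpn alpha {(floor (t / eta))} (%n. l (tau n) K)"
   using l0[OF K] alpha by (intro lpn_member) auto
  then show ?thesis using m by (simp add: mix_def l_def tau_def)
 qed
 define T where "T n = {l t K |t K. finite K & (floor (t / eta)) = n}" for n
 have Tne: "T n ~= {}" for n unfolding T_def using tau0[of n] by (auto intro!: exI[of _ "{}"] exI[of _ "of_int n * eta"])
 have Tbdd: "bdd_above (T n)" for n unfolding T_def using lB by (auto intro!: bdd_aboveI[of _ B])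
 define a where "a n = Sup (T n)" for n
 have la: "l t K <= a (floor (t / eta))" if "finite K" for t K
  unfolding a_def using that by (intro cSup_upper Tbdd) (auto simp: T_def)
 have a0: "0 <= a n" for n
 proof -
  have "0 <= l (of_int n * eta) {}" by (rule l0) simp
  also have "... <= a n" using la[of "{}" "of_int n * eta"] tau0[of n] by simp
  finally show ?thesis .
 qed
 have ex: "EX t K. finite K & (floor (t / eta)) = n & a n <= 2 * l t K" for n
 proof (cases "a n = 0")
  case True
  then show ?thesis using tau0[of n] l0[of "{}"] by (intro exI[of _ "of_int n * eta"] exI[of _ "{}"]) simp
 next
  case False
  then have "a n / 2 < Sup (T n)" using a0[of n] by (simp add: a_def)
  then obtain x where "x : T n" "a n / 2 < x" using less_cSupD[OF Tne] by blast
  then show ?thesis unfolding T_def by force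
 qed
 define Q where "Q n p \<longleftrightarrow> finite (snd p) & (floor (fst p / eta)) = n & a n <= 2 * l (fst p) (snd p)" for n and p :: "real \<times> 'b set"
 have "EX p. Q n p" for n
 proof -
  obtain t K where "finite K" "(floor (t / eta)) = n" "a n <= 2 * l t K" using ex by blast
  then have "Q n (t, K)" by (simp add: Q_def)
  then show ?thesis by (rule exI)
 qed
 then have "EX p. ALL n. Q n (p n)" by (intro choice allI)
 then obtain p where p: "!!n. Q n (p n)" by blast
 define tau where "tau n = fst (p n)" for n
 define kappa where "kappa n = snd (p n)" for n
 have kappa: "ALL n. finite (kappa n) & (floor (tau n / eta)) = n & a n <= 2 * l (tau n) (kappa n)"
  using p by (simp add: Q_def tau_def kappa_def)
 have "lpn alpha N a <= 2 * B" if N: "finite N" for N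
 proof -
  define K where "K = (\<Union>n\<in>N. kappa n)"
  have K: "finite K" unfolding K_def using N kappa by blast
  have "lpn alpha N a <= lpn alpha N (%n. 2 * l (tau n) K)"
  proof (rule lpn_mono[OF N alpha(1) a0])
   fix n assume "n : N"
   then have "l (tau n) (kappa n) <= l (tau n) K" unfolding l_def using K alpha by (intro lpn_subset) (auto simp: K_def)
   then show "a n <= 2 * l (tau n) K" using kappa by (meson mult_left_mono order_trans zero_le_numeral)
  qed
  also have "... = 2 * mix alpha rho N K (%n k. norm (cut c k (Z (tau n))))"
   unfolding mix_def l_def using N alpha K by (intro lpn_scale) (auto intro: lpn_nonneg)
  also have "... <= 2 * B" using g N K kappa unfolding grand_def by (intro mult_left_mono) auto
  finally show ?thesis .
 qed
 then show ?thesis using a0 la unfolding l_def by blast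
qed

lemma esssup_expo: "Lp_norm \<infinity> h = Lp_norm (expo 0) h"
 by (simp add: expo_def)

text \<open>\<open>space_output\<close> bounds the spatial norm at time \<open>t\<close> by the
  entry of \<open>a\<close> for its time cell; a second use of \<open>mesh_output\<close> sums over
  time. Continuity of \<open>V\<close> makes the iterated norms measurable.\<close>

theorem time_output:
 fixes g :: "real => complex" and c :: "'a::euclidean_space => 'k"
 assumes wg: "window_bounds g Mg Rg epsg cg tg" and eta: "0 < eta"
  and wb: "window_bounds \<gamma> M R eps c0 x0" and c: "mesh delta m c" and e: "0 <= alpha" "0 <= rho"
  and V: "!!X t. X \<longlonglongrightarrow> t ==> (%n. V (X n)) \<longlonglongrightarrow> V t"
  and f: "!!t. f t : L2" "!!t. abs_l2 (f t) = V t"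
  and gr: "grand eta c alpha rho V B"
 shows "mixed_amalgam_norm g \<gamma> \<infinity> (expo alpha) 2 (expo rho) f
  <= ennreal (mesh_const 1 eta eta Rg alpha * (Mg * (mesh_const DIM('a) delta m R rho * (M * (2 * B)))))"
proof -
 obtain a where a: "!!n. 0 <= a n" "!!t K. finite K ==> lpn rho K (%k. norm (cut c k (V t))) <= a (floor (t / eta))"
  "!!N. finite N ==> lpn alpha N a <= 2 * B" using grand_sup[OF eta e gr] by blast
 define C1 where "C1 = Mg * (mesh_const DIM('a) delta m R rho * M)"
 have pos: "0 < Mg" "0 < Rg" "0 < M" "0 < R" "0 < m" using wg wb c by (auto simp: window_bounds_def mesh_def)
 have "dist (0::'a) 0 < delta" using c unfolding mesh_def by blast
 then have mc: "0 <= mesh_const DIM('a) delta m R rho" using pos by (simp add: mesh_const_def)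
 have C1: "0 <= C1" using mc pos by (simp add: C1_def)
 define h where "h t = amalgam_norm \<gamma> 2 (expo rho) (%x. ennreal (cmod (f t x)))" for t
 have h: "h t = Lp_norm (expo rho) (%y. ennreal (norm (mult (win \<gamma> y) (V t))))" for t
  unfolding h_def space_norm_eq[OF wb f(1)] f(2) ..
 have [measurable]: "h : borel_measurable borel"
  unfolding h[abs_def] by (rule Lp_norm_borel[OF win_norm_borel[OF wb V] e(2)])
 have [measurable]: "g : borel_measurable borel" by (rule win_borel[OF wg])
 have hb: "h t <= ennreal (mesh_const DIM('a) delta m R rho * (M * a (floor (t / eta))))" for t
  unfolding h by (rule space_output[OF wb c e(2)]) (rule a(2))
 have jm: "(%(y, t). h t * ennreal (cmod (g (t - y)))) : borel_measurable (lborel \<Otimes>\<^sub>M lborel)" by measurable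
 define A where "A y = Lp_norm \<infinity> (%t. h t * ennreal (cmod (g (t - y))))" for y
 have "A : borel_measurable borel" unfolding A_def[abs_def] esssup_expo by (rule Lp_norm_borel[OF jm]) simp
 then have Am: "A : borel_measurable lebesgue" by (simp add: measurable_completion)
 have "Lp_norm (expo alpha) A <= ennreal (mesh_const DIM(real) eta eta Rg alpha * (C1 * (2 * B)))"
 proof (rule mesh_output[OF mesh_floor[OF eta] pos(2) e(1), where N = "%n. C1 * a n"])
  show "0 <= C1 * a n" for n using C1 a(1) by simp
  show "lpn alpha N (%n. C1 * a n) <= C1 * (2 * B)" if "finite N" for N
   using that C1 a e by (subst lpn_scale) (auto intro: mult_left_mono)
  show "A y <= ennreal (SUM n:(%t. (floor (t / eta))) ` ball y Rg. C1 * a n)" for y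
  proof -
   have "h t * ennreal (cmod (g (t - y))) <= ennreal (SUM n:(%t. (floor (t / eta))) ` ball y Rg. C1 * a n)" for t
   proof (cases "t : ball y Rg")
    case True
    have "h t * ennreal (cmod (g (t - y))) <= ennreal (mesh_const DIM('a) delta m R rho * (M * a (floor (t / eta)))) * ennreal Mg"
     using wg by (intro mult_mono hb ennreal_leI) (auto simp: window_bounds_def)
    also have "... = ennreal (C1 * a (floor (t / eta)))"
     using pos mc a(1) by (simp add: ennreal_mult[symmetric] C1_def ac_simps)
    also have "... <= ennreal (SUM n:(%t. (floor (t / eta))) ` ball y Rg. C1 * a n)"
     using True C1 a(1) mesh_card(1)[OF mesh_floor[OF eta] pos(2)]
     by (intro ennreal_leI member_le_sum) auto
    finally show ?thesis .
   next
    case False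
    then have "g (t - y) = 0" using wg by (simp add: window_bounds_def dist_real_def)
    then show ?thesis by simp
   qed
   then show ?thesis unfolding A_def Lp_norm_def
    by (auto intro!: esssup_I AE_I2 measurable_completion)
  qed
 qed (rule Am)
 moreover have "mixed_amalgam_norm g \<gamma> \<infinity> (expo alpha) 2 (expo rho) f = Lp_norm (expo alpha) A"
  unfolding mixed_amalgam_norm_def amalgam_norm_def[of g] A_def h_def ..
 ultimately show ?thesis by (simp add: C1_def ac_simps)
qed

lemma Lp_norm_one: "Lp_norm 1 h = (\<integral>\<^sup>+t. h t \<partial>lebesgue)"
proof -
 have "ennreal_powr x 1 = x" for x by (cases x) (auto simp: ennreal_powr_def)
 then show ?thesis by (simp add: Lp_norm_def)
qed

text \<open>The time window is at least \<open>cg\<close> on a whole cell, so its weighted integral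
  dominates the integral over that cell. Finiteness of each cell integral is established first,
  since \<open>enn2real\<close> would silently send infinity to 0.\<close>

theorem time_input:
 fixes g :: "real => complex"
 assumes wg: "window_bounds g Mg Rg epsg cg tg" and eta: "0 < eta" "eta <= epsg" and rho: "0 < rho"
  and b: "b : borel_measurable borel" and X: "0 <= X" "amalgam_norm g 1 (expo rho) b <= ennreal X"
 shows "(\<integral>\<^sup>+t. b t * indicator {t. (floor (t / eta)) = n} t \<partial>lborel) < \<infinity>"
  and "finite N ==> lpn rho N (%n. enn2real (\<integral>\<^sup>+t. b t * indicator {t. (floor (t / eta)) = n} t \<partial>lborel)) <= eta powr (- rho) / cg * X"
proof -
 note [measurable] = b
 have [measurable]: "g : borel_measurable borel" by (rule win_borel[OF wg])
 have cg: "0 < cg" using wg by (simp add: window_bounds_def)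
 have In: "{t. (floor (t / eta)) = n} : sets borel" for n using mesh_floor[OF eta(1)] by (simp add: mesh_def)
 define \<beta> where "\<beta> n = (\<integral>\<^sup>+t. b t * indicator {t. (floor (t / eta)) = n} t \<partial>lborel)" for n
 define A where "A y = Lp_norm 1 (%t. b t * ennreal (cmod (g (t - y))))" for y
 have A: "A y = (\<integral>\<^sup>+t. b t * ennreal (cmod (g (t - y))) \<partial>lborel)" for y
  unfolding A_def Lp_norm_one by (rule nn_integral_completion)
 have le: "ennreal cg * \<beta> (floor ((tg + y) / eta)) <= A y" for y
 proof -
  define n where "n = (floor ((tg + y) / eta))"
  have "ennreal cg * \<beta> n = (\<integral>\<^sup>+t. ennreal cg * (b t * indicator {t. (floor (t / eta)) = n} t) \<partial>lborel)"
   unfolding \<beta>_def using In[of n] by (intro nn_integral_cmult[symmetric]) measurable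
  also have "... <= A y" unfolding A
  proof (rule nn_integral_mono)
   fix t
   show "ennreal cg * (b t * indicator {t. (floor (t / eta)) = n} t) <= b t * ennreal (cmod (g (t - y)))"
   proof (cases "(floor (t / eta)) = n")
    case True
    then have "dist t (tg + y) < eta" using mesh_floor[OF eta(1)] unfolding n_def mesh_def by blast
    then have "dist (t - y) tg < epsg" using eta(2) by (simp add: dist_real_def algebra_simps)
    then have "cg <= cmod (g (t - y))" using wg by (simp add: window_bounds_def)
    then have "b t * ennreal cg <= b t * ennreal (cmod (g (t - y)))" by (intro mult_left_mono ennreal_leI) auto
    then show ?thesis using True by (simp add: mult.commute)
   qed simp
  qed
  finally show ?thesis by (simp add: n_def)
 qed
 have AX: "Lp_norm (expo rho) A <= ennreal X" using X(2) unfolding amalgam_norm_def A_def .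
 have fin: "\<beta> n < \<infinity>" for n
 proof (rule ccontr)
  assume "\<not> \<beta> n < \<infinity>"
  then have top: "\<beta> n = \<infinity>" by (simp add: not_less top_unique)
  have "n : range (%t. (floor (t / eta)))" using eta by (intro image_eqI[of _ _ "of_int n * eta"]) auto
  then have "(SUM n:{n}. ennreal eta * ennreal_powr (ennreal cg * \<beta> n) (1 / rho)) <= (\<integral>\<^sup>+y. ennreal_powr (A y) (1 / rho) \<partial>lebesgue)"
   using rho le by (intro mesh_input[OF mesh_floor[OF eta(1)], where z = tg]) auto
  also have "... <= ennreal (X powr (1 / rho))" by (rule Lp_norm_expo_leD[OF rho X(1) AX])
  finally show False using top cg eta by (simp add: ennreal_powr_def ennreal_mult_top top_unique)
 qed
 show "(\<integral>\<^sup>+t. b t * indicator {t. (floor (t / eta)) = n} t \<partial>lborel) < \<infinity>" using fin by (simp add: \<beta>_def)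
 assume N: "finite N"
 have "lpn rho N (%n. cg * enn2real (\<beta> n)) <= eta powr (- rho) * X"
 proof (rule mesh_input_lpn[OF mesh_floor[OF eta(1)] N rho _ _ _ X(1) AX, where z = tg])
  show "0 <= cg * enn2real (\<beta> n)" for n using cg by simp
  show "cg * enn2real (\<beta> n) = 0" if "n \<notin> range (%t. (floor (t / eta)))" for n
  proof -
   have "n : range (%t. (floor (t / eta)))" using eta by (intro image_eqI[of _ _ "of_int n * eta"]) auto
   then show ?thesis using that by blast
  qed
  show "ennreal (cg * enn2real (\<beta> (floor ((tg + y) / eta)))) <= A y" for y
   using le[of y] fin[of "(floor ((tg + y) / eta))"] cg by (simp add: ennreal_mult')
 qed
 then have "cg * lpn rho N (%n. enn2real (\<beta> n)) <= eta powr (- rho) * X"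
  using N rho cg by (subst (asm) lpn_scale) auto
 then show "lpn rho N (%n. enn2real (\<integral>\<^sup>+t. b t * indicator {t. (floor (t / eta)) = n} t \<partial>lborel)) <= eta powr (- rho) / cg * X"
  using cg by (simp add: \<beta>_def field_simps)
qed

lemma lpn_extend:
 assumes "finite J" "I <= J" "0 <= rho" "!!i. i : J - I ==> a i = 0"
 shows "lpn rho J a = lpn rho I a"
proof (cases "rho = 0")
 case True
 have "insert 0 (a ` J) = insert 0 (a ` I)" using assms by force
 then show ?thesis using True by (simp add: lpn_def)
next
 case False
 then have "(SUM i:J. a i powr (1 / rho)) = (SUM i:I. a i powr (1 / rho))"
  using assms by (intro sum.mono_neutral_right) auto
 then show ?thesis using False by (simp add: lpn_def)
qed

lemma lpn_empty: "lpn rho {} a = 0"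
 by (simp add: lpn_def)

lemma mix_extend:
 assumes "finite N'" "finite K'" "N <= N'" "K <= K'" "0 <= alpha" "0 <= rho"
 shows "mix alpha rho N' K' (%n k. if n : N & k : K then a n k else 0) = mix alpha rho N K a"
proof -
 let ?a = "%n k. if n : N & k : K then a n k else 0"
 have "mix alpha rho N' K' ?a = lpn alpha N (%n. lpn rho K' (?a n))"
  unfolding mix_def
 proof (rule lpn_extend)
  fix n assume "n : N' - N"
  then have "lpn rho K' (?a n) = lpn rho {} (?a n)" using assms by (intro lpn_extend) auto
  then show "lpn rho K' (?a n) = 0" by (simp add: lpn_empty)
 qed (use assms in auto)
 also have "... = lpn alpha N (%n. lpn rho K (a n))"
 proof (rule lpn_cong[OF refl])
  fix n assume n: "n : N"
  have "lpn rho K' (?a n) = lpn rho K (?a n)" using assms by (intro lpn_extend) auto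
  also have "... = lpn rho K (a n)" using n by (intro lpn_cong) auto
  finally show "lpn rho K' (?a n) = lpn rho K (a n)" .
 qed
 finally show ?thesis by (simp add: mix_def)
qed

lemma propagator_0: "propagator t 0 = 0"
 using propagator_diff[of t 0 0] by simp

lemma propagator_plus: "propagator t (v + w) = propagator t v + propagator t w"
 using propagator_diff[of t v "- w"] propagator_diff[of t 0 w] by (simp add: propagator_0)

lemma propagator_sum: "propagator t (SUM i:I. v i) = (SUM i:I. propagator t (v i))"
 by (induction I rule: infinite_finite_induct) (auto simp: propagator_0 propagator_plus)

lemma inner_propagator: "inner (propagator s v) w = inner v (propagator (- s) w)"
 using propagator_inner[of s v "propagator (- s) w"] by (simp add: propagator_add propagator_zero)

section \<open>Dispersion between cells and discrete Strichartz bounds uniform in the sample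
  times\<close>

context
 fixes c :: "'a::euclidean_space => 'k" and delta m :: real
 assumes c: "mesh delta m c"
begin

text \<open>Cauchy-Schwarz on a cell of measure at most \<open>m\<close>; it makes square-integrable
  data admissible in the dispersive estimate.\<close>

lemma cut_L1:
 fixes k :: 'k
 assumes f: "f : borel_measurable borel" "f : L2"
 defines "h \<equiv> %x. indicator {x. c x = k} x * f x"
 shows "h : borel_measurable borel" "h : L2" "integrable lborel h" "(LINT x|lborel. cmod (h x)) <= sqrt m * norm (abs_l2 h)"
proof -
 have Q: "{x. c x = k} : sets borel" using c by (auto simp: mesh_def)
 have m: "0 < m" using c by (simp add: mesh_def)
 note [measurable] = f(1) Q
 show hm: "h : borel_measurable borel" unfolding h_def by (intro borel_measurable_times borel_measurable_indicator f Q)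
 note [measurable] = hm
 show h2: "h : L2" unfolding h_def by (rule cut_L2[OF c f(2)])
 have em: "emeasure lborel {x. c x = k} <= ennreal m"
 proof (cases "k : range c")
  case True
  then show ?thesis using c by (auto simp: mesh_def)
 next
  case False
  then have "{x. c x = k} = {}" by auto
  then show ?thesis by (metis emeasure_empty zero_le)
 qed
 define i where "i = (indicator {x. c x = k} :: 'a => complex)"
 have im: "i : borel_measurable borel" unfolding i_def by (intro borel_measurable_indicator Q)
 have isq: "(%x. (cmod (i x))^2) = (%x. indicator {x. c x = k} x :: real)" by (auto simp: i_def indicator_def)
 have ii: "integrable lborel (%x. indicator {x. c x = k} x :: real)"
  using em Q by (intro integrable_real_indicator) (auto simp: le_less_trans)
 have i2: "i : L2" unfolding L2_lborel[OF im] isq by (rule ii)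
 have ni: "norm (abs_l2 i) <= sqrt m"
 proof -
  have "measure lborel {x. c x = k} <= m" unfolding measure_def using em m by (intro enn2real_leI) auto
  then show ?thesis using Q by (simp add: norm_abs_l2_lborel[OF im i2] isq)
 qed
 define H where "H x = complex_of_real (cmod (h x))" for x
 have Hm: "H : borel_measurable borel" unfolding H_def by measurable
 have H2: "H : L2" using h2 unfolding L2_lborel[OF Hm] L2_lborel[OF hm] H_def by simp
 have nH: "norm (abs_l2 H) = norm (abs_l2 h)" by (simp add: norm_abs_l2_lborel[OF Hm H2] norm_abs_l2_lborel[OF hm h2]) (simp add: H_def)
 have Hi: "(%x. H x * cnj (i x)) = (%x. complex_of_real (cmod (h x)))"
  by (auto simp: H_def i_def h_def indicator_def)
 have "integrable lebesgue (%x. H x * cnj (i x))" by (rule L2_integrable_mult[OF H2 i2])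
 then have "integrable lebesgue (%x. complex_of_real (cmod (h x)))" unfolding Hi .
 then have "integrable lborel (%x. complex_of_real (cmod (h x)))" by (subst (asm) integrable_completion) auto
 then have ih: "integrable lborel (%x. cmod (h x))" using complex_of_real_integrable_eq by blast
 show "integrable lborel h" using ih hm by (simp add: integrable_norm_iff)
 have "inner (abs_l2 H) (abs_l2 i) = Re (CLINT x|lborel. complex_of_real (cmod (h x)))"
  unfolding inner_abs_l2[OF H2 i2] L2_inner_borel[OF Hm im] Hi ..
 also have "... = (LINT x|lborel. cmod (h x))" by (simp only: integral_complex_of_real Re_complex_of_real)
 finally have "(LINT x|lborel. cmod (h x)) <= norm (abs_l2 H) * norm (abs_l2 i)" using norm_cauchy_schwarz[of "abs_l2 H" "abs_l2 i"] by simp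
 also have "... <= norm (abs_l2 h) * sqrt m" unfolding nH by (intro mult_left_mono ni) simp
 finally show "(LINT x|lborel. cmod (h x)) <= sqrt m * norm (abs_l2 h)" by (simp add: mult.commute)
qed

lemma cell_dispersive:
 assumes t: "t ~= 0"
 shows "\<bar>inner (propagator t (cut c k v)) (cut c l w)\<bar> <= \<bar>t\<bar> powr (- (DIM('a) / 2)) * m * norm (cut c k v) * norm (cut c l w)"
proof -
 obtain f where f: "f : borel_measurable borel" "f : L2" "abs_l2 f = v" using l2_borel_rep by blast
 obtain h where h: "h : borel_measurable borel" "h : L2" "abs_l2 h = w" using l2_borel_rep by blast
 define f' where "f' = (%x. indicator {x. c x = k} x * f x)"
 define h' where "h' = (%x. indicator {x. c x = l} x * h x)"
 note F = cut_L1[OF f(1,2), of k, folded f'_def] and H = cut_L1[OF h(1,2), of l, folded h'_def]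
 have cf: "cut c k v = abs_l2 f'" "cut c l w = abs_l2 h'" using cut_abs[OF c f(2), of k] cut_abs[OF c h(2), of l] by (simp_all add: f'_def h'_def f(3) h(3))
 have m: "0 < m" using c by (simp add: mesh_def)
 have F4: "(LINT x|lborel. cmod (f' x)) <= sqrt m * norm (abs_l2 f')" unfolding f'_def by (rule cut_L1(4)[OF f(1,2)])
 have H4: "(LINT x|lborel. cmod (h' x)) <= sqrt m * norm (abs_l2 h')" unfolding h'_def by (rule cut_L1(4)[OF h(1,2)])
 have "\<bar>inner (propagator t (abs_l2 f')) (abs_l2 h')\<bar> <= \<bar>t\<bar> powr (- (DIM('a) / 2)) * (LINT x|lborel. cmod (f' x)) * (LINT x|lborel. cmod (h' x))"
  by (rule propagator_dispersive[OF F(1,3,2) H(1,3,2) t])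
 also have "... <= \<bar>t\<bar> powr (- (DIM('a) / 2)) * (sqrt m * norm (abs_l2 f')) * (sqrt m * norm (abs_l2 h'))"
  by (intro mult_mono F4 H4) (use m in auto)
 also have "... = \<bar>t\<bar> powr (- (DIM('a) / 2)) * (sqrt m * sqrt m) * norm (abs_l2 f') * norm (abs_l2 h')" by (simp only: ac_simps)
 finally show ?thesis using m by (simp add: cf)
qed

text \<open>Neighbouring cells can contain arbitrarily close times, so index distance 1 is left to
  Cauchy-Schwarz, which explains the 1 in the constant. From distance r >= 2 on, the times differ by
  at least (r - 1) eta, hence by r eta / 2.\<close>

lemma time_dispersive:
 assumes eta: "0 < eta" and tau: "!!n. (floor (tau n / eta)) = n" and \<sigma>: "!!n. \<lfloor>\<sigma> n / eta\<rfloor> = n"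
  and G: "!!n k. cut c k (G n k) = G n k" and H: "!!n k. cut c k (H n k) = H n k"
 shows "dispersive (1 + m * (eta / 2) powr (- (DIM('a) / 2))) DIM('a) N K (%n k. propagator (- tau n) (G n k)) (%n k. propagator (- \<sigma> n) (H n k))"
 unfolding dispersive_def
proof (intro ballI impI)
 fix n n' k l assume nn: "(n::int) ~= n'"
 define d where "d = real DIM('a) / 2"
 define A where "A = 1 + m * (eta / 2) powr (- d)"
 have m: "0 < m" using c by (simp add: mesh_def)
 have eq: "inner (propagator (- tau n) (G n k)) (propagator (- \<sigma> n') (H n' l)) = inner (propagator (\<sigma> n' - tau n) (G n k)) (H n' l)"
  using inner_propagator[of "\<sigma> n'" "propagator (- tau n) (G n k)" "H n' l"] by (simp add: propagator_add)
 have "\<bar>inner (propagator (\<sigma> n' - tau n) (G n k)) (H n' l)\<bar> <= A * real_of_int \<bar>n - n'\<bar> powr (- d) * norm (G n k) * norm (H n' l)"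
 proof (cases "\<bar>n - n'\<bar> = 1")
  case True
  have "\<bar>inner (propagator (\<sigma> n' - tau n) (G n k)) (H n' l)\<bar> <= 1 * (norm (G n k) * norm (H n' l))"
   using Cauchy_Schwarz_ineq2[of "propagator (\<sigma> n' - tau n) (G n k)" "H n' l"] by (simp add: norm_propagator)
  also have "... <= A * (norm (G n k) * norm (H n' l))" using m by (intro mult_right_mono) (auto simp: A_def)
  finally show ?thesis using True by simp
 next
  case False
  then have ge: "2 <= \<bar>n - n'\<bar>" using nn by linarith
  have fl: "of_int n * eta <= tau n" "tau n < (of_int n + 1) * eta" "of_int n' * eta <= \<sigma> n'" "\<sigma> n' < (of_int n' + 1) * eta"
   using floor_eq_scaled[OF eta, of "tau n" n] floor_eq_scaled[OF eta, of "\<sigma> n'" n'] tau \<sigma> by auto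
  define r where "r = real_of_int \<bar>n - n'\<bar>"
  have r: "2 <= r" using ge by (simp add: r_def)
  have "(r - 1) * eta <= \<bar>\<sigma> n' - tau n\<bar>"
  proof (cases "n < n'")
   case True
   then have req: "r = of_int n' - of_int n" by (simp add: r_def)
   have "(r - 1) * eta = of_int n' * eta - (of_int n + 1) * eta" unfolding req by (simp add: algebra_simps)
   then show ?thesis using fl by linarith
  next
   case False
   then have req: "r = of_int n - of_int n'" by (simp add: r_def)
   have "(r - 1) * eta = of_int n * eta - (of_int n' + 1) * eta" unfolding req by (simp add: algebra_simps)
   then show ?thesis using fl by linarith
  qed
  moreover have "r * (eta / 2) <= (r - 1) * eta" using r eta mult_right_mono[of "r / 2" "r - 1" eta] by simp
  ultimately have t: "r * (eta / 2) <= \<bar>\<sigma> n' - tau n\<bar>" by linarith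
  have rp: "0 < r * (eta / 2)" using r eta by simp
  have "\<bar>\<sigma> n' - tau n\<bar> powr (- d) <= (r * (eta / 2)) powr (- d)" using t rp by (intro powr_mono2') (auto simp: d_def)
  also have "... = r powr (- d) * (eta / 2) powr (- d)" by (rule powr_mult)
  finally have "\<bar>\<sigma> n' - tau n\<bar> powr (- d) * m <= r powr (- d) * (eta / 2) powr (- d) * m" using m by (intro mult_right_mono) auto
  also have "... = (m * (eta / 2) powr (- d)) * r powr (- d)" by (simp only: ac_simps)
  also have "... <= A * r powr (- d)" by (intro mult_right_mono) (auto simp: A_def)
  finally have p: "\<bar>\<sigma> n' - tau n\<bar> powr (- d) * m <= A * r powr (- d)" .
  have "\<bar>inner (propagator (\<sigma> n' - tau n) (G n k)) (H n' l)\<bar> <= \<bar>\<sigma> n' - tau n\<bar> powr (- d) * m * norm (G n k) * norm (H n' l)"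
   using cell_dispersive[of "\<sigma> n' - tau n" k "G n k" l "H n' l"] t rp unfolding G H d_def by fastforce
  also have "... <= A * r powr (- d) * norm (G n k) * norm (H n' l)" by (intro mult_right_mono p) auto
  finally show ?thesis by (simp add: r_def)
 qed
 then show "\<bar>inner (propagator (- tau n) (G n k)) (propagator (- \<sigma> n') (H n' l))\<bar>
  <= (1 + m * (eta / 2) powr (- (DIM('a) / 2))) * real_of_int \<bar>n - n'\<bar> powr (- (DIM('a) / 2)) * norm (propagator (- tau n) (G n k)) * norm (propagator (- \<sigma> n') (H n' l))"
  unfolding eq norm_propagator A_def d_def .
qed

lemma propagated_orth:
 assumes G: "!!n k. cut c k (G n k) = G n k" shows "orth_family N K (%n k. propagator (s n) (G n k))"
 unfolding orth_family_def propagator_inner using inner_cut_cut[OF c] G by metis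

text \<open>An extremal dual family can be taken inside the cells, as multiples of
  \<open>cut c k (Z n)\<close>, so tests fixed by the projections suffice.\<close>

lemma mix_by_duality:
 assumes N: "finite N" and K: "finite K" and e: "0 <= alpha" "alpha <= 1" "0 <= rho" "rho <= 1" and B: "0 <= B"
  and le: "!!G. (!!n k. cut c k (G n k) = G n k) ==>
   (SUM n:N. SUM k:K. inner (Z n) (G n k)) <= B * mix (1 - alpha) (1 - rho) N K (%n k. norm (G n k))"
 shows "mix alpha rho N K (%n k. norm (cut c k (Z n))) <= B"
proof -
 obtain b where b: "ALL n k. 0 <= b n k" "mix (1 - alpha) (1 - rho) N K b <= 1"
  "(SUM n:N. SUM k:K. norm (cut c k (Z n)) * b n k) = mix alpha rho N K (%n k. norm (cut c k (Z n)))"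
  using mix_dual[OF N K e, of "%n k. norm (cut c k (Z n))"] by auto
 define G where "G n k = (b n k / norm (cut c k (Z n))) *\<^sub>R cut c k (Z n)" for n k
 have Gc: "cut c k (G n k) = G n k" for n k unfolding G_def by (simp add: cut_scaleR[OF c] cut_cut[OF c])
 have Gn: "norm (G n k) <= b n k" for n k using b(1) by (simp add: G_def)
 have inn: "inner (Z n) (G n k) = norm (cut c k (Z n)) * b n k" for n k
 proof -
  have "inner (Z n) (cut c k (Z n)) = (norm (cut c k (Z n)))^2"
   using inner_cut_cut[OF c, of k "Z n" k "Z n"] by (simp add: power2_norm_eq_inner)
  then show ?thesis by (simp add: G_def power2_eq_square)
 qed
 have "mix alpha rho N K (%n k. norm (cut c k (Z n))) = (SUM n:N. SUM k:K. inner (Z n) (G n k))" unfolding inn b(3) ..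
 also have "... <= B * mix (1 - alpha) (1 - rho) N K (%n k. norm (G n k))" by (rule le[OF Gc])
 also have "... <= B * mix (1 - alpha) (1 - rho) N K b" using e Gn by (intro mult_left_mono[OF _ B] mix_mono N K) auto
 also have "... <= B * 1" by (intro mult_left_mono[OF b(2) B])
 finally show ?thesis by simp
qed

text \<open>The dual of \<open>norm_estimate\<close>: pairing with tests at the sample times moves
  the propagators from \<open>v\<close> onto the tests.\<close>

theorem homogeneous_grand:
 assumes eta: "0 < eta" and e: "diagonal_exponents DIM('a) alpha rho" and theta: "0 <= theta" "theta <= 1"
 shows "\<exists>C\<ge>0. ALL v. grand eta c (theta * alpha) (theta * rho + (1 - theta) / 2) (%t. propagator t v) (C * norm v)"
proof -
 have m: "0 < m" using c by (simp add: mesh_def)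
 define A where "A = 1 + m * (eta / 2) powr (- (DIM('a) / 2))"
 have A: "0 < A" using m by (simp add: A_def add_pos_nonneg)
 have ex: "0 <= theta * alpha" "theta * alpha <= 1" "0 <= theta * rho + (1 - theta) / 2" "theta * rho + (1 - theta) / 2 <= 1"
 proof -
  have r: "0 <= alpha" "alpha <= 1/2" "0 <= rho" "rho < 1/2" using e unfolding diagonal_exponents_def by auto
  then show "0 <= theta * alpha" "0 <= theta * rho + (1 - theta) / 2" using theta by auto
  show "theta * alpha <= 1" using mult_left_le_one_le[of alpha theta] r theta by linarith
  have "theta * rho <= theta * (1/2)" using r theta by (intro mult_left_mono) auto
  then show "theta * rho + (1 - theta) / 2 <= 1" by (simp add: field_simps)
 qed
 obtain C where C: "0 <= C" "!!N K (x :: int => 'k => 'a l2). finite N ==> finite K ==> orth_family N K x ==> dispersive A DIM('a) N K x x ==>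
   norm (SUM n:N. SUM k:K. x n k) <= C * mix (1 - theta * alpha) (1 - (theta * rho + (1 - theta) / 2)) N K (%n k. norm (x n k))"
  using norm_estimate[OF A e theta] by metis
 show ?thesis
 proof (intro exI[of _ C] conjI C(1) allI)
  fix v
  show "grand eta c (theta * alpha) (theta * rho + (1 - theta) / 2) (%t. propagator t v) (C * norm v)"
   unfolding grand_def
  proof (intro allI impI)
   fix tau :: "int => real" and N :: "int set" and K :: "'k set" assume N: "finite N" and K: "finite K" and tau: "ALL n. (floor (tau n / eta)) = n"
   show "mix (theta * alpha) (theta * rho + (1 - theta) / 2) N K (%n k. norm (cut c k (propagator (tau n) v))) <= C * norm v"
   proof (rule mix_by_duality[OF N K ex])
    show "0 <= C * norm v" using C by simp
    fix G :: "int => 'k => 'a l2" assume G: "!!n k. cut c k (G n k) = G n k"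
    have "(SUM n:N. SUM k:K. inner (propagator (tau n) v) (G n k)) = inner v (SUM n:N. SUM k:K. propagator (- tau n) (G n k))"
     by (simp add: inner_propagator inner_sum_right)
    also have "... <= norm v * norm (SUM n:N. SUM k:K. propagator (- tau n) (G n k))" by (rule norm_cauchy_schwarz)
    also have "... <= norm v * (C * mix (1 - theta * alpha) (1 - (theta * rho + (1 - theta) / 2)) N K (%n k. norm (propagator (- tau n) (G n k))))"
     using tau by (intro mult_left_mono C(2) N K propagated_orth[OF G] time_dispersive[OF eta _ _ G G, folded A_def]) auto
    finally show "(SUM n:N. SUM k:K. inner (propagator (tau n) v) (G n k))
      <= C * norm v * mix (1 - theta * alpha) (1 - (theta * rho + (1 - theta) / 2)) N K (%n k. norm (G n k))"
     by (simp add: norm_propagator ac_simps)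
   qed
  qed
 qed
qed

text \<open>The function of \<open>s\<close> is, up to sign, an advanced solution with one pulse at
  \<open>tau n\<close> in each cell, adjoint to the retarded evolution. Sampled at
  \<open>\<sigma>\<close>, the condition \<open>\<sigma> n' < tau n\<close> is the order of the
  cells, except within one cell, where it defines the set \<open>D\<close> of
  \<open>bilinear_estimate\<close>.\<close>

theorem retarded_grand:
 assumes eta: "0 < eta" and e: "diagonal_exponents DIM('a) alpha rho" and theta: "0 <= theta" "theta <= 1" and theta': "0 <= theta'" "theta' <= 1"
 shows "\<exists>C\<ge>0. ALL tau N K G. finite N --> finite K --> (ALL n. (floor (tau n / eta)) = n) --> (ALL n k. cut c k (G n k) = G n k) -->
  grand eta c (theta' * alpha) (theta' * rho + (1 - theta') / 2) (%s. SUM n:N. if s < tau n then SUM k:K. propagator (s - tau n) (G n k) else 0)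
   (C * mix (1 - theta * alpha) (1 - (theta * rho + (1 - theta) / 2)) N K (%n k. norm (G n k)))"
proof -
 have m: "0 < m" using c by (simp add: mesh_def)
 define A where "A = 1 + m * (eta / 2) powr (- (DIM('a) / 2))"
 have A: "0 < A" using m by (simp add: A_def add_pos_nonneg)
 have ex: "0 <= t * alpha" "t * alpha <= 1" "0 <= t * rho + (1 - t) / 2" "t * rho + (1 - t) / 2 <= 1" if t: "0 <= t" "t <= 1" for t
 proof -
  have r: "0 <= alpha" "alpha <= 1/2" "0 <= rho" "rho < 1/2" using e unfolding diagonal_exponents_def by auto
  then show "0 <= t * alpha" "0 <= t * rho + (1 - t) / 2" using t by auto
  show "t * alpha <= 1" using mult_left_le_one_le[of alpha t] r t by linarith
  have "t * rho <= t * (1/2)" using r t by (intro mult_left_mono) auto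
  then show "t * rho + (1 - t) / 2 <= 1" by (simp add: field_simps)
 qed
 define alpha1 where "alpha1 = theta * alpha"
 define rho1 where "rho1 = theta * rho + (1 - theta) / 2"
 define alpha2 where "alpha2 = theta' * alpha"
 define rho2 where "rho2 = theta' * rho + (1 - theta') / 2"
 note e1 = ex[OF theta, folded alpha1_def rho1_def] and e2 = ex[OF theta', folded alpha2_def rho2_def]
 obtain C where C: "0 <= C" and C': "ALL N K D (x :: int => 'k => 'a l2) y. finite N --> finite K --> orth_family N K x --> orth_family N K y -->
   dispersive A DIM('a) N K x x --> dispersive A DIM('a) N K y y --> dispersive A DIM('a) N K x y -->
   \<bar>SUM n:N. SUM m:{m\<in>N. m < n \<or> (m = n & n : D)}. inner (SUM k:K. x n k) (SUM k:K. y m k)\<bar>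
   <= C * mix (1 - alpha1) (1 - rho1) N K (%n k. norm (x n k)) * mix (1 - alpha2) (1 - rho2) N K (%n k. norm (y n k))"
  using bilinear_estimate[OF A e theta theta', folded alpha1_def rho1_def alpha2_def rho2_def] by (elim exE conjE) (rule that)
 note C2 = C'[rule_format]
 have "grand eta c alpha2 rho2 (%s. SUM n:N. if s < tau n then SUM k:K. propagator (s - tau n) (G n k) else 0)
   (C * mix (1 - alpha1) (1 - rho1) N K (%n k. norm (G n k)))"
  if N: "finite N" and K: "finite K" and tau: "ALL n. (floor (tau n / eta)) = n" and G: "ALL n k. cut c k (G n k) = G n k" for tau N K G
  unfolding grand_def
 proof (intro allI impI)
  fix \<sigma> :: "int => real" and N' :: "int set" and K' :: "'k set" assume N': "finite N'" and K': "finite K'" and \<sigma>: "ALL n. \<lfloor>\<sigma> n / eta\<rfloor> = n"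
  define Z where "Z s = (SUM n:N. if s < tau n then SUM k:K. propagator (s - tau n) (G n k) else 0)" for s
  show "mix alpha2 rho2 N' K' (%n k. norm (cut c k (Z (\<sigma> n)))) <= C * mix (1 - alpha1) (1 - rho1) N K (%n k. norm (G n k))"
  proof (rule mix_by_duality[OF N' K' e2])
   show "0 <= C * mix (1 - alpha1) (1 - rho1) N K (%n k. norm (G n k))" by (intro mult_nonneg_nonneg C mix_nonneg[OF N])
   fix H :: "int => 'k => 'a l2" assume H: "!!n k. cut c k (H n k) = H n k"
   \<comment> \<open>Extension by zero to \<open>N2\<close> and \<open>K2\<close> lets sources and
     tests share one index set, without changing the mixed norms.\<close>
   define G' where "G' n k = (if n : N & k : K then G n k else 0)" for n k
   define H' where "H' n k = (if n : N' & k : K' then H n k else 0)" for n k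
   have G': "cut c k (G' n k) = G' n k" and H': "cut c k (H' n k) = H' n k" for n k
    using G H cut_zero[OF c] by (auto simp: G'_def H'_def)
   define x where "x n k = propagator (- tau n) (G' n k)" for n k
   define y where "y n k = propagator (- \<sigma> n) (H' n k)" for n k
   define N2 where "N2 = N \<union> N'"
   define K2 where "K2 = K \<union> K'"
   have f: "finite N2" "finite K2" using N N' K K' by (auto simp: N2_def K2_def)
   define D where "D = {n. \<sigma> n < tau n}"
   have X: "(SUM k:K2. x n k) = (if n : N then SUM k:K. propagator (- tau n) (G n k) else 0)" for n
   proof -
    have "(SUM k:K2. x n k) = (SUM k:K. x n k)" using f by (intro sum.mono_neutral_right) (auto simp: K2_def x_def G'_def propagator_0)
    then show ?thesis by (simp add: x_def G'_def propagator_0)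
   qed
   have Y: "(SUM k:K2. y n k) = (if n : N' then SUM k:K'. propagator (- \<sigma> n) (H n k) else 0)" for n
   proof -
    have "(SUM k:K2. y n k) = (SUM k:K'. y n k)" using f by (intro sum.mono_neutral_right) (auto simp: K2_def y_def H'_def propagator_0)
    then show ?thesis by (simp add: y_def H'_def propagator_0)
   qed
   have rel: "\<sigma> n' < tau n \<longleftrightarrow> n' < n \<or> (n' = n & n : D)" for n n'
   proof -
    have fl: "of_int n * eta <= tau n" "tau n < (of_int n + 1) * eta" "of_int n' * eta <= \<sigma> n'" "\<sigma> n' < (of_int n' + 1) * eta"
     using floor_eq_scaled[OF eta, of "tau n" n] floor_eq_scaled[OF eta, of "\<sigma> n'" n'] tau \<sigma> by auto
    have 1: "\<sigma> n' < tau n" if "n' < n"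
    proof -
     have "(of_int n' + 1) * eta <= of_int n * eta" using that eta by (intro mult_right_mono) auto
     then show ?thesis using fl by linarith
    qed
    have 2: "\<not> \<sigma> n' < tau n" if "n < n'"
    proof -
     have "(of_int n + 1) * eta <= of_int n' * eta" using that eta by (intro mult_right_mono) auto
     then show ?thesis using fl by linarith
    qed
    show ?thesis using 1 2 by (cases n n' rule: linorder_cases) (auto simp: D_def)
   qed
   have "(SUM n':N'. SUM k:K'. inner (Z (\<sigma> n')) (H n' k)) = (SUM n':N'. SUM n:N. if \<sigma> n' < tau n then inner (SUM k:K2. x n k) (SUM k:K2. y n' k) else 0)"
   proof (rule sum.cong[OF refl])
    fix n' assume n': "n' : N'"
    have "(SUM k:K'. inner (Z (\<sigma> n')) (H n' k)) = inner (Z (\<sigma> n')) (SUM k:K'. H n' k)" by (simp add: inner_sum_right)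
    also have "... = (SUM n:N. inner (if \<sigma> n' < tau n then SUM k:K. propagator (\<sigma> n' - tau n) (G n k) else 0) (SUM k:K'. H n' k))"
     unfolding Z_def by (rule inner_sum_left)
    also have "... = (SUM n:N. if \<sigma> n' < tau n then inner (SUM k:K2. x n k) (SUM k:K2. y n' k) else 0)"
    proof (rule sum.cong[OF refl])
     fix n assume n: "n : N"
     have "inner (SUM k:K. propagator (\<sigma> n' - tau n) (G n k)) (SUM k:K'. H n' k)
       = inner (propagator (\<sigma> n') (SUM k:K. propagator (- tau n) (G n k))) (SUM k:K'. H n' k)"
      by (simp add: propagator_sum propagator_add)
     also have "... = inner (SUM k:K. propagator (- tau n) (G n k)) (propagator (- \<sigma> n') (SUM k:K'. H n' k))"
      by (rule inner_propagator)
     also have "... = inner (SUM k:K2. x n k) (SUM k:K2. y n' k)"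
      using n n' by (simp only: X Y propagator_sum if_True)
     finally show "inner (if \<sigma> n' < tau n then SUM k:K. propagator (\<sigma> n' - tau n) (G n k) else 0) (SUM k:K'. H n' k)
       = (if \<sigma> n' < tau n then inner (SUM k:K2. x n k) (SUM k:K2. y n' k) else 0)" by simp
    qed
    finally show "(SUM k:K'. inner (Z (\<sigma> n')) (H n' k)) = (SUM n:N. if \<sigma> n' < tau n then inner (SUM k:K2. x n k) (SUM k:K2. y n' k) else 0)" .
   qed
   also have "... = (SUM n':N2. SUM n:N2. if \<sigma> n' < tau n then inner (SUM k:K2. x n k) (SUM k:K2. y n' k) else 0)"
   proof -
    have "(SUM n:N. if \<sigma> n' < tau n then inner (SUM k:K2. x n k) (SUM k:K2. y n' k) else 0)
      = (SUM n:N2. if \<sigma> n' < tau n then inner (SUM k:K2. x n k) (SUM k:K2. y n' k) else 0)" for n'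
     using f by (intro sum.mono_neutral_left) (auto simp: N2_def X)
    moreover have "(SUM n':N'. SUM n:N2. if \<sigma> n' < tau n then inner (SUM k:K2. x n k) (SUM k:K2. y n' k) else 0)
      = (SUM n':N2. SUM n:N2. if \<sigma> n' < tau n then inner (SUM k:K2. x n k) (SUM k:K2. y n' k) else 0)"
     using f by (intro sum.mono_neutral_left) (auto simp: N2_def Y intro!: sum.neutral)
    ultimately show ?thesis by simp
   qed
   also have "... = (SUM n:N2. SUM n':N2. if \<sigma> n' < tau n then inner (SUM k:K2. x n k) (SUM k:K2. y n' k) else 0)" by (rule sum.swap)
   also have "... = (SUM n:N2. SUM n':{n'\<in>N2. n' < n \<or> (n' = n & n : D)}. inner (SUM k:K2. x n k) (SUM k:K2. y n' k))"
    unfolding rel by (rule sum.cong[OF refl], rule sum.inter_filter[OF f(1), symmetric])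
   also have "... <= C * mix (1 - alpha1) (1 - rho1) N2 K2 (%n k. norm (x n k)) * mix (1 - alpha2) (1 - rho2) N2 K2 (%n k. norm (y n k))"
   proof (rule order_trans[OF abs_ge_self C2[OF f]])
    show "orth_family N2 K2 x" "orth_family N2 K2 y" unfolding x_def[abs_def] y_def[abs_def] by (rule propagated_orth[OF G'], rule propagated_orth[OF H'])
    show "dispersive A DIM('a) N2 K2 x x" "dispersive A DIM('a) N2 K2 y y" "dispersive A DIM('a) N2 K2 x y"
     unfolding x_def[abs_def] y_def[abs_def] A_def using tau \<sigma> G' H' by (auto intro!: time_dispersive[OF eta])
   qed
   also have "mix (1 - alpha1) (1 - rho1) N2 K2 (%n k. norm (x n k)) = mix (1 - alpha1) (1 - rho1) N K (%n k. norm (G n k))"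
   proof -
    have "(%n k. norm (x n k)) = (%n k. if n : N & k : K then norm (G n k) else 0)" by (intro ext) (simp add: x_def G'_def norm_propagator)
    then show ?thesis using f e1 mix_extend[of N2 K2 N K "1 - alpha1" "1 - rho1"] by (simp add: N2_def K2_def)
   qed
   also have "mix (1 - alpha2) (1 - rho2) N2 K2 (%n k. norm (y n k)) = mix (1 - alpha2) (1 - rho2) N' K' (%n k. norm (H n k))"
   proof -
    have "(%n k. norm (y n k)) = (%n k. if n : N' & k : K' then norm (H n k) else 0)" by (intro ext) (simp add: y_def H'_def norm_propagator)
    then show ?thesis using f e2 mix_extend[of N2 K2 N' K' "1 - alpha2" "1 - rho2"] by (simp add: N2_def K2_def)
   qed
   finally show "(SUM n:N'. SUM k:K'. inner (Z (\<sigma> n)) (H n k))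
     <= C * mix (1 - alpha1) (1 - rho1) N K (%n k. norm (G n k)) * mix (1 - alpha2) (1 - rho2) N' K' (%n k. norm (H n k))" .
  qed
 qed
 then show ?thesis unfolding alpha1_def rho1_def alpha2_def rho2_def using C by blast
qed

end

section \<open>Continuous forcing: pairings, weak integrals and the retarded solution\<close>

lemma propagator_scaleR: "propagator t (r *\<^sub>R v) = r *\<^sub>R propagator t v"
proof -
 have "inner (propagator t (r *\<^sub>R v) - r *\<^sub>R propagator t v) w = 0" for w
  by (simp add: inner_diff_left inner_propagator)
 then show ?thesis using inner_eq_zero_iff by (metis eq_iff_diff_eq_0)
qed

text \<open>The selected cells cover the ball of radius \<open>n\<close>, so the error is at most
  that of truncation to this ball.\<close>

lemma cut_tendsto:
 fixes c :: "'a::euclidean_space => 'k"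
 assumes c: "mesh delta m c"
 shows "(%n. SUM k:c ` ball 0 (real n + 1). cut c k v) \<longlonglongrightarrow> v"
proof -
 define f where "f = rep_l2 v"
 have f: "f : L2" "abs_l2 f = v" by (simp_all add: f_def)
 define K where "K n = c ` ball 0 (real n + 1)" for n :: nat
 have K: "finite (K n)" for n
 proof -
  have "(0::real) < real n + 1" by simp
  then show ?thesis unfolding K_def by (rule mesh_card(1)[OF c])
 qed
 define h where "h n x = (SUM k:K n. indicator {x. c x = k} x * f x)" for n x
 have h: "h n : L2" "abs_l2 (h n) = (SUM k:K n. cut c k v)" for n
  using abs_sum[OF c K[of n], of "%k x. indicator {x. c x = k} x * f x", OF cut_L2[OF c f(1)]] cut_abs[OF c f(1)]
  by (simp_all add: h_def[abs_def] f(2))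
 have hx: "h n x = (if c x : K n then f x else 0)" for n x
 proof -
  have "h n x = (SUM k:K n. if k = c x then f x else 0)" unfolding h_def by (intro sum.cong) auto
  then show ?thesis using K by simp
 qed
 have le: "norm ((SUM k:K n. cut c k v) - v) <= norm (v - abs_l2 (trunc n f))" for n
 proof -
  have "norm (abs_l2 (%x. h n x - f x)) <= 1 * norm (abs_l2 (%x. f x - trunc n f x))"
  proof (rule norm_abs_mono[OF L2_diff[OF h(1) f(1)] L2_diff[OF f(1) trunc_L2[OF f(1)]]])
   show "cmod (h n x - f x) <= 1 * cmod (f x - trunc n f x)" for x
   proof (cases "c x : K n")
    case True
    then show ?thesis by (simp add: hx)
   next
    case False
    then have "x \<notin> cball 0 (real n)" by (auto simp: K_def)
    then show ?thesis using False by (simp add: hx trunc_def)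
   qed
  qed simp
  then show ?thesis using abs_l2_diff[OF h(1)[of n] f(1)] abs_l2_diff[OF f(1) trunc_L2[OF f(1), of n]] h(2)[of n] f(2) by simp
 qed
 have "(%n. norm (v - abs_l2 (trunc n f))) \<longlonglongrightarrow> norm (v - v)"
  using tendsto_norm[OF tendsto_diff[OF tendsto_const trunc_tendsto[OF f(1)]], of v] unfolding f(2) .
 then have z: "(%n. norm (v - abs_l2 (trunc n f))) \<longlonglongrightarrow> 0" by simp
 have "(%n. (SUM k:K n. cut c k v) - v) \<longlonglongrightarrow> 0"
  by (rule Lim_null_comparison[OF always_eventually z]) (use le in blast)
 then show ?thesis unfolding K_def by (rule LIM_zero_cancel)
qed

lemma pairing_bound:
 fixes c :: "'a::euclidean_space => 'k"
 assumes c: "mesh delta m c" and rho: "0 <= rho" "rho <= 1"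
  and u: "!!K. finite K ==> lpn (1 - rho) K (%k. norm (cut c k u)) <= b"
  and v: "!!K. finite K ==> lpn rho K (%k. norm (cut c k v)) <= a"
 shows "\<bar>inner u v\<bar> <= b * a"
proof -
 have fin: "\<bar>inner u (SUM k:K. cut c k v)\<bar> <= b * a" if K: "finite K" for K
 proof -
  have "inner u (SUM k:K. cut c k v) = (SUM k:K. inner (cut c k u) (cut c k v))"
   by (simp add: inner_sum_right inner_cut_cut[OF c])
  also have "\<bar>...\<bar> <= (SUM k:K. norm (cut c k u) * norm (cut c k v))"
   by (rule order_trans[OF sum_abs sum_mono]) (rule Cauchy_Schwarz_ineq2)
  also have "... <= lpn (1 - rho) K (%k. norm (cut c k u)) * lpn (1 - (1 - rho)) K (%k. norm (cut c k v))"
   using rho by (intro lpn_sum_le K) auto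
  also have "... <= b * a"
   using u[OF K] v[OF K] lpn_nonneg[OF K, of "1 - rho" "%k. norm (cut c k u)"] lpn_nonneg[OF K, of rho "%k. norm (cut c k v)"]
   by (intro mult_mono) auto
  finally show ?thesis .
 qed
 have "(%n. \<bar>inner u (SUM k:c ` ball 0 (real n + 1). cut c k v)\<bar>) \<longlonglongrightarrow> \<bar>inner u v\<bar>"
  by (rule tendsto_rabs[OF tendsto_inner[OF tendsto_const cut_tendsto[OF c]]])
 then show ?thesis
 proof (rule LIMSEQ_le_const2)
  have "finite (c ` ball 0 (real n + 1))" for n
  proof -
   have "(0::real) < real n + 1" by simp
   then show ?thesis by (rule mesh_card(1)[OF c])
  qed
  then show "EX N. \<forall>n\<ge>N. \<bar>inner u (SUM k:c ` ball 0 (real n + 1). cut c k v)\<bar> <= b * a" using fin by blast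
 qed
qed

text \<open>\<open>f\<close> is a Borel forcing whose every section is in \<open>L2\<close>. The
  scalar function \<open>b\<close> majorizes its spatial norm, in \<open>L2\<close> and over cells
  with the dual exponent, and \<open>X\<close> bounds the dual time norm of the cell integrals of
  \<open>b\<close>.\<close>

locale forcing =
 fixes c :: "'a::euclidean_space => 'k" and delta m eta alpha rho :: real
  and f :: "real => 'a => complex" and b :: "real => real" and X :: real
 assumes c: "mesh delta m c" and eta: "0 < eta" and e: "0 <= alpha" "alpha <= 1" "0 <= rho" "rho <= 1"
  and fm: "(%(s, x). f s x) : borel_measurable (lborel \<Otimes>\<^sub>M lborel)" and f2: "!!s. f s : L2"
  and bm: "b : borel_measurable borel" and b0: "!!s. 0 <= b s" and bn: "!!s. norm (abs_l2 (f s)) <= b s"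
  and bl: "!!s K. finite K ==> lpn (1 - rho) K (%k. norm (cut c k (abs_l2 (f s)))) <= b s"
  and fin: "!!n. (\<integral>\<^sup>+s. ennreal (b s) * indicator {s. (floor (s / eta)) = n} s \<partial>lborel) < \<infinity>"
  and bX: "!!N. finite N ==> lpn (1 - alpha) N (%n. enn2real (\<integral>\<^sup>+s. ennreal (b s) * indicator {s. (floor (s / eta)) = n} s \<partial>lborel)) <= X"
begin

abbreviation "u s \<equiv> abs_l2 (f s)"

definition "I n = {s::real. (floor (s / eta)) = n}"
definition "\<beta> n = enn2real (\<integral>\<^sup>+s. ennreal (b s) * indicator (I n) s \<partial>lborel)"

lemma I_borel: "I n : sets borel" using mesh_floor[OF eta] by (simp add: mesh_def I_def)

lemma \<beta>: "(\<integral>\<^sup>+s. ennreal (b s) * indicator (I n) s \<partial>lborel) = ennreal (\<beta> n)"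
 using fin[of n] by (simp add: \<beta>_def I_def)

text \<open>Hoelder in space at each time, then Hoelder over time cells between the integrals of
  \<open>b\<close> and the suprema of \<open>Z\<close>; the 2 is the cost of
  \<open>grand_sup\<close>.\<close>

lemma pairing_integral:
 assumes g: "grand eta c alpha rho Z B"
 shows "(\<integral>\<^sup>+s. ennreal \<bar>inner (u s) (Z s)\<bar> \<partial>lborel) <= ennreal (2 * B * X)"
proof -
 obtain a where a: "!!n. 0 <= a n" "!!t K. finite K ==> lpn rho K (%k. norm (cut c k (Z t))) <= a (floor (t / eta))"
  "!!N. finite N ==> lpn alpha N a <= 2 * B" using grand_sup[OF eta e(1,3) g] by blast
 define D where "D n s = (SUM k:{- int n..int n}. ennreal (a k) * (ennreal (b s) * indicator (I k) s))" for n :: nat and s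
 have tm: "(%s. ennreal (b s) * indicator (I k) s) : borel_measurable lborel" for k
 proof -
  have "(%s. ennreal (b s)) : borel_measurable lborel" using bm by measurable
  then show ?thesis using I_borel by (intro borel_measurable_times_ennreal borel_measurable_indicator) simp_all
 qed
 have tm': "(%s. ennreal (a k) * (ennreal (b s) * indicator (I k) s)) : borel_measurable lborel" for k
  by (rule borel_measurable_times_ennreal[OF borel_measurable_const tm])
 have Dm: "D n : borel_measurable lborel" for n unfolding D_def[abs_def] by (rule borel_measurable_sum) (rule tm')
 have inc: "incseq D" unfolding D_def by (intro incseq_SucI le_funI sum_mono2) auto
 have "ennreal \<bar>inner (u s) (Z s)\<bar> <= (SUP n. D n s)" for s
 proof -
  define k where "k = (floor (s / eta))"
  have "\<bar>inner (u s) (Z s)\<bar> <= b s * a k" unfolding k_def by (rule pairing_bound[OF c e(3,4) bl a(2)])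
  then have "ennreal \<bar>inner (u s) (Z s)\<bar> <= ennreal (a k) * (ennreal (b s) * indicator (I k) s)"
   using a(1) b0 by (simp add: I_def k_def ennreal_mult'[symmetric] mult.commute ennreal_leI)
  also have "... <= D (nat \<bar>k\<bar>) s" unfolding D_def by (rule member_le_sum) auto
  also have "... <= (SUP n. D n s)" by (rule SUP_upper) simp
  finally show ?thesis .
 qed
 then have "(\<integral>\<^sup>+s. ennreal \<bar>inner (u s) (Z s)\<bar> \<partial>lborel) <= (\<integral>\<^sup>+s. (SUP n. D n s) \<partial>lborel)" by (intro nn_integral_mono)
 also have "... = (SUP n. \<integral>\<^sup>+s. D n s \<partial>lborel)" by (rule nn_integral_monotone_convergence_SUP[OF inc Dm])
 also have "... <= ennreal (2 * B * X)"
 proof (rule SUP_least)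
  fix n :: nat
  have "(\<integral>\<^sup>+s. D n s \<partial>lborel) = (SUM k:{- int n..int n}. \<integral>\<^sup>+s. ennreal (a k) * (ennreal (b s) * indicator (I k) s) \<partial>lborel)"
   unfolding D_def by (rule nn_integral_sum) (rule tm')
  also have "... = (SUM k:{- int n..int n}. ennreal (a k * \<beta> k))"
   using a(1) by (intro sum.cong refl) (simp only: nn_integral_cmult[OF tm] \<beta> ennreal_mult')
  also have "... = ennreal (SUM k:{- int n..int n}. a k * \<beta> k)" using a(1) by (intro sum_ennreal) (simp add: \<beta>_def)
  also have "(SUM k:{- int n..int n}. a k * \<beta> k) <= lpn alpha {- int n..int n} a * lpn (1 - alpha) {- int n..int n} \<beta>"
   using e a(1) by (intro lpn_sum_le) (auto simp: \<beta>_def)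
  also have "... <= 2 * B * X"
  proof (rule mult_mono)
   show "lpn (1 - alpha) {- int n..int n} \<beta> <= X" using bX[of "{- int n..int n}"] by (simp add: \<beta>_def[abs_def] I_def)
   show "0 <= 2 * B" using lpn_nonneg[of "{}" alpha a] a(3)[of "{}"] by simp
   show "0 <= lpn (1 - alpha) {- int n..int n} \<beta>" by (rule lpn_nonneg) simp
  qed (use a(3) in simp)
  finally show "(\<integral>\<^sup>+s. D n s \<partial>lborel) <= ennreal (2 * B * X)" using ennreal_leI by blast
 qed
 finally show ?thesis .
qed

lemma inner_const_measurable: "(%s. inner (u s) v) : borel_measurable borel"
proof -
 obtain h where h: "h : borel_measurable borel" "h : L2" "abs_l2 h = v" using l2_borel_rep by blast
 have fs: "f s : borel_measurable borel" for s using measurable_Pair2[OF fm, of s] by simp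
 have "inner (u s) v = Re (CLINT x|lborel. f s x * cnj (h x))" for s
  using inner_abs_l2[OF f2[of s] h(2)] L2_inner_borel[OF fs[of s] h(1)] h(3) by simp
 moreover have "(%s. Re (CLINT x|lborel. f s x * cnj (h x))) : borel_measurable lborel"
 proof -
  have hc: "(%x. cnj (h x)) : borel_measurable lborel" using measurable_compose[OF h(1) cnj_borel] by simp
  have "(%(s::real, x). cnj (h x)) : borel_measurable (lborel \<Otimes>\<^sub>M lborel)"
   using measurable_compose[OF measurable_snd hc, of "lborel :: real measure"] by (simp add: case_prod_beta)
  from borel_measurable_times[OF fm this]
  have "(%(s, x). f s x * cnj (h x)) : borel_measurable (lborel \<Otimes>\<^sub>M lborel)" by (simp add: case_prod_beta)
  then have "(%s. CLINT x|lborel. f s x * cnj (h x)) : borel_measurable lborel" by (rule lborel.borel_measurable_lebesgue_integral)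
  then show ?thesis by measurable
 qed
 ultimately show ?thesis by simp
qed

text \<open>With \<open>Z\<close> frozen at grid times the pairing is measurable piece by piece;
  continuity of \<open>Z\<close> recovers the pairing as the grid is refined.\<close>

lemma inner_measurable:
 assumes Z: "!!X t. X \<longlonglongrightarrow> t ==> (%n. Z (X n)) \<longlonglongrightarrow> Z t"
 shows "(%s. inner (u s) (Z s)) : borel_measurable borel"
proof (rule borel_measurable_LIMSEQ_real)
 define q where "q n s = of_int (floor (s * real (Suc n))) / real (Suc n)" for n and s :: real
 show "(%n. inner (u s) (Z (q n s))) \<longlonglongrightarrow> inner (u s) (Z s)" for s
 proof (intro tendsto_inner tendsto_const Z)
  have "\<bar>q n s - s\<bar> <= 1 / real (Suc n)" for n
  proof -
   have "\<bar>of_int (floor (s * real (Suc n))) - s * real (Suc n)\<bar> <= 1" by linarith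
   then have "\<bar>of_int (floor (s * real (Suc n))) - s * real (Suc n)\<bar> / real (Suc n) <= 1 / real (Suc n)" by (intro divide_right_mono) auto
   also have "\<bar>of_int (floor (s * real (Suc n))) - s * real (Suc n)\<bar> / real (Suc n) = \<bar>(of_int (floor (s * real (Suc n))) - s * real (Suc n)) / real (Suc n)\<bar>" by simp
   also have "(of_int (floor (s * real (Suc n))) - s * real (Suc n)) / real (Suc n) = q n s - s" by (simp add: q_def diff_divide_distrib)
   finally show ?thesis .
  qed
  then have "(%n. q n s - s) \<longlonglongrightarrow> 0"
   by (intro Lim_null_comparison[OF always_eventually LIMSEQ_Suc[OF lim_1_over_n]]) auto
  then show "(%n. q n s) \<longlonglongrightarrow> s" by (rule LIM_zero_cancel)
 qed
 show "(%s. inner (u s) (Z (q n s))) : borel_measurable borel" for n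
  unfolding q_def
 proof (rule measurable_compose_countable[where f = "%i s. inner (u s) (Z (of_int i / real (Suc n)))"])
  show "(%s. inner (u s) (Z (of_int i / real (Suc n)))) : borel_measurable borel" for i by (rule inner_const_measurable)
  show "(%s. (floor (s * real (Suc n)))) : borel \<rightarrow>\<^sub>M count_space UNIV" by measurable
 qed
qed

lemma propagated_measurable: "(%s. inner (u s) (propagator s v)) : borel_measurable borel"
 by (rule inner_measurable) (rule propagator_tendsto)

text \<open>Finitely many time cells cover an interval. This supplies the majorant in
  \<open>duhamel_tendsto\<close>.\<close>

lemma locally_integrable: "integrable lborel (%s. b s * indicator {x..y} s)"
proof (rule integrableI_bounded)
 show "(%s. b s * indicator {x..y} s) : borel_measurable lborel" using bm by simp
 define N where "N = {(floor (x / eta))..(floor (y / eta))}"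
 have tm: "(%s. ennreal (b s) * indicator (I k) s) : borel_measurable lborel" for k
 proof -
  have "(%s. ennreal (b s)) : borel_measurable lborel" using bm by measurable
  then show ?thesis using I_borel by (intro borel_measurable_times_ennreal borel_measurable_indicator) simp_all
 qed
 have "(\<integral>\<^sup>+s. ennreal (norm (b s * indicator {x..y} s)) \<partial>lborel) <= (\<integral>\<^sup>+s. (SUM n:N. ennreal (b s) * indicator (I n) s) \<partial>lborel)"
 proof (rule nn_integral_mono)
  fix s
  show "ennreal (norm (b s * indicator {x..y} s)) <= (SUM n:N. ennreal (b s) * indicator (I n) s)"
  proof (cases "s : {x..y}")
   case True
   then have "(floor (s / eta)) : N" unfolding N_def using eta by (auto intro!: floor_mono divide_right_mono)
   moreover have "finite N" by (simp add: N_def)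
   ultimately have "ennreal (b s) * indicator (I (floor (s / eta))) s <= (SUM n:N. ennreal (b s) * indicator (I n) s)" by (intro member_le_sum) auto
   then show ?thesis using True b0 by (simp add: I_def)
  qed simp
 qed
 also have "... = (SUM n:N. \<integral>\<^sup>+s. ennreal (b s) * indicator (I n) s \<partial>lborel)" by (rule nn_integral_sum) (rule tm)
 also have "... < \<infinity>" using fin by (simp add: I_def N_def)
 finally show "(\<integral>\<^sup>+s. ennreal (norm (b s * indicator {x..y} s)) \<partial>lborel) < \<infinity>" .
qed

context
 fixes Ch :: real
 assumes Ch: "0 <= Ch" and hom: "!!v. grand eta c alpha rho (%t. propagator t v) (Ch * norm v)"
begin

lemma propagated_integrable:
 shows "integrable lborel (%s. inner (u s) (propagator s v))"
  and "(LINT s|lborel. \<bar>inner (u s) (propagator s v)\<bar>) <= 2 * (Ch * norm v) * X"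
proof -
 have nn: "(\<integral>\<^sup>+s. ennreal (norm (inner (u s) (propagator s v))) \<partial>lborel) <= ennreal (2 * (Ch * norm v) * X)"
  using pairing_integral[OF hom[of v]] by simp
 also have "... < \<infinity>" by simp
 finally show int: "integrable lborel (%s. inner (u s) (propagator s v))"
  using propagated_measurable by (intro integrableI_bounded) simp_all
 have X: "0 <= X" using bX[of "{}"] by (simp add: lpn_empty)
 have "ennreal (LINT s|lborel. \<bar>inner (u s) (propagator s v)\<bar>) = (\<integral>\<^sup>+s. ennreal \<bar>inner (u s) (propagator s v)\<bar> \<partial>lborel)"
  using int by (intro nn_integral_eq_integral[symmetric]) auto
 then have "ennreal (LINT s|lborel. \<bar>inner (u s) (propagator s v)\<bar>) <= ennreal (2 * (Ch * norm v) * X)" using nn by simp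
 then show "(LINT s|lborel. \<bar>inner (u s) (propagator s v)\<bar>) <= 2 * (Ch * norm v) * X" using Ch X by (simp add: ennreal_le_iff)
qed

lemma cut_off_integrable: "S : sets borel ==> integrable lborel (%s. indicator S s * inner (u s) (propagator s v))"
 using integrable_mult_indicator[OF _ propagated_integrable(1)[of v], of S] by simp

text \<open>The homogeneous estimate bounds the functional, and the Riesz theorem represents it: the
  vector is the weak integral over \<open>S\<close> of the forcing transported back to time
  0.\<close>

lemma duhamel_ex:
 assumes S: "S : sets borel"
 shows "EX w. norm w <= 2 * Ch * X & (ALL v. (LINT s|lborel. indicator S s * inner (u s) (propagator s v)) = inner w v)"
proof -
 define \<phi> where "\<phi> v = (LINT s|lborel. indicator S s * inner (u s) (propagator s v))" for v
 have X: "0 <= X" using bX[of "{}"] by (simp add: lpn_empty)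
 have \<phi>b: "\<bar>\<phi> v\<bar> <= norm v * (2 * Ch * X)" for v
 proof -
  have "\<bar>\<phi> v\<bar> <= (LINT s|lborel. \<bar>indicator S s * inner (u s) (propagator s v)\<bar>)" unfolding \<phi>_def by (rule integral_abs_bound)
  also have "... <= (LINT s|lborel. \<bar>inner (u s) (propagator s v)\<bar>)"
   using cut_off_integrable[OF S, of v] propagated_integrable(1)[of v] by (intro integral_mono) (auto simp: indicator_def)
  also have "... <= 2 * (Ch * norm v) * X" by (rule propagated_integrable(2))
  finally show ?thesis by (simp add: ac_simps)
 qed
 have "bounded_linear \<phi>"
 proof (rule bounded_linear_intro[where K = "2 * Ch * X"])
  show "\<phi> (v + w) = \<phi> v + \<phi> w" for v w
   unfolding \<phi>_def by (simp only: propagator_plus inner_add_right distrib_left Bochner_Integration.integral_add[OF cut_off_integrable[OF S] cut_off_integrable[OF S]])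
  show "\<phi> (r *\<^sub>R v) = r *\<^sub>R \<phi> v" for r v
   unfolding \<phi>_def by (simp add: propagator_scaleR mult.left_commute)
 qed (use \<phi>b in simp)
 from Riesz_representation[OF this] obtain w where w: "!!v. \<phi> v = inner w v" by blast
 have "norm w <= 2 * Ch * X"
 proof (cases "w = 0")
  case False
  have "norm w * norm w <= norm w * (2 * Ch * X)" using \<phi>b[of w] unfolding w by (simp add: power2_norm_eq_inner[symmetric] power2_eq_square)
  then show ?thesis using False by simp
 qed (use Ch X in simp)
 then show ?thesis using w \<phi>_def by auto
qed

definition duhamel :: "real set => 'a l2" where
 "duhamel S = (SOME w. norm w <= 2 * Ch * X & (ALL v. (LINT s|lborel. indicator S s * inner (u s) (propagator s v)) = inner w v))"

lemma duhamel:
 assumes S: "S : sets borel"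
 shows "norm (duhamel S) <= 2 * Ch * X" "inner (duhamel S) v = (LINT s|lborel. indicator S s * inner (u s) (propagator s v))"
proof -
 define P where "P w \<longleftrightarrow> norm w <= 2 * Ch * X & (ALL v. (LINT s|lborel. indicator S s * inner (u s) (propagator s v)) = inner w v)" for w
 obtain w where "P w" using duhamel_ex[OF S] unfolding P_def by blast
 then have "P (SOME w. P w)" by (rule someI[where P = P])
 moreover have "duhamel S = (SOME w. P w)" unfolding duhamel_def P_def ..
 ultimately have "P (duhamel S)" by simp
 then show "norm (duhamel S) <= 2 * Ch * X" "inner (duhamel S) v = (LINT s|lborel. indicator S s * inner (u s) (propagator s v))"
  unfolding P_def by auto
qed

text \<open>Testing the difference against itself reduces strong continuity to the integral of
  \<open>b\<close> between \<open>T n\<close> and \<open>t\<close>.\<close>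

lemma duhamel_tendsto:
 assumes T: "T \<longlonglongrightarrow> t" shows "(%n. duhamel {..<T n}) \<longlonglongrightarrow> duhamel {..<t}"
proof -
 \<comment> \<open>The indicator of a unit neighbourhood of \<open>t\<close> provides an integrable
   majorant and changes nothing once \<open>\<bar>T n - t\<bar> < 1\<close>.\<close>
 define k where "k n s = \<bar>indicator {..<T n} s - indicator {..<t} s\<bar> * (b s * indicator {t - 1..t + 1} s)" for n s
 have km: "k n : borel_measurable lborel" for n unfolding k_def[abs_def] using bm by simp
 have kb: "norm (k n s) <= b s * indicator {t - 1..t + 1} s" for n s using b0 by (auto simp: k_def indicator_def)
 have kint: "integrable lborel (k n)" for n
  by (rule Bochner_Integration.integrable_bound[OF locally_integrable km]) (use kb b0 in \<open>auto intro!: order_trans[OF kb]\<close>)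
 have ev: "\<forall>\<^sub>F n in sequentially. \<bar>T n - t\<bar> < 1" using tendstoD[OF T, of 1] by (simp add: dist_real_def)
 have bound: "norm (duhamel {..<T n} - duhamel {..<t}) <= (LINT s|lborel. k n s)" if n: "\<bar>T n - t\<bar> < 1" for n
 proof -
  define \<Delta> where "\<Delta> = duhamel {..<T n} - duhamel {..<t}"
  have i: "integrable lborel (%s. indicator {..<r} s * inner (u s) (propagator s \<Delta>))" for r by (rule cut_off_integrable) simp
  have "(norm \<Delta>)^2 = inner (duhamel {..<T n}) \<Delta> - inner (duhamel {..<t}) \<Delta>"
   by (simp add: \<Delta>_def power2_norm_eq_inner inner_diff_left)
  also have "... = (LINT s|lborel. indicator {..<T n} s * inner (u s) (propagator s \<Delta>) - indicator {..<t} s * inner (u s) (propagator s \<Delta>))"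
   by (simp add: duhamel i)
  also have "... <= (LINT s|lborel. norm \<Delta> * k n s)"
  proof (rule integral_mono)
   fix s
   have *: "\<bar>inner (u s) (propagator s \<Delta>)\<bar> <= b s * norm \<Delta>"
    using Cauchy_Schwarz_ineq2[of "u s" "propagator s \<Delta>"] mult_right_mono[OF bn[of s] norm_ge_zero[of \<Delta>]] by (simp add: norm_propagator)
   show "indicator {..<T n} s * inner (u s) (propagator s \<Delta>) - indicator {..<t} s * inner (u s) (propagator s \<Delta>) <= norm \<Delta> * k n s"
    using * n by (auto simp: k_def indicator_def mult.commute)
  qed (use i kint in auto)
  also have "... = norm \<Delta> * (LINT s|lborel. k n s)" by simp
  finally have le: "norm \<Delta> * norm \<Delta> <= norm \<Delta> * (LINT s|lborel. k n s)" by (simp add: power2_eq_square)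
  have k0: "0 <= (LINT s|lborel. k n s)" using b0 by (intro integral_nonneg_AE AE_I2) (simp add: k_def)
  have "norm \<Delta> <= (LINT s|lborel. k n s)" using le k0 by (cases "\<Delta> = 0") auto
  then show ?thesis by (simp add: \<Delta>_def)
 qed
 have "(%n. integral\<^sup>L lborel (k n)) \<longlonglongrightarrow> integral\<^sup>L lborel (%s::real. 0 :: real)"
 proof (rule integral_dominated_convergence[where M = lborel and s = k and f = "%s. 0" and w = "%s. b s * indicator {t - 1..t + 1} s"])
  show "AE s in lborel. (%n. k n s) \<longlonglongrightarrow> 0"
  proof -
   have "AE s in lborel. s ~= t" by (rule AE_lborel_singleton)
   then show ?thesis
   proof eventually_elim
    case (elim s)
    then have "0 < dist s t" by simp
    then have "\<forall>\<^sub>F n in sequentially. dist (T n) t < dist s t" by (rule tendstoD[OF T])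
    then have "\<forall>\<^sub>F n in sequentially. k n s = 0"
     by (rule eventually_mono) (auto simp: k_def indicator_def dist_real_def)
    then show ?case by (rule tendsto_eventually)
   qed
  qed
 qed (use km kb locally_integrable in auto)
 then have "(%n. LINT s|lborel. k n s) \<longlonglongrightarrow> 0" by simp
 then have "(%n. duhamel {..<T n} - duhamel {..<t}) \<longlonglongrightarrow> 0"
  by (rule Lim_null_comparison[rotated]) (use ev bound in \<open>auto elim: eventually_mono\<close>)
 then show ?thesis by (rule LIM_zero_cancel)
qed

lemma retarded_tendsto:
 assumes T: "T \<longlonglongrightarrow> t" shows "(%n. propagator (T n) (duhamel {..<T n})) \<longlonglongrightarrow> propagator t (duhamel {..<t})"
proof -
 have "(%n. propagator (T n) (duhamel {..<T n} - duhamel {..<t})) \<longlonglongrightarrow> 0"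
 proof (rule Lim_null_comparison[OF always_eventually])
  show "(%n. norm (duhamel {..<T n} - duhamel {..<t})) \<longlonglongrightarrow> 0"
   using tendsto_norm[OF tendsto_diff[OF duhamel_tendsto[OF T] tendsto_const, of "duhamel {..<t}"]] by simp
 qed (simp add: norm_propagator)
 from tendsto_add[OF this propagator_tendsto[OF T, of "duhamel {..<t}"]] show ?thesis by (simp add: propagator_diff)
qed

text \<open>Pairing the retarded solution at sample times with tests in cells gives the integral of
  the forcing against the function \<open>Z\<close> built from those tests. Hypothesis
  \<open>ret\<close> bounds \<open>Z\<close> uniformly in samples, and
  \<open>pairing_integral\<close> concludes with its factor 2.\<close>

theorem retarded_grand_bound:
 fixes alpha' rho' Cr :: real
 assumes e': "0 <= alpha'" "alpha' <= 1" "0 <= rho'" "rho' <= 1" and Cr: "0 <= Cr"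
  and ret: "!!tau N K G. finite N ==> finite K ==> (!!n. (floor (tau n / eta)) = n) ==> (!!n k. cut c k (G n k) = G n k) ==>
   grand eta c alpha rho (%s. SUM n:N. if s < tau n then SUM k:K. propagator (s - tau n) (G n k) else 0)
    (Cr * mix (1 - alpha') (1 - rho') N K (%n k. norm (G n k)))"
 shows "grand eta c alpha' rho' (%t. propagator t (duhamel {..<t})) (2 * Cr * X)"
 unfolding grand_def
proof (intro allI impI)
 fix tau :: "int => real" and N :: "int set" and K :: "'k set" assume N: "finite N" and K: "finite K" and tau: "ALL n. (floor (tau n / eta)) = n"
 have X: "0 <= X" using bX[of "{}"] by (simp add: lpn_empty)
 show "mix alpha' rho' N K (%n k. norm (cut c k (propagator (tau n) (duhamel {..<tau n})))) <= 2 * Cr * X"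
 proof (rule mix_by_duality[OF c N K e'])
  show "0 <= 2 * Cr * X" using Cr X by simp
  fix G :: "int => 'k => 'a l2" assume G: "!!n k. cut c k (G n k) = G n k"
  define Z where "Z s = (SUM n:N. if s < tau n then SUM k:K. propagator (s - tau n) (G n k) else 0)" for s
  define B where "B = Cr * mix (1 - alpha') (1 - rho') N K (%n k. norm (G n k))"
  have B: "0 <= B" unfolding B_def by (intro mult_nonneg_nonneg Cr mix_nonneg[OF N])
  have gZ: "grand eta c alpha rho Z B" unfolding Z_def[abs_def] B_def using tau by (intro ret N K G) simp
  have i: "integrable lborel (%s. indicator {..<tau n} s * inner (u s) (propagator s (propagator (- tau n) (G n k))))" for n k
   by (rule cut_off_integrable) simp
  have eq: "inner (u s) (Z s) = (SUM n:N. SUM k:K. indicator {..<tau n} s * inner (u s) (propagator s (propagator (- tau n) (G n k))))" for s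
   unfolding Z_def inner_sum_right by (intro sum.cong refl) (auto simp: inner_sum_right propagator_add indicator_def)
  have iZ: "integrable lborel (%s. inner (u s) (Z s))" unfolding eq by (intro Bochner_Integration.integrable_sum i)
  have "(SUM n:N. SUM k:K. inner (propagator (tau n) (duhamel {..<tau n})) (G n k)) = (LINT s|lborel. inner (u s) (Z s))"
   unfolding eq by (simp add: i inner_propagator duhamel)
  also have "... <= (LINT s|lborel. \<bar>inner (u s) (Z s)\<bar>)" using iZ by (intro integral_mono) auto
  also have "... <= 2 * B * X"
  proof -
   have "ennreal (LINT s|lborel. \<bar>inner (u s) (Z s)\<bar>) = (\<integral>\<^sup>+s. ennreal \<bar>inner (u s) (Z s)\<bar> \<partial>lborel)"
    using iZ by (intro nn_integral_eq_integral[symmetric]) auto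
   also have "... <= ennreal (2 * B * X)" by (rule pairing_integral[OF gZ])
   finally show ?thesis using B X by (simp add: ennreal_le_iff)
  qed
  finally show "(SUM n:N. SUM k:K. inner (propagator (tau n) (duhamel {..<tau n})) (G n k))
    <= 2 * Cr * X * mix (1 - alpha') (1 - rho') N K (%n k. norm (G n k))" by (simp add: B_def ac_simps)
 qed
qed

text \<open>Real pairings with \<open>\<phi>\<close> and with i times \<open>\<phi>\<close> make up
  the complex pairing, so the vector found in the real Hilbert space solves the complex weak
  equations. Testing with all \<open>v\<close> shows that any choice represents the same
  class.\<close>

theorem weak_integral_duhamel:
 assumes S: "S : sets borel" and F: "AE s in lebesgue. AE x in lebesgue. F s x = f s x"
 shows "weak_integral S (%s. schrodinger (t - s) (F s)) : L2"
  and "abs_l2 (weak_integral S (%s. schrodinger (t - s) (F s))) = propagator t (duhamel S)"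
proof -
 define G where "G s = schrodinger (t - s) (F s)" for s
 \<comment> \<open>Agreement almost everywhere with a measurable function implies measurability
   because Lebesgue measure is complete; thus almost every section of \<open>F\<close> lies in
   \<open>L2\<close>.\<close>
 have good: "G s : L2 & abs_l2 (G s) = propagator (t - s) (u s)" if s: "AE x in lebesgue. F s x = f s x" for s
 proof -
  have "AE x in lebesgue. f s x = F s x" using s by eventually_elim simp
  then have "F s : borel_measurable lebesgue" using borel_measurable_AE[OF L2D(1)[OF f2[of s]]] by blast
  then have "F s : L2" by (rule L2_bound[OF _ f2[of s], where C = 1]) (use s in \<open>auto elim: eventually_mono\<close>)
  moreover have "abs_l2 (F s) = u s" using abs_l2_eq_iff[OF \<open>F s : L2\<close> f2[of s]] s by simp
  ultimately show ?thesis unfolding G_def using schrodinger_propagator[of "F s" "t - s"] by simp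
 qed
 \<comment> \<open>Multiplying the second argument by i multiplies the pairing by -i, whose real
   part is the former imaginary part.\<close>
 have im: "(%x. \<i> * \<phi> x) : L2" "L2_inner h \<phi> = Complex (inner (abs_l2 h) (abs_l2 \<phi>)) (inner (abs_l2 h) (abs_l2 (%x. \<i> * \<phi> x)))"
  if h: "h : L2" and \<phi>: "\<phi> : L2" for h \<phi> :: "'a => complex"
 proof -
  show i\<phi>: "(%x. \<i> * \<phi> x) : L2" by (rule L2_cmult[OF \<phi>])
  have "L2_inner h (%x. \<i> * \<phi> x) = (CLINT x|lebesgue. - \<i> * (h x * cnj (\<phi> x)))"
   unfolding L2_inner_def by (intro Bochner_Integration.integral_cong refl) simp
  also have "... = - \<i> * L2_inner h \<phi>" unfolding L2_inner_def by (rule integral_mult_right_zero)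
  finally show "L2_inner h \<phi> = Complex (inner (abs_l2 h) (abs_l2 \<phi>)) (inner (abs_l2 h) (abs_l2 (%x. \<i> * \<phi> x)))"
   by (simp add: inner_abs_l2 h \<phi> i\<phi> complex_eq_iff)
 qed
 define p where "p v s = indicator S s * inner (u s) (propagator s (propagator (- t) v))" for v s
 have p: "integrable lebesgue (p v)" "(LINT s|lebesgue. p v s) = inner (propagator t (duhamel S)) v" for v
 proof -
  have pi: "integrable lborel (p v)" unfolding p_def[abs_def] by (rule cut_off_integrable[OF S])
  then have pm: "p v : borel_measurable lborel" by simp
  show "integrable lebesgue (p v)" using pi pm by (simp add: integrable_completion)
  have "(LINT s|lebesgue. p v s) = (LINT s|lborel. p v s)" using pm by (simp add: integral_completion)
  also have "... = inner (propagator t (duhamel S)) v" unfolding p_def inner_propagator duhamel(2)[OF S] ..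
  finally show "(LINT s|lebesgue. p v s) = inner (propagator t (duhamel S)) v" .
 qed
 have J: "set_integrable lebesgue S (%s. L2_inner (G s) \<phi>) &
   (CLINT s:S|lebesgue. L2_inner (G s) \<phi>) = Complex (inner (propagator t (duhamel S)) (abs_l2 \<phi>)) (inner (propagator t (duhamel S)) (abs_l2 (%x. \<i> * \<phi> x)))"
  if \<phi>: "\<phi> : L2" for \<phi>
 proof -
  define P where "P s = complex_of_real (p (abs_l2 \<phi>) s) + \<i> * complex_of_real (p (abs_l2 (%x. \<i> * \<phi> x)) s)" for s
  have Pi: "integrable lebesgue P" unfolding P_def[abs_def]
   by (intro Bochner_Integration.integrable_add integrable_mult_right integrable_of_real p)
  have PI: "(CLINT s|lebesgue. P s) = Complex (inner (propagator t (duhamel S)) (abs_l2 \<phi>)) (inner (propagator t (duhamel S)) (abs_l2 (%x. \<i> * \<phi> x)))"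
  proof -
   have "(CLINT s|lebesgue. P s) = (CLINT s|lebesgue. complex_of_real (p (abs_l2 \<phi>) s)) + (CLINT s|lebesgue. \<i> * complex_of_real (p (abs_l2 (%x. \<i> * \<phi> x)) s))"
    unfolding P_def by (intro Bochner_Integration.integral_add integrable_mult_right integrable_of_real p)
   also have "... = complex_of_real (LINT s|lebesgue. p (abs_l2 \<phi>) s) + \<i> * complex_of_real (LINT s|lebesgue. p (abs_l2 (%x. \<i> * \<phi> x)) s)"
    by (simp only: integral_mult_right_zero integral_complex_of_real)
   finally show ?thesis unfolding p(2) by (simp add: complex_eq_iff)
  qed
  have ae: "AE s in lebesgue. P s = indicator S s *\<^sub>R L2_inner (G s) \<phi>"
   using F
  proof eventually_elim
   case (elim s)
   have "inner (u s) (propagator s (propagator (- t) v)) = inner (abs_l2 (G s)) v" for v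
    using good[OF elim] by (simp add: inner_propagator propagator_add)
   then show ?case using im(2)[OF conjunct1[OF good[OF elim]] \<phi>] by (simp add: P_def p_def indicator_def complex_eq_iff)
  qed
  have Gm: "(%s. indicator S s *\<^sub>R L2_inner (G s) \<phi>) : borel_measurable lebesgue"
   by (rule borel_measurable_AE[OF borel_measurable_integrable[OF Pi] ae])
  have "integrable lebesgue (%s. indicator S s *\<^sub>R L2_inner (G s) \<phi>)"
   using Pi ae by (rule integrable_cong_AE_imp[OF _ Gm])
  moreover have "(CLINT s|lebesgue. indicator S s *\<^sub>R L2_inner (G s) \<phi>) = (CLINT s|lebesgue. P s)"
   using ae by (intro integral_cong_AE Gm borel_measurable_integrable[OF Pi]) (auto elim: eventually_mono)
  ultimately show ?thesis using PI by (simp add: set_integrable_def set_lebesgue_integral_def)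
 qed
 have w: "has_weak_integral G (rep_l2 (propagator t (duhamel S))) S"
  unfolding has_weak_integral_def using J im(2)[OF rep_l2_in] by simp
 then have "has_weak_integral G (SOME w. has_weak_integral G w S) S" by (rule someI[where P = "%w. has_weak_integral G w S"])
 then have W: "has_weak_integral G (weak_integral S G) S" by (simp add: weak_integral_def)
 then have W2: "weak_integral S G : L2" by (simp add: has_weak_integral_def)
 have "inner (abs_l2 (weak_integral S G)) v = inner (propagator t (duhamel S)) v" for v
 proof -
  have "L2_inner (weak_integral S G) (rep_l2 v) = (CLINT s:S|lebesgue. L2_inner (G s) (rep_l2 v))"
   using W by (simp add: has_weak_integral_def)
  then have "Re (L2_inner (weak_integral S G) (rep_l2 v)) = inner (propagator t (duhamel S)) (abs_l2 (rep_l2 v))"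
   using J[OF rep_l2_in[of v]] by simp
  then show ?thesis using inner_abs_l2[OF W2 rep_l2_in[of v]] by simp
 qed
 then have "inner (abs_l2 (weak_integral S G) - propagator t (duhamel S)) v = 0" for v by (simp add: inner_diff_left)
 then have "abs_l2 (weak_integral S G) = propagator t (duhamel S)" using inner_eq_zero_iff by (metis eq_iff_diff_eq_0)
 then show "weak_integral S (%s. schrodinger (t - s) (F s)) : L2"
  and "abs_l2 (weak_integral S (%s. schrodinger (t - s) (F s))) = propagator t (duhamel S)"
  using W2 unfolding G_def[abs_def] by auto
qed

end

end

section \<open>Exponents, forcing data from a Lebesgue measurable function, and assembly\<close>

lemma exponent_cases:
 assumes p: "2 <= p"
 shows "EX alpha. 0 <= alpha & alpha <= 1/2 & p = expo alpha & conj_exponent p = expo (1 - alpha) & (\<forall>a\<ge>0. ennreal a / p = ennreal (a * alpha))"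
proof (cases p)
 case top
 then have "p = expo 0" "conj_exponent p = expo (1 - 0)" "\<forall>a\<ge>0. ennreal a / p = ennreal (a * 0)"
  by (simp_all add: expo_def conj_exponent_def)
 then show ?thesis by (intro exI[of _ 0]) simp
next
 case (real x)
 then have x: "2 <= x" using p by (metis ennreal_le_iff ennreal_numeral)
 have "p = expo (1 / x)" using x real by (simp add: expo_def)
 moreover have "conj_exponent p = expo (1 - 1 / x)"
 proof -
  have "1 / p = ennreal (1 / x)" using x real by (simp add: divide_ennreal flip: ennreal_1)
  moreover have "1 - ennreal (1 / x) = ennreal (1 - 1 / x)" using x by (simp add: ennreal_minus flip: ennreal_1)
  moreover have "1 / ennreal (1 - 1 / x) = ennreal (1 / (1 - 1 / x))" using x by (simp add: divide_ennreal flip: ennreal_1)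
  ultimately show ?thesis using x by (simp add: conj_exponent_def expo_def)
 qed
 moreover have "\<forall>a\<ge>0. ennreal a / p = ennreal (a * (1 / x))" using x real by (simp add: divide_ennreal)
 ultimately show ?thesis using x by (intro exI[of _ "1 / x"]) auto
qed

text \<open>In reciprocals the admissibility condition becomes a linear equation between reals, and
  the excluded triple becomes \<open>alpha = 1/2\<close> in dimension 2.\<close>

lemma admissible_exponents:
 assumes "2 <= q" "2 <= r" "2 / q + of_nat d / r = of_nat d / 2" "(q, r, d) ~= (2, \<infinity>, 2)"
 shows "EX alpha rho. 0 <= alpha & alpha <= 1/2 & 0 <= rho & rho <= 1/2 & q = expo alpha & r = expo rho & conj_exponent q = expo (1 - alpha) &
  conj_exponent r = expo (1 - rho) & 2 * alpha + real d * rho = real d / 2 & \<not> (d = 2 & alpha = 1/2)"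
proof -
 obtain alpha where alpha: "0 <= alpha" "alpha <= 1/2" "q = expo alpha" "conj_exponent q = expo (1 - alpha)" "\<forall>a\<ge>0. ennreal a / q = ennreal (a * alpha)"
  using exponent_cases[OF assms(1)] by blast
 obtain rho where rho: "0 <= rho" "rho <= 1/2" "r = expo rho" "conj_exponent r = expo (1 - rho)" "\<forall>a\<ge>0. ennreal a / r = ennreal (a * rho)"
  using exponent_cases[OF assms(2)] by blast
 have "2 / q = ennreal (2 * alpha)" using alpha(5)[rule_format, of 2] by simp
 moreover have "of_nat d / r = ennreal (real d * rho)" using rho(5)[rule_format, of "real d"] by (simp add: ennreal_of_nat_eq_real_of_nat)
 moreover have "of_nat d / 2 = ennreal (real d / 2)"
  using divide_ennreal[of "real d" 2] by (simp add: ennreal_of_nat_eq_real_of_nat)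
 ultimately have sum: "ennreal (2 * alpha + real d * rho) = ennreal (real d / 2)" using assms(3) alpha(1) rho(1) by simp
 have nonneg: "0 <= 2 * alpha + real d * rho" "0 <= real d / 2" using alpha(1) rho(1) by simp_all
 have eq: "2 * alpha + real d * rho = real d / 2" by (rule ennreal_inj[THEN iffD1, OF nonneg sum])
 have "\<not> (d = 2 & alpha = 1/2)"
 proof
  assume *: "d = 2 & alpha = 1/2"
  then have "rho = 0" using eq by simp
  then show False using assms(4) * alpha(3) rho(3) by (simp add: expo_def)
 qed
 then show ?thesis using alpha rho eq by blast
qed

text \<open>In the plane of reciprocals the admissible pairs lie on one segment starting at (0,
  1/2). The common far end is q = 4 in dimension 1 and the endpoint q = 2 from dimension 3 on. In
  dimension 2 it reaches just as far as the given pairs, staying below the excluded 1/2, and the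
  minimum 1/4 keeps it away from the start.\<close>

lemma diagonal_exists:
 assumes d: "1 <= d" and a: "0 <= alpha" "alpha <= 1/2" "0 <= rho" "2 * alpha + real d * rho = real d / 2" "\<not> (d = 2 & alpha = 1/2)"
  and a': "0 <= alpha'" "alpha' <= 1/2" "0 <= rho'" "2 * alpha' + real d * rho' = real d / 2" "\<not> (d = 2 & alpha' = 1/2)"
 shows "EX alpha1 rho1 theta theta'. diagonal_exponents d alpha1 rho1 & 0 <= theta & theta <= 1 & 0 <= theta' & theta' <= 1 &
  alpha = theta * alpha1 & rho = theta * rho1 + (1 - theta) / 2 & alpha' = theta' * alpha1 & rho' = theta' * rho1 + (1 - theta') / 2"
proof -
 have dpos: "0 < real d" using d by simp
 have "0 <= real d * rho" "0 <= real d * rho'" using a a' by simp_all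
 then have le4: "alpha <= d / 4" "alpha' <= d / 4" using a(4) a'(4) by linarith+
 define alpha1 where "alpha1 = (if d = 1 then 1/4 else if d = 2 then max (1/4) (max alpha alpha') else 1/2)"
 have 1: "0 < alpha1" "alpha <= alpha1" "alpha' <= alpha1" "alpha1 <= d / 4" "alpha1 < 1/2 \<or> (3 <= d & alpha1 = 1/2)"
  using d a a' le4 by (auto simp: alpha1_def)
 define rho1 where "rho1 = 1/2 - 2 * alpha1 / d"
 have "diagonal_exponents d alpha1 rho1" unfolding diagonal_exponents_def
  using d 1 dpos by (auto simp: rho1_def field_simps)
 moreover have ex: "t = (t / alpha1) * alpha1" "s = (t / alpha1) * rho1 + (1 - t / alpha1) / 2" if "2 * t + real d * s = real d / 2" for t s
 proof -
  show "t = (t / alpha1) * alpha1" using 1 by simp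
  have "s = 1/2 - 2 * t / d" using that dpos by (simp add: field_simps)
  moreover have "(t / alpha1) * rho1 + (1 - t / alpha1) / 2 = 1/2 - 2 * t / d"
  proof -
   have "(t / alpha1) * rho1 = (t / alpha1) / 2 - 2 * ((t / alpha1) * alpha1) / d" by (simp add: rho1_def right_diff_distrib)
   also have "(t / alpha1) * alpha1 = t" using 1 by simp
   finally show ?thesis by (simp add: diff_divide_distrib)
  qed
  ultimately show "s = (t / alpha1) * rho1 + (1 - t / alpha1) / 2" by simp
 qed
 moreover have "0 <= alpha / alpha1" "alpha / alpha1 <= 1" "0 <= alpha' / alpha1" "alpha' / alpha1 <= 1" using 1 a a' by auto
 ultimately show ?thesis using ex[OF a(4)] ex[OF a'(4)] by blast
qed

text \<open>A Borel representative on the product is fixed first, so that its sections and their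
  norms depend measurably on time. The spatial norm \<open>b'\<close> is finite at almost every time
  because its cell integrals are; at the exceptional times the section is set to 0.\<close>

theorem forcing_exists:
 fixes g :: "real => complex" and c :: "'a::euclidean_space => 'k" and F :: "real => 'a => complex"
 assumes wg: "window_bounds g Mg Rg epsg cg tg" and eta: "0 < eta" "eta <= epsg"
  and wb: "window_bounds \<gamma> M R eps c0 x0" and c: "mesh delta m c" "delta <= eps"
  and e: "0 <= alpha" "alpha <= 1/2" "0 <= rho" "rho <= 1/2"
  and F: "(%(t, x). F t x) : borel_measurable lebesgue"
  and X: "0 <= X" "mixed_amalgam_norm g \<gamma> 1 (expo (1 - alpha)) 2 (expo (1 - rho)) F = ennreal X"
 shows "EX f b. forcing c delta m eta alpha rho f b (m powr (- (1 - rho)) / c0 * (eta powr (- (1 - alpha)) / cg * X)) &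
  (AE s in lebesgue. AE x in lebesgue. F s x = f s x)"
proof -
 define Cs where "Cs = m powr (- (1 - rho)) / c0"
 have Cs: "0 <= Cs" using wb by (simp add: Cs_def window_bounds_def)
 have [measurable]: "\<gamma> : borel_measurable borel" by (rule win_borel[OF wb])
 have r: "0 < 1 - rho" "0 <= 1 - rho" and a: "0 < 1 - alpha" using e by auto
 obtain h where h: "h : borel_measurable borel" "AE p in lebesgue. (case p of (t, x) => F t x) = h p" using complex_borel_rep[OF F] by blast
 note [measurable] = h(1)
 have "AE p in lborel. (case p of (t, x) => F t x) = h p" using h(2) by (simp only: AE_completion_iff)
 then have "AE p in lborel \<Otimes>\<^sub>M lborel. (case p of (t, x) => F t x) = h p" by (simp only: lborel_prod)
 from lborel_pair.AE_pair[OF this] have Fh: "AE s in lborel. AE x in lborel. F s x = h (s, x)" by simp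
 define b' where "b' s = amalgam_norm \<gamma> 2 (expo (1 - rho)) (%x. ennreal (cmod (h (s, x))))" for s
 have two: "2 = expo (1/2)" by (simp add: expo_def)
 have [measurable]: "b' : borel_measurable borel"
 proof -
  have hb: "h : borel_measurable (borel \<Otimes>\<^sub>M borel)" using h(1) by (simp add: borel_prod)
  have pm: "(%q. (fst (fst q), snd q)) : (borel :: ((real \<times> 'a) \<times> 'a) measure) \<rightarrow>\<^sub>M borel"
   by (intro borel_measurable_continuous_onI continuous_intros)
  have pg: "(%q. snd q - snd (fst q)) : (borel :: ((real \<times> 'a) \<times> 'a) measure) \<rightarrow>\<^sub>M borel"
   by (intro borel_measurable_continuous_onI continuous_intros)
  have "(%q. ennreal (cmod (h (fst (fst q), snd q))) * ennreal (cmod (\<gamma> (snd q - snd (fst q))))) : borel_measurable (borel :: ((real \<times> 'a) \<times> 'a) measure)"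
   using measurable_compose[OF pm h(1)] measurable_compose[OF pg win_borel[OF wb]] by measurable
  then have "(%(p, x). ennreal (cmod (h (fst p, x))) * ennreal (cmod (\<gamma> (x - snd p)))) : borel_measurable (lborel \<Otimes>\<^sub>M lborel :: ((real \<times> 'a) \<times> 'a) measure)"
   by (simp add: lborel_prod case_prod_beta)
  then have "(%p. Lp_norm (expo (1/2)) (%x. ennreal (cmod (h (fst p, x))) * ennreal (cmod (\<gamma> (x - snd p))))) : borel_measurable borel"
   by (rule Lp_norm_borel) simp
  then have "(%(s, y). Lp_norm (expo (1/2)) (%x. ennreal (cmod (h (s, x))) * ennreal (cmod (\<gamma> (x - y))))) : borel_measurable (lborel \<Otimes>\<^sub>M lborel)"
   by (simp add: lborel_prod case_prod_beta)
  then show ?thesis unfolding b'_def[abs_def] amalgam_norm_def two by (rule Lp_norm_borel[OF _ r(2)])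
 qed
 have bF: "AE s in lebesgue. amalgam_norm \<gamma> 2 (expo (1 - rho)) (%x. ennreal (cmod (F s x))) = b' s"
 proof (rule AE_completion)
  show "AE s in lborel. amalgam_norm \<gamma> 2 (expo (1 - rho)) (%x. ennreal (cmod (F s x))) = b' s"
   using Fh
  proof eventually_elim
   case (elim s)
   have "Lp_norm (expo (1/2)) (%x. ennreal (cmod (F s x)) * ennreal (cmod (\<gamma> (x - y)))) = Lp_norm (expo (1/2)) (%x. ennreal (cmod (h (s, x))) * ennreal (cmod (\<gamma> (x - y))))" for y
    by (rule Lp_norm_cong_AE) (use AE_completion[OF elim] in \<open>auto elim: eventually_mono\<close>)
   then show ?case by (simp only: b'_def amalgam_norm_def two)
  qed
 qed
 have bX: "amalgam_norm g 1 (expo (1 - alpha)) b' <= ennreal X"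
 proof -
  have "Lp_norm 1 (%t. amalgam_norm \<gamma> 2 (expo (1 - rho)) (%x. ennreal (cmod (F t x))) * ennreal (cmod (g (t - y)))) = Lp_norm 1 (%t. b' t * ennreal (cmod (g (t - y))))" for y
   unfolding Lp_norm_one by (rule nn_integral_cong_AE) (use bF in \<open>auto elim: eventually_mono\<close>)
  then show ?thesis using X(2) unfolding mixed_amalgam_norm_def amalgam_norm_def[of g] by simp
 qed
 have bm: "b' : borel_measurable borel" by measurable
 note T = time_input[OF wg eta a bm X(1) bX]
 have Ib: "{t::real. (floor (t / eta)) = n} : sets borel" for n using mesh_floor[OF eta(1)] by (simp add: mesh_def)
 have tm: "(%t. b' t * indicator {t. (floor (t / eta)) = n} t) : borel_measurable lborel" for n
  using Ib[of n] bm by (intro borel_measurable_times_ennreal borel_measurable_indicator) simp_all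
 \<comment> \<open>Countably many time cells cover the line, so finiteness of each cell integral
   gives finiteness almost everywhere.\<close>
 have bfin: "AE s in lborel. b' s ~= \<infinity>"
 proof -
  have ae: "AE s in lborel. b' s * indicator {t. (floor (t / eta)) = n} s ~= \<infinity>" for n
   using T(1)[of n] by (intro nn_integral_noteq_infinite[OF tm]) simp
  have "AE s in lborel. ALL n. b' s * indicator {t. (floor (t / eta)) = n} s ~= \<infinity>"
   unfolding AE_all_countable by (rule allI, rule ae)
  then show ?thesis
  proof eventually_elim
   case (elim s)
   show ?case using elim[rule_format, of "(floor (s / eta))"] by simp
  qed
 qed
 define f where "f s x = (if b' s < \<infinity> then h (s, x) else 0)" for s x
 define b where "b s = Cs * enn2real (b' s)" for s
 have hs: "(%x. h (s, x)) : borel_measurable borel" for s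
 proof -
  have "(%x::'a. (s, x)) : borel \<rightarrow>\<^sub>M borel" by (intro borel_measurable_continuous_onI continuous_intros)
  from measurable_compose[OF this h(1)] show ?thesis .
 qed
 have fs: "f s : L2 & norm (abs_l2 (f s)) <= b s & (ALL K. finite K --> lpn (1 - rho) K (%k. norm (cut c k (abs_l2 (f s)))) <= b s)" for s
 proof (cases "b' s < \<infinity>")
  case True
  have eq: "ennreal (enn2real (b' s)) = b' s" using True by simp
  have f: "f s = (%x. h (s, x))" using True by (auto simp: f_def)
  have "amalgam_norm \<gamma> 2 (expo (1 - rho)) (%x. ennreal (cmod (f s x))) = b' s" by (simp add: f b'_def)
  then have am: "amalgam_norm \<gamma> 2 (expo (1 - rho)) (%x. ennreal (cmod (f s x))) <= ennreal (enn2real (b' s))" by (simp only: eq order_refl)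
  have fl: "f s : borel_measurable lebesgue" unfolding f by (rule borel_lebesgue[OF hs])
  have half: "1/2 <= 1 - rho" using e by simp
  note S = space_input[OF wb c fl half enn2real_nonneg am]
  show ?thesis using S space_input_L2[OF wb c S(1) r(1) enn2real_nonneg am] by (simp add: b_def Cs_def)
 next
  case False
  then have f: "f s = (%x. 0)" and b: "b s = 0" by (auto simp: f_def b_def not_less top_unique)
  have "lpn (1 - rho) K (%k. 0 :: real) = 0" if "finite K" for K :: "'k set"
   using lpn_extend[OF that, of "{}" "1 - rho" "%k. 0"] r by (simp add: lpn_empty)
  moreover have "abs_l2 (%x. 0) = (0 :: 'a l2)" by (simp add: zero_l2.abs_eq)
  ultimately show ?thesis unfolding f b by (simp add: L2_zero cut_zero[OF c(1)])
 qed
 have bI: "(\<integral>\<^sup>+s. ennreal (b s) * indicator {s. (floor (s / eta)) = n} s \<partial>lborel) = ennreal Cs * (\<integral>\<^sup>+s. b' s * indicator {s. (floor (s / eta)) = n} s \<partial>lborel)" for n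
 proof -
  have "(\<integral>\<^sup>+s. ennreal (b s) * indicator {s. (floor (s / eta)) = n} s \<partial>lborel) = (\<integral>\<^sup>+s. ennreal Cs * (b' s * indicator {s. (floor (s / eta)) = n} s) \<partial>lborel)"
  proof (rule nn_integral_cong_AE)
   show "AE s in lborel. ennreal (b s) * indicator {s. (floor (s / eta)) = n} s = ennreal Cs * (b' s * indicator {s. (floor (s / eta)) = n} s)"
    using bfin
   proof eventually_elim
    case (elim s)
    then have "ennreal (enn2real (b' s)) = b' s" by (simp add: less_top)
    then have "ennreal (b s) = ennreal Cs * b' s" using Cs by (simp add: b_def ennreal_mult)
    then show ?case by (simp add: mult.assoc)
   qed
  qed
  also have "... = ennreal Cs * (\<integral>\<^sup>+s. b' s * indicator {s. (floor (s / eta)) = n} s \<partial>lborel)" by (rule nn_integral_cmult[OF tm])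
  finally show ?thesis .
 qed
 have "forcing c delta m eta alpha rho f b (Cs * (eta powr (- (1 - alpha)) / cg * X))"
 proof
  show "mesh delta m c" "0 < eta" "0 <= alpha" "alpha <= 1" "0 <= rho" "rho <= 1" using c eta e by auto
  show "(%(s, x). f s x) : borel_measurable (lborel \<Otimes>\<^sub>M lborel)"
  proof -
   have b1: "{p : space (borel :: (real \<times> 'a) measure). b' (fst p) < \<infinity>} : sets borel"
   proof -
    have "fst : (borel :: (real \<times> 'a) measure) \<rightarrow>\<^sub>M borel" by (intro borel_measurable_continuous_onI continuous_intros)
    from measurable_compose[OF this bm] have "(%p::real \<times> 'a. b' (fst p)) : borel_measurable borel" .
    then show ?thesis by measurable
   qed
   have "(%p. if b' (fst p) < \<infinity> then h p else 0) : borel_measurable borel"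
    by (rule measurable_If[OF h(1) borel_measurable_const b1])
   moreover have "(%(s, x). f s x) = (%p. if b' (fst p) < \<infinity> then h p else 0)" by (auto simp: f_def fun_eq_iff)
   ultimately show ?thesis by (simp add: lborel_prod)
  qed
  show "f s : L2" "norm (abs_l2 (f s)) <= b s" for s using fs[of s] by auto
  show "lpn (1 - rho) K (%k. norm (cut c k (abs_l2 (f s)))) <= b s" if "finite K" for s K using fs[of s] that by blast
  show "b : borel_measurable borel" unfolding b_def by measurable
  show "0 <= b s" for s using Cs by (simp add: b_def)
  show "(\<integral>\<^sup>+s. ennreal (b s) * indicator {s. (floor (s / eta)) = n} s \<partial>lborel) < \<infinity>" for n
   unfolding bI using T(1)[of n] by (simp add: ennreal_mult_less_top)
  show "lpn (1 - alpha) N (%n. enn2real (\<integral>\<^sup>+s. ennreal (b s) * indicator {s. (floor (s / eta)) = n} s \<partial>lborel)) <= Cs * (eta powr (- (1 - alpha)) / cg * X)"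
   if N: "finite N" for N
  proof -
   have "lpn (1 - alpha) N (%n. enn2real (\<integral>\<^sup>+s. ennreal (b s) * indicator {s. (floor (s / eta)) = n} s \<partial>lborel))
     = Cs * lpn (1 - alpha) N (%n. enn2real (\<integral>\<^sup>+s. b' s * indicator {s. (floor (s / eta)) = n} s \<partial>lborel))"
    unfolding bI using Cs a by (simp add: enn2real_mult lpn_scale[OF N])
   also have "... <= Cs * (eta powr (- (1 - alpha)) / cg * X)" by (intro mult_left_mono T(2) N Cs)
   finally show ?thesis .
  qed
 qed
 moreover have "AE s in lebesgue. AE x in lebesgue. F s x = f s x"
 proof (rule AE_completion)
  show "AE s in lborel. AE x in lebesgue. F s x = f s x"
   using Fh bfin
  proof eventually_elim
   case (elim s)
   have "f s = (%x. h (s, x))" using elim(2) by (auto simp: f_def less_top)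
   then show ?case using AE_completion[OF elim(1)] by simp
  qed
 qed
 ultimately show ?thesis unfolding Cs_def by blast
qed

lemma mesh_const_nonneg: "0 < R ==> 0 < delta ==> 0 < m ==> 0 <= mesh_const d delta m R rho"
 by (simp add: mesh_const_def)

theorem theorem4p1:
  fixes q r qt rt :: ennreal
    and g :: "real \<Rightarrow> complex"
    and \<gamma> :: "'a::euclidean_space \<Rightarrow> complex"
  assumes "window g" and "window \<gamma>"
    and "2 \<le> q" and "2 \<le> r"
    and "2 / q + of_nat DIM('a) / r = of_nat DIM('a) / 2"
    and "(q, r, DIM('a)) \<noteq> (2, \<infinity>, 2)"
    and "2 \<le> qt" and "2 \<le> rt"
    and "2 / qt + of_nat DIM('a) / rt = of_nat DIM('a) / 2"
    and "(qt, rt, DIM('a)) \<noteq> (2, \<infinity>, 2)"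
  shows "\<exists>C::real. C > 0 \<and>
    (\<forall>u\<^sub>0 :: 'a \<Rightarrow> complex. u\<^sub>0 \<in> L2 \<longrightarrow>
      mixed_amalgam_norm g \<gamma> \<infinity> q 2 r (\<lambda>t. schrodinger t u\<^sub>0) \<le> ennreal C * L2_norm u\<^sub>0) \<and>
    (\<forall>F :: real \<Rightarrow> 'a \<Rightarrow> complex.
      (\<lambda>(t, x). F t x) \<in> borel_measurable lebesgue \<longrightarrow>
      mixed_amalgam_norm g \<gamma> 1 (conj_exponent qt) 2 (conj_exponent rt) F < \<infinity> \<longrightarrow>
      L2_norm (weak_integral UNIV (\<lambda>s. schrodinger (- s) (F s)))
        \<le> ennreal C * mixed_amalgam_norm g \<gamma> 1 (conj_exponent qt) 2 (conj_exponent rt) F \<and>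
      mixed_amalgam_norm g \<gamma> \<infinity> q 2 r
          (\<lambda>t. weak_integral {..<t} (\<lambda>s. schrodinger (t - s) (F s)))
        \<le> ennreal C * mixed_amalgam_norm g \<gamma> 1 (conj_exponent qt) 2 (conj_exponent rt) F)"
proof -
 define d where "d = DIM('a)"
 have d: "1 <= d" by (simp add: d_def Suc_leI)
 obtain alpha rho where e: "0 <= alpha" "alpha <= 1/2" "0 <= rho" "rho <= 1/2" "q = expo alpha" "r = expo rho"
   "2 * alpha + real d * rho = real d / 2" "\<not> (d = 2 & alpha = 1/2)"
  using admissible_exponents[OF assms(3-6)] unfolding d_def by blast
 obtain alpha' rho' where e': "0 <= alpha'" "alpha' <= 1/2" "0 <= rho'" "rho' <= 1/2" "conj_exponent qt = expo (1 - alpha')" "conj_exponent rt = expo (1 - rho')"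
   "2 * alpha' + real d * rho' = real d / 2" "\<not> (d = 2 & alpha' = 1/2)"
  using admissible_exponents[OF assms(7-10)] unfolding d_def by blast
 obtain alpha1 rho1 theta theta' where D: "diagonal_exponents DIM('a) alpha1 rho1" and theta: "0 <= theta" "theta <= 1" and theta': "0 <= theta'" "theta' <= 1"
  and alpha: "alpha = theta * alpha1" and rho: "rho = theta * rho1 + (1 - theta) / 2" and alpha': "alpha' = theta' * alpha1" and rho': "rho' = theta' * rho1 + (1 - theta') / 2"
  using diagonal_exists[OF d e(1-3,7,8) e'(1-3,7,8)] unfolding d_def by blast
 obtain Mg Rg epsg cg tg where wg: "window_bounds g Mg Rg epsg cg tg" using window_bounds_exist[OF assms(1)] by blast
 obtain M R eps c0 x0 where wb: "window_bounds \<gamma> M R eps c0 x0" using window_bounds_exist[OF assms(2)] by blast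
 have pos: "0 < epsg" "0 < eps" "0 < Mg" "0 < Rg" "0 < M" "0 < R" "0 < c0" "0 < cg" using wg wb by (auto simp: window_bounds_def)
 \<comment> \<open>\<open>mesh_cell\<close> bounds the diameter by \<open>d * h\<close>; this choice
   makes the bound \<open>eps\<close>, the radius on which the space window is at least
   \<open>c0\<close>.\<close>
 define h where "h = eps / d"
 have h: "0 < h" "d * h = eps" using pos d by (simp_all add: h_def)
 define m where "m = h ^ d"
 have m: "0 < m" using h by (simp add: m_def)
 define c :: "'a => 'a" where "c = cell h"
 have c: "mesh eps m c" using mesh_cell[OF h(1), where 'a='a] h(2) unfolding m_def c_def d_def by simp
 define eta where "eta = epsg"
 have eta: "0 < eta" "eta <= epsg" using pos by (auto simp: eta_def)
 obtain Ch where Ch: "0 <= Ch" "!!v. grand eta c alpha rho (%t. propagator t v) (Ch * norm v)"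
  using homogeneous_grand[OF c eta(1) D theta, folded alpha rho] by blast
 obtain Ch' where Ch': "0 <= Ch'" "!!v. grand eta c alpha' rho' (%t. propagator t v) (Ch' * norm v)"
  using homogeneous_grand[OF c eta(1) D theta', folded alpha' rho'] by blast
 obtain Cr where Cr: "0 <= Cr" and Cr': "ALL tau N K G. finite N --> finite K --> (ALL n. (floor (tau n / eta)) = n) --> (ALL n k. cut c k (G n k) = G n k) -->
  grand eta c alpha' rho' (%s. SUM n:N. if s < tau n then SUM k:K. propagator (s - tau n) (G n k) else 0)
   (Cr * mix (1 - alpha) (1 - rho) N K (%n k. norm (G n k)))"
  using retarded_grand[OF c eta(1) D theta theta', folded alpha rho alpha' rho'] by (elim exE conjE) (rule that)
 \<comment> \<open>The total cost of passing from sampled mixed norms back to the amalgam norm: two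
   mesh constants, two window bounds and the 2 of \<open>grand_sup\<close>.\<close>
 define K1 where "K1 = mesh_const 1 eta eta Rg alpha * (Mg * (mesh_const DIM('a) eps m R rho * (M * 2)))"
 have K1: "0 <= K1" unfolding K1_def using pos m eta by (intro mult_nonneg_nonneg mesh_const_nonneg) auto
 have out: "mixed_amalgam_norm g \<gamma> \<infinity> q 2 r f <= ennreal (K1 * B)"
  if "!!X t. X \<longlonglongrightarrow> t ==> (%n. V (X n)) \<longlonglongrightarrow> V t" "!!t. f t : L2" "!!t. abs_l2 (f t) = V t" "grand eta c alpha rho V B"
  for f :: "real => 'a => complex" and V B
 proof -
  have "mixed_amalgam_norm g \<gamma> \<infinity> (expo alpha) 2 (expo rho) f
    <= ennreal (mesh_const 1 eta eta Rg alpha * (Mg * (mesh_const DIM('a) eps m R rho * (M * (2 * B)))))"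
   by (rule time_output[OF wg eta(1) wb c e(1,3) that])
  also have "mesh_const 1 eta eta Rg alpha * (Mg * (mesh_const DIM('a) eps m R rho * (M * (2 * B)))) = K1 * B"
   by (simp only: K1_def mult.assoc)
  finally show ?thesis unfolding e(5,6) .
 qed
 \<comment> \<open>The cost of bounding the discrete forcing by the given norm, once in space and
   once in time.\<close>
 define CX where "CX = m powr (- (1 - rho')) / c0 * (eta powr (- (1 - alpha')) / cg)"
 have CX: "0 <= CX" unfolding CX_def using pos by simp
 \<comment> \<open>One summand for each of the three estimates; the leading 1 makes \<open>C\<close>
   positive.\<close>
 define C where "C = 1 + K1 * Ch + 2 * Ch' * CX + K1 * (2 * Cr * CX)"
 have Cge: "K1 * Ch <= C" "2 * Ch' * CX <= C" "K1 * (2 * Cr * CX) <= C" "0 < C"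
  unfolding C_def using K1 Ch(1) Ch'(1) Cr CX by (simp_all add: add_nonneg_nonneg add_pos_nonneg)
 show ?thesis
 proof (intro exI[of _ C] conjI allI impI)
  show "0 < C" by (rule Cge(4))
 next
  fix u0 :: "'a => complex" assume u0: "u0 : L2"
  have "mixed_amalgam_norm g \<gamma> \<infinity> q 2 r (%t. schrodinger t u0) <= ennreal (K1 * (Ch * norm (abs_l2 u0)))"
   by (rule out[OF propagator_tendsto]) (use u0 schrodinger_propagator Ch(2) in auto)
  also have "... <= ennreal (C * norm (abs_l2 u0))"
   using mult_right_mono[OF Cge(1) norm_ge_zero[of "abs_l2 u0"]] by (intro ennreal_leI) (simp add: mult.assoc)
  also have "... = ennreal C * L2_norm u0" using Cge(4) by (simp add: L2_norm_abs[OF u0] ennreal_mult)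
  finally show "mixed_amalgam_norm g \<gamma> \<infinity> q 2 r (%t. schrodinger t u0) <= ennreal C * L2_norm u0" .
 next
  fix F :: "real => 'a => complex"
  assume F: "(%(t, x). F t x) : borel_measurable lebesgue"
   and fin: "mixed_amalgam_norm g \<gamma> 1 (conj_exponent qt) 2 (conj_exponent rt) F < \<infinity>"
  define X where "X = enn2real (mixed_amalgam_norm g \<gamma> 1 (conj_exponent qt) 2 (conj_exponent rt) F)"
  have X: "0 <= X" "mixed_amalgam_norm g \<gamma> 1 (conj_exponent qt) 2 (conj_exponent rt) F = ennreal X"
   using fin by (simp_all add: X_def)
  obtain f b where fo: "forcing c eps m eta alpha' rho' f b (CX * X)" and FAE: "AE s in lebesgue. AE x in lebesgue. F s x = f s x"
   using forcing_exists[OF wg eta wb c order_refl e'(1-4) F X(1) X(2)[unfolded e'(5,6)]] unfolding CX_def mult.assoc by blast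
  have e01: "0 <= alpha" "alpha <= 1" "0 <= rho" "rho <= 1" using e by auto
  \<comment> \<open>The forcing is measured in the duals of the second pair, while the solution in
    the retarded estimate is measured in the first; only \<open>Cr\<close> links the two.\<close>
  interpret forcing c eps m eta alpha' rho' f b "CX * X" by (rule fo)
  note W = weak_integral_duhamel[OF Ch' _ FAE]
  have CXX: "ennreal (A * X) <= ennreal C * ennreal X" if "A <= C" for A
   using mult_right_mono[OF that X(1)] Cge(4) X(1) by (simp add: ennreal_mult[symmetric] ennreal_leI)
  \<comment> \<open>The dual homogeneous estimate is the case \<open>t = 0\<close> and
    \<open>S = UNIV\<close> of the weak integral, bounded through the homogeneous estimate for the
    second pair.\<close>
  have w: "weak_integral UNIV (%s. schrodinger (- s) (F s)) : L2"
   "abs_l2 (weak_integral UNIV (%s. schrodinger (- s) (F s))) = propagator 0 (duhamel Ch' UNIV)"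
   using W[of UNIV 0] by simp_all
  have "norm (abs_l2 (weak_integral UNIV (%s. schrodinger (- s) (F s)))) <= 2 * Ch' * (CX * X)"
   unfolding w(2) norm_propagator by (rule duhamel(1)[OF Ch']) simp
  then have "L2_norm (weak_integral UNIV (%s. schrodinger (- s) (F s))) <= ennreal (2 * Ch' * CX * X)"
   unfolding L2_norm_abs[OF w(1)] by (intro ennreal_leI) (simp add: mult.assoc)
  also have "... <= ennreal C * ennreal X" by (rule CXX[OF Cge(2)])
  finally show "L2_norm (weak_integral UNIV (%s. schrodinger (- s) (F s)))
    <= ennreal C * mixed_amalgam_norm g \<gamma> 1 (conj_exponent qt) 2 (conj_exponent rt) F" unfolding X(2) .
  have gr: "grand eta c alpha rho (%t. propagator t (duhamel Ch' {..<t})) (2 * Cr * (CX * X))"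
   by (rule retarded_grand_bound[OF Ch' e01 Cr]) (use Cr' in auto)
  have "mixed_amalgam_norm g \<gamma> \<infinity> q 2 r (%t. weak_integral {..<t} (%s. schrodinger (t - s) (F s))) <= ennreal (K1 * (2 * Cr * (CX * X)))"
   by (rule out[OF retarded_tendsto[OF Ch'] _ _ gr]) (use W in auto)
  also have "... = ennreal (K1 * (2 * Cr * CX) * X)" by (simp add: mult.assoc)
  also have "... <= ennreal C * ennreal X" by (rule CXX[OF Cge(3)])
  finally show "mixed_amalgam_norm g \<gamma> \<infinity> q 2 r (%t. weak_integral {..<t} (%s. schrodinger (t - s) (F s)))
    <= ennreal C * mixed_amalgam_norm g \<gamma> 1 (conj_exponent qt) 2 (conj_exponent rt) F" unfolding X(2) .
 qed
qed

end
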